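(* Let $R$ be a semihereditary ring. Assume that $R$ satisfies one of the following conditions: (a) $R$ is of finite character; (b) $R$ has Krull dimension $\leq 1$. Then $R$ has the stacked bases property, and every finitely presented $R$-module $M$ has a decomposition \[M\cong \Bigl(\bigoplus_{1\leq j\leq m}R/I_j\Bigr)\oplus\Bigl(\bigoplus_{1\leq i\leq p}\bigl(\bigoplus_{1\leq k\leq n_i}J_{i,k}e_i\bigr)\Bigr)\] where $I_1\supseteq\dots\supseteq I_m$ are proper invertible ideals of $R$, $\{e_1,\dots,e_p\}$ is a family of nonzero orthogonal idempotents of $R$, $n_1<\dots<n_p$ is a strictly increasing sequence of integers $>0$, and for each $i$, $1\leq i\leq p$, $J_{i,1},\dots,J_{i,n_i}$ are invertible ideals of the ring $Re_i$.
   Context: All rings are commutative with identity. A ring is semihereditary if every finitely generated ideal is projective. A ring $R$ is of finite character if every non-zero-divisor of $R$ is contained in only finitely many maximal ideals. An ideal is invertible if it is invertible as a fractional ideal in the total ring of fractions. For an idempotent $e$, $Re$ is regarded as a ring with identity $e$. Empty direct sums ($m=0$ or $p=0$) are allowed. A semihereditary ring $R$ has the stacked bases property if for each finitely presented $R$-module $M$ and each presentation $0\to H\to F\to M\to 0$ with $F$ a finitely generated free module (regard $H$ as a submodule of $F$), there exist finitely generated ideals $J_1,\dots,J_n$ of $R$ and invertible ideals $I_1\supseteq\dots\supseteq I_m$ of $R$, with $m\le n$, and an isomorphism $F\cong J_1\oplus\dots\oplus J_n$ which maps $H$ onto $I_1J_1\oplus\dots\oplus I_mJ_m$. *)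

theory Defs
  imports "HOL-Algebra.Algebra" "HOL-Library.Extended_Nat"
begin

section \<open>Total ring of fractions, fractional ideals, invertible ideals\<close>

definition nonzerodivisors :: "('a, 'r) ring_scheme \<Rightarrow> 'a set" where
  "nonzerodivisors R =
     {s \<in> carrier R. \<forall>x \<in> carrier R. x \<otimes>\<^bsub>R\<^esub> s = \<zero>\<^bsub>R\<^esub> \<longrightarrow> x = \<zero>\<^bsub>R\<^esub>}"

definition frac_rel :: "('a, 'r) ring_scheme \<Rightarrow> (('a \<times> 'a) \<times> ('a \<times> 'a)) set" where
  "frac_rel R = {((a, s), (b, t)).
     a \<in> carrier R \<and> b \<in> carrier R \<and> s \<in> nonzerodivisors R \<and> t \<in> nonzerodivisors R \<and>
     a \<otimes>\<^bsub>R\<^esub> t = b \<otimes>\<^bsub>R\<^esub> s}"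

definition mk_frac :: "('a, 'r) ring_scheme \<Rightarrow> 'a \<Rightarrow> 'a \<Rightarrow> ('a \<times> 'a) set" where
  "mk_frac R a s = frac_rel R `` {(a, s)}"

text \<open>The unions below are taken over a family of equal sets, as usual for operations on
  equivalence classes.\<close>

definition total_fraction_ring :: "('a, 'r) ring_scheme \<Rightarrow> ('a \<times> 'a) set ring" where
  "total_fraction_ring R =
    \<lparr>carrier = (carrier R \<times> nonzerodivisors R) // frac_rel R,
     monoid.mult = (\<lambda>U V. \<Union>(a, s) \<in> U. \<Union>(b, t) \<in> V. mk_frac R (a \<otimes>\<^bsub>R\<^esub> b) (s \<otimes>\<^bsub>R\<^esub> t)),
     one = mk_frac R \<one>\<^bsub>R\<^esub> \<one>\<^bsub>R\<^esub>,
     ring.zero = mk_frac R \<zero>\<^bsub>R\<^esub> \<one>\<^bsub>R\<^esub>,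
     add = (\<lambda>U V. \<Union>(a, s) \<in> U. \<Union>(b, t) \<in> V.
              mk_frac R (a \<otimes>\<^bsub>R\<^esub> t \<oplus>\<^bsub>R\<^esub> b \<otimes>\<^bsub>R\<^esub> s) (s \<otimes>\<^bsub>R\<^esub> t))\<rparr>"

definition to_frac :: "('a, 'r) ring_scheme \<Rightarrow> 'a \<Rightarrow> ('a \<times> 'a) set" where
  "to_frac R r = mk_frac R r \<one>\<^bsub>R\<^esub>"

definition total_fraction_module :: "('a, 'r) ring_scheme \<Rightarrow> ('a, ('a \<times> 'a) set) module" where
  "total_fraction_module R =
     ring.extend (total_fraction_ring R)
       \<lparr>smult = (\<lambda>r x. to_frac R r \<otimes>\<^bsub>total_fraction_ring R\<^esub> x)\<rparr>"

definition fractional_ideal :: "('a \<times> 'a) set set \<Rightarrow> ('a, 'r) ring_scheme \<Rightarrow> bool" where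
  "fractional_ideal B R \<longleftrightarrow>
     submodule B R (total_fraction_module R) \<and>
     (\<exists>s \<in> nonzerodivisors R. \<forall>b \<in> B.
        to_frac R s \<otimes>\<^bsub>total_fraction_ring R\<^esub> b \<in> to_frac R ` carrier R)"

text \<open>The library's inductive set \<^const>\<open>ideal_prod\<close> makes sense for arbitrary sets: it is
  the set of finite sums of products, here formed in the total ring of fractions.\<close>

definition invertible_fractional_ideal :: "('a \<times> 'a) set set \<Rightarrow> ('a, 'r) ring_scheme \<Rightarrow> bool" where
  "invertible_fractional_ideal A R \<longleftrightarrow>
     fractional_ideal A R \<and>
     (\<exists>B. fractional_ideal B R \<and>
          ideal_prod (total_fraction_ring R) A B = to_frac R ` carrier R)"

definition invertible_ideal :: "'a set \<Rightarrow> ('a, 'r) ring_scheme \<Rightarrow> bool" where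
  "invertible_ideal I R \<longleftrightarrow> ideal I R \<and> invertible_fractional_ideal (to_frac R ` I) R"

section \<open>Modules\<close>

text \<open>Records of type \<^typ>\<open>('a, 'b) module\<close> carry the fields \<^const>\<open>monoid.mult\<close> and \<^const>\<open>one\<close>
  inherited from rings; these are ignored by the locale \<^locale>\<open>module\<close> and filled in
  arbitrarily below.\<close>

definition regular_module :: "('a, 'r) ring_scheme \<Rightarrow> ('a, 'a) module" where
  "regular_module R =
    \<lparr>carrier = carrier R, monoid.mult = monoid.mult R, one = \<one>\<^bsub>R\<^esub>,
     ring.zero = \<zero>\<^bsub>R\<^esub>, add = add R, smult = monoid.mult R\<rparr>"

definition ideal_module :: "('a, 'r) ring_scheme \<Rightarrow> 'a set \<Rightarrow> ('a, 'a) module" where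
  "ideal_module R J = (regular_module R)\<lparr>carrier := J\<rparr>"

definition quot_module :: "('a, 'r) ring_scheme \<Rightarrow> 'a set \<Rightarrow> ('a, 'a set) module" where
  "quot_module R I =
     ring.extend (R Quot I) \<lparr>smult = (\<lambda>r U. (I +>\<^bsub>R\<^esub> r) \<otimes>\<^bsub>R Quot I\<^esub> U)\<rparr>"

definition direct_sum :: "'i set \<Rightarrow> ('i \<Rightarrow> ('a, 'b) module) \<Rightarrow> ('a, 'i \<Rightarrow> 'b) module" where
  "direct_sum S M =
    \<lparr>carrier = {x \<in> (\<Pi>\<^sub>E i\<in>S. carrier (M i)). finite {i \<in> S. x i \<noteq> \<zero>\<^bsub>M i\<^esub>}},
     monoid.mult = (\<lambda>x y. \<lambda>i\<in>S. x i \<otimes>\<^bsub>M i\<^esub> y i),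
     one = (\<lambda>i\<in>S. \<one>\<^bsub>M i\<^esub>),
     ring.zero = (\<lambda>i\<in>S. \<zero>\<^bsub>M i\<^esub>),
     add = (\<lambda>x y. \<lambda>i\<in>S. x i \<oplus>\<^bsub>M i\<^esub> y i),
     smult = (\<lambda>r x. \<lambda>i\<in>S. r \<odot>\<^bsub>M i\<^esub> x i)\<rparr>"

definition direct_sum2 :: "('a, 'b) module \<Rightarrow> ('a, 'c) module \<Rightarrow> ('a, 'b \<times> 'c) module" where
  "direct_sum2 M N =
    \<lparr>carrier = carrier M \<times> carrier N,
     monoid.mult = (\<lambda>(x, y) (x', y'). (x \<otimes>\<^bsub>M\<^esub> x', y \<otimes>\<^bsub>N\<^esub> y')),
     one = (\<one>\<^bsub>M\<^esub>, \<one>\<^bsub>N\<^esub>),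
     ring.zero = (\<zero>\<^bsub>M\<^esub>, \<zero>\<^bsub>N\<^esub>),
     add = (\<lambda>(x, y) (x', y'). (x \<oplus>\<^bsub>M\<^esub> x', y \<oplus>\<^bsub>N\<^esub> y')),
     smult = (\<lambda>r (x, y). (r \<odot>\<^bsub>M\<^esub> x, r \<odot>\<^bsub>N\<^esub> y))\<rparr>"

definition free_module :: "('a, 'r) ring_scheme \<Rightarrow> 'i set \<Rightarrow> ('a, 'i \<Rightarrow> 'a) module" where
  "free_module R S = direct_sum S (\<lambda>_. regular_module R)"

definition module_hom ::
  "('a, 'r) ring_scheme \<Rightarrow> ('a, 'b) module \<Rightarrow> ('a, 'c) module \<Rightarrow> ('b \<Rightarrow> 'c) set" where
  "module_hom R M N =
    {f \<in> carrier M \<rightarrow> carrier N.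
       (\<forall>x \<in> carrier M. \<forall>y \<in> carrier M. f (x \<oplus>\<^bsub>M\<^esub> y) = f x \<oplus>\<^bsub>N\<^esub> f y) \<and>
       (\<forall>r \<in> carrier R. \<forall>x \<in> carrier M. f (r \<odot>\<^bsub>M\<^esub> x) = r \<odot>\<^bsub>N\<^esub> f x)}"

definition module_iso ::
  "('a, 'r) ring_scheme \<Rightarrow> ('a, 'b) module \<Rightarrow> ('a, 'c) module \<Rightarrow> ('b \<Rightarrow> 'c) set" where
  "module_iso R M N = {f \<in> module_hom R M N. bij_betw f (carrier M) (carrier N)}"

definition isomorphic_modules ::
  "('a, 'r) ring_scheme \<Rightarrow> ('a, 'b) module \<Rightarrow> ('a, 'c) module \<Rightarrow> bool" where
  "isomorphic_modules R M N \<longleftrightarrow> module_iso R M N \<noteq> {}"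

definition finitely_generated_submodule ::
  "'b set \<Rightarrow> ('a, 'r) ring_scheme \<Rightarrow> ('a, 'b) module \<Rightarrow> bool" where
  "finitely_generated_submodule N R M \<longleftrightarrow>
     (\<exists>S. finite S \<and> S \<subseteq> carrier M \<and> N = \<Inter>{N'. submodule N' R M \<and> S \<subseteq> N'})"

definition finitely_generated_ideal :: "'a set \<Rightarrow> ('a, 'r) ring_scheme \<Rightarrow> bool" where
  "finitely_generated_ideal J R \<longleftrightarrow> (\<exists>S. finite S \<and> S \<subseteq> carrier R \<and> J = Idl\<^bsub>R\<^esub> S)"

definition fg_free_module :: "('a, 'r) ring_scheme \<Rightarrow> ('a, 'b) module \<Rightarrow> bool" where
  "fg_free_module R F \<longleftrightarrow>
     module R F \<and> (\<exists>n::nat. isomorphic_modules R (free_module R {..<n}) F)"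

definition finitely_presented :: "('a, 'r) ring_scheme \<Rightarrow> ('a, 'b) module \<Rightarrow> bool" where
  "finitely_presented R M \<longleftrightarrow>
     module R M \<and>
     (\<exists>(n::nat) f. f \<in> module_hom R (free_module R {..<n}) M \<and>
        f ` carrier (free_module R {..<n}) = carrier M \<and>
        finitely_generated_submodule (a_kernel (free_module R {..<n}) M f) R (free_module R {..<n}))"

text \<open>Projective means: direct summand of a free module. There is no loss in taking
  the basis \<open>S\<close> from the type \<^typ>\<open>'b\<close> of elements of \<open>P\<close>, since a projective module
  is a direct summand of the free module on its own carrier, nor in taking the complement \<open>Q\<close>
  from the type of elements of that free module.\<close>

definition projective_module :: "('a, 'r) ring_scheme \<Rightarrow> ('a, 'b) module \<Rightarrow> bool" where
  "projective_module R P \<longleftrightarrow>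
     module R P \<and>
     (\<exists>(S :: 'b set) (Q :: ('a, 'b \<Rightarrow> 'a) module). module R Q \<and>
        isomorphic_modules R (direct_sum2 P Q) (free_module R S))"

section \<open>Classes of rings\<close>

definition semihereditary_ring :: "('a, 'r) ring_scheme \<Rightarrow> bool" where
  "semihereditary_ring R \<longleftrightarrow>
     cring R \<and> (\<forall>J. finitely_generated_ideal J R \<longrightarrow> projective_module R (ideal_module R J))"

definition finite_character :: "('a, 'r) ring_scheme \<Rightarrow> bool" where
  "finite_character R \<longleftrightarrow>
     (\<forall>s \<in> nonzerodivisors R. finite {P. maximalideal P R \<and> s \<in> P})"

text \<open>The zero ring gets dimension 0, which is harmless for upper bounds.\<close>

definition krull_dim :: "('a, 'r) ring_scheme \<Rightarrow> enat" where
  "krull_dim R = Sup {enat k | k. \<exists>P :: nat \<Rightarrow> 'a set.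
     (\<forall>i\<le>k. primeideal (P i) R) \<and> (\<forall>i<k. P i \<subset> P (Suc i))}"

text \<open>The ring \<open>Re\<close>, with identity \<open>e\<close>.\<close>

definition idempotent_ring :: "('a, 'r) ring_scheme \<Rightarrow> 'a \<Rightarrow> ('a, 'r) ring_scheme" where
  "idempotent_ring R e = R\<lparr>carrier := {r \<otimes>\<^bsub>R\<^esub> e | r. r \<in> carrier R}, one := e\<rparr>"

section \<open>Stacked bases\<close>

text \<open>The two type arguments are the types of elements of the free module \<open>F\<close> and of
  the finitely presented module \<open>M\<close>; they are needed because HOL does not quantify over types.
  The set that \<open>H\<close> is mapped onto is \<open>I\<^sub>0J\<^sub>0 \<oplus> \<dots> \<oplus> I\<^sub>m\<^sub>-\<^sub>1J\<^sub>m\<^sub>-\<^sub>1\<close>, sitting inside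
  \<open>J\<^sub>0 \<oplus> \<dots> \<oplus> J\<^sub>n\<^sub>-\<^sub>1\<close> with zeros in the remaining components.\<close>

definition stacked_bases_property ::
  "('a, 'r) ring_scheme \<Rightarrow> 'f itself \<Rightarrow> 'm itself \<Rightarrow> bool" where
  "stacked_bases_property R (TF :: 'f itself) (TM :: 'm itself) \<longleftrightarrow>
     (\<forall>(M :: ('a, 'm) module) (F :: ('a, 'f) module) H \<pi>.
        finitely_presented R M \<and> fg_free_module R F \<and> submodule H R F \<and>
        \<pi> \<in> module_hom R F M \<and> \<pi> ` carrier F = carrier M \<and> a_kernel F M \<pi> = H \<longrightarrow>
        (\<exists>(n::nat) (m::nat) J I \<phi>.
           m \<le> n \<and>
           (\<forall>j<n. finitely_generated_ideal (J j) R) \<and>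
           (\<forall>j<m. invertible_ideal (I j) R) \<and>
           (\<forall>i j. i \<le> j \<longrightarrow> j < m \<longrightarrow> I j \<subseteq> I i) \<and>
           \<phi> \<in> module_iso R F (direct_sum {..<n} (\<lambda>j. ideal_module R (J j))) \<and>
           \<phi> ` H = (\<Pi>\<^sub>E j\<in>{..<n}. if j < m then ideal_prod R (I j) (J j) else {\<zero>\<^bsub>R\<^esub>})))"

end

theory Submission
  imports Defs
begin

text \<open>
  Either hypothesis makes \<open>R\<close> behave like a local-global ring modulo every non-zero-divisor \<open>d\<close>:
  each \<open>a\<close> has a partner \<open>t\<close> lying in exactly those maximal ideals containing \<open>d\<close> which miss \<open>a\<close>.
  Hence, in a module whose elements have coordinates, a suitable combination \<open>h\<close> of the elements
  of a finitely generated submodule has content which is comaximal with \<open>d\<close> on the support of the submodule.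

  Let \<open>H \<subseteq> G\<close> be finitely generated submodules of the free module \<open>F\<close>, with \<open>G\<close> pure, and let
  \<open>C\<close> be the content of \<open>H\<close>, which is invertible over \<open>Rf\<close> for an idempotent \<open>f\<close>. Applied to
  \<open>C\<^sup>-\<^sup>1H\<close>, with \<open>d\<close> clearing the denominators of a projection of \<open>F\<close> onto \<open>H\<close>, the element \<open>h\<close> spans,
  after saturation, a summand \<open>J\<close> of \<open>G\<close> isomorphic to an ideal, and \<open>H = CJ \<oplus> (H \<inter> G')\<close> for the complement
  \<open>G'\<close>, whose part of \<open>H\<close> has content inside \<open>C\<close>. Replacing \<open>C\<close> by \<open>C + (1 - f)A\<close>, where \<open>A\<close> is the
  invertible ideal found in the preceding step (initially \<open>R\<close>), makes it invertible without changing \<open>CJ\<close>,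
  and induction on the rank yields the stacked bases. Once \<open>H\<close> is exhausted, taking \<open>H = G\<close> in the same step
  splits the rest of \<open>F\<close> into ideals with decreasing supports.

  For the structure of \<open>F / H\<close>, the summands \<open>J / IJ\<close> are cyclic because \<open>J\<close> and \<open>I\<close> can be taken comaximal
  on the support of \<open>J\<close>. Two cyclic modules \<open>R / A \<oplus> R / B\<close> can be replaced by
  \<open>R / (A + B) \<oplus> R / (A \<inter> B)\<close> since \<open>(A : B) + (B : A) = R\<close>, which sorts the list, and
  the successive differences of the decreasing supports are the idempotents \<open>e\<^sub>i\<close>.
\<close>

text \<open>Separation holds only modulo a non-zero-divisor, so \<open>h\<close> cannot be made
  unimodular on its support outright; coprimality to one \<open>d\<close> is enough because
  \<open>d\<close> is fixed first, as the denominator of a retraction of \<open>F\<close> onto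
  \<open>H\<close>. If \<open>x\<close> is in the saturation of \<open>Rh\<close>, the content of
  \<open>h\<close> multiplies \<open>x\<close> into \<open>Rh\<close>, hence into the enlarged
  \<open>H\<close>, and \<open>d x\<close> lies there too by that retraction; comaximality then puts
  \<open>x\<close> itself there. So \<open>d\<close> leaves no trace. The combination argument is
  used a second time on functionals, to embed the new summand as an ideal comaximal with the
  invertible ideal attached to it. The rank varies along idempotents, so the induction uses a bound
  that is realised on some smaller idempotent below each nonzero one. Finite sums are rarely
  written: instead of expanding a relation, one shows that the elements with the desired property
  form an ideal or a submodule containing the generators. Likewise inverses are kept as relations
  \<open>JB = sRf\<close> inside \<open>R\<close>; the total ring of fractions is entered only to
  meet the definition of invertibility.\<close>

context cring
begin

section \<open>Ideals and non-zero-divisors\<close>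

lemma ideal_of_closed:
  assumes "L \<subseteq> carrier R" "\<zero> \<in> L"
    and "\<And>x y. x \<in> L \<Longrightarrow> y \<in> L \<Longrightarrow> x \<oplus> y \<in> L"
    and "\<And>r x. r \<in> carrier R \<Longrightarrow> x \<in> L \<Longrightarrow> r \<otimes> x \<in> L"
  shows "ideal L R"
proof (rule idealI[OF ring_axioms])
  have "\<ominus> x \<in> L" if "x \<in> L" for x
  proof -
    have "\<ominus> x = (\<ominus> \<one>) \<otimes> x" using that assms(1) by (simp add: l_minus subset_iff)
    then show ?thesis using assms(4)[OF _ that] by simp
  qed
  then show "subgroup L (add_monoid R)"
    using assms by (intro add.subgroupI) auto
  show "a \<otimes> x \<in> L" if "a \<in> L" "x \<in> carrier R" for a x
    using that assms(1) assms(4)[of x a] by (simp add: m_comm subset_iff)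
qed (use assms in auto)

lemma ideal_memD: "ideal L R \<Longrightarrow> x \<in> L \<Longrightarrow> x \<in> carrier R"
  by (rule ideal.Icarr)

lemma ideal_zero: "ideal L R \<Longrightarrow> \<zero> \<in> L"
  by (simp add: additive_subgroup.zero_closed ideal.axioms(1))

lemma ideal_add: "ideal L R \<Longrightarrow> x \<in> L \<Longrightarrow> y \<in> L \<Longrightarrow> x \<oplus> y \<in> L"
  by (simp add: additive_subgroup.a_closed ideal.axioms(1))

lemma ideal_minus: "ideal L R \<Longrightarrow> x \<in> L \<Longrightarrow> y \<in> L \<Longrightarrow> x \<ominus> y \<in> L"
  by (simp add: a_minus_def additive_subgroup.a_closed additive_subgroup.a_inv_closed ideal.axioms(1))

lemma ideal_mult: "ideal L R \<Longrightarrow> r \<in> carrier R \<Longrightarrow> x \<in> L \<Longrightarrow> r \<otimes> x \<in> L"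
  by (rule ideal.I_l_closed)

lemma ideal_mult_right: "ideal L R \<Longrightarrow> r \<in> carrier R \<Longrightarrow> x \<in> L \<Longrightarrow> x \<otimes> r \<in> L"
  by (rule ideal.I_r_closed)

lemma ideal_add_cancel:
  assumes "ideal L R" "x \<oplus> y \<in> L" "y \<in> L" "x \<in> carrier R" shows "x \<in> L"
proof -
  have "x = (x \<oplus> y) \<ominus> y" using assms ideal_memD[OF assms(1)] by algebra
  then show ?thesis using ideal_minus[OF assms(1-3)] by simp
qed

lemma nzd_closed: "s \<in> nonzerodivisors R \<Longrightarrow> s \<in> carrier R"
  by (simp add: nonzerodivisors_def)

lemma nzd_zero:
  "s \<in> nonzerodivisors R \<Longrightarrow> s \<otimes> x = \<zero> \<Longrightarrow> x \<in> carrier R \<Longrightarrow> x = \<zero>"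
  by (auto simp: nonzerodivisors_def m_comm)

lemma nzd_cancel:
  assumes "s \<in> nonzerodivisors R" "s \<otimes> x = s \<otimes> y" "x \<in> carrier R" "y \<in> carrier R"
  shows "x = y"
proof -
  have s: "s \<in> carrier R" using assms(1) by (rule nzd_closed)
  have "s \<otimes> (x \<ominus> y) = s \<otimes> x \<ominus> s \<otimes> y" using s assms(3,4) by algebra
  also have "\<dots> = \<zero>" using s assms(2-4) by (simp add: r_neg minus_eq)
  finally have "x \<ominus> y = \<zero>" using nzd_zero[OF assms(1)] assms(3,4) by simp
  then show ?thesis using assms(3,4) by (metis r_right_minus_eq)
qed

lemma nzdI:
  assumes "s \<in> carrier R" "\<And>x. x \<in> carrier R \<Longrightarrow> x \<otimes> s = \<zero> \<Longrightarrow> x = \<zero>"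
  shows "s \<in> nonzerodivisors R"
  using assms by (simp add: nonzerodivisors_def)

lemma nzd_mult:
  assumes "s \<in> nonzerodivisors R" "t \<in> nonzerodivisors R"
  shows "s \<otimes> t \<in> nonzerodivisors R"
proof (rule nzdI)
  show "s \<otimes> t \<in> carrier R" using assms nzd_closed by auto
  fix x assume x: "x \<in> carrier R" "x \<otimes> (s \<otimes> t) = \<zero>"
  have "s \<otimes> (t \<otimes> x) = \<zero>" using x assms[THEN nzd_closed] by algebra
  then show "x = \<zero>" using nzd_zero[OF assms(1)] nzd_zero[OF assms(2)] x assms[THEN nzd_closed] by blast
qed

lemma nzd_one: "\<one> \<in> nonzerodivisors R"
  by (rule nzdI) auto

lemma nzd_pow: "s \<in> nonzerodivisors R \<Longrightarrow> s [^] (k::nat) \<in> nonzerodivisors R"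
  by (induction k) (auto intro: nzd_one nzd_mult)

section \<open>Prime and maximal ideals\<close>

text \<open>Common source of prime ideals (with \<open>S\<close> multiplicative) and of maximal
  ideals (with \<open>S\<close> equal to \<open>{\<one>}\<close>).\<close>

lemma exists_ideal_maximal_disjoint:
  assumes D: "ideal D R" and S: "S \<inter> D = {}"
  obtains P where "ideal P R" "D \<subseteq> P" "S \<inter> P = {}"
    "\<And>Q. ideal Q R \<Longrightarrow> P \<subseteq> Q \<Longrightarrow> S \<inter> Q = {} \<Longrightarrow> Q = P"
proof -
  let ?A = "{Q. ideal Q R \<and> D \<subseteq> Q \<and> S \<inter> Q = {}}"
  have "\<exists>M\<in>?A. \<forall>Z\<in>?A. M \<subseteq> Z \<longrightarrow> Z = M"
  proof (rule subset_Zorn_nonempty)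
    show "?A \<noteq> {}" using assms by auto
  next
    fix C assume C: "C \<noteq> {}" "subset.chain ?A C"
    then have "subset.chain {I. ideal I R} C" by (auto simp: subset_chain_def)
    from chain_Union_is_ideal[OF this] have "ideal (\<Union>C) R" using C(1) by simp
    then show "\<Union>C \<in> ?A" using C by (auto simp: subset_chain_def)
  qed
  then obtain M where M: "M \<in> ?A" "\<And>Z. Z \<in> ?A \<Longrightarrow> M \<subseteq> Z \<Longrightarrow> Z = M" by auto
  have "Q = M" if "ideal Q R" "M \<subseteq> Q" "S \<inter> Q = {}" for Q
    using that M by (intro M(2)) auto
  with M(1) show thesis by (intro that[of M]) auto
qed

lemma exists_primeideal_disjoint:
  assumes D: "ideal D R" and S: "S \<inter> D = {}" "S \<subseteq> carrier R" "\<one> \<in> S"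
    and mult: "\<And>s t. s \<in> S \<Longrightarrow> t \<in> S \<Longrightarrow> s \<otimes> t \<in> S"
  obtains P where "primeideal P R" "D \<subseteq> P" "S \<inter> P = {}"
proof -
  obtain P where P: "ideal P R" "D \<subseteq> P" "S \<inter> P = {}"
    and max: "\<And>Q. ideal Q R \<Longrightarrow> P \<subseteq> Q \<Longrightarrow> S \<inter> Q = {} \<Longrightarrow> Q = P"
    using exists_ideal_maximal_disjoint[OF D S(1)] by metis
  \<comment> \<open>If \<open>b\<close> is outside \<open>P\<close> and \<open>a b\<close> inside,
    the colon ideal \<open>P : a\<close> is strictly larger than \<open>P\<close> and so meets
    \<open>S\<close>. Used below for the pair \<open>a, b\<close>, which gives \<open>s\<close>, and
    then for \<open>s, a\<close>, which gives \<open>t\<close> with \<open>s t\<close> in both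
    \<open>S\<close> and \<open>P\<close>.\<close>
  have colon: "\<exists>s\<in>S. a \<otimes> s \<in> P" if "a \<in> carrier R" "b \<in> carrier R" "b \<notin> P" "a \<otimes> b \<in> P" for a b
  proof -
    let ?Q = "{x \<in> carrier R. a \<otimes> x \<in> P}"
    have "ideal ?Q R" using ideal.helper_max_prime[OF P(1) is_cring that(1)] .
    moreover have "P \<subseteq> ?Q" using P(1) that(1) by (auto intro: ideal_mult ideal_memD)
    moreover have "?Q \<noteq> P" using that by auto
    ultimately have "S \<inter> ?Q \<noteq> {}" using max by blast
    then show ?thesis by auto
  qed
  have "primeideal P R"
  proof (rule primeidealI[OF P(1) is_cring])
    show "carrier R \<noteq> P" using P(3) S(3) by auto
    fix a b assume ab: "a \<in> carrier R" "b \<in> carrier R" "a \<otimes> b \<in> P"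
    show "a \<in> P \<or> b \<in> P"
    proof (rule ccontr)
      assume n: "\<not> (a \<in> P \<or> b \<in> P)"
      obtain s where s: "s \<in> S" "a \<otimes> s \<in> P" using colon[OF ab(1,2)] n ab by auto
      then have "s \<otimes> a \<in> P" using S(2) ab by (simp add: m_comm subset_iff)
      then obtain t where "t \<in> S" "s \<otimes> t \<in> P" using colon[of s a] s(1) S(2) n ab by auto
      then show False using P(3) mult[OF s(1)] by auto
    qed
  qed
  then show thesis using that P by blast
qed

lemma exists_maximalideal:
  assumes D: "ideal D R" and "\<one> \<notin> D"
  obtains P where "maximalideal P R" "D \<subseteq> P"
proof -
  obtain P where P: "ideal P R" "D \<subseteq> P" "{\<one>} \<inter> P = {}"
    and max: "\<And>Q. ideal Q R \<Longrightarrow> P \<subseteq> Q \<Longrightarrow> {\<one>} \<inter> Q = {} \<Longrightarrow> Q = P"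
    using exists_ideal_maximal_disjoint[OF D, of "{\<one>}"] assms(2) by (metis Int_insert_left_if0 Int_empty_left)
  have "maximalideal P R"
  proof (rule maximalidealI[OF P(1)])
    show "carrier R \<noteq> P" using P(3) by auto
    fix J assume J: "ideal J R" "P \<subseteq> J" "J \<subseteq> carrier R"
    show "J = P \<or> J = carrier R"
    proof (cases "\<one> \<in> J")
      case True then show ?thesis using ideal.one_imp_carrier[OF J(1)] by simp
    next
      case False then show ?thesis using max[OF J(1,2)] by simp
    qed
  qed
  then show thesis using that P(2) by blast
qed

lemma maximalideal_one: "maximalideal P R \<Longrightarrow> \<one> \<notin> P"
  using ideal.one_imp_carrier maximalideal.I_notcarr maximalideal.axioms(1) by blast

lemma maximalideal_ideal: "maximalideal P R \<Longrightarrow> ideal P R"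
  by (rule maximalideal.axioms(1))

lemma maximalideal_multD:
  "maximalideal P R \<Longrightarrow> a \<otimes> b \<in> P \<Longrightarrow> a \<in> carrier R \<Longrightarrow> b \<in> carrier R \<Longrightarrow> a \<in> P \<or> b \<in> P"
  by (rule primeideal.I_prime[OF maximalideal_prime])

lemma maximalideal_incomparable:
  assumes "maximalideal P R" "maximalideal Q R" "P \<subseteq> Q" shows "P = Q"
  using assms maximalideal.I_maximal[OF assms(1)] maximalideal.I_notcarr[OF assms(2)]
  by (metis ideal_memD maximalideal_ideal subsetI)

text \<open>In the maximal spectrum of \<open>R / dR\<close> this says that the complement of a
  basic open set is again a basic open set.\<close>

definition separating :: "'a \<Rightarrow> bool" where
  "separating d \<longleftrightarrow> (\<forall>a\<in>carrier R. \<exists>t\<in>carrier R. \<forall>P. maximalideal P R \<longrightarrow> d \<in> P \<longrightarrow> (a \<in> P \<longleftrightarrow> t \<notin> P))"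

text \<open>A product of elements, one from each member of \<open>C\<close>, all outside
  \<open>Q\<close>: they exist because distinct maximal ideals are incomparable.\<close>

lemma avoid_one_maximalideal:
  assumes "finite C" "\<And>P. P \<in> C \<Longrightarrow> maximalideal P R" "maximalideal Q R" "Q \<notin> C"
  shows "\<exists>u\<in>carrier R. (\<forall>P\<in>C. u \<in> P) \<and> u \<notin> Q"
  using assms
proof (induction C)
  case empty
  then show ?case using maximalideal_one by auto
next
  case (insert P C)
  then obtain u where u: "u \<in> carrier R" "\<forall>P\<in>C. u \<in> P" "u \<notin> Q" by auto
  have "\<not> P \<subseteq> Q" using insert maximalideal_incomparable by blast
  then obtain v where v: "v \<in> P" "v \<notin> Q" by auto
  have id: "ideal T R" if "T \<in> insert P C" for T using insert(4)[OF that] by (rule maximalideal_ideal)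
  have vR: "v \<in> carrier R" using v(1) ideal_memD[OF id[of P]] by simp
  have "u \<otimes> v \<in> T" if "T \<in> insert P C" for T
  proof (cases "T = P")
    case True then show ?thesis using ideal_mult[OF id[of P] u(1) v(1)] by simp
  next
    case False then show ?thesis using ideal_mult_right[OF id[OF that] vR] u(2) that by auto
  qed
  moreover have "u \<otimes> v \<notin> Q" using maximalideal_multD[OF insert(5), of u v] u(1,3) v(2) vR by auto
  ultimately show ?case using u vR by (intro bexI[of _ "u \<otimes> v"]) auto
qed

text \<open>The members of \<open>B\<close> are treated one at a time. If the current
  \<open>t\<close> falls into the new \<open>Q\<close>, adding some \<open>u\<close> that lies in
  all the other ideals but not in \<open>Q\<close> repairs this and changes nothing
  elsewhere.\<close>

lemma avoid_maximalideals:
  assumes "finite B" "finite A" "\<And>P. P \<in> A \<union> B \<Longrightarrow> maximalideal P R" "A \<inter> B = {}"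
  shows "\<exists>t\<in>carrier R. (\<forall>P\<in>A. t \<in> P) \<and> (\<forall>P\<in>B. t \<notin> P)"
  using assms
proof (induction B)
  case empty
  then show ?case using maximalideal_ideal ideal_zero by (intro bexI[of _ \<zero>]) auto
next
  case (insert Q B)
  then obtain t where t: "t \<in> carrier R" "\<forall>P\<in>A. t \<in> P" "\<forall>P\<in>B. t \<notin> P" by auto
  show ?case
  proof (cases "t \<in> Q")
    case False then show ?thesis using t by blast
  next
    case True
    obtain u where u: "u \<in> carrier R" "\<forall>P\<in>A\<union>B. u \<in> P" "u \<notin> Q"
      using avoid_one_maximalideal[of "A \<union> B" Q] insert by auto
    have id: "ideal P R" if "P \<in> insert Q (A \<union> B)" for P using that insert maximalideal_ideal by auto
    have "t \<oplus> u \<in> P" if "P \<in> A" for P using that t u ideal_add[OF id[of P]] by simp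
    moreover have "t \<oplus> u \<notin> P" if "P \<in> B" for P
      using that t u id[of P] ideal_add_cancel[of P t u] by auto
    moreover have "t \<oplus> u \<notin> Q"
      using True t u id[of Q] ideal_add_cancel[of Q u t] a_comm[of t u] by auto
    ultimately show ?thesis using t u by (intro bexI[of _ "t \<oplus> u"]) auto
  qed
qed

text \<open>Only finitely many maximal ideals contain \<open>d\<close>, and membership in each can
  be prescribed independently.\<close>

lemma separating_finite_character:
  assumes "finite_character R" "d \<in> nonzerodivisors R"
  shows "separating d"
  unfolding separating_def
proof
  fix a assume a: "a \<in> carrier R"
  let ?X = "{P. maximalideal P R \<and> d \<in> P}"
  have "finite ?X" using assms by (simp add: finite_character_def)
  then have "finite {P \<in> ?X. a \<in> P}" "finite {P \<in> ?X. a \<notin> P}"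
    by (rule rev_finite_subset, blast)+
  then have "\<exists>t\<in>carrier R. (\<forall>P\<in>{P \<in> ?X. a \<notin> P}. t \<in> P) \<and> (\<forall>P\<in>{P \<in> ?X. a \<in> P}. t \<notin> P)"
    by (rule avoid_maximalideals) auto
  then show "\<exists>t\<in>carrier R. \<forall>P. maximalideal P R \<longrightarrow> d \<in> P \<longrightarrow> (a \<in> P) = (t \<notin> P)" by auto
qed

text \<open>Localising at \<open>P\<close> and inverting \<open>d\<close> as well leaves a nonzero
  ring, because \<open>d\<close> is a non-zero-divisor. One of its primes gives a \<open>P0\<close>
  strictly below \<open>P\<close>, and a maximal ideal strictly above \<open>P\<close> would
  complete a chain of length 2.\<close>

lemma primeideal_maximal_of_dim_le_1:
  assumes dim: "krull_dim R \<le> 1" and d: "d \<in> nonzerodivisors R" and P: "primeideal P R" "d \<in> P"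
  shows "maximalideal P R"
proof -
  have Pid: "ideal P R" using P(1) primeideal_def by blast
  \<comment> \<open>The multiplicative set generated by \<open>d\<close> and the complement of
    \<open>P\<close>.\<close>
  let ?S = "{t \<otimes> d [^] k |t k::nat. t \<in> carrier R \<and> t \<notin> P}"
  have S: "t \<otimes> d [^] k \<in> ?S" if "t \<in> carrier R" "t \<notin> P" for t and k :: nat
    unfolding mem_Collect_eq using that by (intro exI[of _ t] exI[of _ k] conjI refl)
  have dR: "d \<in> carrier R" using d nzd_closed by auto
  have oneP: "\<one> \<notin> P" using P primeideal.I_notcarr ideal.one_imp_carrier Pid by blast
  obtain P0 where P0: "primeideal P0 R" "?S \<inter> P0 = {}"
  proof (rule exists_primeideal_disjoint[OF zeroideal, of ?S])
    have "t = \<zero>" if "t \<in> carrier R" "t \<otimes> d [^] k = \<zero>" for t and k :: nat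
      using nzd_zero[OF nzd_pow[OF d], of k t] that dR by (simp add: m_comm)
    then show "?S \<inter> {\<zero>} = {}" using ideal_zero[OF Pid] by fastforce
    show "?S \<subseteq> carrier R" using dR by auto
    show "\<one> \<in> ?S" using S[OF one_closed oneP, of 0] by simp
    fix s t assume "s \<in> ?S" "t \<in> ?S"
    then obtain s' k t' l where st: "s = s' \<otimes> d [^] (k::nat)" "t = t' \<otimes> d [^] (l::nat)"
      "s' \<in> carrier R" "t' \<in> carrier R" "s' \<notin> P" "t' \<notin> P" by auto
    have "s \<otimes> t = (s' \<otimes> t') \<otimes> (d [^] k \<otimes> d [^] l)" using st dR by (simp add: m_ac)
    also have "\<dots> = (s' \<otimes> t') \<otimes> d [^] (k + l)" using dR by (simp add: nat_pow_mult)
    finally have "s \<otimes> t = (s' \<otimes> t') \<otimes> d [^] (k + l)" .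
    moreover have "s' \<otimes> t' \<notin> P" using primeideal.I_prime[OF P(1) st(3,4)] st(5,6) by auto
    ultimately show "s \<otimes> t \<in> ?S" using S[of "s' \<otimes> t'" "k + l"] st by simp
  qed auto
  have "P0 \<subseteq> P"
  proof
    fix t assume t: "t \<in> P0"
    have tR: "t \<in> carrier R" using t P0(1) primeideal_def ideal_memD by blast
    show "t \<in> P"
    proof (rule ccontr)
      assume "t \<notin> P"
      then have "t \<in> ?S" using S[OF tR, of 0] tR by simp
      then show False using t P0(2) by blast
    qed
  qed
  moreover have "d \<in> ?S" using S[OF one_closed oneP, of 1] dR by (simp only: nat_pow_eone l_one)
  then have "d \<notin> P0" using P0(2) by blast
  ultimately have lt: "P0 \<subset> P" using P(2) by auto
  obtain M where M: "maximalideal M R" "P \<subseteq> M" using exists_maximalideal[OF Pid oneP] .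
  have "P = M"
  proof (rule ccontr)
    assume "P \<noteq> M"
    then have PM: "P \<subset> M" using M by auto
    let ?c = "\<lambda>i::nat. if i = 0 then P0 else if i = 1 then P else M"
    have "\<exists>P :: nat \<Rightarrow> 'a set. (\<forall>i\<le>2. primeideal (P i) R) \<and> (\<forall>i<2. P i \<subset> P (Suc i))"
      by (rule exI[of _ ?c]) (use P0 P M maximalideal_prime lt PM in \<open>auto simp: less_2_cases_iff\<close>)
    then have "enat 2 \<le> krull_dim R" unfolding krull_dim_def by (intro Sup_upper) auto
    also note dim
    finally show False by (simp add: one_enat_def)
  qed
  then show ?thesis using M by simp
qed

text \<open>Every prime containing \<open>d\<close> is maximal, so \<open>R / dR\<close> is
  zero-dimensional and \<open>a^k (1 - a x)\<close> is divisible by \<open>d\<close> for some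
  \<open>k\<close> and \<open>x\<close>. The partner of \<open>a\<close> is
  \<open>1 - a x\<close>.\<close>

lemma separating_dim_le_1:
  assumes dim: "krull_dim R \<le> 1" and d: "d \<in> nonzerodivisors R"
  shows "separating d"
  unfolding separating_def
proof
  fix a assume a: "a \<in> carrier R"
  have dR: "d \<in> carrier R" using d nzd_closed by auto
  let ?S = "{a [^] k \<otimes> (\<one> \<ominus> a \<otimes> x) |x k::nat. x \<in> carrier R}"
  have S: "a [^] k \<otimes> (\<one> \<ominus> a \<otimes> x) \<in> ?S" if "x \<in> carrier R" for x and k :: nat
    unfolding mem_Collect_eq using that by (intro exI[of _ x] exI[of _ k] conjI refl)
  have "?S \<inter> PIdl d \<noteq> {}"
  proof
    \<comment> \<open>A prime over \<open>d\<close> avoiding \<open>?S\<close> would be maximal and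
      miss \<open>a\<close>, hence contain some \<open>1 - a x\<close>; but this is in
      \<open>?S\<close>, with exponent 0.\<close>
    assume disj: "?S \<inter> PIdl d = {}"
    obtain P where P: "primeideal P R" "PIdl d \<subseteq> P" "?S \<inter> P = {}"
    proof (rule exists_primeideal_disjoint[OF cgenideal_ideal[OF dR] disj])
      show "?S \<subseteq> carrier R" using a by auto
      show "\<one> \<in> ?S" using S[OF zero_closed, of 0] a by (simp add: minus_eq)
      fix s t assume "s \<in> ?S" "t \<in> ?S"
      then obtain x k y l where st: "s = a [^] (k::nat) \<otimes> (\<one> \<ominus> a \<otimes> x)" "t = a [^] (l::nat) \<otimes> (\<one> \<ominus> a \<otimes> y)"
        "x \<in> carrier R" "y \<in> carrier R" by auto
      have "(\<one> \<ominus> a \<otimes> x) \<otimes> (\<one> \<ominus> a \<otimes> y) = \<one> \<ominus> a \<otimes> (x \<oplus> y \<ominus> a \<otimes> x \<otimes> y)"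
        using a st(3,4) by algebra
      moreover have "s \<otimes> t = (a [^] k \<otimes> a [^] l) \<otimes> ((\<one> \<ominus> a \<otimes> x) \<otimes> (\<one> \<ominus> a \<otimes> y))"
        using st a by (simp add: m_ac)
      ultimately have "s \<otimes> t = a [^] (k + l) \<otimes> (\<one> \<ominus> a \<otimes> (x \<oplus> y \<ominus> a \<otimes> x \<otimes> y))"
        using a by (simp add: nat_pow_mult)
      then show "s \<otimes> t \<in> ?S" using S[of "x \<oplus> y \<ominus> a \<otimes> x \<otimes> y" "k + l"] st a by simp
    qed blast
    have dP: "d \<in> P" using P(2) cgenideal_self[OF dR] by auto
    have M: "maximalideal P R" using primeideal_maximal_of_dim_le_1[OF dim d P(1) dP] .
    have Pid: "ideal P R" using M by (rule maximalideal_ideal)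
    have "a = a [^] (1::nat) \<otimes> (\<one> \<ominus> a \<otimes> \<zero>)" using a by (simp add: minus_eq)
    then have "a \<in> ?S" using S[OF zero_closed, of 1] by (simp only:)
    then have aP: "a \<notin> P" using P(3) by blast
    \<comment> \<open>This is \<open>P + aR\<close>, which maximality makes equal to
      \<open>R\<close>.\<close>
    let ?Q = "{z \<in> carrier R. \<exists>x\<in>carrier R. z \<ominus> a \<otimes> x \<in> P}"
    have "ideal ?Q R"
    proof (rule ideal_of_closed)
      show "\<zero> \<in> ?Q" using a ideal_zero[OF Pid] by (auto simp: minus_eq intro!: bexI[of _ \<zero>])
    next
      fix z w assume "z \<in> ?Q" "w \<in> ?Q"
      then obtain x y where *: "x \<in> carrier R" "y \<in> carrier R" "z \<in> carrier R" "w \<in> carrier R"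
        "z \<ominus> a \<otimes> x \<in> P" "w \<ominus> a \<otimes> y \<in> P" by auto
      have "z \<oplus> w \<ominus> a \<otimes> (x \<oplus> y) = (z \<ominus> a \<otimes> x) \<oplus> (w \<ominus> a \<otimes> y)" using * a by algebra
      then show "z \<oplus> w \<in> ?Q" using * ideal_add[OF Pid] by (auto intro!: bexI[of _ "x \<oplus> y"])
    next
      fix r z assume "r \<in> carrier R" "z \<in> ?Q"
      then obtain x where *: "x \<in> carrier R" "r \<in> carrier R" "z \<in> carrier R" "z \<ominus> a \<otimes> x \<in> P" by auto
      have "r \<otimes> z \<ominus> a \<otimes> (r \<otimes> x) = r \<otimes> (z \<ominus> a \<otimes> x)" using * a by algebra
      then show "r \<otimes> z \<in> ?Q" using * ideal_mult[OF Pid] by (auto intro!: bexI[of _ "r \<otimes> x"])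
    qed auto
    moreover have "P \<subseteq> ?Q" using a ideal_memD[OF Pid] by (auto simp: minus_eq intro!: bexI[of _ \<zero>])
    moreover have "a \<in> ?Q" using a ideal_zero[OF Pid]
      by (auto simp: minus_eq r_neg intro!: bexI[of _ \<one>])
    ultimately have "?Q = carrier R" using maximalideal.I_maximal[OF M, of ?Q] aP by blast
    then obtain x where x: "x \<in> carrier R" "\<one> \<ominus> a \<otimes> x \<in> P" by blast
    moreover have "\<one> \<ominus> a \<otimes> x \<in> ?S" using S[OF x(1), of 0] x a by (simp only: nat_pow_0 l_one minus_closed m_closed one_closed)
    ultimately show False using P(3) by blast
  qed
  then obtain x k where x: "x \<in> carrier R" "a [^] (k::nat) \<otimes> (\<one> \<ominus> a \<otimes> x) \<in> PIdl d" by auto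
  show "\<exists>t\<in>carrier R. \<forall>P. maximalideal P R \<longrightarrow> d \<in> P \<longrightarrow> (a \<in> P) = (t \<notin> P)"
  proof (intro bexI[of _ "\<one> \<ominus> a \<otimes> x"] allI impI)
    fix P assume P: "maximalideal P R" "d \<in> P"
    have Pid: "ideal P R" using P(1) by (rule maximalideal_ideal)
    have in_P: "a [^] k \<otimes> (\<one> \<ominus> a \<otimes> x) \<in> P"
      using x(2) cgenideal_minimal[OF Pid P(2)] by auto
    show "(a \<in> P) = (\<one> \<ominus> a \<otimes> x \<notin> P)"
    proof
      assume "a \<in> P"
      then have ax: "a \<otimes> x \<in> P" using ideal_mult_right[OF Pid] x by auto
      show "\<one> \<ominus> a \<otimes> x \<notin> P"
      proof
        assume "\<one> \<ominus> a \<otimes> x \<in> P"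
        from ideal_add[OF Pid this ax] have "\<one> \<in> P"
          using a x by (simp add: minus_eq a_assoc l_neg)
        then show False using maximalideal_one[OF P(1)] by simp
      qed
    next
      assume t: "\<one> \<ominus> a \<otimes> x \<notin> P"
      have "a [^] k \<in> P" using maximalideal_multD[OF P(1) in_P] t a x by auto
      then show "a \<in> P"
      proof (induction k)
        case 0 then show ?case using maximalideal_one[OF P(1)] by simp
      next
        case (Suc k) then show ?case using maximalideal_multD[OF P(1), of "a [^] k" a] a by auto
      qed
    qed
  qed (use a x in auto)
qed

end

section \<open>Idempotent supports and divisibility\<close>

lemma module_homD:
  assumes "f \<in> module_hom R M N"
  shows "x \<in> carrier M \<Longrightarrow> f x \<in> carrier N"
    and "x \<in> carrier M \<Longrightarrow> y \<in> carrier M \<Longrightarrow> f (x \<oplus>\<^bsub>M\<^esub> y) = f x \<oplus>\<^bsub>N\<^esub> f y"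
    and "r \<in> carrier R \<Longrightarrow> x \<in> carrier M \<Longrightarrow> f (r \<odot>\<^bsub>M\<^esub> x) = r \<odot>\<^bsub>N\<^esub> f x"
  using assms by (auto simp: module_hom_def)

lemma module_homI:
  assumes "\<And>x. x \<in> carrier M \<Longrightarrow> f x \<in> carrier N"
    and "\<And>x y. x \<in> carrier M \<Longrightarrow> y \<in> carrier M \<Longrightarrow> f (x \<oplus>\<^bsub>M\<^esub> y) = f x \<oplus>\<^bsub>N\<^esub> f y"
    and "\<And>r x. r \<in> carrier R \<Longrightarrow> x \<in> carrier M \<Longrightarrow> f (r \<odot>\<^bsub>M\<^esub> x) = r \<odot>\<^bsub>N\<^esub> f x"
  shows "f \<in> module_hom R M N"
  using assms by (auto simp: module_hom_def)

lemma module_iso_inv: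
  assumes f: "f \<in> module_iso R M N"
    and "\<And>x y. x \<in> carrier M \<Longrightarrow> y \<in> carrier M \<Longrightarrow> x \<oplus>\<^bsub>M\<^esub> y \<in> carrier M"
    and "\<And>r x. r \<in> carrier R \<Longrightarrow> x \<in> carrier M \<Longrightarrow> r \<odot>\<^bsub>M\<^esub> x \<in> carrier M"
  shows "inv_into (carrier M) f \<in> module_iso R N M"
proof -
  let ?g = "inv_into (carrier M) f"
  have hom: "f \<in> module_hom R M N" and bij: "bij_betw f (carrier M) (carrier N)"
    using f by (auto simp: module_iso_def)
  have inj: "inj_on f (carrier M)" and im: "f ` carrier M = carrier N"
    using bij by (auto simp: bij_betw_def)
  have g: "?g y \<in> carrier M" "f (?g y) = y" if "y \<in> carrier N" for y
    using that im by (auto simp: inv_into_into f_inv_into_f)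
  have "?g \<in> module_hom R N M"
  proof (rule module_homI)
    fix x y assume xy: "x \<in> carrier N" "y \<in> carrier N"
    have "f (?g x \<oplus>\<^bsub>M\<^esub> ?g y) = x \<oplus>\<^bsub>N\<^esub> y" using module_homD(2)[OF hom] g xy by simp
    then show "?g (x \<oplus>\<^bsub>N\<^esub> y) = ?g x \<oplus>\<^bsub>M\<^esub> ?g y"
      using inv_into_f_eq[OF inj] assms(2) g xy by metis
  next
    fix r x assume xy: "r \<in> carrier R" "x \<in> carrier N"
    have "f (r \<odot>\<^bsub>M\<^esub> ?g x) = r \<odot>\<^bsub>N\<^esub> x" using module_homD(3)[OF hom] g xy by simp
    then show "?g (r \<odot>\<^bsub>N\<^esub> x) = r \<odot>\<^bsub>M\<^esub> ?g x"
      using inv_into_f_eq[OF inj] assms(3) g xy by metis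
  qed (use g in auto)
  then show ?thesis using bij_betw_inv_into[OF bij] by (simp add: module_iso_def)
qed

context cring
begin

text \<open>The dual basis lemma, with the finite sums hidden in the ideal \<open>L\<close>.\<close>

lemma projective_ideal_dual_basis:
  assumes proj: "projective_module R (ideal_module R J)" and J: "ideal J R" and L: "ideal L R"
    and x: "x \<in> J"
    and dual: "\<And>\<psi> y. (\<And>z. z \<in> J \<Longrightarrow> \<psi> z \<in> carrier R) \<Longrightarrow>
        (\<And>z w. z \<in> J \<Longrightarrow> w \<in> J \<Longrightarrow> \<psi> (z \<oplus> w) = \<psi> z \<oplus> \<psi> w) \<Longrightarrow>
        (\<And>r z. r \<in> carrier R \<Longrightarrow> z \<in> J \<Longrightarrow> \<psi> (r \<otimes> z) = r \<otimes> \<psi> z) \<Longrightarrow> y \<in> J \<Longrightarrow> \<psi> x \<otimes> y \<in> L"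
  shows "x \<in> L"
proof -
  obtain S :: "'a set" and Q :: "('a, 'a \<Rightarrow> 'a) module" and \<Phi> where Q: "module R Q"
    and \<Phi>: "\<Phi> \<in> module_iso R (direct_sum2 (ideal_module R J) Q) (free_module R S)"
    using proj unfolding projective_module_def isomorphic_modules_def by auto
  interpret Q: module R Q by (rule Q)
  let ?P = "direct_sum2 (ideal_module R J) Q" and ?V = "free_module R S"
  have P: "carrier ?P = J \<times> carrier Q" "\<And>a b c d. (a, b) \<oplus>\<^bsub>?P\<^esub> (c, d) = (a \<oplus> c, b \<oplus>\<^bsub>Q\<^esub> d)"
    "\<And>r a b. r \<odot>\<^bsub>?P\<^esub> (a, b) = (r \<otimes> a, r \<odot>\<^bsub>Q\<^esub> b)"
    by (auto simp: direct_sum2_def ideal_module_def regular_module_def)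
  have V: "carrier ?V = {v \<in> S \<rightarrow>\<^sub>E carrier R. finite {i \<in> S. v i \<noteq> \<zero>}}"
    "\<And>v w. v \<oplus>\<^bsub>?V\<^esub> w = (\<lambda>i\<in>S. v i \<oplus> w i)" "\<And>r v. r \<odot>\<^bsub>?V\<^esub> v = (\<lambda>i\<in>S. r \<otimes> v i)"
    by (auto simp: free_module_def direct_sum_def regular_module_def)
  have \<Phi>h: "\<Phi> \<in> module_hom R ?P ?V" using \<Phi> by (simp add: module_iso_def)
  have \<Psi>: "inv_into (carrier ?P) \<Phi> \<in> module_iso R ?V ?P"
    using J by (intro module_iso_inv[OF \<Phi>]) (auto simp: P intro: ideal_add ideal_mult)
  define p where "p v = fst (inv_into (carrier ?P) \<Phi> v)" for v
  have \<Psi>h: "inv_into (carrier ?P) \<Phi> \<in> module_hom R ?V ?P" using \<Psi> by (simp add: module_iso_def)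
  have pJ: "p v \<in> J" if "v \<in> carrier ?V" for v
    using module_homD(1)[OF \<Psi>h that] by (simp add: p_def P(1) mem_Times_iff)
  have padd: "p (v \<oplus>\<^bsub>?V\<^esub> w) = p v \<oplus> p w" if "v \<in> carrier ?V" "w \<in> carrier ?V" for v w
    using module_homD(2)[OF \<Psi>h that]
    by (cases "inv_into (carrier ?P) \<Phi> v"; cases "inv_into (carrier ?P) \<Phi> w") (simp add: p_def P)
  have psm: "p (r \<odot>\<^bsub>?V\<^esub> v) = r \<otimes> p v" if "r \<in> carrier R" "v \<in> carrier ?V" for r v
    using module_homD(3)[OF \<Psi>h that] by (cases "inv_into (carrier ?P) \<Phi> v") (simp add: p_def P)
  \<comment> \<open>The expansion of \<open>p v\<close> as the sum of the
    \<open>v i \<otimes> p (e i)\<close>, carried out by removing one index at a time from a finite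
    set \<open>T\<close> containing the support of \<open>v\<close>. Every term lies in
    \<open>L\<close>.\<close>
  have pinL: "p v \<in> L"
    if "finite T" "v \<in> carrier ?V" "{i \<in> S. v i \<noteq> \<zero>} \<subseteq> T" "\<And>i y. i \<in> S \<Longrightarrow> y \<in> J \<Longrightarrow> v i \<otimes> y \<in> L" for v T
    using that
  proof (induction T arbitrary: v)
    case empty
    have v: "v i = \<zero>" if "i \<in> S" for i using empty(2) that by blast
    have vS: "v \<in> S \<rightarrow>\<^sub>E carrier R" using empty(1) unfolding V(1) by blast
    have "v i = (\<zero> \<odot>\<^bsub>?V\<^esub> v) i" for i
    proof (cases "i \<in> S")
      case True
      then show ?thesis unfolding V(3) restrict_apply by (simp add: v)
    next
      case False
      then show ?thesis unfolding V(3) restrict_apply by (simp add: PiE_arb[OF vS])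
    qed
    then have "v = \<zero> \<odot>\<^bsub>?V\<^esub> v" by (rule ext)
    then have "p v = p (\<zero> \<odot>\<^bsub>?V\<^esub> v)" by (rule arg_cong)
    also have "\<dots> = \<zero>" using psm[OF zero_closed empty(1)] ideal_memD[OF J pJ[OF empty(1)]] by simp
    finally show ?case using ideal_zero[OF L] by simp
  next
    case (insert t T)
    show ?case
    proof (cases "t \<in> S")
      case False
      then show ?thesis using insert by blast
    next
      case True
      define v' where "v' = (\<lambda>i\<in>S. if i = t then \<zero> else v i)"
      define e where "e = (\<lambda>i\<in>S. if i = t then \<one> else \<zero>)"
      have "{i \<in> S. v' i \<noteq> \<zero>} \<subseteq> {i \<in> S. v i \<noteq> \<zero>}" by (auto simp: v'_def)
      moreover have vS: "v \<in> S \<rightarrow>\<^sub>E carrier R" "finite {i \<in> S. v i \<noteq> \<zero>}" using insert(4) by (simp_all add: V(1))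
      ultimately have "finite {i \<in> S. v' i \<noteq> \<zero>}" by (elim finite_subset)
      moreover have "v' \<in> S \<rightarrow>\<^sub>E carrier R" using vS(1) by (auto simp: v'_def)
      ultimately have v'V: "v' \<in> carrier ?V" by (simp add: V(1))
      have "{i \<in> S. e i \<noteq> \<zero>} \<subseteq> {t}" by (auto simp: e_def)
      then have "finite {i \<in> S. e i \<noteq> \<zero>}" by (rule finite_subset) simp
      moreover have "e \<in> S \<rightarrow>\<^sub>E carrier R" by (auto simp: e_def)
      ultimately have eV: "e \<in> carrier ?V" by (simp add: V(1))
      have vt: "v t \<in> carrier R" using insert(4) True by (auto simp: V)
      have smV: "v t \<odot>\<^bsub>?V\<^esub> e \<in> carrier ?V"
      proof -
        have "{i \<in> S. (v t \<odot>\<^bsub>?V\<^esub> e) i \<noteq> \<zero>} \<subseteq> {t}" using vt by (auto simp: V e_def)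
        then have "finite {i \<in> S. (v t \<odot>\<^bsub>?V\<^esub> e) i \<noteq> \<zero>}" by (rule finite_subset) simp
        moreover have "v t \<odot>\<^bsub>?V\<^esub> e \<in> S \<rightarrow>\<^sub>E carrier R" using vt by (auto simp: V(3) e_def)
        ultimately show ?thesis by (simp add: V(1))
      qed
      have v_eq: "v = v' \<oplus>\<^bsub>?V\<^esub> v t \<odot>\<^bsub>?V\<^esub> e"
      proof
        fix i show "v i = (v' \<oplus>\<^bsub>?V\<^esub> v t \<odot>\<^bsub>?V\<^esub> e) i"
          using insert(4) vt by (cases "i \<in> S") (auto simp: V v'_def e_def PiE_iff extensional_def)
      qed
      have "p v = p v' \<oplus> v t \<otimes> p e"
        by (subst v_eq) (simp only: padd[OF v'V smV] psm[OF vt eV])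
      moreover have "p v' \<in> L"
      proof (rule insert.IH[OF v'V])
        show "{i \<in> S. v' i \<noteq> \<zero>} \<subseteq> T" using insert(5) by (auto simp: v'_def)
        show "v' i \<otimes> y \<in> L" if "i \<in> S" "y \<in> J" for i y
          using insert(6)[OF that] that ideal_zero[OF L] ideal_memD[OF J] by (auto simp: v'_def)
      qed
      moreover have "v t \<otimes> p e \<in> L" using insert(6)[OF True pJ[OF eV]] .
      ultimately show ?thesis using ideal_add[OF L] by simp
    qed
  qed
  have xP: "(x, \<zero>\<^bsub>Q\<^esub>) \<in> carrier ?P" using x by (simp add: P)
  let ?v = "\<Phi> (x, \<zero>\<^bsub>Q\<^esub>)"
  have vV: "?v \<in> carrier ?V" using module_homD(1)[OF \<Phi>h xP] .
  have "p ?v = x" using \<Phi> xP by (simp add: p_def module_iso_def bij_betw_def inv_into_f_f)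
  moreover have "p ?v \<in> L"
  proof (rule pinL[OF _ vV order_refl])
    show "finite {i \<in> S. ?v i \<noteq> \<zero>}" using vV by (simp add: V)
    fix i y assume i: "i \<in> S" and y: "y \<in> J"
    show "?v i \<otimes> y \<in> L"
    proof (rule dual[of "\<lambda>z. \<Phi> (z, \<zero>\<^bsub>Q\<^esub>) i" y])
      fix z assume z: "z \<in> J"
      show "\<Phi> (z, \<zero>\<^bsub>Q\<^esub>) i \<in> carrier R" using module_homD(1)[OF \<Phi>h, of "(z, \<zero>\<^bsub>Q\<^esub>)"] z i by (auto simp: P V)
      show "\<Phi> (z \<oplus> w, \<zero>\<^bsub>Q\<^esub>) i = \<Phi> (z, \<zero>\<^bsub>Q\<^esub>) i \<oplus> \<Phi> (w, \<zero>\<^bsub>Q\<^esub>) i" if "w \<in> J" for w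
        using module_homD(2)[OF \<Phi>h, of "(z, \<zero>\<^bsub>Q\<^esub>)" "(w, \<zero>\<^bsub>Q\<^esub>)"] z i that by (simp add: P V)
      show "\<Phi> (r \<otimes> z, \<zero>\<^bsub>Q\<^esub>) i = r \<otimes> \<Phi> (z, \<zero>\<^bsub>Q\<^esub>) i" if "r \<in> carrier R" for r
        using module_homD(3)[OF \<Phi>h that, of "(z, \<zero>\<^bsub>Q\<^esub>)"] z i that by (simp add: P V)
    qed (rule y)
  qed
  ultimately show ?thesis by simp
qed

end

definition idem_elem :: "('a, 'r) ring_scheme \<Rightarrow> 'a \<Rightarrow> bool" where
  "idem_elem R f \<longleftrightarrow> f \<in> carrier R \<and> f \<otimes>\<^bsub>R\<^esub> f = f"

locale semihereditary = cring R for R (structure) +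
  assumes fg_projective: "finitely_generated_ideal J R \<Longrightarrow> projective_module R (ideal_module R J)"
begin

lemma fg_ideal: "finitely_generated_ideal J R \<Longrightarrow> ideal J R"
  by (auto simp: finitely_generated_ideal_def genideal_ideal)

lemma idempotent_compl:
  assumes "idem_elem R f" shows "idem_elem R (\<one> \<ominus> f)" "f \<otimes> (\<one> \<ominus> f) = \<zero>"
proof -
  have f: "f \<in> carrier R" "f \<otimes> f = f" using assms by (auto simp: idem_elem_def)
  have "(\<one> \<ominus> f) \<otimes> (\<one> \<ominus> f) = \<one> \<ominus> f \<ominus> f \<oplus> f \<otimes> f" using f(1) by algebra
  also have "\<dots> = \<one> \<ominus> f" unfolding f(2) using f(1) by algebra
  finally show "idem_elem R (\<one> \<ominus> f)" using f by (simp add: idem_elem_def)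
  have "f \<otimes> (\<one> \<ominus> f) = f \<ominus> f \<otimes> f" using f(1) by algebra
  then show "f \<otimes> (\<one> \<ominus> f) = \<zero>" unfolding f(2) using f(1) by (simp add: minus_eq r_neg)
qed

text \<open>The idempotent \<open>f\<close> is the support of \<open>a\<close>: the annihilator of \<open>a\<close> is generated by \<open>1 - f\<close>.\<close>

definition support :: "'a \<Rightarrow> 'a \<Rightarrow> bool" where
  "support a f \<longleftrightarrow> idem_elem R f \<and> a \<in> carrier R \<and> f \<otimes> a = a \<and> (\<forall>x\<in>carrier R. x \<otimes> a = \<zero> \<longrightarrow> x \<otimes> f = \<zero>)"

text \<open>For a functional \<open>\<psi>\<close> on \<open>aR\<close>, whatever annihilates
  \<open>a\<close> annihilates \<open>\<psi> a\<close>. The dual basis lemma therefore yields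
  \<open>a = u a\<close> with \<open>u\<close> killed by the annihilator of \<open>a\<close>. As
  \<open>1 - u\<close> belongs to that annihilator, \<open>u\<close> is idempotent.\<close>

lemma exists_support:
  assumes a: "a \<in> carrier R"
  shows "\<exists>f. support a f"
proof -
  let ?J = "Idl {a}"
  have fg: "finitely_generated_ideal ?J R"
    using a unfolding finitely_generated_ideal_def by (intro exI[of _ "{a}"]) auto
  have Ja: "?J = PIdl a" using cgenideal_eq_genideal[OF a] by simp
  have Jid: "ideal ?J R" using fg_ideal[OF fg] .
  have aJ: "a \<in> ?J" using a genideal_self' by simp
  \<comment> \<open>The double annihilator of \<open>a\<close>.\<close>
  let ?U = "{u \<in> carrier R. \<forall>x\<in>carrier R. x \<otimes> a = \<zero> \<longrightarrow> x \<otimes> u = \<zero>}"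
  let ?L = "{u \<otimes> a |u. u \<in> ?U}"
  have U: "ideal ?U R"
  proof (rule ideal_of_closed)
    fix r x assume r: "r \<in> carrier R" "x \<in> ?U"
    have "y \<otimes> (r \<otimes> x) = r \<otimes> (y \<otimes> x)" if "y \<in> carrier R" for y using r that by (simp add: m_ac)
    then show "r \<otimes> x \<in> ?U" using r by auto
  qed (auto simp: r_distr)
  have L: "ideal ?L R"
  proof (rule ideal_of_closed)
    show "?L \<subseteq> carrier R" using a by auto
    show "\<zero> \<in> ?L" using a ideal_zero[OF U] by (auto intro!: exI[of _ \<zero>])
    fix x y assume "x \<in> ?L" "y \<in> ?L"
    then obtain u v where uv: "u \<in> ?U" "v \<in> ?U" "x = u \<otimes> a" "y = v \<otimes> a" by auto
    then have "x \<oplus> y = (u \<oplus> v) \<otimes> a" using a by (simp add: l_distr)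
    then show "x \<oplus> y \<in> ?L" using ideal_add[OF U uv(1,2)] by blast
  next
    fix r x assume r: "r \<in> carrier R" and "x \<in> ?L"
    then obtain u where uv: "u \<in> ?U" "x = u \<otimes> a" by auto
    then have "r \<otimes> x = (r \<otimes> u) \<otimes> a" using a r by (simp add: m_assoc)
    then show "r \<otimes> x \<in> ?L" using ideal_mult[OF U r uv(1)] by blast
  qed
  have "a \<in> ?L"
  proof (rule projective_ideal_dual_basis[OF fg_projective[OF fg] Jid L aJ])
    fix \<psi> y
    assume \<psi>: "\<And>z. z \<in> ?J \<Longrightarrow> \<psi> z \<in> carrier R"
      "\<And>z w. z \<in> ?J \<Longrightarrow> w \<in> ?J \<Longrightarrow> \<psi> (z \<oplus> w) = \<psi> z \<oplus> \<psi> w"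
      "\<And>r z. r \<in> carrier R \<Longrightarrow> z \<in> ?J \<Longrightarrow> \<psi> (r \<otimes> z) = r \<otimes> \<psi> z" and "y \<in> ?J"
    then obtain r where r: "r \<in> carrier R" "y = r \<otimes> a" unfolding Ja by (auto simp: cgenideal_def)
    have \<psi>a: "\<psi> a \<in> carrier R" using \<psi>(1) aJ by simp
    have psi0: "\<psi> \<zero> = \<zero>" using \<psi>(3)[OF zero_closed aJ] \<psi>a a by simp
    have "x \<otimes> \<psi> a = \<zero>" if "x \<in> carrier R" "x \<otimes> a = \<zero>" for x
      using \<psi>(3)[OF that(1) aJ] that psi0 by simp
    then have "\<psi> a \<in> ?U" using \<psi>a by auto
    then have "r \<otimes> \<psi> a \<in> ?U" using ideal_mult[OF U r(1)] by simp
    moreover have "\<psi> a \<otimes> y = (r \<otimes> \<psi> a) \<otimes> a" using r \<psi>a a by (simp add: m_ac)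
    ultimately show "\<psi> a \<otimes> y \<in> ?L" by blast
  qed
  then obtain u where uU: "u \<in> ?U" and ua: "a = u \<otimes> a" by blast
  have u: "u \<in> carrier R" "u \<otimes> a = a" "\<And>x. x \<in> carrier R \<Longrightarrow> x \<otimes> a = \<zero> \<Longrightarrow> x \<otimes> u = \<zero>"
    using uU ua[symmetric] by simp_all
  have "(\<one> \<ominus> u) \<otimes> a = a \<ominus> u \<otimes> a" using u(1) a by algebra
  then have "(\<one> \<ominus> u) \<otimes> a = \<zero>" using u(2) a by (simp add: minus_eq r_neg)
  then have "(\<one> \<ominus> u) \<otimes> u = \<zero>" using u(3) u(1) by simp
  moreover have "(\<one> \<ominus> u) \<otimes> u = u \<ominus> u \<otimes> u" using u(1) by algebra
  ultimately have "u \<otimes> u = u" using u(1) by (metis m_closed r_right_minus_eq)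
  then show ?thesis using u a unfolding support_def idem_elem_def by blast
qed

text \<open>The ideal contains a single element with the same annihilator as the whole ideal. A
  further generator \<open>c\<close> is absorbed by passing from \<open>a\<close> to
  \<open>a + (1 - f) c\<close>, where \<open>f\<close> is the support of \<open>a\<close>, so that
  the two terms live over complementary idempotents.\<close>

lemma fg_ideal_support:
  assumes "finitely_generated_ideal J R"
  shows "\<exists>a f. a \<in> J \<and> support a f \<and> (\<forall>c\<in>J. f \<otimes> c = c)"
proof -
  obtain S where S: "finite S" "S \<subseteq> carrier R" "J = Idl S"
    using assms by (auto simp: finitely_generated_ideal_def)
  have "\<exists>a f. a \<in> J \<and> support a f \<and> (\<forall>c\<in>T. f \<otimes> c = c)" if "finite T" "T \<subseteq> S" for T
    using that
  proof (induction T)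
    case empty
    have "support \<zero> \<zero>" by (simp add: support_def idem_elem_def)
    then show ?case using ideal_zero[OF fg_ideal[OF assms]] by blast
  next
    case (insert c T)
    then obtain a f where af: "a \<in> J" "support a f" "\<forall>c\<in>T. f \<otimes> c = c" by auto
    have cJ: "c \<in> J" using insert S genideal_self[OF S(2)] by auto
    have f: "idem_elem R f" "f \<in> carrier R" "f \<otimes> f = f" "a \<in> carrier R" "f \<otimes> a = a"
      "\<And>x. x \<in> carrier R \<Longrightarrow> x \<otimes> a = \<zero> \<Longrightarrow> x \<otimes> f = \<zero>"
      using af by (auto simp: support_def idem_elem_def)
    have c: "c \<in> carrier R" using cJ ideal_memD[OF fg_ideal[OF assms]] by auto
    let ?e = "\<one> \<ominus> f"
    have e: "?e \<in> carrier R" "f \<otimes> ?e = \<zero>" using f idempotent_compl by auto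
    let ?b = "a \<oplus> ?e \<otimes> c"
    have bJ: "?b \<in> J" using af cJ e ideal_add ideal_mult fg_ideal[OF assms] by metis
    have b: "?b \<in> carrier R" using f c by simp
    obtain g where g: "support ?b g" using exists_support[OF b] by auto
    have g': "idem_elem R g" "g \<in> carrier R" "g \<otimes> ?b = ?b"
      using g by (auto simp: support_def idem_elem_def)
    \<comment> \<open>Since \<open>f\<close> recovers \<open>a\<close> from \<open>?b\<close>,
      whatever annihilates \<open>?b\<close> annihilates \<open>a\<close>, hence \<open>f\<close>,
      and then \<open>c\<close> as well.\<close>
    have fb: "f \<otimes> ?b = a"
    proof -
      have "f \<otimes> ?b = f \<otimes> a \<oplus> (f \<otimes> ?e) \<otimes> c" using f(2,4) c e(1) by algebra
      then show ?thesis using f e c by simp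
    qed
    have ge: "(\<one> \<ominus> g) \<otimes> ?b = \<zero>"
    proof -
      have "(\<one> \<ominus> g) \<otimes> ?b = ?b \<ominus> g \<otimes> ?b" using g'(2) b by algebra
      then show ?thesis using g'(3) b by (simp add: minus_eq r_neg)
    qed
    have ga: "(\<one> \<ominus> g) \<otimes> a = \<zero>"
    proof -
      have "(\<one> \<ominus> g) \<otimes> (f \<otimes> ?b) = f \<otimes> ((\<one> \<ominus> g) \<otimes> ?b)" using f(2) g'(2) b by (intro m_lcomm) simp_all
      then show ?thesis unfolding fb ge using f by simp
    qed
    have gf: "(\<one> \<ominus> g) \<otimes> f = \<zero>" using f(6)[OF _ ga] g' by simp
    have gc: "(\<one> \<ominus> g) \<otimes> c = \<zero>"
    proof -
      have "(\<one> \<ominus> g) \<otimes> c = (\<one> \<ominus> g) \<otimes> ?b \<ominus> (\<one> \<ominus> g) \<otimes> a \<oplus> ((\<one> \<ominus> g) \<otimes> f) \<otimes> c"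
        using f(2,4) g'(2) c by algebra
      then show ?thesis using ge ga gf c by (simp add: minus_eq)
    qed
    have gfix: "g \<otimes> y = y" if "y \<in> carrier R" "(\<one> \<ominus> g) \<otimes> y = \<zero>" for y
    proof -
      have "(\<one> \<ominus> g) \<otimes> y = y \<ominus> g \<otimes> y" using g'(2) that(1) by algebra
      then show ?thesis using that g'(2) by (metis m_closed r_right_minus_eq)
    qed
    have "g \<otimes> y = y" if "y \<in> insert c T" for y
    proof (cases "y = c")
      case True then show ?thesis using gfix gc c by simp
    next
      case False
      then have y: "y \<in> carrier R" "f \<otimes> y = y" using that af insert S by auto
      have "(\<one> \<ominus> g) \<otimes> y = ((\<one> \<ominus> g) \<otimes> f) \<otimes> y" using y f(2) g'(2) by (simp add: m_assoc)
      then show ?thesis using gfix y gf by simp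
    qed
    then show ?case using bJ g by blast
  qed
  from this[OF S(1) order_refl] obtain a f where af: "a \<in> J" "support a f" "\<forall>c\<in>S. f \<otimes> c = c" by auto
  have f: "f \<in> carrier R" using af by (auto simp: support_def idem_elem_def)
  have "ideal {c \<in> carrier R. f \<otimes> c = c} R"
  proof (rule ideal_of_closed)
    fix r x assume "r \<in> carrier R" "x \<in> {c \<in> carrier R. f \<otimes> c = c}"
    then show "r \<otimes> x \<in> {c \<in> carrier R. f \<otimes> c = c}" using f m_lcomm[of f r x] by simp
  qed (use f in \<open>auto simp: r_distr\<close>)
  then have "J \<subseteq> {c \<in> carrier R. f \<otimes> c = c}"
    unfolding S(3) using S(2) af(3) by (intro genideal_minimal) auto
  then show ?thesis using af by blast
qed

text \<open>Filling the complement of the support with 1 gives a non-zero-divisor that agrees with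
  \<open>a\<close> over \<open>f\<close>. This is the source of the denominators \<open>s\<close> in
  the pairings below.\<close>

lemma support_nzd:
  assumes "support a f" shows "a \<oplus> (\<one> \<ominus> f) \<in> nonzerodivisors R" "f \<otimes> (a \<oplus> (\<one> \<ominus> f)) = a"
proof -
  have f: "idem_elem R f" "f \<in> carrier R" "a \<in> carrier R" "f \<otimes> a = a"
    "\<And>x. x \<in> carrier R \<Longrightarrow> x \<otimes> a = \<zero> \<Longrightarrow> x \<otimes> f = \<zero>"
    using assms by (auto simp: support_def idem_elem_def)
  have "f \<otimes> (a \<oplus> (\<one> \<ominus> f)) = f \<otimes> a \<oplus> f \<otimes> (\<one> \<ominus> f)" using f(2,3) by (simp add: r_distr)
  then show fa: "f \<otimes> (a \<oplus> (\<one> \<ominus> f)) = a" using idempotent_compl[OF f(1)] f by simp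
  show "a \<oplus> (\<one> \<ominus> f) \<in> nonzerodivisors R"
  proof (rule nzdI)
    fix x assume x: "x \<in> carrier R" "x \<otimes> (a \<oplus> (\<one> \<ominus> f)) = \<zero>"
    have "x \<otimes> a = f \<otimes> (x \<otimes> (a \<oplus> (\<one> \<ominus> f)))" using x f fa by (metis m_lcomm a_closed one_closed minus_closed)
    then have "x \<otimes> a = \<zero>" using x f by simp
    then have xf: "x \<otimes> f = \<zero>" using f(5) x by simp
    have "x = x \<otimes> (a \<oplus> (\<one> \<ominus> f)) \<ominus> x \<otimes> a \<oplus> x \<otimes> f" using x(1) f(2,3) by algebra
    then show "x = \<zero>" using x \<open>x \<otimes> a = \<zero>\<close> xf by (simp add: minus_eq)
  qed (use f in simp)
qed

text \<open>Together the clauses say \<open>JB = sRf\<close>.\<close>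

definition divisible_pairing :: "'a \<Rightarrow> 'a \<Rightarrow> 'a set \<Rightarrow> 'a set \<Rightarrow> bool" where
  "divisible_pairing s f J B \<longleftrightarrow> s \<in> nonzerodivisors R \<and> idem_elem R f \<and> ideal J R \<and> ideal B R \<and>
     (\<forall>c\<in>J. f \<otimes> c = c) \<and> (\<forall>c\<in>J. \<forall>b\<in>B. \<exists>t\<in>carrier R. c \<otimes> b = s \<otimes> t) \<and> s \<otimes> f \<in> ideal_prod R J B"

text \<open>A finitely generated ideal \<open>J\<close> with support \<open>f\<close> is invertible over \<open>Rf\<close>, with inverse \<open>s\<^sup>-\<^sup>1B\<close>.\<close>

lemma exists_divisible_pairing:
  assumes fg: "finitely_generated_ideal J R"
  shows "\<exists>s f B. divisible_pairing s f J B \<and> s \<otimes> f \<in> J"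
proof -
  have J: "ideal J R" using fg by (rule fg_ideal)
  obtain a f where af: "a \<in> J" "support a f" "\<forall>c\<in>J. f \<otimes> c = c" using fg_ideal_support[OF fg] by auto
  let ?s = "a \<oplus> (\<one> \<ominus> f)"
  have s: "?s \<in> nonzerodivisors R" "f \<otimes> ?s = a" using support_nzd[OF af(2)] by auto
  have sR: "?s \<in> carrier R" using nzd_closed[OF s(1)] .
  have f: "idem_elem R f" "f \<in> carrier R" "a \<in> carrier R" using af by (auto simp: support_def idem_elem_def)
  \<comment> \<open>The colon ideal \<open>sR : J\<close>, so that \<open>?B / s\<close> consists of
    fractions multiplying \<open>J\<close> into \<open>R\<close>.\<close>
  let ?B = "{b \<in> carrier R. \<forall>c\<in>J. \<exists>t\<in>carrier R. c \<otimes> b = ?s \<otimes> t}"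
  have B: "ideal ?B R"
  proof (rule ideal_of_closed)
    show "\<zero> \<in> ?B" using sR ideal_memD[OF J] by (auto intro!: bexI[of _ \<zero>])
    fix x y assume xy: "x \<in> ?B" "y \<in> ?B"
    have "\<exists>t\<in>carrier R. c \<otimes> (x \<oplus> y) = ?s \<otimes> t" if c: "c \<in> J" for c
    proof -
      obtain t u where "t \<in> carrier R" "u \<in> carrier R" "c \<otimes> x = ?s \<otimes> t" "c \<otimes> y = ?s \<otimes> u" using xy c by blast
      then show ?thesis using xy ideal_memD[OF J c] sR by (intro bexI[of _ "t \<oplus> u"]) (auto simp: r_distr)
    qed
    then show "x \<oplus> y \<in> ?B" using xy by auto
  next
    fix r x assume rx: "r \<in> carrier R" "x \<in> ?B"
    have "\<exists>t\<in>carrier R. c \<otimes> (r \<otimes> x) = ?s \<otimes> t" if c: "c \<in> J" for c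
    proof -
      obtain t where t: "t \<in> carrier R" "c \<otimes> x = ?s \<otimes> t" using rx c by blast
      have "c \<otimes> (r \<otimes> x) = r \<otimes> (c \<otimes> x)" using rx ideal_memD[OF J c] by (simp add: m_lcomm)
      also have "\<dots> = ?s \<otimes> (r \<otimes> t)" using t rx sR by (simp add: m_lcomm)
      finally show ?thesis using t rx by blast
    qed
    then show "r \<otimes> x \<in> ?B" using rx by auto
  qed auto
  have "a \<in> ideal_prod R J ?B"
  proof (rule projective_ideal_dual_basis[OF fg_projective[OF fg] J ideal_prod_is_ideal[OF J B] af(1)])
    fix \<psi> y
    assume \<psi>: "\<And>z. z \<in> J \<Longrightarrow> \<psi> z \<in> carrier R"
      "\<And>r z. r \<in> carrier R \<Longrightarrow> z \<in> J \<Longrightarrow> \<psi> (r \<otimes> z) = r \<otimes> \<psi> z" and y: "y \<in> J"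
    \<comment> \<open>From \<open>c \<psi>(a) = \<psi>(a c) = a \<psi>(c)\<close> and
      \<open>a = f s\<close>: a functional on \<open>J\<close> produces an element of the colon
      ideal, and the dual basis lemma then puts \<open>a = s f\<close> into
      \<open>J ?B\<close>.\<close>
    have "\<psi> a \<in> ?B"
    proof -
      have "c \<otimes> \<psi> a = ?s \<otimes> (f \<otimes> \<psi> c)" if c: "c \<in> J" for c
      proof -
        have cR: "c \<in> carrier R" using ideal_memD[OF J c] .
        have "c \<otimes> \<psi> a = \<psi> (a \<otimes> c)" using \<psi>(2)[OF cR af(1)] f cR by (simp add: m_comm)
        also have "\<dots> = (f \<otimes> ?s) \<otimes> \<psi> c" using \<psi>(2)[OF f(3) c] s(2) by simp
        finally show ?thesis using f sR \<psi>(1)[OF c] by (simp add: m_ac)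
      qed
      then show ?thesis using \<psi>(1) af(1) f by blast
    qed
    then have "y \<otimes> \<psi> a \<in> ideal_prod R J ?B" using y by (rule ideal_prod.prod[rotated])
    then show "\<psi> a \<otimes> y \<in> ideal_prod R J ?B" using \<psi>(1)[OF af(1)] ideal_memD[OF J y] by (simp add: m_comm)
  qed
  moreover have sf: "?s \<otimes> f = a" using s(2) sR f by (simp add: m_comm)
  ultimately have "divisible_pairing ?s f J ?B"
    unfolding divisible_pairing_def sf using s(1) f(1) J B af(3) by (intro conjI) simp_all
  moreover have "?s \<otimes> f \<in> J" unfolding sf by (rule af(1))
  ultimately show ?thesis by blast
qed

text \<open>Dividing the relation \<open>sf \<in> JB\<close> by \<open>s\<close>.\<close>

lemma divisible_pairing_ideal:
  assumes p: "divisible_pairing s f J B" and L: "ideal L R"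
    and gen: "\<And>c b t. c \<in> J \<Longrightarrow> b \<in> B \<Longrightarrow> t \<in> carrier R \<Longrightarrow> c \<otimes> b = s \<otimes> t \<Longrightarrow> t \<in> L"
  shows "f \<in> L"
proof -
  have s: "s \<in> nonzerodivisors R" "s \<in> carrier R" using p nzd_closed by (auto simp: divisible_pairing_def)
  have f: "f \<in> carrier R" using p by (auto simp: divisible_pairing_def idem_elem_def)
  have "\<exists>t\<in>L. z = s \<otimes> t" if "z \<in> ideal_prod R J B" for z
    using that
  proof induction
    case (prod i j)
    then obtain t where "t \<in> carrier R" "i \<otimes> j = s \<otimes> t" using p unfolding divisible_pairing_def by blast
    then show ?case using gen prod by blast
  next
    case (sum x y)
    then obtain t u where "t \<in> L" "u \<in> L" "x = s \<otimes> t" "y = s \<otimes> u" by auto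
    then show ?case using s(2) ideal_memD[OF L] by (intro bexI[of _ "t \<oplus> u"]) (auto simp: r_distr ideal_add[OF L])
  qed
  moreover have "s \<otimes> f \<in> ideal_prod R J B" using p by (simp add: divisible_pairing_def)
  ultimately obtain t where t: "t \<in> L" "s \<otimes> f = s \<otimes> t" by blast
  then show ?thesis using nzd_cancel[OF s(1) t(2) f] ideal_memD[OF L] by blast
qed

end

section \<open>Coprime combinations modulo a non-zero-divisor\<close>

lemma (in semihereditary) family_support:
  fixes q :: nat
  assumes w: "\<And>j. j < q \<Longrightarrow> w j \<in> carrier R"
  shows "\<exists>g. idem_elem R g \<and> (\<forall>j<q. g \<otimes> w j = w j) \<and>
    (\<forall>x\<in>carrier R. (\<forall>j<q. x \<otimes> w j = \<zero>) \<longrightarrow> x \<otimes> g = \<zero>)"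
proof -
  let ?S = "w ` {..<q}"
  have S: "?S \<subseteq> carrier R" using w by auto
  have "finitely_generated_ideal (Idl ?S) R" using S unfolding finitely_generated_ideal_def by blast
  then obtain a g where ag: "a \<in> Idl ?S" "support a g" "\<forall>c\<in>Idl ?S. g \<otimes> c = c"
    using fg_ideal_support by blast
  have "x \<otimes> g = \<zero>" if x: "x \<in> carrier R" "\<forall>j<q. x \<otimes> w j = \<zero>" for x
  proof -
    have "ideal {c \<in> carrier R. x \<otimes> c = \<zero>} R"
      using x(1) by (intro ideal_of_closed) (auto simp: r_distr m_lcomm)
    then have "Idl ?S \<subseteq> {c \<in> carrier R. x \<otimes> c = \<zero>}" using w x(2) by (intro genideal_minimal) auto
    then show ?thesis using ag(1,2) x(1) by (auto simp: support_def)
  qed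
  moreover have "\<forall>j<q. g \<otimes> w j = w j" using ag(3) genideal_self[OF S] by auto
  ultimately show ?thesis using ag(2) unfolding support_def by blast
qed

text \<open>The only form in which finite character, or dimension at most 1, enters from here
  on.\<close>

locale almost_local_global = semihereditary +
  assumes nzd_separating: "d \<in> nonzerodivisors R \<Longrightarrow> separating d"
begin

text \<open>The product of the partners of the \<open>w j\<close>: it avoids \<open>P\<close>
  exactly when each factor does.\<close>

lemma separate_family:
  fixes q :: nat
  assumes d: "d \<in> nonzerodivisors R" and w: "\<And>j. j < q \<Longrightarrow> w j \<in> carrier R"
  shows "\<exists>t\<in>carrier R. \<forall>P. maximalideal P R \<longrightarrow> d \<in> P \<longrightarrow> (t \<notin> P \<longleftrightarrow> (\<forall>j<q. w j \<in> P))"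
  using w
proof (induction q)
  case 0
  then show ?case using maximalideal_one by auto
next
  case (Suc q)
  have "\<exists>t\<in>carrier R. \<forall>P. maximalideal P R \<longrightarrow> d \<in> P \<longrightarrow> (t \<notin> P \<longleftrightarrow> (\<forall>j<q. w j \<in> P))"
    by (rule Suc.IH) (simp add: Suc.prems)
  then obtain t where t: "t \<in> carrier R"
    "\<And>P. maximalideal P R \<Longrightarrow> d \<in> P \<Longrightarrow> (t \<notin> P \<longleftrightarrow> (\<forall>j<q. w j \<in> P))" by blast
  obtain u where u: "u \<in> carrier R"
    "\<And>P. maximalideal P R \<Longrightarrow> d \<in> P \<Longrightarrow> (w q \<in> P \<longleftrightarrow> u \<notin> P)"
    using nzd_separating[OF d] Suc(2)[of q] unfolding separating_def by auto
  have "t \<otimes> u \<notin> P \<longleftrightarrow> (\<forall>j<Suc q. w j \<in> P)" if P: "maximalideal P R" "d \<in> P" for P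
  proof -
    have "t \<otimes> u \<in> P \<longleftrightarrow> t \<in> P \<or> u \<in> P"
      using maximalideal_multD[OF P(1) _ t(1) u(1)] ideal_mult[OF maximalideal_ideal[OF P(1)] t(1)]
        ideal_mult_right[OF maximalideal_ideal[OF P(1)] u(1)] by auto
    then show ?thesis using t(2)[OF P] u(2)[OF P] by (auto simp: less_Suc_eq)
  qed
  then show ?case using t(1) u(1) by (intro bexI[of _ "t \<otimes> u"]) auto
qed

context
  fixes W :: "(nat \<Rightarrow> 'a) set" and q :: nat and f :: 'a
  assumes W_closed: "\<And>w j. w \<in> W \<Longrightarrow> j < q \<Longrightarrow> w j \<in> carrier R"
    and W_comb: "\<And>w w' r. w \<in> W \<Longrightarrow> w' \<in> W \<Longrightarrow> r \<in> carrier R \<Longrightarrow>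
      \<exists>w''\<in>W. \<forall>j<q. w'' j = w j \<oplus> r \<otimes> w' j"
    and W_ne: "W \<noteq> {}"
    and f: "idem_elem R f"
    and content: "\<And>L. ideal L R \<Longrightarrow> (\<And>w j. w \<in> W \<Longrightarrow> j < q \<Longrightarrow> w j \<in> L) \<Longrightarrow> f \<in> L"
begin

text \<open>If \<open>w\<close> works for \<open>a\<close> and \<open>w'\<close> for
  \<open>a'\<close>, then \<open>w + t w'\<close> works for \<open>a + a'\<close>, provided that,
  among the maximal ideals over \<open>d\<close>, \<open>t\<close> avoids exactly those containing
  all \<open>w j\<close>. So the elements for which some member of \<open>W\<close> works form an
  ideal, and it contains every coordinate. Two families \<open>W\<close> are used later: the
  coordinate vectors of a submodule, and the values of all functionals at fixed vectors.\<close>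

lemma exists_coprime_combination:
  assumes d: "d \<in> nonzerodivisors R"
  shows "\<exists>w\<in>W. \<forall>L. ideal L R \<longrightarrow> (\<forall>j<q. w j \<in> L) \<longrightarrow> d \<in> L \<longrightarrow> f \<in> L"
proof -
  have fR: "f \<in> carrier R" using f by (simp add: idem_elem_def)
  let ?L = "{a \<in> carrier R. \<exists>w\<in>W. \<forall>P. maximalideal P R \<longrightarrow> d \<in> P \<longrightarrow> a \<notin> P \<longrightarrow> (\<exists>j<q. w j \<notin> P)}"
  have "ideal ?L R"
  proof (rule ideal_of_closed)
    show "\<zero> \<in> ?L" using W_ne ideal_zero[OF maximalideal_ideal] by blast
  next
    fix a a' assume "a \<in> ?L" "a' \<in> ?L"
    then obtain w w' where a: "a \<in> carrier R" "a' \<in> carrier R" and w: "w \<in> W" "w' \<in> W"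
      and wP: "\<And>P. maximalideal P R \<Longrightarrow> d \<in> P \<Longrightarrow> a \<notin> P \<Longrightarrow> \<exists>j<q. w j \<notin> P"
      and w'P: "\<And>P. maximalideal P R \<Longrightarrow> d \<in> P \<Longrightarrow> a' \<notin> P \<Longrightarrow> \<exists>j<q. w' j \<notin> P" by blast
    have "\<exists>t\<in>carrier R. \<forall>P. maximalideal P R \<longrightarrow> d \<in> P \<longrightarrow> (t \<notin> P \<longleftrightarrow> (\<forall>j<q. w j \<in> P))"
      by (rule separate_family[OF d]) (rule W_closed[OF w(1)])
    then obtain t where t1: "t \<in> carrier R"
      and t2: "\<forall>P. maximalideal P R \<longrightarrow> d \<in> P \<longrightarrow> (t \<notin> P \<longleftrightarrow> (\<forall>j<q. w j \<in> P))"
      by (elim bexE)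
    have t: "t \<in> carrier R"
      "\<And>P. maximalideal P R \<Longrightarrow> d \<in> P \<Longrightarrow> (t \<notin> P \<longleftrightarrow> (\<forall>j<q. w j \<in> P))"
      using t1 t2 by simp_all
    obtain v where v: "v \<in> W" "\<And>j. j < q \<Longrightarrow> v j = w j \<oplus> t \<otimes> w' j" using W_comb[OF w t(1)] by blast
    have "\<exists>j<q. v j \<notin> P" if P: "maximalideal P R" "d \<in> P" "a \<oplus> a' \<notin> P" for P
    proof -
      have I: "ideal P R" using maximalideal_ideal[OF P(1)] .
      show ?thesis
      proof (cases "t \<in> P")
        case True
        then obtain j where j: "j < q" "w j \<notin> P" using t(2)[OF P(1,2)] by blast
        have "t \<otimes> w' j \<in> P" using ideal_mult_right[OF I W_closed[OF w(2) j(1)] True] .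
        then have "v j \<notin> P" using ideal_add_cancel[OF I _ _ W_closed[OF w(1) j(1)]] j v(2) by metis
        then show ?thesis using j by blast
      next
        case False
        then have w0: "\<forall>j<q. w j \<in> P" using t(2)[OF P(1,2)] by blast
        then have "a \<in> P" using wP[OF P(1,2)] by blast
        then have "a' \<notin> P" using ideal_add[OF I] P(3) by blast
        then obtain j where j: "j < q" "w' j \<notin> P" using w'P[OF P(1,2)] by blast
        have tR: "t \<otimes> w' j \<in> carrier R" using t(1) W_closed[OF w(2) j(1)] by simp
        have "t \<otimes> w' j \<notin> P" using maximalideal_multD[OF P(1) _ t(1) W_closed[OF w(2) j(1)]] False j(2) by blast
        moreover have "v j = t \<otimes> w' j \<oplus> w j" using v(2)[OF j(1)] tR W_closed[OF w(1) j(1)] by (simp add: a_comm)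
        ultimately have "v j \<notin> P" using ideal_add_cancel[OF I, of "t \<otimes> w' j" "w j"] w0 j(1) tR by auto
        then show ?thesis using j by blast
      qed
    qed
    then show "a \<oplus> a' \<in> ?L" using v(1) a by blast
  next
    fix r a assume r: "r \<in> carrier R" and "a \<in> ?L"
    then obtain w where a: "a \<in> carrier R" and w: "w \<in> W"
      and wP: "\<And>P. maximalideal P R \<Longrightarrow> d \<in> P \<Longrightarrow> a \<notin> P \<Longrightarrow> \<exists>j<q. w j \<notin> P" by blast
    have "\<exists>j<q. w j \<notin> P" if "maximalideal P R" "d \<in> P" "r \<otimes> a \<notin> P" for P
      using wP[OF that(1,2)] that(3) ideal_mult[OF maximalideal_ideal[OF that(1)] r] by blast
    then show "r \<otimes> a \<in> ?L" using r a w by blast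
  qed blast
  moreover have "w j \<in> ?L" if "w \<in> W" "j < q" for w j
    using that W_closed by blast
  ultimately have "f \<in> ?L" using content[of ?L] by blast
  then obtain w where w: "w \<in> W" "\<And>P. maximalideal P R \<Longrightarrow> d \<in> P \<Longrightarrow> f \<notin> P \<Longrightarrow> \<exists>j<q. w j \<notin> P" by blast
  have "f \<in> L" if L: "ideal L R" "\<forall>j<q. w j \<in> L" "d \<in> L" for L
  proof (rule ccontr)
    assume nf: "f \<notin> L"
    \<comment> \<open>The colon ideal \<open>L : f\<close>. It contains \<open>L\<close>, hence
      \<open>d\<close>, and \<open>1 - f\<close>, so a maximal ideal above it misses
      \<open>f\<close>; by the choice of \<open>w\<close> it misses some \<open>w j\<close>, which
      however lies in \<open>L\<close>.\<close>
    let ?Q = "{r \<in> carrier R. f \<otimes> r \<in> L}"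
    have Q: "ideal ?Q R" using ideal.helper_max_prime[OF L(1) is_cring fR] .
    have "\<one> \<notin> ?Q" using nf fR by simp
    then obtain P where P: "maximalideal P R" "?Q \<subseteq> P" using exists_maximalideal[OF Q] by metis
    have LQ: "L \<subseteq> ?Q" using ideal_mult[OF L(1) fR] ideal_memD[OF L(1)] by blast
    have "\<one> \<ominus> f \<in> ?Q" using idempotent_compl[OF f] ideal_zero[OF L(1)] fR by simp
    then have f1: "\<one> \<ominus> f \<in> P" using P by blast
    have "f \<notin> P"
    proof
      assume "f \<in> P"
      then have "f \<oplus> (\<one> \<ominus> f) \<in> P" using f1 ideal_add[OF maximalideal_ideal[OF P(1)]] by blast
      moreover have "f \<oplus> (\<one> \<ominus> f) = \<one>" using fR by algebra
      ultimately show False using maximalideal_one[OF P(1)] by simp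
    qed
    then obtain j where "j < q" "w j \<notin> P" using w(2)[OF P(1)] L(3) LQ P(2) by blast
    then show False using L(2) LQ P(2) by blast
  qed
  then show ?thesis using w(1) by blast
qed

text \<open>The same scheme with annihilators in place of maximal ideals: \<open>w'\<close> is added
  only over the complement of the support \<open>g\<close> of \<open>w\<close>, so nothing of
  \<open>w\<close> is cancelled.\<close>

lemma exists_faithful_combination:
  "\<exists>w\<in>W. \<forall>x\<in>carrier R. (\<forall>j<q. x \<otimes> w j = \<zero>) \<longrightarrow> x \<otimes> f = \<zero>"
proof -
  let ?L = "{a \<in> carrier R. \<exists>w\<in>W. \<forall>x\<in>carrier R. (\<forall>j<q. x \<otimes> w j = \<zero>) \<longrightarrow> x \<otimes> a = \<zero>}"
  have "ideal ?L R"
  proof (rule ideal_of_closed)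
    show "\<zero> \<in> ?L" using W_ne by auto
  next
    fix a a' assume "a \<in> ?L" "a' \<in> ?L"
    then obtain w w' where a: "a \<in> carrier R" "a' \<in> carrier R" and w: "w \<in> W" "w' \<in> W"
      and wa: "\<And>x. x \<in> carrier R \<Longrightarrow> (\<And>j. j < q \<Longrightarrow> x \<otimes> w j = \<zero>) \<Longrightarrow> x \<otimes> a = \<zero>"
      and wa': "\<And>x. x \<in> carrier R \<Longrightarrow> (\<And>j. j < q \<Longrightarrow> x \<otimes> w' j = \<zero>) \<Longrightarrow> x \<otimes> a' = \<zero>" by blast
    obtain g where g: "idem_elem R g" "\<And>j. j < q \<Longrightarrow> g \<otimes> w j = w j"
      "\<And>x. x \<in> carrier R \<Longrightarrow> (\<And>j. j < q \<Longrightarrow> x \<otimes> w j = \<zero>) \<Longrightarrow> x \<otimes> g = \<zero>"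
      using family_support[of q w] W_closed[OF w(1)] by blast
    have gR: "g \<in> carrier R" "g \<otimes> g = g" using g(1) by (auto simp: idem_elem_def)
    have ge: "g \<otimes> (\<one> \<ominus> g) = \<zero>" using idempotent_compl[OF g(1)] by simp
    obtain v where v: "v \<in> W" "\<And>j. j < q \<Longrightarrow> v j = w j \<oplus> (\<one> \<ominus> g) \<otimes> w' j"
      using W_comb[OF w, of "\<one> \<ominus> g"] gR by auto
    have "x \<otimes> (a \<oplus> a') = \<zero>" if x: "x \<in> carrier R" "\<forall>j<q. x \<otimes> v j = \<zero>" for x
    proof -
      have gv: "g \<otimes> v j = w j" if "j < q" for j
      proof -
        have "g \<otimes> v j = g \<otimes> w j \<oplus> (g \<otimes> (\<one> \<ominus> g)) \<otimes> w' j"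
          unfolding v(2)[OF that] using gR(1) W_closed[OF w(1) that] W_closed[OF w(2) that] by algebra
        then show ?thesis using g(2)[OF that] ge W_closed[OF w(1) that] W_closed[OF w(2) that] by simp
      qed
      have xw: "x \<otimes> w j = \<zero>" if "j < q" for j
      proof -
        have "x \<otimes> (g \<otimes> v j) = g \<otimes> (x \<otimes> v j)" using x(1) gR(1) W_closed[OF v(1) that] by (intro m_lcomm)
        then show ?thesis using gv[OF that] x(2) that gR by simp
      qed
      have xa: "x \<otimes> a = \<zero>" using wa[OF x(1)] xw by blast
      have xg: "x \<otimes> g = \<zero>" using g(3)[OF x(1)] xw by blast
      have "x \<otimes> w' j = \<zero>" if "j < q" for j
      proof -
        have "x \<otimes> w' j = x \<otimes> v j \<ominus> x \<otimes> w j \<oplus> (x \<otimes> g) \<otimes> w' j"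
          unfolding v(2)[OF that] using gR(1) x(1) W_closed[OF w(1) that] W_closed[OF w(2) that] by algebra
        then show ?thesis using xw[OF that] x(2) that xg W_closed[OF w(2) that] by (simp add: minus_eq)
      qed
      then have "x \<otimes> a' = \<zero>" using wa'[OF x(1)] by blast
      then show ?thesis using xa x a by (simp add: r_distr)
    qed
    then show "a \<oplus> a' \<in> ?L" using v(1) a by blast
  next
    fix r a assume r: "r \<in> carrier R" and "a \<in> ?L"
    then obtain w where a: "a \<in> carrier R" and w: "w \<in> W"
      and wa: "\<And>x. x \<in> carrier R \<Longrightarrow> (\<forall>j<q. x \<otimes> w j = \<zero>) \<Longrightarrow> x \<otimes> a = \<zero>" by blast
    have "x \<otimes> (r \<otimes> a) = \<zero>" if "x \<in> carrier R" "\<forall>j<q. x \<otimes> w j = \<zero>" for x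
      using wa[OF that] that(1) r a m_lcomm[of x r a] by simp
    then show "r \<otimes> a \<in> ?L" using r a w by blast
  qed blast
  moreover have "w j \<in> ?L" if "w \<in> W" "j < q" for w j
    using that W_closed by blast
  ultimately have "f \<in> ?L" using content[of ?L] by blast
  then show ?thesis by blast
qed

text \<open>A faithful \<open>y\<close> is added to a coprime \<open>w\<close> as
  \<open>d (1 - g) y\<close>, with \<open>g\<close> the support of \<open>w\<close>. The factor
  \<open>d\<close> preserves coprimality to \<open>d\<close>; the factor \<open>1 - g\<close> keeps
  \<open>w\<close> recoverable as \<open>g v\<close>.\<close>

lemma exists_coprime_faithful_combination:
  assumes d: "d \<in> nonzerodivisors R"
  shows "\<exists>w\<in>W. (\<forall>L. ideal L R \<longrightarrow> (\<forall>j<q. w j \<in> L) \<longrightarrow> d \<in> L \<longrightarrow> f \<in> L) \<and>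
    (\<forall>x\<in>carrier R. (\<forall>j<q. x \<otimes> w j = \<zero>) \<longrightarrow> x \<otimes> f = \<zero>)"
proof -
  have fR: "f \<in> carrier R" and dR: "d \<in> carrier R" using f nzd_closed[OF d] by (auto simp: idem_elem_def)
  obtain w where w: "w \<in> W" "\<And>L. ideal L R \<Longrightarrow> (\<And>j. j < q \<Longrightarrow> w j \<in> L) \<Longrightarrow> d \<in> L \<Longrightarrow> f \<in> L"
    using exists_coprime_combination[OF d] by blast
  obtain y where y: "y \<in> W" "\<And>x. x \<in> carrier R \<Longrightarrow> (\<And>j. j < q \<Longrightarrow> x \<otimes> y j = \<zero>) \<Longrightarrow> x \<otimes> f = \<zero>"
    using exists_faithful_combination by blast
  obtain g where g: "idem_elem R g" "\<And>j. j < q \<Longrightarrow> g \<otimes> w j = w j"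
    "\<And>x. x \<in> carrier R \<Longrightarrow> (\<And>j. j < q \<Longrightarrow> x \<otimes> w j = \<zero>) \<Longrightarrow> x \<otimes> g = \<zero>"
    using family_support[of q w] W_closed[OF w(1)] by blast
  have gR: "g \<in> carrier R" using g(1) by (auto simp: idem_elem_def)
  have ge: "g \<otimes> (\<one> \<ominus> g) = \<zero>" using idempotent_compl[OF g(1)] by simp
  obtain v where v: "v \<in> W" "\<And>j. j < q \<Longrightarrow> v j = w j \<oplus> (d \<otimes> (\<one> \<ominus> g)) \<otimes> y j"
    using W_comb[OF w(1) y(1), of "d \<otimes> (\<one> \<ominus> g)"] gR dR by auto
  have "f \<in> L" if L: "ideal L R" "\<forall>j<q. v j \<in> L" "d \<in> L" for L
  proof (rule w(2)[OF L(1) _ L(3)])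
    fix j assume j: "j < q"
    have "(\<one> \<ominus> g) \<otimes> y j \<in> carrier R" using gR W_closed[OF y(1) j] by simp
    then have "d \<otimes> ((\<one> \<ominus> g) \<otimes> y j) \<in> L" using ideal_mult_right[OF L(1) _ L(3)] by blast
    then have "(d \<otimes> (\<one> \<ominus> g)) \<otimes> y j \<in> L" using gR dR W_closed[OF y(1) j] by (simp add: m_assoc)
    then show "w j \<in> L" using ideal_add_cancel[OF L(1) _ _ W_closed[OF w(1) j]] L(2) j v(2) by metis
  qed
  moreover have "x \<otimes> f = \<zero>" if x: "x \<in> carrier R" "\<forall>j<q. x \<otimes> v j = \<zero>" for x
  proof -
    have gv: "g \<otimes> v j = w j" if "j < q" for j
    proof -
      have "g \<otimes> v j = g \<otimes> w j \<oplus> (g \<otimes> (\<one> \<ominus> g)) \<otimes> (d \<otimes> y j)"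
        unfolding v(2)[OF that] using gR(1) dR W_closed[OF w(1) that] W_closed[OF y(1) that] by algebra
      then show ?thesis using g(2)[OF that] ge dR W_closed[OF w(1) that] W_closed[OF y(1) that] by simp
    qed
    have xw: "x \<otimes> w j = \<zero>" if "j < q" for j
    proof -
      have "x \<otimes> (g \<otimes> v j) = g \<otimes> (x \<otimes> v j)" using x(1) gR(1) W_closed[OF v(1) that] by (intro m_lcomm)
      then show ?thesis using gv[OF that] x(2) that gR by simp
    qed
    have xg: "x \<otimes> g = \<zero>" using g(3)[OF x(1)] xw by blast
    \<comment> \<open>As \<open>x\<close> kills \<open>w\<close>, it kills \<open>g\<close>; of
      \<open>x v\<close> only \<open>d x y\<close> remains, and \<open>d\<close> cancels.\<close>
    have "x \<otimes> y j = \<zero>" if "j < q" for j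
    proof -
      have "d \<otimes> (x \<otimes> y j) = x \<otimes> v j \<ominus> x \<otimes> w j \<oplus> (x \<otimes> g) \<otimes> (d \<otimes> y j)"
        unfolding v(2)[OF that] using gR(1) dR x(1) W_closed[OF w(1) that] W_closed[OF y(1) that] by algebra
      then have "d \<otimes> (x \<otimes> y j) = \<zero>" using xw[OF that] x(2) that xg dR W_closed[OF y(1) that] by (simp add: minus_eq)
      then show ?thesis using nzd_zero[OF d] x(1) W_closed[OF y(1) that] by simp
    qed
    then show ?thesis using y(2)[OF x(1)] by blast
  qed
  ultimately show ?thesis using v(1) by blast
qed

end

end

section \<open>Submodules of a free module\<close>

locale plain_module = module R M
  for R :: "('a, 'r) ring_scheme" (structure) and M :: "('a, 'c) module" (structure)
begin

definition functional :: "('c \<Rightarrow> 'a) \<Rightarrow> bool" where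
  "functional \<phi> \<longleftrightarrow> (\<forall>x\<in>carrier M. \<phi> x \<in> carrier R) \<and>
    (\<forall>x\<in>carrier M. \<forall>y\<in>carrier M. \<phi> (x \<oplus>\<^bsub>M\<^esub> y) = \<phi> x \<oplus> \<phi> y) \<and>
    (\<forall>r\<in>carrier R. \<forall>x\<in>carrier M. \<phi> (r \<odot>\<^bsub>M\<^esub> x) = r \<otimes> \<phi> x)"

definition endo :: "('c \<Rightarrow> 'c) \<Rightarrow> bool" where
  "endo \<pi> \<longleftrightarrow> (\<forall>x\<in>carrier M. \<pi> x \<in> carrier M) \<and>
    (\<forall>x\<in>carrier M. \<forall>y\<in>carrier M. \<pi> (x \<oplus>\<^bsub>M\<^esub> y) = \<pi> x \<oplus>\<^bsub>M\<^esub> \<pi> y) \<and>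
    (\<forall>r\<in>carrier R. \<forall>x\<in>carrier M. \<pi> (r \<odot>\<^bsub>M\<^esub> x) = r \<odot>\<^bsub>M\<^esub> \<pi> x)"

lemma functionalD:
  assumes "functional \<phi>"
  shows "x \<in> carrier M \<Longrightarrow> \<phi> x \<in> carrier R"
    and "x \<in> carrier M \<Longrightarrow> y \<in> carrier M \<Longrightarrow> \<phi> (x \<oplus>\<^bsub>M\<^esub> y) = \<phi> x \<oplus> \<phi> y"
    and "r \<in> carrier R \<Longrightarrow> x \<in> carrier M \<Longrightarrow> \<phi> (r \<odot>\<^bsub>M\<^esub> x) = r \<otimes> \<phi> x"
    and "\<phi> \<zero>\<^bsub>M\<^esub> = \<zero>"
    and "x \<in> carrier M \<Longrightarrow> \<phi> (\<ominus>\<^bsub>M\<^esub> x) = \<ominus> \<phi> x"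
    and "x \<in> carrier M \<Longrightarrow> y \<in> carrier M \<Longrightarrow> \<phi> (x \<ominus>\<^bsub>M\<^esub> y) = \<phi> x \<ominus> \<phi> y"
proof -
  show c: "\<phi> x \<in> carrier R" if "x \<in> carrier M" for x using assms that by (simp add: functional_def)
  show a: "\<phi> (x \<oplus>\<^bsub>M\<^esub> y) = \<phi> x \<oplus> \<phi> y" if "x \<in> carrier M" "y \<in> carrier M" for x y
    using assms that by (simp add: functional_def)
  show s: "\<phi> (r \<odot>\<^bsub>M\<^esub> x) = r \<otimes> \<phi> x" if "r \<in> carrier R" "x \<in> carrier M" for r x
    using assms that by (simp add: functional_def)
  show "\<phi> \<zero>\<^bsub>M\<^esub> = \<zero>" using s[of \<zero> "\<zero>\<^bsub>M\<^esub>"] c[of "\<zero>\<^bsub>M\<^esub>"] by simp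
  show n: "\<phi> (\<ominus>\<^bsub>M\<^esub> x) = \<ominus> \<phi> x" if "x \<in> carrier M" for x
    using s[of "\<ominus> \<one>" x] that c[of x] by (simp add: smult_l_minus l_minus)
  show "\<phi> (x \<ominus>\<^bsub>M\<^esub> y) = \<phi> x \<ominus> \<phi> y" if "x \<in> carrier M" "y \<in> carrier M" for x y
    using a[of x "\<ominus>\<^bsub>M\<^esub> y"] n[of y] that by (simp add: a_minus_def)
qed

lemma functionalI:
  assumes "\<And>x. x \<in> carrier M \<Longrightarrow> \<phi> x \<in> carrier R"
    and "\<And>x y. x \<in> carrier M \<Longrightarrow> y \<in> carrier M \<Longrightarrow> \<phi> (x \<oplus>\<^bsub>M\<^esub> y) = \<phi> x \<oplus> \<phi> y"
    and "\<And>r x. r \<in> carrier R \<Longrightarrow> x \<in> carrier M \<Longrightarrow> \<phi> (r \<odot>\<^bsub>M\<^esub> x) = r \<otimes> \<phi> x"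
  shows "functional \<phi>"
  using assms by (simp add: functional_def)

lemma endoD:
  assumes "endo \<pi>"
  shows "x \<in> carrier M \<Longrightarrow> \<pi> x \<in> carrier M"
    and "x \<in> carrier M \<Longrightarrow> y \<in> carrier M \<Longrightarrow> \<pi> (x \<oplus>\<^bsub>M\<^esub> y) = \<pi> x \<oplus>\<^bsub>M\<^esub> \<pi> y"
    and "r \<in> carrier R \<Longrightarrow> x \<in> carrier M \<Longrightarrow> \<pi> (r \<odot>\<^bsub>M\<^esub> x) = r \<odot>\<^bsub>M\<^esub> \<pi> x"
    and "\<pi> \<zero>\<^bsub>M\<^esub> = \<zero>\<^bsub>M\<^esub>"
    and "x \<in> carrier M \<Longrightarrow> y \<in> carrier M \<Longrightarrow> \<pi> (x \<ominus>\<^bsub>M\<^esub> y) = \<pi> x \<ominus>\<^bsub>M\<^esub> \<pi> y"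
proof -
  show c: "\<pi> x \<in> carrier M" if "x \<in> carrier M" for x using assms that by (simp add: endo_def)
  show a: "\<pi> (x \<oplus>\<^bsub>M\<^esub> y) = \<pi> x \<oplus>\<^bsub>M\<^esub> \<pi> y" if "x \<in> carrier M" "y \<in> carrier M" for x y
    using assms that by (simp add: endo_def)
  show s: "\<pi> (r \<odot>\<^bsub>M\<^esub> x) = r \<odot>\<^bsub>M\<^esub> \<pi> x" if "r \<in> carrier R" "x \<in> carrier M" for r x
    using assms that by (simp add: endo_def)
  show "\<pi> \<zero>\<^bsub>M\<^esub> = \<zero>\<^bsub>M\<^esub>" using s[of \<zero> "\<zero>\<^bsub>M\<^esub>"] c[of "\<zero>\<^bsub>M\<^esub>"] by simp
  show "\<pi> (x \<ominus>\<^bsub>M\<^esub> y) = \<pi> x \<ominus>\<^bsub>M\<^esub> \<pi> y" if "x \<in> carrier M" "y \<in> carrier M" for x y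
    using a[of x "\<ominus>\<^bsub>M\<^esub> y"] s[of "\<ominus> \<one>" y] c[of y] that by (simp add: a_minus_def smult_l_minus)
qed

lemma endoI:
  assumes "\<And>x. x \<in> carrier M \<Longrightarrow> \<pi> x \<in> carrier M"
    and "\<And>x y. x \<in> carrier M \<Longrightarrow> y \<in> carrier M \<Longrightarrow> \<pi> (x \<oplus>\<^bsub>M\<^esub> y) = \<pi> x \<oplus>\<^bsub>M\<^esub> \<pi> y"
    and "\<And>r x. r \<in> carrier R \<Longrightarrow> x \<in> carrier M \<Longrightarrow> \<pi> (r \<odot>\<^bsub>M\<^esub> x) = r \<odot>\<^bsub>M\<^esub> \<pi> x"
  shows "endo \<pi>"
  using assms by (simp add: endo_def)

lemma endo_add:
  assumes "endo \<pi>" "endo \<tau>" shows "endo (\<lambda>x. \<pi> x \<oplus>\<^bsub>M\<^esub> \<tau> x)"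
  by (rule endoI) (use endoD[OF assms(1)] endoD[OF assms(2)] in \<open>simp_all add: smult_r_distr M.a_ac\<close>)

lemma endo_smult:
  assumes "endo \<pi>" "r \<in> carrier R" shows "endo (\<lambda>x. r \<odot>\<^bsub>M\<^esub> \<pi> x)"
  by (rule endoI)
    (use endoD[OF assms(1)] assms(2) in \<open>simp_all add: smult_r_distr smult_assoc1[symmetric] R.m_comm\<close>)

lemma endo_id: "endo (\<lambda>x. x)"
  by (rule endoI) auto

lemma endo_zero: "endo (\<lambda>x. \<zero>\<^bsub>M\<^esub>)"
  by (rule endoI) auto

lemma endo_minus:
  assumes "endo \<pi>" "endo \<tau>" shows "endo (\<lambda>x. \<pi> x \<ominus>\<^bsub>M\<^esub> \<tau> x)"
proof -
  have "endo (\<lambda>x. \<pi> x \<oplus>\<^bsub>M\<^esub> (\<ominus> \<one>) \<odot>\<^bsub>M\<^esub> \<tau> x)" using assms by (intro endo_add endo_smult) auto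
  moreover have "\<pi> x \<oplus>\<^bsub>M\<^esub> (\<ominus> \<one>) \<odot>\<^bsub>M\<^esub> \<tau> x = \<pi> x \<ominus>\<^bsub>M\<^esub> \<tau> x" if "x \<in> carrier M" for x
    using endoD(1)[OF assms(2) that] by (simp add: smult_l_minus a_minus_def)
  ultimately show ?thesis by (simp add: endo_def)
qed

lemma endo_functional:
  assumes "functional \<phi>" "y \<in> carrier M" shows "endo (\<lambda>x. \<phi> x \<odot>\<^bsub>M\<^esub> y)"
  by (rule endoI) (use functionalD[OF assms(1)] assms(2) in \<open>simp_all add: smult_l_distr smult_assoc1\<close>)

lemma functional_compose: "functional \<phi> \<Longrightarrow> endo \<tau> \<Longrightarrow> functional (\<lambda>x. \<phi> (\<tau> x))"
  by (simp add: functional_def endo_def)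

lemma functional_zero: "functional (\<lambda>x. \<zero>)"
  by (rule functionalI) auto

lemma functional_add:
  assumes "functional \<phi>" "functional \<psi>" shows "functional (\<lambda>x. \<phi> x \<oplus> \<psi> x)"
  by (rule functionalI)
    (use functionalD[OF assms(1)] functionalD[OF assms(2)] in \<open>simp_all add: R.r_distr R.a_ac\<close>)

lemma functional_smult:
  assumes "functional \<phi>" "r \<in> carrier R" shows "functional (\<lambda>x. r \<otimes> \<phi> x)"
  by (rule functionalI) (use functionalD[OF assms(1)] assms(2) in \<open>simp_all add: R.r_distr R.m_lcomm\<close>)

lemma functional_minus:
  assumes "functional \<phi>" "functional \<psi>" shows "functional (\<lambda>x. \<phi> x \<ominus> \<psi> x)"
proof -
  have "functional (\<lambda>x. \<phi> x \<oplus> (\<ominus> \<one>) \<otimes> \<psi> x)" using assms by (intro functional_add functional_smult) auto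
  moreover have "\<phi> x \<oplus> (\<ominus> \<one>) \<otimes> \<psi> x = \<phi> x \<ominus> \<psi> x" if "x \<in> carrier M" for x
    using functionalD(1)[OF assms(2) that] by (simp add: R.l_minus a_minus_def)
  ultimately show ?thesis by (simp add: functional_def)
qed

lemma submodule_of_closed:
  assumes "N \<subseteq> carrier M" "\<zero>\<^bsub>M\<^esub> \<in> N"
    and "\<And>x y. x \<in> N \<Longrightarrow> y \<in> N \<Longrightarrow> x \<oplus>\<^bsub>M\<^esub> y \<in> N"
    and "\<And>r x. r \<in> carrier R \<Longrightarrow> x \<in> N \<Longrightarrow> r \<odot>\<^bsub>M\<^esub> x \<in> N"
  shows "submodule N R M"
proof (rule submoduleI[OF assms(1,2) _ assms(3,4)])
  fix x assume x: "x \<in> N"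
  have "(\<ominus> \<one>) \<odot>\<^bsub>M\<^esub> x = \<ominus>\<^bsub>M\<^esub> x" using x assms(1) by (simp add: smult_l_minus subset_iff)
  then show "\<ominus>\<^bsub>M\<^esub> x \<in> N" using assms(4)[OF _ x, of "\<ominus> \<one>"] by simp
qed

lemma submoduleD:
  assumes "submodule N R M"
  shows "x \<in> N \<Longrightarrow> x \<in> carrier M" and "\<zero>\<^bsub>M\<^esub> \<in> N"
    and "x \<in> N \<Longrightarrow> y \<in> N \<Longrightarrow> x \<oplus>\<^bsub>M\<^esub> y \<in> N"
    and "r \<in> carrier R \<Longrightarrow> x \<in> N \<Longrightarrow> r \<odot>\<^bsub>M\<^esub> x \<in> N"
    and "x \<in> N \<Longrightarrow> y \<in> N \<Longrightarrow> x \<ominus>\<^bsub>M\<^esub> y \<in> N"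
proof -
  note E = submoduleE[OF assms]
  show c: "x \<in> carrier M" if "x \<in> N" for x using E(1) that by blast
  show a: "x \<oplus>\<^bsub>M\<^esub> y \<in> N" if "x \<in> N" "y \<in> N" for x y using E(5) that by blast
  show "r \<odot>\<^bsub>M\<^esub> x \<in> N" if "r \<in> carrier R" "x \<in> N" for r x using E(4) that by blast
  show "x \<ominus>\<^bsub>M\<^esub> y \<in> N" if "x \<in> N" "y \<in> N" for x y using E(3,5) that by (simp add: a_minus_def)
  obtain x where x: "x \<in> N" using E(2) by blast
  then have "\<zero> \<odot>\<^bsub>M\<^esub> x \<in> N" using E(4) R.zero_closed by blast
  then show "\<zero>\<^bsub>M\<^esub> \<in> N" using smult_l_null[OF c[OF x]] by simp
qed

text \<open>Generation is handled as an induction principle: a submodule containing \<open>S\<close>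
  contains \<open>N\<close>. Later proofs check a property on generators and exhibit the submodule
  of elements having it.\<close>

lemma fg_submoduleI:
  assumes "submodule N R M" "finite S" "S \<subseteq> N" "\<And>N'. submodule N' R M \<Longrightarrow> S \<subseteq> N' \<Longrightarrow> N \<subseteq> N'"
  shows "finitely_generated_submodule N R M"
proof -
  have "N = \<Inter>{N'. submodule N' R M \<and> S \<subseteq> N'}" using assms by blast
  moreover have "S \<subseteq> carrier M" using assms(1,3) submoduleD(1) by blast
  ultimately show ?thesis using assms(2) unfolding finitely_generated_submodule_def by blast
qed

lemma fg_submoduleE:
  assumes "finitely_generated_submodule N R M"
  obtains S where "submodule N R M" "finite S" "S \<subseteq> N" "\<And>N'. submodule N' R M \<Longrightarrow> S \<subseteq> N' \<Longrightarrow> N \<subseteq> N'"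
proof -
  obtain S where S: "finite S" "S \<subseteq> carrier M" "N = \<Inter>{N'. submodule N' R M \<and> S \<subseteq> N'}"
    using assms by (auto simp: finitely_generated_submodule_def)
  have "submodule N R M"
  proof (rule submodule_of_closed)
    show "N \<subseteq> carrier M" using S carrier_is_submodule by blast
    show "\<zero>\<^bsub>M\<^esub> \<in> N" unfolding S(3) using submoduleD(2) by blast
    show "x \<oplus>\<^bsub>M\<^esub> y \<in> N" if "x \<in> N" "y \<in> N" for x y
      using that unfolding S(3) by (blast intro: submoduleD(3))
    show "r \<odot>\<^bsub>M\<^esub> x \<in> N" if "r \<in> carrier R" "x \<in> N" for r x
      using that unfolding S(3) by (blast intro: submoduleD(4))
  qed
  then show thesis using that[of S] S by blast
qed

lemma fg_submodule: "finitely_generated_submodule N R M \<Longrightarrow> submodule N R M"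
  by (elim fg_submoduleE)

lemma submodule_endo_image:
  assumes "endo \<pi>" "submodule N R M" shows "submodule (\<pi> ` N) R M"
proof -
  have N: "x \<in> carrier M" if "x \<in> N" for x using submoduleD(1)[OF assms(2) that] .
  show ?thesis
  proof (rule submodule_of_closed)
    show "\<pi> ` N \<subseteq> carrier M" using endoD(1)[OF assms(1)] N by blast
    show "\<zero>\<^bsub>M\<^esub> \<in> \<pi> ` N" using endoD(4)[OF assms(1)] submoduleD(2)[OF assms(2)] by (metis image_eqI)
    fix x y assume "x \<in> \<pi> ` N" "y \<in> \<pi> ` N"
    then obtain u v where uv: "u \<in> N" "v \<in> N" "x = \<pi> u" "y = \<pi> v" by blast
    then have "x \<oplus>\<^bsub>M\<^esub> y = \<pi> (u \<oplus>\<^bsub>M\<^esub> v)" using endoD(2)[OF assms(1)] N by simp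
    then show "x \<oplus>\<^bsub>M\<^esub> y \<in> \<pi> ` N" using submoduleD(3)[OF assms(2) uv(1,2)] by blast
  next
    fix r x assume r: "r \<in> carrier R" and "x \<in> \<pi> ` N"
    then obtain u where u: "u \<in> N" "x = \<pi> u" by blast
    then have "r \<odot>\<^bsub>M\<^esub> x = \<pi> (r \<odot>\<^bsub>M\<^esub> u)" using endoD(3)[OF assms(1) r] N by simp
    then show "r \<odot>\<^bsub>M\<^esub> x \<in> \<pi> ` N" using submoduleD(4)[OF assms(2) r u(1)] by blast
  qed
qed

lemma submodule_endo_vimage:
  assumes "endo \<pi>" "submodule N R M" shows "submodule {x \<in> carrier M. \<pi> x \<in> N} R M"
  by (rule submodule_of_closed) (use endoD[OF assms(1)] submoduleD[OF assms(2)] in auto)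

lemma submodule_functional_vimage:
  assumes "functional \<phi>" "ideal L R" shows "submodule {x \<in> carrier M. \<phi> x \<in> L} R M"
  by (rule submodule_of_closed)
    (use functionalD[OF assms(1)] R.ideal_zero[OF assms(2)] R.ideal_add[OF assms(2)] R.ideal_mult[OF assms(2)] in auto)

lemma submodule_endo_eq:
  assumes "endo \<pi>" "endo \<tau>" shows "submodule {x \<in> carrier M. \<pi> x = \<tau> x} R M"
  by (rule submodule_of_closed) (use endoD[OF assms(1)] endoD[OF assms(2)] in auto)

lemma fg_endo_image:
  assumes "endo \<pi>" "finitely_generated_submodule N R M"
  shows "finitely_generated_submodule (\<pi> ` N) R M"
proof -
  obtain S where S: "submodule N R M" "finite S" "S \<subseteq> N" "\<And>N'. submodule N' R M \<Longrightarrow> S \<subseteq> N' \<Longrightarrow> N \<subseteq> N'"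
    using fg_submoduleE[OF assms(2)] by metis
  show ?thesis
  proof (rule fg_submoduleI[OF submodule_endo_image[OF assms(1) S(1)], of "\<pi> ` S"])
    fix N' assume N': "submodule N' R M" "\<pi> ` S \<subseteq> N'"
    have "N \<subseteq> {x \<in> carrier M. \<pi> x \<in> N'}"
      using N' S(3) submoduleD(1)[OF S(1)] by (intro S(4) submodule_endo_vimage[OF assms(1) N'(1)]) blast
    then show "\<pi> ` N \<subseteq> N'" by blast
  qed (use S in auto)
qed

lemma fg_functional_image:
  assumes "functional \<phi>" "finitely_generated_submodule N R M"
  shows "finitely_generated_ideal (\<phi> ` N) R"
proof -
  obtain S where S: "submodule N R M" "finite S" "S \<subseteq> N" "\<And>N'. submodule N' R M \<Longrightarrow> S \<subseteq> N' \<Longrightarrow> N \<subseteq> N'"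
    using fg_submoduleE[OF assms(2)] by metis
  have N: "x \<in> carrier M" if "x \<in> N" for x using submoduleD(1)[OF S(1) that] .
  have SR: "\<phi> ` S \<subseteq> carrier R" using functionalD(1)[OF assms(1)] S(3) N by blast
  have "ideal (\<phi> ` N) R"
  proof (rule R.ideal_of_closed)
    show "\<phi> ` N \<subseteq> carrier R" using functionalD(1)[OF assms(1)] N by blast
    show "\<zero> \<in> \<phi> ` N" using functionalD(4)[OF assms(1)] submoduleD(2)[OF S(1)] by (metis image_eqI)
    fix x y assume "x \<in> \<phi> ` N" "y \<in> \<phi> ` N"
    then obtain u v where uv: "u \<in> N" "v \<in> N" "x = \<phi> u" "y = \<phi> v" by blast
    then have "x \<oplus> y = \<phi> (u \<oplus>\<^bsub>M\<^esub> v)" using functionalD(2)[OF assms(1)] N by simp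
    then show "x \<oplus> y \<in> \<phi> ` N" using submoduleD(3)[OF S(1) uv(1,2)] by blast
  next
    fix r x assume r: "r \<in> carrier R" and "x \<in> \<phi> ` N"
    then obtain u where u: "u \<in> N" "x = \<phi> u" by blast
    then have "r \<otimes> x = \<phi> (r \<odot>\<^bsub>M\<^esub> u)" using functionalD(3)[OF assms(1) r] N by simp
    then show "r \<otimes> x \<in> \<phi> ` N" using submoduleD(4)[OF S(1) r u(1)] by blast
  qed
  then have "Idl (\<phi> ` S) \<subseteq> \<phi> ` N" using S(3) by (intro R.genideal_minimal) auto
  moreover have "N \<subseteq> {x \<in> carrier M. \<phi> x \<in> Idl (\<phi> ` S)}"
    using R.genideal_self[OF SR] S(3) N
    by (intro S(4) submodule_functional_vimage[OF assms(1) R.genideal_ideal[OF SR]]) blast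
  ultimately have "\<phi> ` N = Idl (\<phi> ` S)" by blast
  then show ?thesis using S(2) SR unfolding finitely_generated_ideal_def by blast
qed

end

text \<open>The given free module is only isomorphic to a standard one and its elements have an
  arbitrary type; the assumptions on \<open>\<xi>\<close> are the form in which freeness is
  used.\<close>

locale coord_module = almost_local_global R + plain_module R F
  for R :: "('a, 'r) ring_scheme" (structure) and F :: "('a, 'c) module" (structure) +
  fixes n :: nat and \<xi> :: "nat \<Rightarrow> 'c \<Rightarrow> 'a"
  assumes coord_functional: "i < n \<Longrightarrow> functional (\<xi> i)"
    and coord_eqI: "x \<in> carrier F \<Longrightarrow> y \<in> carrier F \<Longrightarrow> (\<And>i. i < n \<Longrightarrow> \<xi> i x = \<xi> i y) \<Longrightarrow> x = y"
    and coord_exists: "(\<And>i. i < n \<Longrightarrow> a i \<in> carrier R) \<Longrightarrow> \<exists>x\<in>carrier F. \<forall>i<n. \<xi> i x = a i"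
begin

lemmas coord [simp] =
  functionalD(1)[OF coord_functional] functionalD(2)[OF coord_functional]
  functionalD(3)[OF coord_functional] functionalD(4)[OF coord_functional]
  functionalD(5)[OF coord_functional] functionalD(6)[OF coord_functional]

lemma smult_nzd_cancel:
  assumes s: "s \<in> nonzerodivisors R" and "s \<odot>\<^bsub>F\<^esub> x = s \<odot>\<^bsub>F\<^esub> y" "x \<in> carrier F" "y \<in> carrier F"
  shows "x = y"
proof (rule coord_eqI[OF assms(3,4)])
  fix i assume i: "i < n"
  have "\<xi> i (s \<odot>\<^bsub>F\<^esub> x) = \<xi> i (s \<odot>\<^bsub>F\<^esub> y)" using assms(2) by simp
  then show "\<xi> i x = \<xi> i y"
    using nzd_cancel[OF s] i assms(3,4) nzd_closed[OF s] by simp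
qed

text \<open>The last clause is the expansion of \<open>x\<close> in the basis \<open>e\<close>,
  stated without a sum: a submodule containing every term contains \<open>x\<close>. The induction
  lowers the bound \<open>k\<close> above which all coordinates vanish.\<close>

lemma coord_basis:
  "\<exists>e. (\<forall>j. e j \<in> carrier F) \<and> (\<forall>i<n. \<forall>j. \<xi> i (e j) = (if i = j then \<one> else \<zero>)) \<and> (\<forall>N x. submodule N R F \<longrightarrow> x \<in> carrier F \<longrightarrow>
    (\<forall>i<n. \<xi> i x \<odot>\<^bsub>F\<^esub> e i \<in> N) \<longrightarrow> x \<in> N)"
proof -
  have "\<forall>j. \<exists>x\<in>carrier F. \<forall>i<n. \<xi> i x = (if i = j then \<one> else \<zero>)"
    by (intro allI coord_exists) auto
  then obtain e where e: "\<And>j. e j \<in> carrier F" "\<And>i j. i < n \<Longrightarrow> \<xi> i (e j) = (if i = j then \<one> else \<zero>)"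
    by metis
  have "x \<in> N" if N: "submodule N R F" and "x \<in> carrier F" "\<And>i. k \<le> i \<Longrightarrow> i < n \<Longrightarrow> \<xi> i x = \<zero>" "k \<le> n"
    "\<And>i. i < k \<Longrightarrow> \<xi> i x \<odot>\<^bsub>F\<^esub> e i \<in> N" for N k x
    using that(2-)
  proof (induction k arbitrary: x)
    case 0
    then have "x = \<zero>\<^bsub>F\<^esub>" by (intro coord_eqI) auto
    then show ?case using submoduleD(2)[OF N] by simp
  next
    case (Suc k)
    let ?z = "\<xi> k x \<odot>\<^bsub>F\<^esub> e k"
    have k: "k < n" using Suc(4) by simp
    have zF: "?z \<in> carrier F" using k Suc(2) e(1) by simp
    have zN: "?z \<in> N" using Suc(5)[of k] by simp
    have "x \<ominus>\<^bsub>F\<^esub> ?z \<in> N"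
    proof (rule Suc.IH)
      fix i assume i: "k \<le> i" "i < n"
      show "\<xi> i (x \<ominus>\<^bsub>F\<^esub> ?z) = \<zero>"
      proof (cases "i = k")
        case True
        then show ?thesis using i k zF Suc(2) e by (simp add: r_right_minus_eq)
      next
        case False
        then show ?thesis using i k zF Suc(2) e Suc(3)[of i] by (simp add: a_minus_def)
      qed
    next
      fix i assume i: "i < k"
      then have "\<xi> i (x \<ominus>\<^bsub>F\<^esub> ?z) = \<xi> i x" using k zF Suc(2) e by (simp add: a_minus_def)
      then show "\<xi> i (x \<ominus>\<^bsub>F\<^esub> ?z) \<odot>\<^bsub>F\<^esub> e i \<in> N" using Suc(5)[of i] i by simp
    qed (use zF Suc k in auto)
    then have "(x \<ominus>\<^bsub>F\<^esub> ?z) \<oplus>\<^bsub>F\<^esub> ?z \<in> N" using submoduleD(3)[OF N] zN by blast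
    moreover have "(x \<ominus>\<^bsub>F\<^esub> ?z) \<oplus>\<^bsub>F\<^esub> ?z = x"
      using zF Suc(2) by (simp add: a_minus_def M.a_assoc M.l_neg)
    ultimately show ?case by simp
  qed
  then have "x \<in> N" if "submodule N R F" "x \<in> carrier F" "\<And>i. i < n \<Longrightarrow> \<xi> i x \<odot>\<^bsub>F\<^esub> e i \<in> N" for N x
    using that by (metis linorder_not_less order_refl)
  then show ?thesis using e by (intro exI[of _ e] conjI allI impI) blast+
qed

lemma carrier_fg: "finitely_generated_submodule (carrier F) R F"
proof -
  obtain e where e: "\<And>j. e j \<in> carrier F"
    "\<And>N x. submodule N R F \<Longrightarrow> x \<in> carrier F \<Longrightarrow> (\<And>i. i < n \<Longrightarrow> \<xi> i x \<odot>\<^bsub>F\<^esub> e i \<in> N) \<Longrightarrow> x \<in> N"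
    using coord_basis by blast
  show ?thesis
  proof (rule fg_submoduleI[OF carrier_is_submodule, of "e ` {..<n}"])
    fix N assume N: "submodule N R F" "e ` {..<n} \<subseteq> N"
    show "carrier F \<subseteq> N"
    proof
      fix x assume x: "x \<in> carrier F"
      then have "\<xi> i x \<odot>\<^bsub>F\<^esub> e i \<in> N" if "i < n" for i
        using that N(2) submoduleD(4)[OF N(1), of "\<xi> i x" "e i"] by auto
      then show "x \<in> N" using e(2)[OF N(1) x] by blast
    qed
  qed (use e in auto)
qed

definition content :: "'c set \<Rightarrow> 'a set" where
  "content N = Idl {\<xi> i x |i x. i < n \<and> x \<in> N}"

lemma content_ideal: "N \<subseteq> carrier F \<Longrightarrow> ideal (content N) R"
  unfolding content_def by (intro genideal_ideal) auto

lemma coord_in_content: "N \<subseteq> carrier F \<Longrightarrow> x \<in> N \<Longrightarrow> i < n \<Longrightarrow> \<xi> i x \<in> content N"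
  unfolding content_def by (rule subsetD[OF genideal_self]) auto

lemma content_minimal:
  assumes "ideal L R" "\<And>i x. i < n \<Longrightarrow> x \<in> N \<Longrightarrow> \<xi> i x \<in> L" shows "content N \<subseteq> L"
  unfolding content_def using assms by (intro genideal_minimal) auto

lemma fg_content:
  assumes "finitely_generated_submodule N R F"
  shows "finitely_generated_ideal (content N) R"
proof -
  obtain S where S: "submodule N R F" "finite S" "S \<subseteq> N" "\<And>N'. submodule N' R F \<Longrightarrow> S \<subseteq> N' \<Longrightarrow> N \<subseteq> N'"
    using fg_submoduleE[OF assms] by metis
  have N: "N \<subseteq> carrier F" using submoduleD(1)[OF S(1)] by blast
  let ?T = "(\<lambda>(i, x). \<xi> i x) ` ({..<n} \<times> S)"
  have T: "?T \<subseteq> carrier R" using S(3) N by auto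
  have "N \<subseteq> {x \<in> carrier F. \<xi> i x \<in> Idl ?T}" if "i < n" for i
  proof (rule S(4)[OF submodule_functional_vimage[OF coord_functional[OF that] genideal_ideal[OF T]]])
    show "S \<subseteq> {x \<in> carrier F. \<xi> i x \<in> Idl ?T}" using that S(3) N genideal_self[OF T] by auto
  qed
  then have "content N \<subseteq> Idl ?T" by (intro content_minimal genideal_ideal T) auto
  moreover have "Idl ?T \<subseteq> content N"
    using S(3) coord_in_content[OF N] by (intro genideal_minimal content_ideal N) auto
  ultimately have "content N = Idl ?T" by blast
  then show ?thesis using S(2) T unfolding finitely_generated_ideal_def by (intro exI[of _ ?T]) auto
qed

lemma support_smult:
  assumes "\<And>c. c \<in> content N \<Longrightarrow> f \<otimes> c = c" "f \<in> carrier R" "N \<subseteq> carrier F" "x \<in> N"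
  shows "f \<odot>\<^bsub>F\<^esub> x = x"
  using assms coord_in_content[OF assms(3,4)] by (intro coord_eqI) auto

text \<open>The values at \<open>u\<close> of all functionals form an ideal. It contains the
  coordinates of \<open>u\<close>, hence the ideal they generate, and \<open>s f\<close> lies in the
  latter.\<close>

lemma exists_functional_support:
  assumes u: "u \<in> carrier F"
  shows "\<exists>\<phi> s f. functional \<phi> \<and> s \<in> nonzerodivisors R \<and> idem_elem R f \<and> f \<odot>\<^bsub>F\<^esub> u = u \<and> \<phi> u = s \<otimes> f"
proof -
  let ?T = "{\<xi> i u |i. i < n}"
  have T: "?T \<subseteq> carrier R" using u by auto
  have "?T = (\<lambda>i. \<xi> i u) ` {..<n}" by auto
  then have "finite ?T" by simp
  then have "finitely_generated_ideal (Idl ?T) R" using T unfolding finitely_generated_ideal_def by blast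
  then obtain s f B where p: "divisible_pairing s f (Idl ?T) B" "s \<otimes> f \<in> Idl ?T"
    using exists_divisible_pairing by blast
  have f: "idem_elem R f" "f \<in> carrier R" "\<forall>c\<in>Idl ?T. f \<otimes> c = c" "s \<in> nonzerodivisors R"
    using p(1) by (auto simp: divisible_pairing_def idem_elem_def)
  have "f \<odot>\<^bsub>F\<^esub> u = u"
    using f u genideal_self[OF T] by (intro coord_eqI) auto
  moreover have "ideal {z. \<exists>\<phi>. functional \<phi> \<and> \<phi> u = z} R"
  proof (rule ideal_of_closed)
    show "{z. \<exists>\<phi>. functional \<phi> \<and> \<phi> u = z} \<subseteq> carrier R" using functionalD(1) u by auto
    show "\<zero> \<in> {z. \<exists>\<phi>. functional \<phi> \<and> \<phi> u = z}" using functional_zero by auto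
    show "x \<oplus> y \<in> {z. \<exists>\<phi>. functional \<phi> \<and> \<phi> u = z}"
      if "x \<in> {z. \<exists>\<phi>. functional \<phi> \<and> \<phi> u = z}" "y \<in> {z. \<exists>\<phi>. functional \<phi> \<and> \<phi> u = z}" for x y
      using that functional_add by blast
    show "r \<otimes> x \<in> {z. \<exists>\<phi>. functional \<phi> \<and> \<phi> u = z}"
      if "r \<in> carrier R" "x \<in> {z. \<exists>\<phi>. functional \<phi> \<and> \<phi> u = z}" for r x
      using that functional_smult by blast
  qed
  then have "Idl ?T \<subseteq> {z. \<exists>\<phi>. functional \<phi> \<and> \<phi> u = z}"
    using coord_functional by (intro genideal_minimal) auto
  ultimately show ?thesis using f p(2) by blast
qed

text \<open>Up to a non-zero-divisor \<open>d\<close>, the finitely generated submodule \<open>H\<close> is a direct summand.\<close>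

lemma exists_quasi_retraction:
  assumes H: "finitely_generated_submodule H R F"
  shows "\<exists>d \<rho>. d \<in> nonzerodivisors R \<and> endo \<rho> \<and> (\<forall>x\<in>carrier F. \<rho> x \<in> H) \<and> (\<forall>x\<in>H. \<rho> x = d \<odot>\<^bsub>F\<^esub> x)"
proof -
  obtain S where S: "submodule H R F" "finite S" "S \<subseteq> H" "\<And>N'. submodule N' R F \<Longrightarrow> S \<subseteq> N' \<Longrightarrow> H \<subseteq> N'"
    using fg_submoduleE[OF H] by metis
  have SF: "S \<subseteq> carrier F" using S(3) submoduleD(1)[OF S(1)] by blast
  have "\<exists>d \<rho>. d \<in> nonzerodivisors R \<and> endo \<rho> \<and> (\<forall>x\<in>carrier F. \<rho> x \<in> H) \<and> (\<forall>x\<in>T. \<rho> x = d \<odot>\<^bsub>F\<^esub> x)"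
    if "finite T" "T \<subseteq> S" for T
    using that
  proof (induction T)
    case empty
    show ?case
      by (rule exI[of _ \<one>], rule exI[of _ "\<lambda>x. \<zero>\<^bsub>F\<^esub>"]) (use nzd_one endo_zero submoduleD(2)[OF S(1)] in auto)
  next
    case (insert g T)
    then obtain d \<rho> where d: "d \<in> nonzerodivisors R" and \<rho>: "endo \<rho>" "\<And>x. x \<in> carrier F \<Longrightarrow> \<rho> x \<in> H"
      "\<And>x. x \<in> T \<Longrightarrow> \<rho> x = d \<odot>\<^bsub>F\<^esub> x" by auto
    have dR: "d \<in> carrier R" using nzd_closed[OF d] .
    have gF: "g \<in> carrier F" and gH: "g \<in> H" using insert(4) SF S(3) by auto
    let ?\<delta> = "\<lambda>x. d \<odot>\<^bsub>F\<^esub> x \<ominus>\<^bsub>F\<^esub> \<rho> x"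
    have \<delta>: "endo ?\<delta>" by (intro endo_minus endo_smult[OF endo_id dR] \<rho>(1))
    let ?u = "?\<delta> g"
    have uF: "?u \<in> carrier F" using endoD(1)[OF \<delta> gF] .
    have uH: "?u \<in> H" using submoduleD(5)[OF S(1) submoduleD(4)[OF S(1) dR gH] \<rho>(2)[OF gF]] .
    obtain \<phi> s f where \<phi>: "functional \<phi>" "s \<in> nonzerodivisors R" "idem_elem R f" "f \<odot>\<^bsub>F\<^esub> ?u = ?u" "\<phi> ?u = s \<otimes> f"
      using exists_functional_support[OF uF] by blast
    have sR: "s \<in> carrier R" and fR: "f \<in> carrier R" using \<phi> nzd_closed by (auto simp: idem_elem_def)
    \<comment> \<open>The correction vanishes on the old generators, where \<open>\<rho>\<close> is
      already multiplication by \<open>d\<close>. At \<open>g\<close> it equals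
      \<open>s ?u = s (d g - \<rho> g)\<close>, because \<open>\<phi> ?u = s f\<close> and
      \<open>f\<close> fixes \<open>?u\<close>; so the new denominator is
      \<open>s d\<close>.\<close>
    let ?\<rho> = "\<lambda>x. s \<odot>\<^bsub>F\<^esub> \<rho> x \<oplus>\<^bsub>F\<^esub> \<phi> (?\<delta> x) \<odot>\<^bsub>F\<^esub> ?u"
    have "endo ?\<rho>"
      by (intro endo_add endo_smult[OF \<rho>(1) sR] endo_functional[OF functional_compose[OF \<phi>(1) \<delta>] uF])
    moreover have "?\<rho> x \<in> H" if "x \<in> carrier F" for x
      using submoduleD(3)[OF S(1) submoduleD(4)[OF S(1) sR \<rho>(2)[OF that]]
        submoduleD(4)[OF S(1) functionalD(1)[OF \<phi>(1) endoD(1)[OF \<delta> that]] uH]] .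
    moreover have "?\<rho> x = (s \<otimes> d) \<odot>\<^bsub>F\<^esub> x" if "x \<in> insert g T" for x
    proof (cases "x = g")
      case True
      have "\<phi> ?u \<odot>\<^bsub>F\<^esub> ?u = s \<odot>\<^bsub>F\<^esub> ?u" using \<phi>(4,5) smult_assoc1[OF sR fR uF] by simp
      then have "?\<rho> g = s \<odot>\<^bsub>F\<^esub> \<rho> g \<oplus>\<^bsub>F\<^esub> s \<odot>\<^bsub>F\<^esub> ?u" by simp
      also have "\<dots> = (s \<otimes> d) \<odot>\<^bsub>F\<^esub> g"
      proof (rule coord_eqI)
        fix i assume i: "i < n"
        have "s \<otimes> \<xi> i (\<rho> g) \<oplus> s \<otimes> (d \<otimes> \<xi> i g \<ominus> \<xi> i (\<rho> g)) = (s \<otimes> d) \<otimes> \<xi> i g"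
          using i sR dR gF endoD(1)[OF \<rho>(1) gF] coord(1)[OF i] by algebra
        then show "\<xi> i (s \<odot>\<^bsub>F\<^esub> \<rho> g \<oplus>\<^bsub>F\<^esub> s \<odot>\<^bsub>F\<^esub> ?u) = \<xi> i ((s \<otimes> d) \<odot>\<^bsub>F\<^esub> g)"
          using i sR dR gF endoD(1)[OF \<rho>(1) gF] by simp
      qed (use sR dR gF endoD(1)[OF \<rho>(1) gF] in auto)
      finally show ?thesis using True by simp
    next
      case False
      then have x: "x \<in> T" "x \<in> carrier F" using that insert(4) SF by auto
      have "?\<delta> x = \<zero>\<^bsub>F\<^esub>" using \<rho>(3)[OF x(1)] x(2) dR by (simp add: a_minus_def M.r_neg)
      then have "?\<rho> x = s \<odot>\<^bsub>F\<^esub> (d \<odot>\<^bsub>F\<^esub> x)"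
        using \<rho>(3)[OF x(1)] functionalD(4)[OF \<phi>(1)] uF sR dR x(2) by simp
      then show ?thesis using smult_assoc1[OF sR dR x(2)] by simp
    qed
    ultimately show ?case using nzd_mult[OF \<phi>(2) d] by blast
  qed
  from this[OF S(2) order_refl] obtain d \<rho> where d: "d \<in> nonzerodivisors R" and \<rho>: "endo \<rho>"
    "\<And>x. x \<in> carrier F \<Longrightarrow> \<rho> x \<in> H" "\<And>x. x \<in> S \<Longrightarrow> \<rho> x = d \<odot>\<^bsub>F\<^esub> x" by blast
  have "H \<subseteq> {x \<in> carrier F. \<rho> x = d \<odot>\<^bsub>F\<^esub> x}"
    using \<rho>(3) SF by (intro S(4) submodule_endo_eq[OF \<rho>(1) endo_smult[OF endo_id nzd_closed[OF d]]]) auto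
  then show ?thesis using d \<rho> by blast
qed

section \<open>Splitting off one summand\<close>

lemma smult_swap: "r \<in> carrier R \<Longrightarrow> s \<in> carrier R \<Longrightarrow> x \<in> carrier F \<Longrightarrow> r \<odot>\<^bsub>F\<^esub> (s \<odot>\<^bsub>F\<^esub> x) = s \<odot>\<^bsub>F\<^esub> (r \<odot>\<^bsub>F\<^esub> x)"
  by (simp add: smult_assoc1[symmetric] m_comm)

text \<open>This is \<open>C\<^sup>-\<^sup>1N\<close> for the content \<open>C\<close> of \<open>N\<close>, inverted over \<open>Rf\<close>.\<close>

definition star :: "'a \<Rightarrow> 'c set \<Rightarrow> 'c set" where
  "star f N = {x \<in> carrier F. f \<odot>\<^bsub>F\<^esub> x = x \<and> (\<forall>c\<in>content N. c \<odot>\<^bsub>F\<^esub> x \<in> N)}"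

lemma star_submodule:
  assumes "f \<in> carrier R" "submodule N R F" shows "submodule (star f N) R F"
proof -
  have N: "N \<subseteq> carrier F" using submoduleD(1)[OF assms(2)] by blast
  have cR: "c \<in> carrier R" if "c \<in> content N" for c using ideal_memD[OF content_ideal[OF N] that] .
  show ?thesis
  proof (rule submodule_of_closed)
    show "star f N \<subseteq> carrier F" by (auto simp: star_def)
    show "\<zero>\<^bsub>F\<^esub> \<in> star f N" using assms(1) cR submoduleD(2)[OF assms(2)] by (auto simp: star_def)
    show "x \<oplus>\<^bsub>F\<^esub> y \<in> star f N" if "x \<in> star f N" "y \<in> star f N" for x y
      using that assms(1) cR submoduleD(3)[OF assms(2)] by (simp add: star_def smult_r_distr)
    show "r \<odot>\<^bsub>F\<^esub> x \<in> star f N" if "r \<in> carrier R" "x \<in> star f N" for r x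
      using that assms(1) cR submoduleD(4)[OF assms(2)]
      by (simp add: star_def smult_swap[of f r] smult_swap[of _ r])
  qed
qed

section \<open>Working with the inverse of a content ideal\<close>

context
  fixes s f N B
  assumes p: "divisible_pairing s f (content N) B" and sf: "s \<otimes> f \<in> content N" and N: "submodule N R F"
begin

lemma pairing_facts:
  "s \<in> nonzerodivisors R" "s \<in> carrier R" "idem_elem R f" "f \<in> carrier R" "f \<otimes> f = f" "ideal B R"
  "N \<subseteq> carrier F"
  "c \<in> content N \<Longrightarrow> f \<otimes> c = c" "c \<in> content N \<Longrightarrow> c \<in> carrier R"
  "b \<in> B \<Longrightarrow> b \<in> carrier R"
  using p nzd_closed ideal_memD submoduleD(1)[OF N] by (auto simp: divisible_pairing_def idem_elem_def)

text \<open>One of the admissible multipliers is \<open>s f\<close>, and \<open>s\<close>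
  cancels.\<close>

lemma pairing_cancel:
  assumes "\<And>c. c \<in> content N \<Longrightarrow> c \<odot>\<^bsub>F\<^esub> x = c \<odot>\<^bsub>F\<^esub> y" "x \<in> carrier F" "y \<in> carrier F"
  shows "f \<odot>\<^bsub>F\<^esub> x = f \<odot>\<^bsub>F\<^esub> y"
proof (rule smult_nzd_cancel[OF pairing_facts(1)])
  show "s \<odot>\<^bsub>F\<^esub> (f \<odot>\<^bsub>F\<^esub> x) = s \<odot>\<^bsub>F\<^esub> (f \<odot>\<^bsub>F\<^esub> y)"
    using assms(1)[OF sf] unfolding smult_assoc1[OF pairing_facts(2,4) assms(2)]
      smult_assoc1[OF pairing_facts(2,4) assms(3)] .
qed (use assms(2,3) pairing_facts(4) in auto)

text \<open>This sharpens \<open>divisible_pairing_ideal\<close>: the content is generated by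
  coordinates, so among the fractions \<open>c b / s\<close> only those with \<open>c\<close> a
  coordinate of an element of \<open>N\<close> have to be examined.\<close>

lemma pairing_coord:
  assumes L: "ideal L R"
    and gen: "\<And>i x b t. i < n \<Longrightarrow> x \<in> N \<Longrightarrow> b \<in> B \<Longrightarrow> t \<in> carrier R \<Longrightarrow> \<xi> i x \<otimes> b = s \<otimes> t \<Longrightarrow> t \<in> L"
  shows "f \<in> L"
proof (rule divisible_pairing_ideal[OF p L])
  fix c b t assume c: "c \<in> content N" and b: "b \<in> B" and t: "t \<in> carrier R" "c \<otimes> b = s \<otimes> t"
  have bR: "b \<in> carrier R" using pairing_facts(10)[OF b] .
  note sR = pairing_facts(2)
  let ?K = "{c \<in> carrier R. \<exists>t\<in>L. c \<otimes> b = s \<otimes> t}"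
  have "ideal ?K R"
  proof (rule ideal_of_closed)
    show "\<zero> \<in> ?K" using bR sR ideal_zero[OF L] by (auto intro!: bexI[of _ \<zero>])
    fix x y assume "x \<in> ?K" "y \<in> ?K"
    then obtain t u where "x \<in> carrier R" "y \<in> carrier R" "t \<in> L" "u \<in> L" "x \<otimes> b = s \<otimes> t" "y \<otimes> b = s \<otimes> u" by blast
    moreover from this have "(x \<oplus> y) \<otimes> b = s \<otimes> (t \<oplus> u)" using bR sR ideal_memD[OF L]
      by (simp add: l_distr r_distr)
    ultimately show "x \<oplus> y \<in> ?K" using ideal_add[OF L] by blast
  next
    fix r x assume r: "r \<in> carrier R" and "x \<in> ?K"
    then obtain t where t: "x \<in> carrier R" "t \<in> L" "x \<otimes> b = s \<otimes> t" by blast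
    have "r \<otimes> x \<otimes> b = s \<otimes> (r \<otimes> t)" using t r bR sR ideal_memD[OF L] by (simp add: m_assoc m_lcomm[of s r t])
    then show "r \<otimes> x \<in> ?K" using t r ideal_mult[OF L] by blast
  qed auto
  moreover have "\<xi> i x \<in> ?K" if "i < n" "x \<in> N" for i x
  proof -
    have "\<xi> i x \<in> content N" using coord_in_content[OF pairing_facts(7) that(2,1)] .
    then obtain t where "t \<in> carrier R" "\<xi> i x \<otimes> b = s \<otimes> t" using p b unfolding divisible_pairing_def by blast
    then show ?thesis using gen[OF that b] that pairing_facts(7) by auto
  qed
  ultimately have "content N \<subseteq> ?K" by (rule content_minimal)
  then obtain u where u: "u \<in> L" "c \<otimes> b = s \<otimes> u" using c by blast
  then have "t = u" using nzd_cancel[OF pairing_facts(1)] t ideal_memD[OF L] by simp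
  then show "t \<in> L" using u by simp
qed

text \<open>The element \<open>y\<close> is \<open>(b / s) x\<close>, formed coordinatewise; the
  extra factor \<open>f\<close> in its coordinates makes \<open>f\<close> fix it.\<close>

lemma star_witness:
  assumes x: "x \<in> N" and b: "b \<in> B"
  shows "\<exists>y\<in>star f N. s \<odot>\<^bsub>F\<^esub> y = b \<odot>\<^bsub>F\<^esub> x"
proof -
  have xF: "x \<in> carrier F" and bR: "b \<in> carrier R" using x b pairing_facts(7,10) by auto
  have "\<exists>t\<in>carrier R. \<xi> i x \<otimes> b = s \<otimes> t" if "i < n" for i
    using coord_in_content[OF pairing_facts(7) x that] p b unfolding divisible_pairing_def by blast
  then obtain t where t: "\<And>i. i < n \<Longrightarrow> t i \<in> carrier R" "\<And>i. i < n \<Longrightarrow> \<xi> i x \<otimes> b = s \<otimes> t i" by metis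
  obtain y where y: "y \<in> carrier F" "\<And>i. i < n \<Longrightarrow> \<xi> i y = f \<otimes> t i"
    using coord_exists[of "\<lambda>i. f \<otimes> t i"] t(1) pairing_facts(4) by auto
  have sy: "s \<odot>\<^bsub>F\<^esub> y = b \<odot>\<^bsub>F\<^esub> x"
  proof (rule coord_eqI)
    fix i assume i: "i < n"
    have "s \<otimes> (f \<otimes> t i) = f \<otimes> (\<xi> i x \<otimes> b)"
      using t i pairing_facts(2,4) by (simp add: m_lcomm)
    also have "\<dots> = (f \<otimes> \<xi> i x) \<otimes> b" using pairing_facts(4) i xF bR by (simp add: m_assoc)
    also have "\<dots> = b \<otimes> \<xi> i x"
      using pairing_facts(8)[OF coord_in_content[OF pairing_facts(7) x i]] i xF bR by (simp add: m_comm)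
    finally show "\<xi> i (s \<odot>\<^bsub>F\<^esub> y) = \<xi> i (b \<odot>\<^bsub>F\<^esub> x)" using i y xF bR pairing_facts(2) by simp
  qed (use y xF bR pairing_facts in auto)
  have "f \<odot>\<^bsub>F\<^esub> y = y"
    using y t(1) pairing_facts(4,5) by (intro coord_eqI) (auto simp: m_assoc[symmetric])
  moreover have "c \<odot>\<^bsub>F\<^esub> y \<in> N" if c: "c \<in> content N" for c
  proof -
    have cR: "c \<in> carrier R" using pairing_facts(9)[OF c] .
    obtain u where u: "u \<in> carrier R" "c \<otimes> b = s \<otimes> u" using p b c unfolding divisible_pairing_def by blast
    have "s \<odot>\<^bsub>F\<^esub> (c \<odot>\<^bsub>F\<^esub> y) = c \<odot>\<^bsub>F\<^esub> (s \<odot>\<^bsub>F\<^esub> y)" using y cR pairing_facts(2) by (intro smult_swap)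
    also have "\<dots> = (c \<otimes> b) \<odot>\<^bsub>F\<^esub> x" unfolding sy using smult_assoc1[OF cR bR xF] by simp
    also have "\<dots> = s \<odot>\<^bsub>F\<^esub> (u \<odot>\<^bsub>F\<^esub> x)" unfolding u(2) using smult_assoc1[OF pairing_facts(2) u(1) xF] .
    finally have "c \<odot>\<^bsub>F\<^esub> y = u \<odot>\<^bsub>F\<^esub> x"
      using smult_nzd_cancel[OF pairing_facts(1)] cR u(1) y xF by simp
    then show ?thesis using submoduleD(4)[OF N u(1) x] by simp
  qed
  ultimately show ?thesis using sy y(1) by (intro bexI[of _ y]) (auto simp: star_def)
qed

text \<open>The fractions \<open>\<xi> i x b / s\<close> which generate \<open>f\<close> are
  coordinates of the elements supplied by \<open>star_witness\<close>: dividing by the content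
  leaves full content over \<open>f\<close>.\<close>

lemma star_content:
  assumes L: "ideal L R" and gen: "\<And>i y. i < n \<Longrightarrow> y \<in> star f N \<Longrightarrow> \<xi> i y \<in> L"
  shows "f \<in> L"
proof (rule pairing_coord[OF L])
  fix i x b t assume *: "i < n" "x \<in> N" "b \<in> B" "t \<in> carrier R" "\<xi> i x \<otimes> b = s \<otimes> t"
  obtain y where y: "y \<in> star f N" "s \<odot>\<^bsub>F\<^esub> y = b \<odot>\<^bsub>F\<^esub> x" using star_witness[OF *(2,3)] by blast
  have yF: "y \<in> carrier F" and xF: "x \<in> carrier F" and bR: "b \<in> carrier R"
    using y(1) * pairing_facts(7,10) by (auto simp: star_def)
  have "\<xi> i (s \<odot>\<^bsub>F\<^esub> y) = \<xi> i (b \<odot>\<^bsub>F\<^esub> x)" using y(2) by simp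
  then have "s \<otimes> \<xi> i y = s \<otimes> t" using * yF xF bR pairing_facts(2) by (simp add: m_comm)
  then have "\<xi> i y = t" using nzd_cancel[OF pairing_facts(1)] * yF by simp
  then show "t \<in> L" using gen[OF *(1) y(1)] by simp
qed

lemma subset_star: "N \<subseteq> star f N"
proof
  fix x assume x: "x \<in> N"
  have "f \<odot>\<^bsub>F\<^esub> x = x" using support_smult[OF pairing_facts(8,4,7) x] .
  then show "x \<in> star f N"
    using x pairing_facts(7,9) submoduleD(4)[OF N] by (auto simp: star_def)
qed

end

text \<open>The image of \<open>\<pi>\<close> is the summand split off, and \<open>\<phi>\<close>
  embeds it into \<open>R\<close>. The non-zero-divisor \<open>d0\<close> is prescribed by the
  caller: the image of the summand under \<open>\<phi>\<close> is made comaximal with it over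
  \<open>f\<close>. The element \<open>h\<close> is returned for its faithfulness, which later makes
  the rank drop.\<close>

lemma decomposition_step:
  assumes H: "finitely_generated_submodule H R F"
    and p: "divisible_pairing s f (content H) B" and sf: "s \<otimes> f \<in> content H"
    and G: "submodule G R F" and pure: "\<And>x t. x \<in> carrier F \<Longrightarrow> t \<in> nonzerodivisors R \<Longrightarrow> t \<odot>\<^bsub>F\<^esub> x \<in> G \<Longrightarrow> x \<in> G"
    and HG: "H \<subseteq> G" and d0: "d0 \<in> nonzerodivisors R"
  obtains \<pi> \<phi> h where
    "endo \<pi>" "\<And>x. x \<in> carrier F \<Longrightarrow> \<pi> x \<in> G" "\<And>x. x \<in> carrier F \<Longrightarrow> \<pi> (\<pi> x) = \<pi> x"
    "\<And>x. x \<in> carrier F \<Longrightarrow> f \<odot>\<^bsub>F\<^esub> \<pi> x = \<pi> x"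
    "\<And>c x. c \<in> content H \<Longrightarrow> x \<in> carrier F \<Longrightarrow> c \<odot>\<^bsub>F\<^esub> \<pi> x \<in> H"
    "functional \<phi>" "\<And>x. x \<in> carrier F \<Longrightarrow> \<phi> (\<pi> x) = \<zero> \<Longrightarrow> \<pi> x = \<zero>\<^bsub>F\<^esub>"
    "\<And>r. r \<in> carrier R \<Longrightarrow> (\<And>x. x \<in> carrier F \<Longrightarrow> r \<otimes> \<phi> (\<pi> x) = \<zero>) \<Longrightarrow> r \<otimes> f = \<zero>"
    "\<And>L. ideal L R \<Longrightarrow> (\<And>x. x \<in> carrier F \<Longrightarrow> \<phi> (\<pi> x) \<in> L) \<Longrightarrow> d0 \<in> L \<Longrightarrow> f \<in> L"
    "h \<in> carrier F" "\<pi> h = h" "\<And>r. r \<in> carrier R \<Longrightarrow> r \<odot>\<^bsub>F\<^esub> h = \<zero>\<^bsub>F\<^esub> \<Longrightarrow> r \<otimes> f = \<zero>"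
proof -
  have Hs: "submodule H R F" using fg_submodule[OF H] .
  note pf = pairing_facts[OF p sf Hs]
  let ?H = "star f H"
  have H's: "submodule ?H R F" using star_submodule[OF pf(4) Hs] .
  have H'F: "x \<in> carrier F" if "x \<in> ?H" for x using that by (simp add: star_def)
  have H'f: "f \<odot>\<^bsub>F\<^esub> x = x" if "x \<in> ?H" for x using that by (simp add: star_def)
  obtain d \<rho> where d: "d \<in> nonzerodivisors R" and \<rho>: "endo \<rho>" "\<And>x. x \<in> carrier F \<Longrightarrow> \<rho> x \<in> H"
    "\<And>x. x \<in> H \<Longrightarrow> \<rho> x = d \<odot>\<^bsub>F\<^esub> x" using exists_quasi_retraction[OF H] by blast
  have dR: "d \<in> carrier R" using nzd_closed[OF d] .
  have \<rho>F: "\<rho> x \<in> carrier F" if "x \<in> carrier F" for x using endoD(1)[OF \<rho>(1) that] .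
  \<comment> \<open>On \<open>H\<close> itself \<open>\<rho>\<close> is multiplication by
    \<open>d\<close>. An element of \<open>?H\<close> is moved into \<open>H\<close> by every
    content element, and these multipliers can be cancelled only up to \<open>f\<close>.\<close>
  have \<rho>': "f \<odot>\<^bsub>F\<^esub> \<rho> x = d \<odot>\<^bsub>F\<^esub> x" if x: "x \<in> ?H" for x
  proof -
    have "f \<odot>\<^bsub>F\<^esub> \<rho> x = f \<odot>\<^bsub>F\<^esub> (d \<odot>\<^bsub>F\<^esub> x)"
    proof (rule pairing_cancel[OF p sf Hs])
      fix c assume c: "c \<in> content H"
      then have "\<rho> (c \<odot>\<^bsub>F\<^esub> x) = d \<odot>\<^bsub>F\<^esub> (c \<odot>\<^bsub>F\<^esub> x)" using x by (intro \<rho>(3)) (simp add: star_def)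
      then show "c \<odot>\<^bsub>F\<^esub> \<rho> x = c \<odot>\<^bsub>F\<^esub> (d \<odot>\<^bsub>F\<^esub> x)"
        using endoD(3)[OF \<rho>(1) pf(9)[OF c] H'F[OF x]] smult_swap[OF dR pf(9)[OF c] H'F[OF x]] by simp
    qed (use x H'F \<rho>F dR in auto)
    then show ?thesis using smult_swap[OF pf(4) dR H'F[OF x]] H'f[OF x] by simp
  qed
  text \<open>The element \<open>h\<close> has content coprime to \<open>d\<close>.\<close>
  obtain h where h: "h \<in> ?H" "\<And>L. ideal L R \<Longrightarrow> (\<And>i. i < n \<Longrightarrow> \<xi> i h \<in> L) \<Longrightarrow> d \<in> L \<Longrightarrow> f \<in> L"
    "\<And>r. r \<in> carrier R \<Longrightarrow> r \<odot>\<^bsub>F\<^esub> h = \<zero>\<^bsub>F\<^esub> \<Longrightarrow> r \<otimes> f = \<zero>"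
  proof -
    let ?W = "(\<lambda>y i. \<xi> i y) ` ?H"
    have "\<exists>w\<in>?W. (\<forall>L. ideal L R \<longrightarrow> (\<forall>j<n. w j \<in> L) \<longrightarrow> d \<in> L \<longrightarrow> f \<in> L) \<and>
        (\<forall>x\<in>carrier R. (\<forall>j<n. x \<otimes> w j = \<zero>) \<longrightarrow> x \<otimes> f = \<zero>)"
    proof (rule exists_coprime_faithful_combination[OF _ _ _ pf(3) _ d])
      show "w j \<in> carrier R" if "w \<in> ?W" "j < n" for w j using that H'F by auto
      show "?W \<noteq> {}" using submoduleD(2)[OF H's] by blast
      fix w w' r assume *: "w \<in> ?W" "w' \<in> ?W" "r \<in> carrier R"
      then obtain y y' where y: "y \<in> ?H" "y' \<in> ?H" "w = (\<lambda>i. \<xi> i y)" "w' = (\<lambda>i. \<xi> i y')" by blast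
      have "y \<oplus>\<^bsub>F\<^esub> r \<odot>\<^bsub>F\<^esub> y' \<in> ?H" using y * submoduleD(3,4)[OF H's] by blast
      then have "(\<lambda>i. \<xi> i (y \<oplus>\<^bsub>F\<^esub> r \<odot>\<^bsub>F\<^esub> y')) \<in> ?W" by blast
      moreover have "\<forall>j<n. \<xi> j (y \<oplus>\<^bsub>F\<^esub> r \<odot>\<^bsub>F\<^esub> y') = w j \<oplus> r \<otimes> w' j" using y * H'F by simp
      ultimately show "\<exists>w''\<in>?W. \<forall>j<n. w'' j = w j \<oplus> r \<otimes> w' j"
        by (intro bexI[where x = "\<lambda>i. \<xi> i (y \<oplus>\<^bsub>F\<^esub> r \<odot>\<^bsub>F\<^esub> y')"])
    next
      fix L assume L: "ideal L R" "\<And>w j. w \<in> ?W \<Longrightarrow> j < n \<Longrightarrow> w j \<in> L"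
      show "f \<in> L" by (rule star_content[OF p sf Hs L(1)]) (use L(2) in blast)
    qed
    then obtain w where "w \<in> ?W" and w: "\<forall>L. ideal L R \<longrightarrow> (\<forall>j<n. w j \<in> L) \<longrightarrow> d \<in> L \<longrightarrow> f \<in> L"
      "\<forall>x\<in>carrier R. (\<forall>j<n. x \<otimes> w j = \<zero>) \<longrightarrow> x \<otimes> f = \<zero>" by (elim bexE conjE)
    then obtain h where h0: "h \<in> ?H" and w_eq: "w = (\<lambda>i. \<xi> i h)" by (elim imageE)
    have h: "h \<in> ?H" "\<And>L. ideal L R \<Longrightarrow> (\<forall>j<n. \<xi> j h \<in> L) \<Longrightarrow> d \<in> L \<Longrightarrow> f \<in> L"
      "\<And>x. x \<in> carrier R \<Longrightarrow> (\<forall>j<n. x \<otimes> \<xi> j h = \<zero>) \<Longrightarrow> x \<otimes> f = \<zero>"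
      using h0 w by (simp_all add: w_eq)
    have "r \<otimes> f = \<zero>" if "r \<in> carrier R" "r \<odot>\<^bsub>F\<^esub> h = \<zero>\<^bsub>F\<^esub>" for r
    proof (rule h(3)[OF that(1)], intro allI impI)
      fix j assume j: "j < n"
      have "\<xi> j (r \<odot>\<^bsub>F\<^esub> h) = \<xi> j \<zero>\<^bsub>F\<^esub>" using that(2) by simp
      then show "r \<otimes> \<xi> j h = \<zero>" using j that(1) H'F[OF h(1)] by simp
    qed
    then show thesis using h(1,2) that[of h] by blast
  qed
  have hF: "h \<in> carrier F" and fh: "f \<odot>\<^bsub>F\<^esub> h = h" using H'F[OF h(1)] H'f[OF h(1)] by auto
  let ?X = "(\<lambda>r. r \<odot>\<^bsub>F\<^esub> h) ` carrier R"
  have Xs: "submodule ?X R F"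
  proof (rule submodule_of_closed)
    show "\<zero>\<^bsub>F\<^esub> \<in> ?X" using smult_l_null[OF hF] by (intro image_eqI[where x = \<zero>]) auto
    show "?X \<subseteq> carrier F" using hF by auto
    fix x y assume "x \<in> ?X" "y \<in> ?X"
    then obtain r t where "r \<in> carrier R" "t \<in> carrier R" "x = r \<odot>\<^bsub>F\<^esub> h" "y = t \<odot>\<^bsub>F\<^esub> h" by blast
    then have "r \<oplus> t \<in> carrier R" "x \<oplus>\<^bsub>F\<^esub> y = (r \<oplus> t) \<odot>\<^bsub>F\<^esub> h" using hF by (simp_all add: smult_l_distr)
    then show "x \<oplus>\<^bsub>F\<^esub> y \<in> ?X" by blast
  next
    fix t x assume "t \<in> carrier R" "x \<in> ?X"
    then obtain r where "r \<in> carrier R" "t \<in> carrier R" "x = r \<odot>\<^bsub>F\<^esub> h" by blast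
    then have "t \<otimes> r \<in> carrier R" "t \<odot>\<^bsub>F\<^esub> x = (t \<otimes> r) \<odot>\<^bsub>F\<^esub> h" using hF by (simp_all add: smult_assoc1)
    then show "t \<odot>\<^bsub>F\<^esub> x \<in> ?X" by blast
  qed
  have hX: "h \<in> ?X" using smult_one[OF hF] by (intro image_eqI[where x = \<one>]) auto
  have "finitely_generated_submodule ?X R F"
  proof (rule fg_submoduleI[OF Xs, of "{h}"])
    fix N' assume "submodule N' R F" "{h} \<subseteq> N'"
    then show "?X \<subseteq> N'" using submoduleD(4) by blast
  qed (use hX in auto)
  then obtain s1 f1 B1 where p1: "divisible_pairing s1 f1 (content ?X) B1" and sf1: "s1 \<otimes> f1 \<in> content ?X"
    using exists_divisible_pairing[OF fg_content] by blast
  note pf1 = pairing_facts[OF p1 sf1 Xs]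
  \<comment> \<open>Faithfulness of \<open>h\<close> makes the support of its content at least
    \<open>f\<close>; that \<open>f\<close> fixes \<open>h\<close> gives the other
    inequality.\<close>
  have f1: "f1 = f"
  proof -
    have "f1 \<odot>\<^bsub>F\<^esub> h = h" using support_smult[OF pf1(8,4,7) hX] .
    then have "(\<one> \<ominus> f1) \<odot>\<^bsub>F\<^esub> h = \<zero>\<^bsub>F\<^esub>"
      using hF pf1(4) by (simp add: a_minus_def smult_l_distr smult_l_minus M.r_neg)
    then have "(\<one> \<ominus> f1) \<otimes> f = \<zero>" using h(3) pf1(4) by simp
    moreover have "(\<one> \<ominus> f1) \<otimes> f = f \<ominus> f1 \<otimes> f" using pf1(4) pf(4) by algebra
    ultimately have 1: "f = f1 \<otimes> f" using pf1(4) pf(4) r_right_minus_eq by simp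
    have "ideal {c \<in> carrier R. f \<otimes> c = c} R"
      using pf(4) by (intro ideal_of_closed) (auto simp: r_distr m_lcomm[of f])
    then have "content ?X \<subseteq> {c \<in> carrier R. f \<otimes> c = c}"
    proof (rule content_minimal)
      fix i x assume i: "i < n" and "x \<in> ?X"
      then obtain r where r: "r \<in> carrier R" "x = r \<odot>\<^bsub>F\<^esub> h" by blast
      have "\<xi> i (f \<odot>\<^bsub>F\<^esub> h) = \<xi> i h" using fh by simp
      then have "f \<otimes> \<xi> i h = \<xi> i h" using i hF pf(4) by simp
      then show "\<xi> i x \<in> {c \<in> carrier R. f \<otimes> c = c}" using i r hF pf(4) by (simp add: m_lcomm[of f])
    qed
    then have "f \<otimes> (s1 \<otimes> f1) = s1 \<otimes> f1" using sf1 by blast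
    then have "s1 \<otimes> (f \<otimes> f1) = s1 \<otimes> f1" using pf(4) pf1(2,4) by (simp add: m_lcomm)
    then have "f \<otimes> f1 = f1" using nzd_cancel[OF pf1(1)] pf(4) pf1(4) by simp
    then show ?thesis using 1 pf(4) pf1(4) by (simp add: m_comm)
  qed
  note p1 = p1[unfolded f1] and sf1 = sf1[unfolded f1]
  note pf1 = pairing_facts[OF p1 sf1 Xs]
  \<comment> \<open>The saturation of \<open>Rh\<close>, which will be the summand.\<close>
  let ?J = "star f ?X"
  have Js: "submodule ?J R F" using star_submodule[OF pf(4) Xs] .
  have JF: "x \<in> carrier F" if "x \<in> ?J" for x using that by (simp add: star_def)
  have Jf: "f \<odot>\<^bsub>F\<^esub> x = x" if "x \<in> ?J" for x using that by (simp add: star_def)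
  have hJ: "h \<in> ?J" using subset_star[OF p1 sf1 Xs] hX by blast
  have XH: "?X \<subseteq> ?H" using submoduleD(4)[OF H's _ h(1)] by blast
  \<comment> \<open>The multipliers taking \<open>x\<close> into \<open>?H\<close> form an ideal. It
    contains \<open>d\<close>, by the quasi-retraction, and the coordinates of \<open>h\<close>,
    since these take \<open>x\<close> into \<open>?X\<close>; so it contains \<open>f\<close>, which
    fixes \<open>x\<close>.\<close>
  have JH: "x \<in> ?H" if x: "x \<in> ?J" for x
  proof -
    have "f \<odot>\<^bsub>F\<^esub> (d \<odot>\<^bsub>F\<^esub> x) = f \<odot>\<^bsub>F\<^esub> (f \<odot>\<^bsub>F\<^esub> \<rho> x)"
    proof (rule pairing_cancel[OF p1 sf1 Xs])
      fix c assume c: "c \<in> content ?X"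
      have "c \<odot>\<^bsub>F\<^esub> x \<in> ?H" using x c XH by (auto simp: star_def[of f ?X])
      from \<rho>'[OF this] show "c \<odot>\<^bsub>F\<^esub> (d \<odot>\<^bsub>F\<^esub> x) = c \<odot>\<^bsub>F\<^esub> (f \<odot>\<^bsub>F\<^esub> \<rho> x)"
        using endoD(3)[OF \<rho>(1) pf1(9)[OF c] JF[OF x]] smult_swap[OF dR pf1(9)[OF c] JF[OF x]]
          smult_swap[OF pf(4) pf1(9)[OF c] \<rho>F[OF JF[OF x]]] by simp
    qed (use x JF \<rho>F dR pf(4) in auto)
    then have "d \<odot>\<^bsub>F\<^esub> x = f \<odot>\<^bsub>F\<^esub> (f \<odot>\<^bsub>F\<^esub> \<rho> x)"
      using smult_swap[OF pf(4) dR JF[OF x]] Jf[OF x] by simp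
    moreover have "\<rho> x \<in> ?H" using \<rho>(2)[OF JF[OF x]] subset_star[OF p sf Hs] by blast
    ultimately have dx: "d \<odot>\<^bsub>F\<^esub> x \<in> ?H" using submoduleD(4)[OF H's pf(4)] by simp
    have "ideal {r \<in> carrier R. r \<odot>\<^bsub>F\<^esub> x \<in> ?H} R"
      using JF[OF x] submoduleD(2-4)[OF H's]
      by (intro ideal_of_closed) (auto simp: smult_l_distr smult_assoc1)
    then have "f \<in> {r \<in> carrier R. r \<odot>\<^bsub>F\<^esub> x \<in> ?H}"
    proof (rule h(2))
      fix i assume i: "i < n"
      have "\<xi> i h \<in> content ?X" using coord_in_content[OF pf1(7) hX i] .
      then show "\<xi> i h \<in> {r \<in> carrier R. r \<odot>\<^bsub>F\<^esub> x \<in> ?H}" using x XH pf1(9) by (auto simp: star_def[of f ?X])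
    qed (use dx dR in auto)
    then show ?thesis using Jf[OF x] by simp
  qed
  \<comment> \<open>Content elements of \<open>?X\<close> turn \<open>x\<close> into a multiple of
    \<open>h\<close>, so \<open>x\<close> and \<open>h\<close> are proportional up to cancellable
    factors. The same argument, with this as input, compares two arbitrary elements of
    \<open>?J\<close>.\<close>
  have rank1h: "\<psi> x \<odot>\<^bsub>F\<^esub> h = \<psi> h \<odot>\<^bsub>F\<^esub> x" if \<psi>: "functional \<psi>" and x: "x \<in> ?J" for \<psi> x
  proof -
    note [simp] = functionalD(1)[OF \<psi>] JF[OF x] hF
    have "f \<odot>\<^bsub>F\<^esub> (\<psi> x \<odot>\<^bsub>F\<^esub> h) = f \<odot>\<^bsub>F\<^esub> (\<psi> h \<odot>\<^bsub>F\<^esub> x)"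
    proof (rule pairing_cancel[OF p1 sf1 Xs])
      fix c assume c: "c \<in> content ?X"
      note [simp] = pf1(9)[OF c]
      obtain r where r: "r \<in> carrier R" "c \<odot>\<^bsub>F\<^esub> x = r \<odot>\<^bsub>F\<^esub> h" using x c by (auto simp: star_def)
      have "c \<odot>\<^bsub>F\<^esub> (\<psi> x \<odot>\<^bsub>F\<^esub> h) = \<psi> (c \<odot>\<^bsub>F\<^esub> x) \<odot>\<^bsub>F\<^esub> h"
        by (simp add: functionalD(3)[OF \<psi>] smult_assoc1)
      also have "\<dots> = \<psi> h \<odot>\<^bsub>F\<^esub> (r \<odot>\<^bsub>F\<^esub> h)"
        using r by (simp add: functionalD(3)[OF \<psi>] smult_assoc1 smult_swap)
      also have "\<dots> = c \<odot>\<^bsub>F\<^esub> (\<psi> h \<odot>\<^bsub>F\<^esub> x)" unfolding r(2)[symmetric] by (intro smult_swap) auto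
      finally show "c \<odot>\<^bsub>F\<^esub> (\<psi> x \<odot>\<^bsub>F\<^esub> h) = c \<odot>\<^bsub>F\<^esub> (\<psi> h \<odot>\<^bsub>F\<^esub> x)" .
    qed auto
    then show ?thesis using pf(4) fh Jf[OF x] by (simp add: smult_swap[of f])
  qed
  have rank1: "\<psi> x \<odot>\<^bsub>F\<^esub> y = \<psi> y \<odot>\<^bsub>F\<^esub> x" if \<psi>: "functional \<psi>" and x: "x \<in> ?J" and y: "y \<in> ?J" for \<psi> x y
  proof -
    note [simp] = functionalD(1)[OF \<psi>] JF[OF x] JF[OF y] hF
    have "f \<odot>\<^bsub>F\<^esub> (\<psi> x \<odot>\<^bsub>F\<^esub> y) = f \<odot>\<^bsub>F\<^esub> (\<psi> y \<odot>\<^bsub>F\<^esub> x)"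
    proof (rule pairing_cancel[OF p1 sf1 Xs])
      fix c assume c: "c \<in> content ?X"
      note [simp] = pf1(9)[OF c]
      obtain r where r: "r \<in> carrier R" "c \<odot>\<^bsub>F\<^esub> y = r \<odot>\<^bsub>F\<^esub> h" using y c by (auto simp: star_def)
      have "c \<odot>\<^bsub>F\<^esub> (\<psi> x \<odot>\<^bsub>F\<^esub> y) = \<psi> x \<odot>\<^bsub>F\<^esub> (r \<odot>\<^bsub>F\<^esub> h)"
        unfolding r(2)[symmetric] by (intro smult_swap) auto
      also have "\<dots> = r \<odot>\<^bsub>F\<^esub> (\<psi> x \<odot>\<^bsub>F\<^esub> h)" using r by (intro smult_swap) auto
      also have "\<dots> = \<psi> (r \<odot>\<^bsub>F\<^esub> h) \<odot>\<^bsub>F\<^esub> x"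
        unfolding rank1h[OF \<psi> x] using r by (simp add: functionalD(3)[OF \<psi>] smult_assoc1)
      also have "\<dots> = c \<odot>\<^bsub>F\<^esub> (\<psi> y \<odot>\<^bsub>F\<^esub> x)"
        unfolding r(2)[symmetric] by (simp add: functionalD(3)[OF \<psi>] smult_assoc1)
      finally show "c \<odot>\<^bsub>F\<^esub> (\<psi> x \<odot>\<^bsub>F\<^esub> y) = c \<odot>\<^bsub>F\<^esub> (\<psi> y \<odot>\<^bsub>F\<^esub> x)" .
    qed auto
    then show ?thesis using pf(4) Jf[OF x] Jf[OF y] by (simp add: smult_swap[of f])
  qed
  \<comment> \<open>The \<open>t\<close> for which multiplication by \<open>t\<close> on
    \<open>?J\<close> extends to a map of \<open>F\<close> into \<open>?J\<close>. A fraction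
    \<open>t = \<xi> i x b / s1\<close> qualifies through the map sending \<open>z\<close> to
    \<open>\<xi> i z\<close> times \<open>y\<close>, where \<open>y = (b / s1) x\<close>, by
    proportionality. Hence \<open>f\<close> qualifies, and its extension is the projection
    \<open>\<pi>\<close>.\<close>
  let ?L = "{t \<in> carrier R. \<exists>\<pi>. endo \<pi> \<and> (\<forall>x\<in>carrier F. \<pi> x \<in> ?J) \<and> (\<forall>x\<in>?J. \<pi> x = t \<odot>\<^bsub>F\<^esub> x)}"
  have "ideal ?L R"
  proof (rule ideal_of_closed)
    show "\<zero> \<in> ?L" using endo_zero submoduleD(2)[OF Js] JF by (auto intro!: exI[of _ "\<lambda>x. \<zero>\<^bsub>F\<^esub>"])
    fix t u assume "t \<in> ?L" "u \<in> ?L"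
    then obtain \<pi> \<tau> where *: "t \<in> carrier R" "u \<in> carrier R" "endo \<pi>" "endo \<tau>"
      "\<forall>x\<in>carrier F. \<pi> x \<in> ?J" "\<forall>x\<in>carrier F. \<tau> x \<in> ?J"
      "\<forall>x\<in>?J. \<pi> x = t \<odot>\<^bsub>F\<^esub> x" "\<forall>x\<in>?J. \<tau> x = u \<odot>\<^bsub>F\<^esub> x" by auto
    then have "endo (\<lambda>x. \<pi> x \<oplus>\<^bsub>F\<^esub> \<tau> x)" "\<forall>x\<in>carrier F. \<pi> x \<oplus>\<^bsub>F\<^esub> \<tau> x \<in> ?J"
      "\<forall>x\<in>?J. \<pi> x \<oplus>\<^bsub>F\<^esub> \<tau> x = (t \<oplus> u) \<odot>\<^bsub>F\<^esub> x"
      using submoduleD(3)[OF Js] JF by (auto intro: endo_add simp: smult_l_distr)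
    then show "t \<oplus> u \<in> ?L" using * by blast
  next
    fix r t assume r: "r \<in> carrier R" and "t \<in> ?L"
    then obtain \<pi> where *: "t \<in> carrier R" "endo \<pi>" "\<forall>x\<in>carrier F. \<pi> x \<in> ?J" "\<forall>x\<in>?J. \<pi> x = t \<odot>\<^bsub>F\<^esub> x" by auto
    then have "endo (\<lambda>x. r \<odot>\<^bsub>F\<^esub> \<pi> x)" "\<forall>x\<in>carrier F. r \<odot>\<^bsub>F\<^esub> \<pi> x \<in> ?J"
      "\<forall>x\<in>?J. r \<odot>\<^bsub>F\<^esub> \<pi> x = (r \<otimes> t) \<odot>\<^bsub>F\<^esub> x"
      using submoduleD(4)[OF Js] JF r by (auto intro: endo_smult simp: smult_assoc1)
    then show "r \<otimes> t \<in> ?L" using * r by blast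
  qed auto
  then have "f \<in> ?L"
  proof (rule pairing_coord[OF p1 sf1 Xs])
    fix i x b t assume *: "i < n" "x \<in> ?X" "b \<in> B1" "t \<in> carrier R" "\<xi> i x \<otimes> b = s1 \<otimes> t"
    have bR: "b \<in> carrier R" using pf1(10)[OF *(3)] .
    have xJ: "x \<in> ?J" using *(2) subset_star[OF p1 sf1 Xs] by blast
    obtain y where y: "y \<in> ?J" "s1 \<odot>\<^bsub>F\<^esub> y = b \<odot>\<^bsub>F\<^esub> x" using star_witness[OF p1 sf1 Xs *(2,3)] by blast
    note [simp] = JF[OF xJ] JF[OF y(1)]
    have "endo (\<lambda>z. \<xi> i z \<odot>\<^bsub>F\<^esub> y)" using endo_functional[OF coord_functional[OF *(1)]] by simp
    moreover have "\<forall>z\<in>carrier F. \<xi> i z \<odot>\<^bsub>F\<^esub> y \<in> ?J" using *(1) submoduleD(4)[OF Js _ y(1)] by simp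
    moreover have "\<xi> i z \<odot>\<^bsub>F\<^esub> y = t \<odot>\<^bsub>F\<^esub> z" if z: "z \<in> ?J" for z
    proof -
      note [simp] = JF[OF z]
      have "s1 \<odot>\<^bsub>F\<^esub> (\<xi> i z \<odot>\<^bsub>F\<^esub> y) = \<xi> i z \<odot>\<^bsub>F\<^esub> (b \<odot>\<^bsub>F\<^esub> x)"
        unfolding y(2)[symmetric] using *(1) pf1(2) by (intro smult_swap) auto
      also have "\<dots> = b \<odot>\<^bsub>F\<^esub> (\<xi> i z \<odot>\<^bsub>F\<^esub> x)" using *(1) bR by (intro smult_swap) auto
      also have "\<xi> i z \<odot>\<^bsub>F\<^esub> x = \<xi> i x \<odot>\<^bsub>F\<^esub> z" using rank1[OF coord_functional[OF *(1)] z xJ] .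
      also have "b \<odot>\<^bsub>F\<^esub> (\<xi> i x \<odot>\<^bsub>F\<^esub> z) = (\<xi> i x \<otimes> b) \<odot>\<^bsub>F\<^esub> z"
        using *(1) bR by (simp add: smult_assoc1 smult_swap)
      also have "\<dots> = s1 \<odot>\<^bsub>F\<^esub> (t \<odot>\<^bsub>F\<^esub> z)" unfolding *(5) using *(4) pf1(2) by (simp add: smult_assoc1)
      finally show ?thesis using smult_nzd_cancel[OF pf1(1)] *(1,4) by simp
    qed
    ultimately show "t \<in> ?L" using *(4) by blast
  qed
  then obtain \<pi> where \<pi>: "endo \<pi>" "\<And>x. x \<in> carrier F \<Longrightarrow> \<pi> x \<in> ?J" "\<And>x. x \<in> ?J \<Longrightarrow> \<pi> x = f \<odot>\<^bsub>F\<^esub> x" by blast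
  have \<pi>J: "\<pi> x = x" if "x \<in> ?J" for x using \<pi>(3)[OF that] Jf[OF that] by simp
  \<comment> \<open>Generators \<open>e j\<close> of \<open>F\<close>. The vectors of values
    \<open>\<phi> (\<pi> (e j))\<close>, for all functionals \<open>\<phi>\<close>, form the second
    family to which the combination lemma is applied, now with \<open>d0\<close>.\<close>
  obtain S where S: "finite S" "S \<subseteq> carrier F" "\<And>N'. submodule N' R F \<Longrightarrow> S \<subseteq> N' \<Longrightarrow> carrier F \<subseteq> N'"
    using fg_submoduleE[OF carrier_fg] by metis
  obtain q :: nat and e where e: "S = e ` {i. i < q}" using S(1) finite_imp_nat_seg_image_inj_on by blast
  have eF: "e j \<in> carrier F" if "j < q" for j using e S(2) that by blast
  obtain \<phi> where \<phi>: "functional \<phi>" "\<And>L. ideal L R \<Longrightarrow> (\<forall>j<q. \<phi> (\<pi> (e j)) \<in> L) \<Longrightarrow> d0 \<in> L \<Longrightarrow> f \<in> L"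
    "\<And>x. x \<in> carrier R \<Longrightarrow> (\<forall>j<q. x \<otimes> \<phi> (\<pi> (e j)) = \<zero>) \<Longrightarrow> x \<otimes> f = \<zero>"
  proof -
    let ?W = "(\<lambda>\<phi> j. \<phi> (\<pi> (e j))) ` {\<phi>. functional \<phi>}"
    have \<pi>e: "\<pi> (e j) \<in> carrier F" if "j < q" for j using endoD(1)[OF \<pi>(1) eF[OF that]] .
    have "\<exists>w\<in>?W. (\<forall>L. ideal L R \<longrightarrow> (\<forall>j<q. w j \<in> L) \<longrightarrow> d0 \<in> L \<longrightarrow> f \<in> L) \<and>
        (\<forall>x\<in>carrier R. (\<forall>j<q. x \<otimes> w j = \<zero>) \<longrightarrow> x \<otimes> f = \<zero>)"
    proof (rule exists_coprime_faithful_combination[OF _ _ _ pf(3) _ d0])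
      show "w j \<in> carrier R" if "w \<in> ?W" "j < q" for w j using that \<pi>e functionalD(1) by auto
      show "?W \<noteq> {}" using functional_zero by blast
      fix w w' r assume *: "w \<in> ?W" "w' \<in> ?W" "r \<in> carrier R"
      then obtain \<phi> \<phi>' where y: "functional \<phi>" "functional \<phi>'" "w = (\<lambda>j. \<phi> (\<pi> (e j)))" "w' = (\<lambda>j. \<phi>' (\<pi> (e j)))" by blast
      have "functional (\<lambda>x. \<phi> x \<oplus> r \<otimes> \<phi>' x)" using y * by (intro functional_add functional_smult)
      then have "(\<lambda>j. \<phi> (\<pi> (e j)) \<oplus> r \<otimes> \<phi>' (\<pi> (e j))) \<in> ?W"
        by (intro image_eqI[of _ _ "\<lambda>x. \<phi> x \<oplus> r \<otimes> \<phi>' x"]) auto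
      moreover have "\<forall>j<q. \<phi> (\<pi> (e j)) \<oplus> r \<otimes> \<phi>' (\<pi> (e j)) = w j \<oplus> r \<otimes> w' j" using y(3,4) by simp
      ultimately show "\<exists>w''\<in>?W. \<forall>j<q. w'' j = w j \<oplus> r \<otimes> w' j"
        by (intro bexI[where x = "\<lambda>j. \<phi> (\<pi> (e j)) \<oplus> r \<otimes> \<phi>' (\<pi> (e j))"])
    next
      fix L assume L: "ideal L R" "\<And>w j. w \<in> ?W \<Longrightarrow> j < q \<Longrightarrow> w j \<in> L"
      show "f \<in> L"
      proof (rule star_content[OF p1 sf1 Xs L(1)])
        fix i y assume i: "i < n" and y: "y \<in> ?J"
        have "carrier F \<subseteq> {x \<in> carrier F. \<xi> i (\<pi> x) \<in> L}"
        proof (rule S(3)[OF submodule_functional_vimage[OF functional_compose[OF coord_functional[OF i] \<pi>(1)] L(1)]])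
          have "\<xi> i (\<pi> (e j)) \<in> L" if "j < q" for j
            using L(2)[of "\<lambda>j. \<xi> i (\<pi> (e j))" j] coord_functional[OF i] that by blast
          then show "S \<subseteq> {x \<in> carrier F. \<xi> i (\<pi> x) \<in> L}" using S(2) by (auto simp: e)
        qed
        then have "\<xi> i (\<pi> y) \<in> L" using JF[OF y] by blast
        then show "\<xi> i y \<in> L" using \<pi>J[OF y] by simp
      qed
    qed
    then obtain w where "w \<in> ?W" and w: "\<forall>L. ideal L R \<longrightarrow> (\<forall>j<q. w j \<in> L) \<longrightarrow> d0 \<in> L \<longrightarrow> f \<in> L"
      "\<forall>x\<in>carrier R. (\<forall>j<q. x \<otimes> w j = \<zero>) \<longrightarrow> x \<otimes> f = \<zero>" by (elim bexE conjE)
    then obtain \<phi> where "functional \<phi>" and w_eq: "w = (\<lambda>j. \<phi> (\<pi> (e j)))" by (elim imageE) simp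
    then show thesis using w by (intro that[of \<phi>]) (simp_all add: w_eq)
  qed
  show thesis
  proof (rule that[of \<pi> \<phi> h])
    show "endo \<pi>" "functional \<phi>" "h \<in> carrier F" by fact+
    show "\<pi> h = h" using \<pi>J[OF hJ] .
    show "\<pi> (\<pi> x) = \<pi> x" "f \<odot>\<^bsub>F\<^esub> \<pi> x = \<pi> x" if "x \<in> carrier F" for x
      using \<pi>J[OF \<pi>(2)[OF that]] Jf[OF \<pi>(2)[OF that]] by auto
    \<comment> \<open>The multiplier \<open>s f\<close> moves \<open>\<pi> x\<close> into
      \<open>H\<close>, and purity of \<open>G\<close> removes \<open>s\<close>.\<close>
    show "\<pi> x \<in> G" if x: "x \<in> carrier F" for x
    proof -
      have y: "\<pi> x \<in> ?H" using JH[OF \<pi>(2)[OF x]] .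
      then have "(s \<otimes> f) \<odot>\<^bsub>F\<^esub> \<pi> x \<in> H" using sf by (simp add: star_def)
      then have "s \<odot>\<^bsub>F\<^esub> \<pi> x \<in> G" using HG H'f[OF y] H'F[OF y] pf(2,4) by (auto simp: smult_assoc1)
      then show ?thesis using pure[OF H'F[OF y] pf(1)] by blast
    qed
    show "c \<odot>\<^bsub>F\<^esub> \<pi> x \<in> H" if "c \<in> content H" "x \<in> carrier F" for c x
      using JH[OF \<pi>(2)[OF that(2)]] that(1) by (simp add: star_def)
    show "r \<otimes> f = \<zero>" if "r \<in> carrier R" "r \<odot>\<^bsub>F\<^esub> h = \<zero>\<^bsub>F\<^esub>" for r using h(3)[OF that] .
    show "r \<otimes> f = \<zero>" if "r \<in> carrier R" "\<And>x. x \<in> carrier F \<Longrightarrow> r \<otimes> \<phi> (\<pi> x) = \<zero>" for r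
      using \<phi>(3)[OF that(1)] that(2) eF by blast
    show "f \<in> L" if "ideal L R" "\<And>x. x \<in> carrier F \<Longrightarrow> \<phi> (\<pi> x) \<in> L" "d0 \<in> L" for L
      using \<phi>(2)[OF that(1) _ that(3)] that(2) eF by blast
    \<comment> \<open>By proportionality \<open>\<phi> (\<pi> (e j))\<close> times
      \<open>\<pi> x\<close> equals \<open>\<phi> (\<pi> x)\<close> times
      \<open>\<pi> (e j)\<close>, which is zero. So the coordinates of \<open>\<pi> x\<close>
      annihilate all \<open>\<phi> (\<pi> (e j))\<close>, hence \<open>f\<close>, and
      \<open>f\<close> fixes \<open>\<pi> x\<close>.\<close>
    show "\<pi> x = \<zero>\<^bsub>F\<^esub>" if x: "x \<in> carrier F" and 0: "\<phi> (\<pi> x) = \<zero>" for x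
    proof -
      have xJ: "\<pi> x \<in> ?J" using \<pi>(2)[OF x] .
      have "\<xi> i (\<pi> x) = \<xi> i \<zero>\<^bsub>F\<^esub>" if i: "i < n" for i
      proof -
        have "\<xi> i (\<pi> x) \<otimes> f = \<zero>"
        proof (rule \<phi>(3), use i JF[OF xJ] in simp, intro allI impI)
          fix j assume j: "j < q"
          have eJ: "\<pi> (e j) \<in> ?J" using \<pi>(2)[OF eF[OF j]] .
          have "\<phi> (\<pi> (e j)) \<odot>\<^bsub>F\<^esub> \<pi> x = \<zero>\<^bsub>F\<^esub>" using rank1[OF \<phi>(1) eJ xJ] 0 JF[OF eJ] by simp
          then have "\<xi> i (\<phi> (\<pi> (e j)) \<odot>\<^bsub>F\<^esub> \<pi> x) = \<xi> i \<zero>\<^bsub>F\<^esub>" by simp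
          then show "\<xi> i (\<pi> x) \<otimes> \<phi> (\<pi> (e j)) = \<zero>"
            using i JF[OF xJ] functionalD(1)[OF \<phi>(1) JF[OF eJ]] by (simp add: m_comm)
        qed
        moreover have "\<xi> i (f \<odot>\<^bsub>F\<^esub> \<pi> x) = \<xi> i (\<pi> x)" using Jf[OF xJ] by simp
        ultimately show ?thesis using i JF[OF xJ] pf(4) by (simp add: m_comm)
      qed
      then show ?thesis using JF[OF xJ] by (intro coord_eqI) auto
    qed
  qed
qed

end

section \<open>Finitely generated ideals and gluing along an idempotent\<close>

context semihereditary
begin

lemma idempotent_le_trans:
  assumes "g \<otimes> f = g" "f \<otimes> e = f" "g \<in> carrier R" "f \<in> carrier R" "e \<in> carrier R"
  shows "g \<otimes> e = g"
  using assms by (metis m_assoc)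

lemma fg_ideal_sum:
  assumes "finitely_generated_ideal A R" "finitely_generated_ideal B R"
  shows "finitely_generated_ideal (Idl (A \<union> B)) R"
proof -
  obtain S T where S: "finite S" "S \<subseteq> carrier R" "A = Idl S" and T: "finite T" "T \<subseteq> carrier R" "B = Idl T"
    using assms by (auto simp: finitely_generated_ideal_def)
  have AB: "A \<subseteq> carrier R" "B \<subseteq> carrier R" using assms fg_ideal ideal_memD by blast+
  have ST: "ideal (Idl (S \<union> T)) R" using S T by (intro genideal_ideal) auto
  have "A \<subseteq> Idl (S \<union> T)" "B \<subseteq> Idl (S \<union> T)"
    unfolding S(3) T(3) using genideal_self[of "S \<union> T"] S T by (auto intro!: genideal_minimal[OF ST])
  then have "Idl (A \<union> B) \<subseteq> Idl (S \<union> T)" by (intro genideal_minimal ST) auto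
  moreover have "Idl (S \<union> T) \<subseteq> Idl (A \<union> B)"
    using genideal_self[OF S(2)] genideal_self[OF T(2)] genideal_self[of "A \<union> B"] AB S T
    by (intro genideal_minimal genideal_ideal) auto
  ultimately have "Idl (A \<union> B) = Idl (S \<union> T)" by blast
  then show ?thesis using S T unfolding finitely_generated_ideal_def by (intro exI[of _ "S \<union> T"]) auto
qed

lemma fg_ideal_smult:
  assumes "finitely_generated_ideal A R" and r: "r \<in> carrier R"
  shows "finitely_generated_ideal ((\<lambda>a. r \<otimes> a) ` A) R"
proof -
  obtain S where S: "finite S" "S \<subseteq> carrier R" "A = Idl S"
    using assms by (auto simp: finitely_generated_ideal_def)
  have A: "ideal A R" using assms(1) by (rule fg_ideal)
  note [simp] = r ideal_memD[OF A]
  let ?rA = "(\<lambda>a. r \<otimes> a) ` A"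
  have rA: "ideal ?rA R"
  proof (rule ideal_of_closed)
    show "\<zero> \<in> ?rA" using ideal_zero[OF A] by (intro image_eqI[where x = \<zero>]) auto
    fix x y assume "x \<in> ?rA" "y \<in> ?rA"
    then obtain a b where ab: "a \<in> A" "b \<in> A" "x = r \<otimes> a" "y = r \<otimes> b" by blast
    then have "x \<oplus> y = r \<otimes> (a \<oplus> b)" by (simp add: r_distr)
    then show "x \<oplus> y \<in> ?rA" using ideal_add[OF A ab(1,2)] by blast
  next
    fix t x assume t: "t \<in> carrier R" and "x \<in> ?rA"
    then obtain a where a: "a \<in> A" "x = r \<otimes> a" by blast
    then have "t \<otimes> x = r \<otimes> (t \<otimes> a)" using t by (simp add: m_lcomm)
    then show "t \<otimes> x \<in> ?rA" using ideal_mult[OF A t a(1)] by blast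
  qed auto
  have SA: "S \<subseteq> A" unfolding S(3) using genideal_self[OF S(2)] .
  have rS: "(\<lambda>a. r \<otimes> a) ` S \<subseteq> carrier R" using S(2) by auto
  have I: "ideal (Idl ((\<lambda>a. r \<otimes> a) ` S)) R" using genideal_ideal[OF rS] .
  have "ideal {a \<in> carrier R. r \<otimes> a \<in> Idl ((\<lambda>a. r \<otimes> a) ` S)} R"
    using ideal.helper_max_prime[OF I is_cring r] .
  then have "A \<subseteq> {a \<in> carrier R. r \<otimes> a \<in> Idl ((\<lambda>a. r \<otimes> a) ` S)}"
    unfolding S(3) using S(2) genideal_self[OF rS] by (intro genideal_minimal) auto
  then have "?rA \<subseteq> Idl ((\<lambda>a. r \<otimes> a) ` S)" by blast
  moreover have "Idl ((\<lambda>a. r \<otimes> a) ` S) \<subseteq> ?rA" using SA by (intro genideal_minimal rA) auto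
  ultimately have "?rA = Idl ((\<lambda>a. r \<otimes> a) ` S)" by blast
  then show ?thesis using S(1) rS unfolding finitely_generated_ideal_def by (intro exI[of _ "(\<lambda>a. r \<otimes> a) ` S"]) auto
qed

text \<open>Over a semihereditary ring these are exactly the invertible ideals.\<close>

definition regular_ideal :: "'a set \<Rightarrow> bool" where
  "regular_ideal A \<longleftrightarrow> finitely_generated_ideal A R \<and> (\<exists>t\<in>nonzerodivisors R. t \<in> A)"

lemma regular_idealD: "regular_ideal A \<Longrightarrow> ideal A R"
  by (simp add: regular_ideal_def fg_ideal)

lemma nzd_glue:
  assumes "idem_elem R f" "s \<in> nonzerodivisors R" "t \<in> nonzerodivisors R"
  shows "s \<otimes> f \<oplus> (\<one> \<ominus> f) \<otimes> t \<in> nonzerodivisors R"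
proof (rule nzdI)
  have f: "f \<in> carrier R" "f \<otimes> f = f" using assms(1) by (auto simp: idem_elem_def)
  note f0 = idempotent_compl[OF assms(1)]
  have st: "s \<in> carrier R" "t \<in> carrier R" using assms nzd_closed by auto
  show "s \<otimes> f \<oplus> (\<one> \<ominus> f) \<otimes> t \<in> carrier R" using f st by simp
  fix x assume x: "x \<in> carrier R" "x \<otimes> (s \<otimes> f \<oplus> (\<one> \<ominus> f) \<otimes> t) = \<zero>"
  have "s \<otimes> (f \<otimes> x) = f \<otimes> (x \<otimes> (s \<otimes> f \<oplus> (\<one> \<ominus> f) \<otimes> t)) \<ominus> (f \<otimes> (\<one> \<ominus> f)) \<otimes> (x \<otimes> t) \<oplus> s \<otimes> x \<otimes> (f \<ominus> f \<otimes> f)"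
    using f(1) st x(1) by algebra
  also have "\<dots> = \<zero>" unfolding x(2) f0(2) f(2) using f(1) st x(1) by (simp add: a_minus_def r_neg)
  finally have fx: "f \<otimes> x = \<zero>" using nzd_zero[OF assms(2)] f x by simp
  have "t \<otimes> x = x \<otimes> (s \<otimes> f \<oplus> (\<one> \<ominus> f) \<otimes> t) \<ominus> s \<otimes> (f \<otimes> x) \<oplus> t \<otimes> (f \<otimes> x)"
    using f(1) st x(1) by algebra
  also have "\<dots> = \<zero>" unfolding x(2) fx using st by (simp add: r_right_minus_eq)
  finally show "x = \<zero>" using nzd_zero[OF assms(3)] x by simp
qed

end

context coord_module
begin

section \<open>Rank\<close>

text \<open>A functional that lowers the rank can be chosen only after shrinking an idempotent, and
  the choice differs from piece to piece. Asking for \<open>k\<close> jointly injective functionals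
  somewhere below every nonzero \<open>g\<close> avoids gluing these choices.\<close>

definition rank_le :: "nat \<Rightarrow> 'a \<Rightarrow> 'c set \<Rightarrow> bool" where
  "rank_le k f G \<longleftrightarrow> (\<forall>g. idem_elem R g \<longrightarrow> g \<noteq> \<zero> \<longrightarrow> g \<otimes> f = g \<longrightarrow>
     (\<exists>g' \<phi>. idem_elem R g' \<and> g' \<noteq> \<zero> \<and> g' \<otimes> g = g' \<and> (\<forall>i<k. functional (\<phi> i)) \<and>
       (\<forall>x\<in>G. g' \<odot>\<^bsub>F\<^esub> x = x \<longrightarrow> (\<forall>i<k. \<phi> i x = \<zero>) \<longrightarrow> x = \<zero>\<^bsub>F\<^esub>)))"

lemma rank_le_coords: "G \<subseteq> carrier F \<Longrightarrow> rank_le n f G"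
  unfolding rank_le_def
proof (intro allI impI)
  fix g assume G: "G \<subseteq> carrier F" and g: "idem_elem R g" "g \<noteq> \<zero>" "g \<otimes> f = g"
  have "\<forall>x\<in>G. g \<odot>\<^bsub>F\<^esub> x = x \<longrightarrow> (\<forall>i<n. \<xi> i x = \<zero>) \<longrightarrow> x = \<zero>\<^bsub>F\<^esub>"
    using G by (auto intro!: coord_eqI)
  then show "\<exists>g' \<phi>. idem_elem R g' \<and> g' \<noteq> \<zero> \<and> g' \<otimes> g = g' \<and> (\<forall>i<n. functional (\<phi> i)) \<and>
       (\<forall>x\<in>G. g' \<odot>\<^bsub>F\<^esub> x = x \<longrightarrow> (\<forall>i<n. \<phi> i x = \<zero>) \<longrightarrow> x = \<zero>\<^bsub>F\<^esub>)"
    using g coord_functional by (intro exI[of _ g] exI[of _ \<xi>]) (auto simp: idem_elem_def)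
qed

lemma rank_le_mono:
  assumes "rank_le k f G" "f' \<otimes> f = f'" "f \<in> carrier R" "f' \<in> carrier R"
  shows "rank_le k f' G"
  unfolding rank_le_def
proof (intro allI impI)
  fix g assume g: "idem_elem R g" "g \<noteq> \<zero>" "g \<otimes> f' = g"
  have "g \<otimes> f = g" using idempotent_le_trans[OF g(3) assms(2)] g(1) assms(3,4) by (simp add: idem_elem_def)
  then show "\<exists>g' \<phi>. idem_elem R g' \<and> g' \<noteq> \<zero> \<and> g' \<otimes> g = g' \<and> (\<forall>i<k. functional (\<phi> i)) \<and>
       (\<forall>x\<in>G. g' \<odot>\<^bsub>F\<^esub> x = x \<longrightarrow> (\<forall>i<k. \<phi> i x = \<zero>) \<longrightarrow> x = \<zero>\<^bsub>F\<^esub>)"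
    using assms(1) g(1,2) unfolding rank_le_def by blast
qed

lemma smult_compl_zero:
  assumes "f \<odot>\<^bsub>F\<^esub> x = x" "f \<in> carrier R" "x \<in> carrier F"
  shows "(\<one> \<ominus> f) \<odot>\<^bsub>F\<^esub> x = \<zero>\<^bsub>F\<^esub>"
  using assms by (simp add: a_minus_def smult_l_distr smult_l_minus M.r_neg)

lemma compl_mult_zero:
  assumes "(\<one> \<ominus> f) \<otimes> g = \<zero>" "f \<in> carrier R" "g \<in> carrier R"
  shows "g \<otimes> f = g"
proof -
  have "(\<one> \<ominus> f) \<otimes> g = g \<ominus> g \<otimes> f" using assms(2,3) by algebra
  then show ?thesis using assms r_right_minus_eq[of g "g \<otimes> f"] by simp
qed

text \<open>A nonzero \<open>x\<close> would have a nonzero support \<open>g\<close>, lying under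
  \<open>f\<close>. Some nonzero \<open>g'\<close> below \<open>g\<close> annihilates
  \<open>x\<close>, contradicting that \<open>g\<close> is its support.\<close>

lemma rank_le_0:
  assumes rk: "rank_le 0 f G" and G: "submodule G R F" and f: "f \<in> carrier R" and x: "x \<in> G" "f \<odot>\<^bsub>F\<^esub> x = x"
  shows "x = \<zero>\<^bsub>F\<^esub>"
proof (rule ccontr)
  assume nz: "x \<noteq> \<zero>\<^bsub>F\<^esub>"
  have xF: "x \<in> carrier F" using submoduleD(1)[OF G x(1)] .
  obtain \<phi> s g where \<phi>: "functional \<phi>" "s \<in> nonzerodivisors R" "idem_elem R g" "g \<odot>\<^bsub>F\<^esub> x = x" "\<phi> x = s \<otimes> g"
    using exists_functional_support[OF xF] by blast
  have g: "g \<in> carrier R" and s: "s \<in> carrier R" using \<phi> nzd_closed by (auto simp: idem_elem_def)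
  have "g \<noteq> \<zero>" using nz \<phi>(4) xF by auto
  moreover have "g \<otimes> f = g"
  proof (rule compl_mult_zero[OF _ f g])
    have "s \<otimes> ((\<one> \<ominus> f) \<otimes> g) = \<phi> ((\<one> \<ominus> f) \<odot>\<^bsub>F\<^esub> x)"
      using functionalD(3)[OF \<phi>(1) _ xF] f g s \<phi>(5) by (simp add: m_lcomm)
    also have "\<dots> = \<zero>" using smult_compl_zero[OF x(2) f xF] functionalD(4)[OF \<phi>(1)] by simp
    finally show "(\<one> \<ominus> f) \<otimes> g = \<zero>" using nzd_zero[OF \<phi>(2)] f g by simp
  qed
  ultimately obtain g' where g': "idem_elem R g'" "g' \<noteq> \<zero>" "g' \<otimes> g = g'"
    "\<And>y. y \<in> G \<Longrightarrow> g' \<odot>\<^bsub>F\<^esub> y = y \<Longrightarrow> y = \<zero>\<^bsub>F\<^esub>"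
    using rk \<phi>(3) unfolding rank_le_def by auto
  have g'R: "g' \<in> carrier R" "g' \<otimes> g' = g'" using g'(1) by (auto simp: idem_elem_def)
  have "g' \<odot>\<^bsub>F\<^esub> x = \<zero>\<^bsub>F\<^esub>"
    using g'(4)[of "g' \<odot>\<^bsub>F\<^esub> x"] submoduleD(4)[OF G g'R(1) x(1)] smult_assoc1[OF g'R(1) g'R(1) xF] g'R(2) by simp
  then have "g' \<otimes> \<phi> x = \<zero>" using functionalD(3,4)[OF \<phi>(1)] g'R(1) xF by metis
  then have "s \<otimes> g' = \<zero>" using \<phi>(5) g'R(1) s g g'(3) m_lcomm[of g' s g] by simp
  then show False using nzd_zero[OF \<phi>(2)] g'R g'(2) by blast
qed

text \<open>Gaussian elimination with pivot \<open>\<phi> i (g' h)\<close>, carried out below the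
  support \<open>e\<close> of the pivot. If all \<open>\<psi> l\<close> vanish at \<open>x\<close>,
  then the pivot times \<open>x\<close> equals \<open>\<phi> i x\<close> times \<open>g' h\<close>.
  Applying \<open>\<pi>\<close>, which kills \<open>x\<close> and fixes \<open>h\<close>, shows that
  both sides are zero, and so \<open>e\<close> kills \<open>x\<close>.\<close>

lemma rank_le_step:
  assumes rk: "rank_le (Suc k) f G" and G: "submodule G R F" and f: "f \<in> carrier R"
    and h: "h \<in> G" "\<And>r. r \<in> carrier R \<Longrightarrow> r \<odot>\<^bsub>F\<^esub> h = \<zero>\<^bsub>F\<^esub> \<Longrightarrow> r \<otimes> f = \<zero>"
    and \<pi>: "endo \<pi>" "\<pi> h = h"
  shows "rank_le k f {x \<in> G. \<pi> x = \<zero>\<^bsub>F\<^esub>}"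
  unfolding rank_le_def
proof (intro allI impI)
  fix g assume g: "idem_elem R g" "g \<noteq> \<zero>" "g \<otimes> f = g"
  have gR: "g \<in> carrier R" using g(1) by (simp add: idem_elem_def)
  have hF: "h \<in> carrier F" using submoduleD(1)[OF G h(1)] .
  obtain g' \<phi> where g': "idem_elem R g'" "g' \<noteq> \<zero>" "g' \<otimes> g = g'" and \<phi>0: "\<forall>i<Suc k. functional (\<phi> i)"
    and inj0: "\<forall>x\<in>G. g' \<odot>\<^bsub>F\<^esub> x = x \<longrightarrow> (\<forall>i<Suc k. \<phi> i x = \<zero>) \<longrightarrow> x = \<zero>\<^bsub>F\<^esub>"
    using rk[unfolded rank_le_def, rule_format, OF g] by (elim exE conjE)
  have \<phi>: "\<And>i. i < Suc k \<Longrightarrow> functional (\<phi> i)" using \<phi>0 by simp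
  have inj: "x = \<zero>\<^bsub>F\<^esub>" if "x \<in> G" "g' \<odot>\<^bsub>F\<^esub> x = x" "\<And>i. i < Suc k \<Longrightarrow> \<phi> i x = \<zero>" for x
    using inj0 that by simp
  have g'R: "g' \<in> carrier R" "g' \<otimes> g' = g'" using g'(1) by (auto simp: idem_elem_def)
  let ?h = "g' \<odot>\<^bsub>F\<^esub> h"
  have hG: "?h \<in> G" using submoduleD(4)[OF G g'R(1) h(1)] .
  have hF': "?h \<in> carrier F" using hF g'R by simp
  have g'h: "g' \<odot>\<^bsub>F\<^esub> ?h = ?h" using smult_assoc1[OF g'R(1) g'R(1) hF] g'R(2) by simp
  have "?h \<noteq> \<zero>\<^bsub>F\<^esub>"
    using h(2)[OF g'R(1)] g'(2) idempotent_le_trans[OF g'(3) g(3) g'R(1) gR f] by auto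
  then obtain i where i: "i < Suc k" "\<phi> i ?h \<noteq> \<zero>" using inj[OF hG g'h] by blast
  let ?a = "\<phi> i ?h"
  note \<phi>i = functionalD[OF \<phi>[OF i(1)]]
  have aR: "?a \<in> carrier R" using \<phi>i(1)[OF hF'] .
  obtain e where "support ?a e" using exists_support[OF aR] by blast
  then have e: "idem_elem R e" "e \<in> carrier R" "e \<otimes> ?a = ?a"
    "\<And>x. x \<in> carrier R \<Longrightarrow> x \<otimes> ?a = \<zero> \<Longrightarrow> x \<otimes> e = \<zero>"
    by (auto simp: support_def idem_elem_def)
  have "e \<noteq> \<zero>" using e(3) i(2) aR by auto
  moreover have eg': "e \<otimes> g' = e"
  proof (rule compl_mult_zero[OF e(4) g'R(1) e(2)])
    have "(\<one> \<ominus> g') \<otimes> ?a = \<phi> i ((\<one> \<ominus> g') \<odot>\<^bsub>F\<^esub> ?h)" using \<phi>i(3)[OF _ hF'] g'R by simp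
    then show "(\<one> \<ominus> g') \<otimes> ?a = \<zero>" using smult_compl_zero[OF g'h g'R(1) hF'] \<phi>i(4) by simp
  qed (use g'R in simp)
  moreover have "e \<otimes> g = e" using idempotent_le_trans[OF eg' g'(3) e(2) g'R(1) gR] .
  moreover
  \<comment> \<open>Lists the indices up to \<open>k\<close> other than \<open>i\<close>, by putting
    \<open>k\<close> into the gap at \<open>i\<close>.\<close>
  define c where "c l = (if l = i then k else l)" for l
  define \<psi> where "\<psi> l x = ?a \<otimes> \<phi> (c l) x \<ominus> \<phi> (c l) ?h \<otimes> \<phi> i x" for l x
  have cl: "c l < Suc k" if "l < k" for l using that by (simp add: c_def)
  have "functional (\<psi> l)" if "l < k" for l
    unfolding \<psi>_def[abs_def] using cl[OF that] i(1) aR functionalD(1)[OF \<phi>[OF cl[OF that]] hF']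
    by (intro functional_minus functional_smult \<phi>)
  moreover have "x = \<zero>\<^bsub>F\<^esub>" if x: "x \<in> {x \<in> G. \<pi> x = \<zero>\<^bsub>F\<^esub>}" "e \<odot>\<^bsub>F\<^esub> x = x" "\<forall>l<k. \<psi> l x = \<zero>" for x
  proof -
    have xG: "x \<in> G" and \<pi>x: "\<pi> x = \<zero>\<^bsub>F\<^esub>" using x(1) by auto
    have xF: "x \<in> carrier F" using submoduleD(1)[OF G xG] .
    have bR: "\<phi> i x \<in> carrier R" using \<phi>i(1)[OF xF] .
    let ?z = "?a \<odot>\<^bsub>F\<^esub> x \<ominus>\<^bsub>F\<^esub> \<phi> i x \<odot>\<^bsub>F\<^esub> ?h"
    have zG: "?z \<in> G" using submoduleD(5)[OF G submoduleD(4)[OF G aR xG] submoduleD(4)[OF G bR hG]] .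
    have g'x: "g' \<odot>\<^bsub>F\<^esub> x = x"
    proof -
      have "g' \<odot>\<^bsub>F\<^esub> (e \<odot>\<^bsub>F\<^esub> x) = (e \<otimes> g') \<odot>\<^bsub>F\<^esub> x"
        using smult_assoc1[OF g'R(1) e(2) xF] m_comm[OF g'R(1) e(2)] by simp
      then show ?thesis using x(2) eg' by simp
    qed
    have "?z = \<zero>\<^bsub>F\<^esub>"
    proof (rule inj[OF zG])
      have g'endo: "endo (\<lambda>y. g' \<odot>\<^bsub>F\<^esub> y)" using endo_smult[OF endo_id g'R(1)] .
      have "g' \<odot>\<^bsub>F\<^esub> ?z = ?a \<odot>\<^bsub>F\<^esub> (g' \<odot>\<^bsub>F\<^esub> x) \<ominus>\<^bsub>F\<^esub> \<phi> i x \<odot>\<^bsub>F\<^esub> (g' \<odot>\<^bsub>F\<^esub> ?h)"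
        using endoD(3,5)[OF g'endo] aR bR xF hF' by simp
      then show "g' \<odot>\<^bsub>F\<^esub> ?z = ?z" using g'x g'h by simp
      fix m assume m: "m < Suc k"
      note \<phi>m = functionalD[OF \<phi>[OF m]]
      have eq: "\<phi> m ?z = ?a \<otimes> \<phi> m x \<ominus> \<phi> m ?h \<otimes> \<phi> i x"
        using \<phi>m(3,6) \<phi>m(1)[OF hF'] aR bR xF hF' by (simp add: m_comm)
      show "\<phi> m ?z = \<zero>"
      proof (cases "m = i")
        case True
        then show ?thesis unfolding eq using aR bR by (simp add: r_right_minus_eq)
      next
        case False
        then obtain l where l: "l < k" "m = c l"
          using m i(1) by (cases "m = k") (auto simp: c_def less_Suc_eq intro: that[of i] that[of m])
        show ?thesis unfolding eq using x(3) l by (simp add: \<psi>_def)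
      qed
    qed
    then have ax: "?a \<odot>\<^bsub>F\<^esub> x = \<phi> i x \<odot>\<^bsub>F\<^esub> ?h"
    proof (intro coord_eqI)
      fix j assume j: "j < n"
      have "\<xi> j ?z = \<xi> j \<zero>\<^bsub>F\<^esub>" using \<open>?z = \<zero>\<^bsub>F\<^esub>\<close> by simp
      then show "\<xi> j (?a \<odot>\<^bsub>F\<^esub> x) = \<xi> j (\<phi> i x \<odot>\<^bsub>F\<^esub> ?h)"
        using j aR bR xF hF' by (simp add: r_right_minus_eq)
    qed (use aR bR xF hF' in auto)
    have "\<pi> ?h = ?h" using endoD(3)[OF \<pi>(1) g'R(1) hF] \<pi>(2) by simp
    then have "\<phi> i x \<odot>\<^bsub>F\<^esub> ?h = \<pi> (\<phi> i x \<odot>\<^bsub>F\<^esub> ?h)" using endoD(3)[OF \<pi>(1) bR hF'] by simp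
    also have "\<dots> = ?a \<odot>\<^bsub>F\<^esub> \<pi> x" unfolding ax[symmetric] using endoD(3)[OF \<pi>(1) aR xF] .
    finally have ax0: "?a \<odot>\<^bsub>F\<^esub> x = \<zero>\<^bsub>F\<^esub>" using ax \<pi>x aR by simp
    have "\<xi> j (e \<odot>\<^bsub>F\<^esub> x) = \<zero>" if j: "j < n" for j
    proof -
      have "\<xi> j (?a \<odot>\<^bsub>F\<^esub> x) = \<zero>" unfolding ax0 using j by simp
      then have "\<xi> j x \<otimes> ?a = \<zero>" using j xF aR by (simp add: m_comm)
      then have "\<xi> j x \<otimes> e = \<zero>" using e(4) j xF by simp
      then show ?thesis using j xF e(2) m_comm[of e "\<xi> j x"] by simp
    qed
    then show ?thesis unfolding x(2) using xF by (intro coord_eqI) auto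
  qed
  ultimately show "\<exists>g' \<phi>. idem_elem R g' \<and> g' \<noteq> \<zero> \<and> g' \<otimes> g = g' \<and> (\<forall>i<k. functional (\<phi> i)) \<and>
       (\<forall>x\<in>{x \<in> G. \<pi> x = \<zero>\<^bsub>F\<^esub>}. g' \<odot>\<^bsub>F\<^esub> x = x \<longrightarrow> (\<forall>i<k. \<phi> i x = \<zero>) \<longrightarrow> x = \<zero>\<^bsub>F\<^esub>)"
    using e(1) by (intro exI[of _ e] exI[of _ \<psi>]) blast
qed

section \<open>Simultaneous decomposition\<close>

text \<open>The functionals \<open>\<mu> j\<close> split \<open>G\<close> as the direct sum of the ideals \<open>\<mu> j ` G\<close>.\<close>

definition splits :: "nat \<Rightarrow> (nat \<Rightarrow> 'c \<Rightarrow> 'a) \<Rightarrow> 'c set \<Rightarrow> bool" where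
  "splits N \<mu> G \<longleftrightarrow> (\<forall>j<N. functional (\<mu> j)) \<and> (\<forall>x\<in>G. (\<forall>j<N. \<mu> j x = \<zero>) \<longrightarrow> x = \<zero>\<^bsub>F\<^esub>) \<and>
    (\<forall>y. (\<forall>j<N. y j \<in> G) \<longrightarrow> (\<exists>x\<in>G. \<forall>j<N. \<mu> j x = \<mu> j (y j)))"

definition component_support :: "('c \<Rightarrow> 'a) \<Rightarrow> 'c set \<Rightarrow> 'a \<Rightarrow> bool" where
  "component_support \<phi> G f \<longleftrightarrow> idem_elem R f \<and> (\<forall>x\<in>G. f \<otimes> \<phi> x = \<phi> x) \<and>
    (\<forall>r\<in>carrier R. (\<forall>x\<in>G. r \<otimes> \<phi> x = \<zero>) \<longrightarrow> r \<otimes> f = \<zero>)"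

text \<open>Torsion-freeness of \<open>F / G\<close>; it lets a denominator be cancelled without
  leaving \<open>G\<close>.\<close>

definition pure :: "'c set \<Rightarrow> bool" where
  "pure G \<longleftrightarrow> (\<forall>x\<in>carrier F. \<forall>t\<in>nonzerodivisors R. t \<odot>\<^bsub>F\<^esub> x \<in> G \<longrightarrow> x \<in> G)"

text \<open>The endomorphism \<open>\<pi>\<close> projects onto a summand of \<open>G\<close>, which \<open>\<phi>\<close> embeds into \<open>R\<close>.\<close>

definition projects :: "('c \<Rightarrow> 'c) \<Rightarrow> 'c set \<Rightarrow> ('c \<Rightarrow> 'a) \<Rightarrow> bool" where
  "projects \<pi> G \<phi> \<longleftrightarrow> endo \<pi> \<and> (\<forall>x\<in>carrier F. \<pi> x \<in> G \<and> \<pi> (\<pi> x) = \<pi> x) \<and> submodule G R F \<and>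
    functional \<phi> \<and> (\<forall>x\<in>carrier F. \<phi> (\<pi> x) = \<zero> \<longrightarrow> \<pi> x = \<zero>\<^bsub>F\<^esub>)"

context
  fixes \<pi> G \<phi>
  assumes proj: "projects \<pi> G \<phi>"
begin

lemma projects_facts:
  "endo \<pi>" "x \<in> carrier F \<Longrightarrow> \<pi> x \<in> G" "x \<in> carrier F \<Longrightarrow> \<pi> (\<pi> x) = \<pi> x"
  "submodule G R F" "functional \<phi>" "x \<in> carrier F \<Longrightarrow> \<phi> (\<pi> x) = \<zero> \<Longrightarrow> \<pi> x = \<zero>\<^bsub>F\<^esub>"
  using proj by (simp_all add: projects_def)

lemmas \<pi> = projects_facts(1-3) and G = projects_facts(4) and \<phi> = projects_facts(5,6)

lemma complement_submodule: "submodule {x \<in> G. \<pi> x = \<zero>\<^bsub>F\<^esub>} R F"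
  by (rule submodule_of_closed) (use submoduleD[OF G] endoD[OF \<pi>(1)] in auto)

lemma complement_endo: "endo (\<lambda>x. x \<ominus>\<^bsub>F\<^esub> \<pi> x)"
  by (intro endo_minus endo_id \<pi>(1))

lemma complement_proj:
  assumes "x \<in> G" shows "x \<ominus>\<^bsub>F\<^esub> \<pi> x \<in> {x \<in> G. \<pi> x = \<zero>\<^bsub>F\<^esub>}"
proof -
  have x: "x \<in> carrier F" "\<pi> x \<in> G" "\<pi> x \<in> carrier F"
    using submoduleD(1)[OF G assms] \<pi>(2) endoD(1)[OF \<pi>(1)] by auto
  have "\<pi> (x \<ominus>\<^bsub>F\<^esub> \<pi> x) = \<zero>\<^bsub>F\<^esub>" using endoD(5)[OF \<pi>(1) x(1,3)] \<pi>(3)[OF x(1)] x(3)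
    by (simp add: a_minus_def M.r_neg)
  then show ?thesis using submoduleD(5)[OF G assms x(2)] by simp
qed

lemma complement_fix: "x \<in> carrier F \<Longrightarrow> \<pi> x = \<zero>\<^bsub>F\<^esub> \<Longrightarrow> x \<ominus>\<^bsub>F\<^esub> \<pi> x = x"
  by (simp add: a_minus_def)

lemma complement_decomp: "x \<in> carrier F \<Longrightarrow> \<pi> x \<oplus>\<^bsub>F\<^esub> (x \<ominus>\<^bsub>F\<^esub> \<pi> x) = x"
  using endoD(1)[OF \<pi>(1)] by (simp add: a_minus_def M.a_lcomm M.r_neg)

lemma complement_image:
  assumes "submodule N R F" "N \<subseteq> G" "\<forall>x\<in>N. \<pi> x \<in> N"
  shows "(\<lambda>x. x \<ominus>\<^bsub>F\<^esub> \<pi> x) ` N = {x \<in> N. \<pi> x = \<zero>\<^bsub>F\<^esub>}"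
proof (intro subset_antisym subsetI)
  fix x assume "x \<in> (\<lambda>x. x \<ominus>\<^bsub>F\<^esub> \<pi> x) ` N"
  then show "x \<in> {x \<in> N. \<pi> x = \<zero>\<^bsub>F\<^esub>}"
    using complement_proj assms submoduleD(5)[OF assms(1)] by auto
next
  fix x assume x: "x \<in> {x \<in> N. \<pi> x = \<zero>\<^bsub>F\<^esub>}"
  then have "x \<ominus>\<^bsub>F\<^esub> \<pi> x = x" using submoduleD(1)[OF assms(1)] by (intro complement_fix) auto
  then show "x \<in> (\<lambda>x. x \<ominus>\<^bsub>F\<^esub> \<pi> x) ` N" using x by (metis (mono_tags, lifting) image_eqI mem_Collect_eq)
qed

lemma complement_pure: "pure G \<Longrightarrow> pure {x \<in> G. \<pi> x = \<zero>\<^bsub>F\<^esub>}"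
  unfolding pure_def
proof (intro ballI impI)
  fix x t assume *: "\<forall>x\<in>carrier F. \<forall>t\<in>nonzerodivisors R. t \<odot>\<^bsub>F\<^esub> x \<in> G \<longrightarrow> x \<in> G"
    "x \<in> carrier F" "t \<in> nonzerodivisors R" "t \<odot>\<^bsub>F\<^esub> x \<in> {x \<in> G. \<pi> x = \<zero>\<^bsub>F\<^esub>}"
  have tR: "t \<in> carrier R" using nzd_closed[OF *(3)] .
  have "t \<odot>\<^bsub>F\<^esub> \<pi> x = t \<odot>\<^bsub>F\<^esub> \<zero>\<^bsub>F\<^esub>" using endoD(3)[OF \<pi>(1) tR *(2)] *(4) tR by simp
  then have "\<pi> x = \<zero>\<^bsub>F\<^esub>" using smult_nzd_cancel[OF *(3)] endoD(1)[OF \<pi>(1) *(2)] by simp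
  then show "x \<in> {x \<in> G. \<pi> x = \<zero>\<^bsub>F\<^esub>}" using * by blast
qed

text \<open>\<open>G\<close> is the direct sum of the image of \<open>\<pi>\<close> and the kernel
  of \<open>\<pi>\<close> on \<open>G\<close>. The functionals of the kernel are composed with
  \<open>1 - \<pi>\<close> and shifted by one, and index 0 goes to the new summand.\<close>

lemma splits_Suc:
  assumes "splits N \<mu> {x \<in> G. \<pi> x = \<zero>\<^bsub>F\<^esub>}"
  shows "splits (Suc N) (case_nat (\<lambda>x. \<phi> (\<pi> x)) (\<lambda>j x. \<mu> j (x \<ominus>\<^bsub>F\<^esub> \<pi> x))) G"
proof -
  let ?G = "{x \<in> G. \<pi> x = \<zero>\<^bsub>F\<^esub>}"
  let ?\<mu> = "case_nat (\<lambda>x. \<phi> (\<pi> x)) (\<lambda>j x. \<mu> j (x \<ominus>\<^bsub>F\<^esub> \<pi> x))"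
  have \<mu>: "\<And>j. j < N \<Longrightarrow> functional (\<mu> j)" "\<And>x. x \<in> ?G \<Longrightarrow> (\<forall>j<N. \<mu> j x = \<zero>) \<Longrightarrow> x = \<zero>\<^bsub>F\<^esub>"
    "\<And>y. (\<forall>j<N. y j \<in> ?G) \<Longrightarrow> \<exists>x\<in>?G. \<forall>j<N. \<mu> j x = \<mu> j (y j)"
    using assms unfolding splits_def by blast+
  have GF: "x \<in> carrier F" if "x \<in> G" for x using submoduleD(1)[OF G that] .
  have "\<forall>j<Suc N. functional (?\<mu> j)"
    using functional_compose[OF \<phi>(1) \<pi>(1)] functional_compose[OF \<mu>(1) complement_endo]
    by (auto simp: less_Suc_eq_0_disj)
  moreover have "x = \<zero>\<^bsub>F\<^esub>" if x: "x \<in> G" "\<forall>j<Suc N. ?\<mu> j x = \<zero>" for x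
  proof -
    have xF: "x \<in> carrier F" using GF[OF x(1)] .
    have "\<pi> x = \<zero>\<^bsub>F\<^esub>" using x(2)[rule_format, of 0] \<phi>(2)[OF xF] by simp
    moreover have "\<forall>j<N. \<mu> j (x \<ominus>\<^bsub>F\<^esub> \<pi> x) = \<zero>" using x(2) by auto
    then have "x \<ominus>\<^bsub>F\<^esub> \<pi> x = \<zero>\<^bsub>F\<^esub>" using \<mu>(2)[OF complement_proj[OF x(1)]] by blast
    ultimately show ?thesis using complement_fix[OF xF] by simp
  qed
  moreover have "\<exists>x\<in>G. \<forall>j<Suc N. ?\<mu> j x = ?\<mu> j (y j)" if y: "\<forall>j<Suc N. y j \<in> G" for y
  proof -
    have "\<forall>j<N. y (Suc j) \<ominus>\<^bsub>F\<^esub> \<pi> (y (Suc j)) \<in> ?G" using y complement_proj by blast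
    from \<mu>(3)[OF this] obtain z where z: "z \<in> ?G" "\<forall>j<N. \<mu> j z = \<mu> j (y (Suc j) \<ominus>\<^bsub>F\<^esub> \<pi> (y (Suc j)))" by blast
    have y0: "y 0 \<in> carrier F" using y GF by blast
    let ?x = "\<pi> (y 0) \<oplus>\<^bsub>F\<^esub> z"
    have zF: "z \<in> carrier F" and pF: "\<pi> (y 0) \<in> carrier F" using z(1) GF endoD(1)[OF \<pi>(1) y0] by auto
    have xG: "?x \<in> G" using submoduleD(3)[OF G] \<pi>(2)[OF y0] z(1) by blast
    have \<pi>x: "\<pi> ?x = \<pi> (y 0)" using endoD(2)[OF \<pi>(1) pF zF] \<pi>(3)[OF y0] z(1) pF by simp
    have "?x \<ominus>\<^bsub>F\<^esub> \<pi> ?x = z" unfolding \<pi>x using pF zF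
      by (simp add: a_minus_def M.a_comm[of _ z] M.a_assoc M.r_neg)
    then have "?\<mu> j ?x = ?\<mu> j (y j)" if "j < Suc N" for j
      using z(2) \<pi>x that by (cases j) auto
    then show ?thesis using xG by blast
  qed
  ultimately show ?thesis unfolding splits_def by blast
qed

lemma complement_component_image: "(\<lambda>x. \<mu> (x \<ominus>\<^bsub>F\<^esub> \<pi> x)) ` G = \<mu> ` {x \<in> G. \<pi> x = \<zero>\<^bsub>F\<^esub>}"
proof -
  have "(\<lambda>x. \<mu> (x \<ominus>\<^bsub>F\<^esub> \<pi> x)) ` G = \<mu> ` ((\<lambda>x. x \<ominus>\<^bsub>F\<^esub> \<pi> x) ` G)" by (rule image_image[symmetric])
  moreover have "\<forall>x\<in>G. \<pi> x \<in> G" using \<pi>(2)[OF submoduleD(1)[OF G]] by blast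
  then have "(\<lambda>x. x \<ominus>\<^bsub>F\<^esub> \<pi> x) ` G = {x \<in> G. \<pi> x = \<zero>\<^bsub>F\<^esub>}" by (rule complement_image[OF G order_refl])
  ultimately show ?thesis by simp
qed

lemma component_support_complement:
  assumes "component_support \<mu> {x \<in> G. \<pi> x = \<zero>\<^bsub>F\<^esub>} f"
  shows "component_support (\<lambda>x. \<mu> (x \<ominus>\<^bsub>F\<^esub> \<pi> x)) G f"
proof -
  have 1: "(\<forall>x\<in>G. P (\<mu> (x \<ominus>\<^bsub>F\<^esub> \<pi> x))) \<longleftrightarrow> (\<forall>x\<in>{x \<in> G. \<pi> x = \<zero>\<^bsub>F\<^esub>}. P (\<mu> x))" for P
  proof -
    have "(\<forall>x\<in>G. P (\<mu> (x \<ominus>\<^bsub>F\<^esub> \<pi> x))) \<longleftrightarrow> (\<forall>z\<in>(\<lambda>x. \<mu> (x \<ominus>\<^bsub>F\<^esub> \<pi> x)) ` G. P z)" by blast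
    also have "\<dots> \<longleftrightarrow> (\<forall>x\<in>{x \<in> G. \<pi> x = \<zero>\<^bsub>F\<^esub>}. P (\<mu> x))"
      unfolding complement_component_image by blast
    finally show ?thesis .
  qed
  show ?thesis using assms unfolding component_support_def
    1[of "\<lambda>z. f \<otimes> z = z"] 1[of "\<lambda>z. _ \<otimes> z = \<zero>"] .
qed

end

text \<open>The clause \<open>g j \<otimes> f = g j\<close> is the invariant behind the decreasing
  supports: the content of the complement lies in the content of \<open>G\<close>, so the remaining
  summands are supported under \<open>f0\<close>, the support of the first.\<close>

lemma free_part:
  assumes "rank_le k f G" "submodule G R F" "pure G" "finitely_generated_submodule G R F"
    and "idem_elem R f" "\<And>c. c \<in> content G \<Longrightarrow> f \<otimes> c = c"
  shows "\<exists>N \<mu> g. splits N \<mu> G \<and> (\<forall>j<N. component_support (\<mu> j) G (g j) \<and> g j \<otimes> f = g j) \<and>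
    (\<forall>i j. i \<le> j \<longrightarrow> j < N \<longrightarrow> g j \<otimes> g i = g j)"
  using assms
proof (induction k arbitrary: f G)
  case 0
  have fR: "f \<in> carrier R" using 0(5) by (simp add: idem_elem_def)
  have GF: "G \<subseteq> carrier F" using submoduleD(1)[OF 0(2)] by blast
  have "x = \<zero>\<^bsub>F\<^esub>" if x: "x \<in> G" for x
    using rank_le_0[OF 0(1,2) fR x support_smult[OF 0(6) fR GF x]] .
  then have "splits 0 (\<lambda>_ _. \<zero>) G" using submoduleD(2)[OF 0(2)] by (auto simp: splits_def)
  then show ?case by blast
next
  case (Suc k)
  note G = Suc.prems(2)
  have fR: "f \<in> carrier R" using Suc.prems(5) by (simp add: idem_elem_def)
  obtain s f0 B where p: "divisible_pairing s f0 (content G) B" and sf: "s \<otimes> f0 \<in> content G"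
    using exists_divisible_pairing[OF fg_content[OF Suc.prems(4)]] by blast
  note pf = pairing_facts[OF p sf G]
  have f0f: "f0 \<otimes> f = f0"
  proof -
    have "s \<otimes> (f \<otimes> f0) = s \<otimes> f0" using Suc.prems(6)[OF sf] pf(2,4) fR by (simp add: m_lcomm)
    then show ?thesis using nzd_cancel[OF pf(1)] pf(4) fR by (simp add: m_comm)
  qed
  obtain \<pi> \<phi> h where st: "endo \<pi>" "\<And>x. x \<in> carrier F \<Longrightarrow> \<pi> x \<in> G" "\<And>x. x \<in> carrier F \<Longrightarrow> \<pi> (\<pi> x) = \<pi> x"
    "\<And>x. x \<in> carrier F \<Longrightarrow> f0 \<odot>\<^bsub>F\<^esub> \<pi> x = \<pi> x"
    "functional \<phi>" "\<And>x. x \<in> carrier F \<Longrightarrow> \<phi> (\<pi> x) = \<zero> \<Longrightarrow> \<pi> x = \<zero>\<^bsub>F\<^esub>"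
    "\<And>r. r \<in> carrier R \<Longrightarrow> (\<And>x. x \<in> carrier F \<Longrightarrow> r \<otimes> \<phi> (\<pi> x) = \<zero>) \<Longrightarrow> r \<otimes> f0 = \<zero>"
    "h \<in> carrier F" "\<pi> h = h" "\<And>r. r \<in> carrier R \<Longrightarrow> r \<odot>\<^bsub>F\<^esub> h = \<zero>\<^bsub>F\<^esub> \<Longrightarrow> r \<otimes> f0 = \<zero>"
    by (rule decomposition_step[OF Suc.prems(4) p sf G _ order_refl nzd_one])
      (use Suc.prems(3) in \<open>auto simp: pure_def\<close>)
  let ?G = "{x \<in> G. \<pi> x = \<zero>\<^bsub>F\<^esub>}"
  have ctx: "projects \<pi> G \<phi>" using st(1-3,5,6) G by (simp add: projects_def)
  have hG: "h \<in> G" using st(2)[OF st(8)] st(9) by simp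
  have GF: "x \<in> carrier F" if "x \<in> G" for x using submoduleD(1)[OF G that] .
  have rk: "rank_le k f0 ?G"
    using rank_le_step[OF rank_le_mono[OF Suc.prems(1) f0f fR pf(4)] G pf(4) hG st(10) st(1) st(9)] by blast
  have \<pi>G: "\<forall>x\<in>G. \<pi> x \<in> G" using st(2)[OF GF] by blast
  have fg: "finitely_generated_submodule ?G R F"
    using fg_endo_image[OF complement_endo[OF ctx] Suc.prems(4)]
    unfolding complement_image[OF ctx G order_refl \<pi>G] .
  have c: "f0 \<otimes> c = c" if "c \<in> content ?G" for c
  proof -
    have "content ?G \<subseteq> content G"
      using content_ideal[OF pf(7)] coord_in_content[OF pf(7)] by (intro content_minimal) auto
    then show ?thesis using pf(8) that by blast
  qed
  obtain N \<mu> g where IH: "splits N \<mu> ?G" "\<And>j. j < N \<Longrightarrow> component_support (\<mu> j) ?G (g j)"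
    "\<And>j. j < N \<Longrightarrow> g j \<otimes> f0 = g j" "\<And>i j. i \<le> j \<Longrightarrow> j < N \<Longrightarrow> g j \<otimes> g i = g j"
    using Suc.IH[OF rk complement_submodule[OF ctx] complement_pure[OF ctx Suc.prems(3)] fg pf(3) c] by blast
  let ?\<mu> = "case_nat (\<lambda>x. \<phi> (\<pi> x)) (\<lambda>j x. \<mu> j (x \<ominus>\<^bsub>F\<^esub> \<pi> x))" and ?g = "case_nat f0 g"
  have cs0: "component_support (\<lambda>x. \<phi> (\<pi> x)) G f0"
    unfolding component_support_def
  proof (intro conjI ballI impI)
    show "f0 \<otimes> \<phi> (\<pi> x) = \<phi> (\<pi> x)" if "x \<in> G" for x
      using functionalD(3)[OF st(5) pf(4) endoD(1)[OF st(1) GF[OF that]]] st(4)[OF GF[OF that]] by simp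
    fix r assume r: "r \<in> carrier R" "\<forall>x\<in>G. r \<otimes> \<phi> (\<pi> x) = \<zero>"
    show "r \<otimes> f0 = \<zero>"
    proof (rule st(7)[OF r(1)])
      fix x assume x: "x \<in> carrier F"
      then have "r \<otimes> \<phi> (\<pi> (\<pi> x)) = \<zero>" using r(2) st(2) by blast
      then show "r \<otimes> \<phi> (\<pi> x) = \<zero>" using st(3)[OF x] by simp
    qed
  qed (rule pf(3))
  have gR: "g j \<in> carrier R" if "j < N" for j
    using IH(2)[OF that] by (simp add: component_support_def idem_elem_def)
  have "component_support (?\<mu> j) G (?g j) \<and> ?g j \<otimes> f = ?g j" if "j < Suc N" for j
    using that cs0 f0f component_support_complement[OF ctx IH(2)]
      idempotent_le_trans[OF IH(3) f0f gR pf(4) fR] by (cases j) auto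
  moreover have "?g j \<otimes> ?g i = ?g j" if "i \<le> j" "j < Suc N" for i j
    using that IH(3,4) pf(5) by (cases j; cases i) auto
  moreover have "splits (Suc N) ?\<mu> G" using splits_Suc[OF ctx IH(1)] .
  ultimately show ?case by (intro exI[of _ "Suc N"] exI[of _ ?\<mu>] exI[of _ ?g]) blast
qed

text \<open>The first \<open>m\<close> summands are those which meet \<open>H\<close>; the supports of the others decrease.\<close>

definition stacked :: "'c set \<Rightarrow> 'c set \<Rightarrow> 'a set \<Rightarrow> nat \<Rightarrow> nat \<Rightarrow> (nat \<Rightarrow> 'c \<Rightarrow> 'a) \<Rightarrow> (nat \<Rightarrow> 'a set) \<Rightarrow> (nat \<Rightarrow> 'a) \<Rightarrow> bool" where
  "stacked G H A N m \<mu> I g \<longleftrightarrow> m \<le> N \<and> splits N \<mu> G \<and> (\<forall>j<N. component_support (\<mu> j) G (g j)) \<and>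
    (\<forall>j<m. regular_ideal (I j) \<and> I j \<subseteq> A) \<and> (\<forall>i j. i \<le> j \<longrightarrow> j < m \<longrightarrow> I j \<subseteq> I i) \<and>
    (\<forall>x\<in>G. x \<in> H \<longleftrightarrow> (\<forall>j<m. \<mu> j x \<in> ideal_prod R (I j) (\<mu> j ` G)) \<and> (\<forall>j. m \<le> j \<longrightarrow> j < N \<longrightarrow> \<mu> j x = \<zero>)) \<and>
    (\<forall>j<m. \<forall>L. ideal L R \<longrightarrow> I j \<subseteq> L \<longrightarrow> \<mu> j ` G \<subseteq> L \<longrightarrow> g j \<in> L) \<and>
    (\<forall>i j. m \<le> i \<longrightarrow> i \<le> j \<longrightarrow> j < N \<longrightarrow> g j \<otimes> g i = g j)"

text \<open>The rank is bounded only over an idempotent \<open>f\<close> supporting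
  \<open>H\<close>, since a step lowers it only over the support of the content of \<open>H\<close>.
  So \<open>k = 0\<close> means that \<open>H\<close> is exhausted, while \<open>G\<close> may still
  be large; \<open>free_part\<close> then starts afresh over the idempotent 1 with the bound
  \<open>n\<close>.\<close>

lemma exists_stacked:
  assumes "rank_le k f G" "submodule G R F" "pure G" "finitely_generated_submodule G R F"
    and "idem_elem R f" "finitely_generated_submodule H R F" "H \<subseteq> G" "\<And>c. c \<in> content H \<Longrightarrow> f \<otimes> c = c"
    and "regular_ideal A" "content H \<subseteq> A"
  shows "\<exists>N m \<mu> I g. stacked G H A N m \<mu> I g"
  using assms
proof (induction k arbitrary: f G H A)
  case 0
  have fR: "f \<in> carrier R" using 0(5) by (simp add: idem_elem_def)
  have GF: "G \<subseteq> carrier F" using submoduleD(1)[OF 0(2)] by blast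
  have H: "submodule H R F" using fg_submodule[OF 0(6)] .
  have "x = \<zero>\<^bsub>F\<^esub>" if x: "x \<in> H" for x
    using rank_le_0[OF 0(1,2) fR _ support_smult[OF 0(8) fR _ x]] x 0(7) GF by blast
  then have H0: "x \<in> H \<longleftrightarrow> x = \<zero>\<^bsub>F\<^esub>" for x using submoduleD(2)[OF H] by blast
  have "\<one> \<otimes> c = c" if "c \<in> content G" for c using ideal_memD[OF content_ideal[OF GF] that] by simp
  then obtain N \<mu> g where 1: "splits N \<mu> G" "\<forall>j<N. component_support (\<mu> j) G (g j) \<and> g j \<otimes> \<one> = g j"
    "\<forall>i j. i \<le> j \<longrightarrow> j < N \<longrightarrow> g j \<otimes> g i = g j"
    using free_part[OF rank_le_coords[OF GF] 0(2-4), of \<one>] by (auto simp: idem_elem_def)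
  have "x \<in> H \<longleftrightarrow> (\<forall>j<N. \<mu> j x = \<zero>)" if x: "x \<in> G" for x
    unfolding H0 using 1(1) x functionalD(4) by (auto simp: splits_def)
  then have "stacked G H A N 0 \<mu> (\<lambda>_. A) g" unfolding stacked_def using 1 by auto
  then show ?case by blast
next
  case (Suc k)
  note G = Suc.prems(2) and Afg = Suc.prems(9)
  have fR: "f \<in> carrier R" using Suc.prems(5) by (simp add: idem_elem_def)
  have H: "submodule H R F" using fg_submodule[OF Suc.prems(6)] .
  have A: "ideal A R" using Suc.prems(9) by (rule regular_idealD)
  obtain t where t: "t \<in> nonzerodivisors R" "t \<in> A" using Suc.prems(9) by (auto simp: regular_ideal_def)
  have tR: "t \<in> carrier R" using nzd_closed[OF t(1)] .
  have GF: "x \<in> carrier F" if "x \<in> G" for x using submoduleD(1)[OF G that] .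
  obtain s f0 B where p: "divisible_pairing s f0 (content H) B" and sf: "s \<otimes> f0 \<in> content H"
    using exists_divisible_pairing[OF fg_content[OF Suc.prems(6)]] by blast
  note pf = pairing_facts[OF p sf H]
  have C: "ideal (content H) R" using content_ideal[OF pf(7)] .
  have f0f: "f0 \<otimes> f = f0"
  proof -
    have "s \<otimes> (f \<otimes> f0) = s \<otimes> f0" using Suc.prems(8)[OF sf] pf(2,4) fR by (simp add: m_lcomm)
    then show ?thesis using nzd_cancel[OF pf(1)] pf(4) fR by (simp add: m_comm)
  qed
  let ?e = "\<one> \<ominus> f0"
  have eR: "?e \<in> carrier R" using pf(4) by simp
  let ?D = "(\<lambda>a. ?e \<otimes> a) ` A"
  define I0 where "I0 = Idl (content H \<union> ?D)"
  have Dfg: "finitely_generated_ideal ?D R"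
    using fg_ideal_smult[OF _ eR] Suc.prems(9) by (simp add: regular_ideal_def)
  have I0: "ideal I0 R" "content H \<subseteq> I0" "?D \<subseteq> I0" "finitely_generated_ideal I0 R"
  proof -
    have sub: "content H \<union> ?D \<subseteq> carrier R" using pf(9) fg_ideal[OF Dfg] ideal_memD by blast
    show "ideal I0 R" "content H \<subseteq> I0" "?D \<subseteq> I0"
      unfolding I0_def using genideal_ideal[OF sub] genideal_self[OF sub] by auto
    show "finitely_generated_ideal I0 R"
      unfolding I0_def using fg_ideal_sum[OF fg_content[OF Suc.prems(6)] Dfg] .
  qed
  have I0_min: "I0 \<subseteq> L" if "ideal L R" "content H \<subseteq> L" "?D \<subseteq> L" for L
    unfolding I0_def using that by (intro genideal_minimal) auto
  have I0A: "I0 \<subseteq> A" using Suc.prems(10) ideal_mult[OF A eR] by (intro I0_min[OF A]) auto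
  \<comment> \<open>A non-zero-divisor of \<open>I0\<close>, glued from \<open>s\<close> over
    \<open>f0\<close> and an element of \<open>A\<close> over the complement. Passed on as
    \<open>d0\<close>, it makes the image of \<open>\<phi>\<close> comaximal with \<open>I0\<close>
    over \<open>f0\<close>.\<close>
  let ?d = "s \<otimes> f0 \<oplus> ?e \<otimes> t"
  have d: "?d \<in> nonzerodivisors R" using nzd_glue[OF pf(3,1) t(1)] .
  have dI0: "?d \<in> I0" using sf t(2) I0(2,3) by (intro ideal_add[OF I0(1)]) auto
  have I0reg: "regular_ideal I0" using I0(4) d dI0 by (auto simp: regular_ideal_def)
  obtain \<pi> \<phi> h where st: "endo \<pi>" "\<And>x. x \<in> carrier F \<Longrightarrow> \<pi> x \<in> G" "\<And>x. x \<in> carrier F \<Longrightarrow> \<pi> (\<pi> x) = \<pi> x"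
    "\<And>x. x \<in> carrier F \<Longrightarrow> f0 \<odot>\<^bsub>F\<^esub> \<pi> x = \<pi> x"
    "\<And>c x. c \<in> content H \<Longrightarrow> x \<in> carrier F \<Longrightarrow> c \<odot>\<^bsub>F\<^esub> \<pi> x \<in> H"
    "functional \<phi>" "\<And>x. x \<in> carrier F \<Longrightarrow> \<phi> (\<pi> x) = \<zero> \<Longrightarrow> \<pi> x = \<zero>\<^bsub>F\<^esub>"
    "\<And>r. r \<in> carrier R \<Longrightarrow> (\<And>x. x \<in> carrier F \<Longrightarrow> r \<otimes> \<phi> (\<pi> x) = \<zero>) \<Longrightarrow> r \<otimes> f0 = \<zero>"
    "\<And>L. ideal L R \<Longrightarrow> (\<And>x. x \<in> carrier F \<Longrightarrow> \<phi> (\<pi> x) \<in> L) \<Longrightarrow> ?d \<in> L \<Longrightarrow> f0 \<in> L"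
    "h \<in> carrier F" "\<pi> h = h" "\<And>r. r \<in> carrier R \<Longrightarrow> r \<odot>\<^bsub>F\<^esub> h = \<zero>\<^bsub>F\<^esub> \<Longrightarrow> r \<otimes> f0 = \<zero>"
    by (rule decomposition_step[OF Suc.prems(6) p sf G _ Suc.prems(7) d])
      (use Suc.prems(3) in \<open>auto simp: pure_def\<close>)
  let ?G = "{x \<in> G. \<pi> x = \<zero>\<^bsub>F\<^esub>}" and ?H = "{x \<in> H. \<pi> x = \<zero>\<^bsub>F\<^esub>}"
  have ctx: "projects \<pi> G \<phi>" using st(1-3,6,7) G by (simp add: projects_def)
  have \<pi>F: "\<pi> x \<in> carrier F" if "x \<in> carrier F" for x using endoD(1)[OF st(1) that] .
  have hG: "h \<in> G" using st(2)[OF st(10)] st(11) by simp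
  obtain e where e: "\<And>j. e j \<in> carrier F"
    "\<And>N x. submodule N R F \<Longrightarrow> x \<in> carrier F \<Longrightarrow> (\<And>i. i < n \<Longrightarrow> \<xi> i x \<odot>\<^bsub>F\<^esub> e i \<in> N) \<Longrightarrow> x \<in> N"
    using coord_basis by blast
  \<comment> \<open>Expanded in the basis, \<open>x\<close> has coefficients in the content of
    \<open>H\<close>, and these multiply the image of \<open>\<pi>\<close> into
    \<open>H\<close>.\<close>
  have \<pi>H: "\<pi> x \<in> H" if x: "x \<in> H" for x
  proof -
    have "x \<in> {x \<in> carrier F. \<pi> x \<in> H}"
    proof (rule e(2)[OF submodule_endo_vimage[OF st(1) H]])
      fix i assume i: "i < n"
      have c: "\<xi> i x \<in> content H" using coord_in_content[OF pf(7) x i] .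
      then show "\<xi> i x \<odot>\<^bsub>F\<^esub> e i \<in> {x \<in> carrier F. \<pi> x \<in> H}"
        using st(5)[OF c e(1)] endoD(3)[OF st(1) pf(9)[OF c] e(1)] e(1) pf(9)[OF c] by simp
    qed (use x pf(7) in blast)
    then show ?thesis by blast
  qed
  have rk: "rank_le k f0 ?G"
    using rank_le_step[OF rank_le_mono[OF Suc.prems(1) f0f fR pf(4)] G pf(4) hG st(12) st(1) st(11)] by blast
  have \<pi>G: "\<forall>x\<in>G. \<pi> x \<in> G" using st(2)[OF GF] by blast
  have Gfg: "finitely_generated_submodule ?G R F"
    using fg_endo_image[OF complement_endo[OF ctx] Suc.prems(4)]
    unfolding complement_image[OF ctx G order_refl \<pi>G] .
  have \<pi>H': "\<forall>x\<in>H. \<pi> x \<in> H" using \<pi>H by blast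
  have Hfg: "finitely_generated_submodule ?H R F"
    using fg_endo_image[OF complement_endo[OF ctx] Suc.prems(6)]
    unfolding complement_image[OF ctx H Suc.prems(7) \<pi>H'] .
  have cH: "content ?H \<subseteq> content H" using coord_in_content[OF pf(7)] by (intro content_minimal C) auto
  obtain N m \<mu> I g where IH: "stacked ?G ?H I0 N m \<mu> I g"
    using Suc.IH[OF rk complement_submodule[OF ctx] complement_pure[OF ctx Suc.prems(3)] Gfg pf(3) Hfg _ _ I0reg]
      Suc.prems(7) cH pf(8) I0(2) by blast
  let ?\<mu> = "case_nat (\<lambda>x. \<phi> (\<pi> x)) (\<lambda>j x. \<mu> j (x \<ominus>\<^bsub>F\<^esub> \<pi> x))" and ?g = "case_nat f0 g" and ?I = "case_nat I0 I"
  have cs0: "component_support (\<lambda>x. \<phi> (\<pi> x)) G f0"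
    unfolding component_support_def
  proof (intro conjI ballI impI)
    show "f0 \<otimes> \<phi> (\<pi> x) = \<phi> (\<pi> x)" if "x \<in> G" for x
      using functionalD(3)[OF st(6) pf(4) \<pi>F[OF GF[OF that]]] st(4)[OF GF[OF that]] by simp
    fix r assume r: "r \<in> carrier R" "\<forall>x\<in>G. r \<otimes> \<phi> (\<pi> x) = \<zero>"
    show "r \<otimes> f0 = \<zero>"
    proof (rule st(8)[OF r(1)])
      fix x assume x: "x \<in> carrier F"
      then have "r \<otimes> \<phi> (\<pi> (\<pi> x)) = \<zero>" using r(2) st(2) by blast
      then show "r \<otimes> \<phi> (\<pi> x) = \<zero>" using st(3)[OF x] by simp
    qed
  qed (rule pf(3))
  have im: "(\<lambda>x. \<mu> j (x \<ominus>\<^bsub>F\<^esub> \<pi> x)) ` G = \<mu> j ` ?G" for j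
    using complement_component_image[OF ctx] .
  let ?J = "(\<lambda>x. \<phi> (\<pi> x)) ` G"
  have J: "ideal ?J R" using fg_ideal[OF fg_functional_image[OF functional_compose[OF st(6,1)] Suc.prems(4)]] .
  have I0J: "ideal (ideal_prod R I0 ?J) R" using ideal_prod_is_ideal[OF I0(1) J] .
  \<comment> \<open>The part \<open>(1 - f0) A\<close> added to the content annihilates the image of
    \<open>\<pi>\<close>, which \<open>f0\<close> fixes.\<close>
  have I0\<pi>: "c \<odot>\<^bsub>F\<^esub> \<pi> x \<in> H" if c: "c \<in> I0" and x: "x \<in> carrier F" for c x
  proof -
    have "ideal {r \<in> carrier R. r \<odot>\<^bsub>F\<^esub> \<pi> x \<in> H} R"
      using \<pi>F[OF x] submoduleD(2-4)[OF H] by (intro ideal_of_closed) (auto simp: smult_l_distr smult_assoc1)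
    moreover have "content H \<subseteq> {r \<in> carrier R. r \<odot>\<^bsub>F\<^esub> \<pi> x \<in> H}" using st(5) x pf(9) by blast
    moreover have "?e \<otimes> a \<in> {r \<in> carrier R. r \<odot>\<^bsub>F\<^esub> \<pi> x \<in> H}" if a: "a \<in> A" for a
    proof -
      have aR: "a \<in> carrier R" using ideal_memD[OF A a] .
      have "(?e \<otimes> a) \<odot>\<^bsub>F\<^esub> \<pi> x = a \<odot>\<^bsub>F\<^esub> (?e \<odot>\<^bsub>F\<^esub> \<pi> x)"
        using smult_assoc1[OF aR eR \<pi>F[OF x]] m_comm[OF aR eR] by simp
      also have "\<dots> = \<zero>\<^bsub>F\<^esub>" using smult_compl_zero[OF st(4)[OF x] pf(4) \<pi>F[OF x]] aR by simp
      finally show ?thesis using submoduleD(2)[OF H] eR aR by simp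
    qed
    ultimately have "I0 \<subseteq> {r \<in> carrier R. r \<odot>\<^bsub>F\<^esub> \<pi> x \<in> H}" by (intro I0_min) auto
    then show ?thesis using c by blast
  qed
  \<comment> \<open>The part of \<open>H\<close> in the image of \<open>\<pi>\<close> corresponds to
    \<open>I0 ?J\<close>. Backwards, a preimage is built in \<open>H\<close> from the products, and
    it is \<open>\<pi> x\<close> because \<open>\<phi>\<close> is injective on the image of
    \<open>\<pi>\<close>.\<close>
  have \<pi>H_iff: "\<pi> x \<in> H \<longleftrightarrow> \<phi> (\<pi> x) \<in> ideal_prod R I0 ?J" if x: "x \<in> carrier F" for x
  proof
    assume H1: "\<pi> x \<in> H"
    have "\<pi> x \<in> {y \<in> carrier F. \<phi> (\<pi> y) \<in> ideal_prod R I0 ?J}"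
    proof (rule e(2)[OF submodule_functional_vimage[OF functional_compose[OF st(6,1)] I0J] \<pi>F[OF x]])
      fix i assume i: "i < n"
      have c: "\<xi> i (\<pi> x) \<in> content H" using coord_in_content[OF pf(7) H1 i] .
      have "\<phi> (\<pi> (e i)) \<in> ?J" using st(2,3)[OF e(1)] by (metis image_eqI)
      then have "\<xi> i (\<pi> x) \<otimes> \<phi> (\<pi> (e i)) \<in> ideal_prod R I0 ?J" using c I0(2) by (intro ideal_prod.prod) auto
      then show "\<xi> i (\<pi> x) \<odot>\<^bsub>F\<^esub> e i \<in> {y \<in> carrier F. \<phi> (\<pi> y) \<in> ideal_prod R I0 ?J}"
        using endoD(3)[OF st(1) pf(9)[OF c] e(1)] functionalD(3)[OF st(6) pf(9)[OF c] \<pi>F[OF e(1)]]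
          pf(9)[OF c] e(1) by simp
    qed
    then show "\<phi> (\<pi> x) \<in> ideal_prod R I0 ?J" using st(3)[OF x] by simp
  next
    have "\<exists>y\<in>H. \<pi> y = y \<and> \<phi> y = z" if "z \<in> ideal_prod R I0 ?J" for z
      using that
    proof induction
      case (prod i j)
      then obtain w where w: "w \<in> G" "j = \<phi> (\<pi> w)" by blast
      have iR: "i \<in> carrier R" using ideal_memD[OF I0(1) prod(1)] .
      have "\<pi> (i \<odot>\<^bsub>F\<^esub> \<pi> w) = i \<odot>\<^bsub>F\<^esub> \<pi> w" using endoD(3)[OF st(1) iR \<pi>F[OF GF[OF w(1)]]] st(3)[OF GF[OF w(1)]] by simp
      moreover have "\<phi> (i \<odot>\<^bsub>F\<^esub> \<pi> w) = i \<otimes> j" using functionalD(3)[OF st(6) iR \<pi>F[OF GF[OF w(1)]]] w(2) by simp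
      ultimately show ?case using I0\<pi>[OF prod(1) GF[OF w(1)]] by blast
    next
      case (sum z1 z2)
      then obtain y1 y2 where y: "y1 \<in> H" "y2 \<in> H" "\<pi> y1 = y1" "\<pi> y2 = y2" "\<phi> y1 = z1" "\<phi> y2 = z2" by blast
      have yF: "y1 \<in> carrier F" "y2 \<in> carrier F" using y pf(7) by auto
      have "\<pi> (y1 \<oplus>\<^bsub>F\<^esub> y2) = y1 \<oplus>\<^bsub>F\<^esub> y2" "\<phi> (y1 \<oplus>\<^bsub>F\<^esub> y2) = z1 \<oplus> z2"
        using endoD(2)[OF st(1) yF] functionalD(2)[OF st(6) yF] y by simp_all
      then show ?case using submoduleD(3)[OF H y(1,2)] by blast
    qed
    moreover assume "\<phi> (\<pi> x) \<in> ideal_prod R I0 ?J"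
    ultimately obtain y where y: "y \<in> H" "\<pi> y = y" "\<phi> y = \<phi> (\<pi> x)" by blast
    have yF: "y \<in> carrier F" using y pf(7) by blast
    have "\<phi> (\<pi> (\<pi> x \<ominus>\<^bsub>F\<^esub> y)) = \<phi> (\<pi> x \<ominus>\<^bsub>F\<^esub> y)"
      using endoD(5)[OF st(1) \<pi>F[OF x] yF] st(3)[OF x] y(2) by simp
    also have "\<dots> = \<zero>" using functionalD(6)[OF st(6) \<pi>F[OF x] yF] functionalD(1)[OF st(6)] \<pi>F[OF x] y(3)
      by (simp add: r_right_minus_eq)
    finally have "\<pi> (\<pi> x \<ominus>\<^bsub>F\<^esub> y) = \<zero>\<^bsub>F\<^esub>" using st(7) \<pi>F[OF x] yF by simp
    then have *: "\<pi> x \<ominus>\<^bsub>F\<^esub> y = \<zero>\<^bsub>F\<^esub>" using endoD(5)[OF st(1) \<pi>F[OF x] yF] st(3)[OF x] y(2) by simp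
    have "\<pi> x = (\<pi> x \<ominus>\<^bsub>F\<^esub> y) \<oplus>\<^bsub>F\<^esub> y" using \<pi>F[OF x] yF by (simp add: a_minus_def M.a_assoc M.l_neg)
    then show "\<pi> x \<in> H" using y(1) yF unfolding * by simp
  qed
  have Hiff: "x \<in> H \<longleftrightarrow> \<phi> (\<pi> x) \<in> ideal_prod R I0 ?J \<and> x \<ominus>\<^bsub>F\<^esub> \<pi> x \<in> ?H" if x: "x \<in> G" for x
  proof
    assume "x \<in> H"
    then show "\<phi> (\<pi> x) \<in> ideal_prod R I0 ?J \<and> x \<ominus>\<^bsub>F\<^esub> \<pi> x \<in> ?H"
      using \<pi>H \<pi>H_iff[OF GF[OF x]] complement_proj[OF ctx x] submoduleD(5)[OF H] by blast
  next
    assume "\<phi> (\<pi> x) \<in> ideal_prod R I0 ?J \<and> x \<ominus>\<^bsub>F\<^esub> \<pi> x \<in> ?H"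
    then have "\<pi> x \<oplus>\<^bsub>F\<^esub> (x \<ominus>\<^bsub>F\<^esub> \<pi> x) \<in> H" using \<pi>H_iff[OF GF[OF x]] submoduleD(3)[OF H] by blast
    then show "x \<in> H" using complement_decomp[OF ctx GF[OF x]] by simp
  qed
  have IHs: "m \<le> N" "splits N \<mu> ?G" "\<forall>j<N. component_support (\<mu> j) ?G (g j)"
    "\<forall>j<m. regular_ideal (I j) \<and> I j \<subseteq> I0" "\<forall>i j. i \<le> j \<longrightarrow> j < m \<longrightarrow> I j \<subseteq> I i"
    "\<forall>x\<in>?G. x \<in> ?H \<longleftrightarrow> (\<forall>j<m. \<mu> j x \<in> ideal_prod R (I j) (\<mu> j ` ?G)) \<and> (\<forall>j. m \<le> j \<longrightarrow> j < N \<longrightarrow> \<mu> j x = \<zero>)"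
    "\<forall>j<m. \<forall>L. ideal L R \<longrightarrow> I j \<subseteq> L \<longrightarrow> \<mu> j ` ?G \<subseteq> L \<longrightarrow> g j \<in> L"
    "\<forall>i j. m \<le> i \<longrightarrow> i \<le> j \<longrightarrow> j < N \<longrightarrow> g j \<otimes> g i = g j"
    using IH unfolding stacked_def by - (elim conjE, assumption)+
  have "stacked G H A (Suc N) (Suc m) ?\<mu> ?I ?g"
    unfolding stacked_def
  proof (intro conjI allI impI ballI)
    show "Suc m \<le> Suc N" using IHs(1) by simp
    show "splits (Suc N) ?\<mu> G" using splits_Suc[OF ctx IHs(2)] .
    show "component_support (?\<mu> j) G (?g j)" if "j < Suc N" for j
    proof (cases j)
      case 0 then show ?thesis using cs0 by simp
    next
      case (Suc i)
      then show ?thesis using component_support_complement[OF ctx] IHs(3) that by simp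
    qed
    show "regular_ideal (?I j)" if "j < Suc m" for j
      using that IHs(4) I0reg by (cases j) simp_all
    show "?I j \<subseteq> A" if "j < Suc m" for j
    proof (cases j)
      case 0 then show ?thesis using I0A by simp
    next
      case (Suc i)
      then have "I i \<subseteq> I0" using IHs(4) that by simp
      then show ?thesis using I0A Suc by auto
    qed
    show "?I j \<subseteq> ?I i" if "i \<le> j" "j < Suc m" for i j
    proof (cases j)
      case 0 then show ?thesis using that by simp
    next
      case (Suc j')
      show ?thesis
      proof (cases i)
        case 0 then show ?thesis using IHs(4) that Suc by simp
      next
        case (Suc i')
        then show ?thesis using IHs(5) that \<open>j = Suc j'\<close> by simp
      qed
    qed
    show "(x \<in> H) = ((\<forall>j<Suc m. ?\<mu> j x \<in> ideal_prod R (?I j) (?\<mu> j ` G)) \<and>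
        (\<forall>j. Suc m \<le> j \<longrightarrow> j < Suc N \<longrightarrow> ?\<mu> j x = \<zero>))" if x: "x \<in> G" for x
    proof -
      have a: "(\<forall>j<Suc m. P j) \<longleftrightarrow> P 0 \<and> (\<forall>j<m. P (Suc j))" for P by (auto simp: less_Suc_eq_0_disj)
      have b: "(\<forall>j. Suc m \<le> j \<longrightarrow> j < Suc N \<longrightarrow> P j) \<longleftrightarrow> (\<forall>j. m \<le> j \<longrightarrow> j < N \<longrightarrow> P (Suc j))" for P
        by (metis Suc_le_D Suc_le_mono Suc_less_eq)
      have "x \<ominus>\<^bsub>F\<^esub> \<pi> x \<in> ?H \<longleftrightarrow> (\<forall>j<m. \<mu> j (x \<ominus>\<^bsub>F\<^esub> \<pi> x) \<in> ideal_prod R (I j) (\<mu> j ` ?G)) \<and>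
          (\<forall>j. m \<le> j \<longrightarrow> j < N \<longrightarrow> \<mu> j (x \<ominus>\<^bsub>F\<^esub> \<pi> x) = \<zero>)"
        by (rule bspec[OF IHs(6) complement_proj[OF ctx x]])
      then show ?thesis unfolding Hiff[OF x] a b by (simp only: nat.case im conj_assoc)
    qed
    show "?g j \<in> L" if j: "j < Suc m" and L: "ideal L R" "?I j \<subseteq> L" "?\<mu> j ` G \<subseteq> L" for j L
    proof (cases j)
      case 0
      have "\<phi> (\<pi> x) \<in> L" if x: "x \<in> carrier F" for x
      proof -
        have "\<phi> (\<pi> (\<pi> x)) \<in> L" using L(3) 0 st(2)[OF x] by auto
        then show ?thesis using st(3)[OF x] by simp
      qed
      moreover have "?d \<in> L" using L(2) dI0 0 by auto
      ultimately have "f0 \<in> L" by (rule st(9)[OF L(1)])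
      then show ?thesis using 0 by simp
    next
      case (Suc i)
      have "i < m" "I i \<subseteq> L" "\<mu> i ` ?G \<subseteq> L" using j L(2,3) by (simp_all only: Suc nat.case im Suc_less_eq)
      then have "g i \<in> L" using IHs(7) L(1) by blast
      then show ?thesis using Suc by simp
    qed
    show "?g j \<otimes> ?g i = ?g j" if "Suc m \<le> i" "i \<le> j" "j < Suc N" for i j
    proof -
      have "i = Suc (i - 1)" "j = Suc (j - 1)" using that by auto
      then obtain i' j' where i': "i = Suc i'" and j': "j = Suc j'" by blast
      show ?thesis using IHs(8)[rule_format, of i' j'] that by (simp add: i' j')
    qed
  qed
  then show ?case by blast
qed

end

section \<open>Invertible ideals\<close>

text \<open>Reduces the operations on fractions to independence of representatives.\<close>

lemma UN_pair_const:
  assumes "\<And>a s b t. (a, s) \<in> U \<Longrightarrow> (b, t) \<in> V \<Longrightarrow> f a s b t = C" "(a0, s0) \<in> U" "(b0, t0) \<in> V"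
  shows "(\<Union>(a, s)\<in>U. \<Union>(b, t)\<in>V. f a s b t) = C"
proof (rule SUP_eq_const)
  fix p assume "p \<in> U"
  then show "(case p of (a, s) \<Rightarrow> \<Union>(b, t)\<in>V. f a s b t) = C"
    using assms(1,3) by (cases p) (auto intro!: SUP_eq_const)
qed (use assms(2) in auto)

context cring
begin

lemma mem_mk_frac:
  assumes "a \<in> carrier R" "s \<in> nonzerodivisors R"
  shows "(b, t) \<in> mk_frac R a s \<longleftrightarrow> b \<in> carrier R \<and> t \<in> nonzerodivisors R \<and> a \<otimes> t = b \<otimes> s"
  using assms by (auto simp: mk_frac_def frac_rel_def)

lemma mk_frac_eqI:
  assumes "a \<in> carrier R" "s \<in> nonzerodivisors R" "b \<in> carrier R" "t \<in> nonzerodivisors R" "a \<otimes> t = b \<otimes> s"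
  shows "mk_frac R a s = mk_frac R b t"
proof -
  note [simp] = assms(1,3) nzd_closed[OF assms(2)] nzd_closed[OF assms(4)]
  have "a \<otimes> u = c \<otimes> s \<longleftrightarrow> b \<otimes> u = c \<otimes> t" if c: "c \<in> carrier R" and u: "u \<in> nonzerodivisors R" for c u
  proof -
    note [simp] = c nzd_closed[OF u]
    have "t \<otimes> (a \<otimes> u) = s \<otimes> (b \<otimes> u)"
    proof -
      have "t \<otimes> (a \<otimes> u) = (a \<otimes> t) \<otimes> u" by (simp add: m_ac)
      then show ?thesis unfolding assms(5) by (simp add: m_ac)
    qed
    moreover have "t \<otimes> (c \<otimes> s) = s \<otimes> (c \<otimes> t)" by (simp add: m_ac)
    ultimately have "t \<otimes> (a \<otimes> u) = t \<otimes> (c \<otimes> s) \<longleftrightarrow> s \<otimes> (b \<otimes> u) = s \<otimes> (c \<otimes> t)" by simp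
    then show ?thesis using nzd_cancel[OF assms(2), of "b \<otimes> u" "c \<otimes> t"] nzd_cancel[OF assms(4), of "a \<otimes> u" "c \<otimes> s"]
      by auto
  qed
  then show ?thesis using mem_mk_frac[OF assms(1,2)] mem_mk_frac[OF assms(3,4)] by (auto simp: set_eq_iff)
qed

lemma mk_frac_eqD:
  assumes "mk_frac R a s = mk_frac R b t" "a \<in> carrier R" "s \<in> nonzerodivisors R" "b \<in> carrier R" "t \<in> nonzerodivisors R"
  shows "a \<otimes> t = b \<otimes> s"
  using mem_mk_frac[OF assms(2,3), of b t] mem_mk_frac[OF assms(4,5), of b t] assms by simp

lemma total_fraction_carrier:
  "carrier (total_fraction_ring R) = {mk_frac R a s |a s. a \<in> carrier R \<and> s \<in> nonzerodivisors R}"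
  by (auto simp: total_fraction_ring_def quotient_def mk_frac_def)

lemma total_fraction_mult:
  assumes "a \<in> carrier R" "s \<in> nonzerodivisors R" "b \<in> carrier R" "t \<in> nonzerodivisors R"
  shows "mk_frac R a s \<otimes>\<^bsub>total_fraction_ring R\<^esub> mk_frac R b t = mk_frac R (a \<otimes> b) (s \<otimes> t)"
proof -
  have "mk_frac R (a' \<otimes> b') (s' \<otimes> t') = mk_frac R (a \<otimes> b) (s \<otimes> t)"
    if "(a', s') \<in> mk_frac R a s" "(b', t') \<in> mk_frac R b t" for a' s' b' t'
  proof -
    have *: "a' \<in> carrier R" "s' \<in> nonzerodivisors R" "b' \<in> carrier R" "t' \<in> nonzerodivisors R"
      "a \<otimes> s' = a' \<otimes> s" "b \<otimes> t' = b' \<otimes> t" using that mem_mk_frac assms by auto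
    note [simp] = *(1,3) assms(1,3) nzd_closed[OF *(2)] nzd_closed[OF *(4)] nzd_closed[OF assms(2)] nzd_closed[OF assms(4)]
    have "(a' \<otimes> b') \<otimes> (s \<otimes> t) = (a' \<otimes> s) \<otimes> (b' \<otimes> t)" by (simp add: m_ac)
    also have "\<dots> = (a \<otimes> s') \<otimes> (b \<otimes> t')" using *(5,6) by simp
    also have "\<dots> = (a \<otimes> b) \<otimes> (s' \<otimes> t')" by (simp add: m_ac)
    finally show ?thesis using * assms by (intro mk_frac_eqI) (auto intro: nzd_mult)
  qed
  from UN_pair_const[of "mk_frac R a s" "mk_frac R b t", OF this]
  show ?thesis using mem_mk_frac[of a s a s] mem_mk_frac[of b t b t] assms by (simp add: total_fraction_ring_def)
qed

lemma total_fraction_add: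
  assumes "a \<in> carrier R" "s \<in> nonzerodivisors R" "b \<in> carrier R" "t \<in> nonzerodivisors R"
  shows "mk_frac R a s \<oplus>\<^bsub>total_fraction_ring R\<^esub> mk_frac R b t = mk_frac R (a \<otimes> t \<oplus> b \<otimes> s) (s \<otimes> t)"
proof -
  have "mk_frac R (a' \<otimes> t' \<oplus> b' \<otimes> s') (s' \<otimes> t') = mk_frac R (a \<otimes> t \<oplus> b \<otimes> s) (s \<otimes> t)"
    if "(a', s') \<in> mk_frac R a s" "(b', t') \<in> mk_frac R b t" for a' s' b' t'
  proof -
    have *: "a' \<in> carrier R" "s' \<in> nonzerodivisors R" "b' \<in> carrier R" "t' \<in> nonzerodivisors R"
      "a \<otimes> s' = a' \<otimes> s" "b \<otimes> t' = b' \<otimes> t" using that mem_mk_frac assms by auto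
    note [simp] = *(1,3) assms(1,3) nzd_closed[OF *(2)] nzd_closed[OF *(4)] nzd_closed[OF assms(2)] nzd_closed[OF assms(4)]
    have "(a' \<otimes> t' \<oplus> b' \<otimes> s') \<otimes> (s \<otimes> t) = (a' \<otimes> s) \<otimes> (t' \<otimes> t) \<oplus> (b' \<otimes> t) \<otimes> (s' \<otimes> s)"
      using *(1,3) nzd_closed[OF *(2)] nzd_closed[OF *(4)] nzd_closed[OF assms(2)] nzd_closed[OF assms(4)] by algebra
    also have "\<dots> = (a \<otimes> s') \<otimes> (t' \<otimes> t) \<oplus> (b \<otimes> t') \<otimes> (s' \<otimes> s)" using *(5,6) by simp
    also have "\<dots> = (a \<otimes> t \<oplus> b \<otimes> s) \<otimes> (s' \<otimes> t')"
      using assms(1,3) nzd_closed[OF *(2)] nzd_closed[OF *(4)] nzd_closed[OF assms(2)] nzd_closed[OF assms(4)] by algebra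
    finally show ?thesis using * assms by (intro mk_frac_eqI) (auto intro: nzd_mult)
  qed
  from UN_pair_const[of "mk_frac R a s" "mk_frac R b t", OF this]
  show ?thesis using mem_mk_frac[of a s a s] mem_mk_frac[of b t b t] assms by (simp add: total_fraction_ring_def)
qed

lemma total_fraction_add_same:
  assumes "a \<in> carrier R" "b \<in> carrier R" "s \<in> nonzerodivisors R"
  shows "mk_frac R a s \<oplus>\<^bsub>total_fraction_ring R\<^esub> mk_frac R b s = mk_frac R (a \<oplus> b) s"
proof -
  note sR = nzd_closed[OF assms(3)]
  have "(a \<otimes> s \<oplus> b \<otimes> s) \<otimes> s = (a \<oplus> b) \<otimes> (s \<otimes> s)" using assms(1,2) sR by algebra
  then show ?thesis unfolding total_fraction_add[OF assms(1,3,2,3)]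
    using assms sR by (intro mk_frac_eqI nzd_mult) auto
qed

lemma to_frac_mult:
  assumes "r \<in> carrier R" "a \<in> carrier R" "s \<in> nonzerodivisors R"
  shows "to_frac R r \<otimes>\<^bsub>total_fraction_ring R\<^esub> mk_frac R a s = mk_frac R (r \<otimes> a) s"
  using total_fraction_mult[OF assms(1) nzd_one assms(2,3)] nzd_closed[OF assms(3)] by (simp add: to_frac_def)

lemma mk_frac_cancel:
  assumes "r \<in> carrier R" "s \<in> nonzerodivisors R"
  shows "mk_frac R (s \<otimes> r) s = to_frac R r"
  unfolding to_frac_def using assms nzd_closed[OF assms(2)]
  by (intro mk_frac_eqI nzd_one) (auto simp: m_comm)

lemma fractional_ideal_mk_frac:
  assumes B: "ideal B R" and s: "s \<in> nonzerodivisors R"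
  shows "fractional_ideal ((\<lambda>b. mk_frac R b s) ` B) R"
proof -
  let ?M = "total_fraction_module R" and ?Q = "total_fraction_ring R" and ?B = "(\<lambda>b. mk_frac R b s) ` B"
  have M: "carrier ?M = carrier ?Q" "add ?M = add ?Q" "\<zero>\<^bsub>?M\<^esub> = mk_frac R \<zero> \<one>"
    "\<And>r x. r \<odot>\<^bsub>?M\<^esub> x = to_frac R r \<otimes>\<^bsub>?Q\<^esub> x"
    by (simp_all add: total_fraction_module_def total_fraction_ring_def ring.defs)
  have BR: "b \<in> carrier R" if "b \<in> B" for b using ideal_memD[OF B that] .
  have sR: "s \<in> carrier R" using nzd_closed[OF s] .
  have zero: "mk_frac R \<zero> t = mk_frac R \<zero> \<one>" if "t \<in> nonzerodivisors R" for t
    using that nzd_closed by (intro mk_frac_eqI nzd_one) auto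
  have sum0: "mk_frac R b s \<oplus>\<^bsub>?Q\<^esub> mk_frac R (\<ominus> b) s = mk_frac R \<zero> \<one>"
    "mk_frac R (\<ominus> b) s \<oplus>\<^bsub>?Q\<^esub> mk_frac R b s = mk_frac R \<zero> \<one>" if "b \<in> B" for b
    using that BR s zero by (simp_all add: total_fraction_add_same r_neg l_neg)
  \<comment> \<open>The negative is identified straight from the definition of \<open>m_inv\<close>,
    by uniqueness, so no group structure on the module of fractions has to be established
    first.\<close>
  have inv: "m_inv (add_monoid ?M) (mk_frac R b s) = mk_frac R (\<ominus> b) s" if b: "b \<in> B" for b
    unfolding m_inv_def
  proof (rule the_equality)
    show "mk_frac R (\<ominus> b) s \<in> carrier (add_monoid ?M) \<and>
        mk_frac R b s \<otimes>\<^bsub>add_monoid ?M\<^esub> mk_frac R (\<ominus> b) s = \<one>\<^bsub>add_monoid ?M\<^esub> \<and>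
        mk_frac R (\<ominus> b) s \<otimes>\<^bsub>add_monoid ?M\<^esub> mk_frac R b s = \<one>\<^bsub>add_monoid ?M\<^esub>"
      using sum0[OF b] BR[OF b] s by (auto simp: M total_fraction_carrier)
    fix y assume y: "y \<in> carrier (add_monoid ?M) \<and>
        mk_frac R b s \<otimes>\<^bsub>add_monoid ?M\<^esub> y = \<one>\<^bsub>add_monoid ?M\<^esub> \<and>
        y \<otimes>\<^bsub>add_monoid ?M\<^esub> mk_frac R b s = \<one>\<^bsub>add_monoid ?M\<^esub>"
    then obtain c t where c: "c \<in> carrier R" "t \<in> nonzerodivisors R" "y = mk_frac R c t"
      by (auto simp: M total_fraction_carrier)
    note [simp] = BR[OF b] sR c(1) nzd_closed[OF c(2)]
    have "mk_frac R (b \<otimes> t \<oplus> c \<otimes> s) (s \<otimes> t) = mk_frac R \<zero> \<one>"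
      using y by (simp add: M c(3) total_fraction_add[OF BR[OF b] s c(1,2)])
    then have "(b \<otimes> t \<oplus> c \<otimes> s) \<otimes> \<one> = \<zero> \<otimes> (s \<otimes> t)"
      by (rule mk_frac_eqD) (auto intro: nzd_mult s c nzd_one)
    then have 0: "b \<otimes> t \<oplus> c \<otimes> s = \<zero>" by simp
    have "c \<otimes> s = (b \<otimes> t \<oplus> c \<otimes> s) \<ominus> b \<otimes> t" using BR[OF b] sR c(1) nzd_closed[OF c(2)] by algebra
    then have "c \<otimes> s = (\<ominus> b) \<otimes> t" unfolding 0 by (simp add: a_minus_def l_minus)
    then show "y = mk_frac R (\<ominus> b) s" unfolding c(3) by (intro mk_frac_eqI c s) auto
  qed
  have neg: "\<ominus> b \<in> B" if "b \<in> B" for b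
    using ideal_mult[OF B, of "\<ominus> \<one>" b] that BR by (simp add: l_minus)
  have "submodule ?B R ?M"
  proof (intro submodule.intro subgroup.intro submodule_axioms.intro)
    show "?B \<subseteq> carrier (add_monoid ?M)" using BR s by (auto simp: M total_fraction_carrier)
    show "\<one>\<^bsub>add_monoid ?M\<^esub> \<in> ?B"
      using ideal_zero[OF B] zero[OF s] by (simp add: M) (metis image_eqI)
    show "inv\<^bsub>add_monoid ?M\<^esub> x \<in> ?B" if "x \<in> ?B" for x
      using that inv neg by auto
    show "x \<otimes>\<^bsub>add_monoid ?M\<^esub> y \<in> ?B" if "x \<in> ?B" "y \<in> ?B" for x y
      using that total_fraction_add_same[OF BR BR s] ideal_add[OF B] by (auto simp: M)
    show "r \<odot>\<^bsub>?M\<^esub> x \<in> ?B" if "r \<in> carrier R" "x \<in> ?B" for r x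
      using that to_frac_mult[OF _ BR s] ideal_mult[OF B] by (auto simp: M)
  qed
  moreover have "to_frac R s \<otimes>\<^bsub>?Q\<^esub> x \<in> to_frac R ` carrier R" if "x \<in> ?B" for x
    using that to_frac_mult[OF sR BR s] mk_frac_cancel[OF BR s] BR by auto
  ultimately show ?thesis using s unfolding fractional_ideal_def by blast
qed

text \<open>The inverse is \<open>B / s\<close>: divisibility of the products by \<open>s\<close>
  puts \<open>I (B / s)\<close> inside \<open>R\<close>, and \<open>s\<close> in \<open>IB\<close>
  puts 1 into it.\<close>

lemma invertible_idealI:
  assumes I: "ideal I R" and B: "ideal B R" and s: "s \<in> nonzerodivisors R"
    and div: "\<And>i b. i \<in> I \<Longrightarrow> b \<in> B \<Longrightarrow> \<exists>r\<in>carrier R. i \<otimes> b = s \<otimes> r"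
    and sIB: "s \<in> ideal_prod R I B"
  shows "invertible_ideal I R"
proof -
  let ?Q = "total_fraction_ring R" and ?B = "(\<lambda>b. mk_frac R b s) ` B"
  have IR: "i \<in> carrier R" if "i \<in> I" for i using ideal_memD[OF I that] .
  have BR: "b \<in> carrier R" if "b \<in> B" for b using ideal_memD[OF B that] .
  have fprod: "to_frac R i \<otimes>\<^bsub>?Q\<^esub> mk_frac R b s = mk_frac R (i \<otimes> b) s" if "i \<in> I" "b \<in> B" for i b
    using to_frac_mult[OF IR[OF that(1)] BR[OF that(2)] s] .
  have "ideal_prod ?Q (to_frac R ` I) ?B = to_frac R ` carrier R"
  proof (intro subset_antisym subsetI)
    fix x assume "x \<in> ideal_prod ?Q (to_frac R ` I) ?B"
    then show "x \<in> to_frac R ` carrier R"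
    proof induction
      case (prod u v)
      then obtain i b where ib: "i \<in> I" "b \<in> B" "u = to_frac R i" "v = mk_frac R b s" by blast
      obtain r where r: "r \<in> carrier R" "i \<otimes> b = s \<otimes> r" using div[OF ib(1,2)] by blast
      then have "u \<otimes>\<^bsub>?Q\<^esub> v = to_frac R r"
        using fprod[OF ib(1,2)] ib mk_frac_cancel[OF r(1) s] by simp
      then show ?case using r by blast
    next
      case (sum u v)
      then obtain r r' where "r \<in> carrier R" "r' \<in> carrier R" "u = to_frac R r" "v = to_frac R r'" by blast
      then have "u \<oplus>\<^bsub>?Q\<^esub> v = to_frac R (r \<oplus> r')" "r \<oplus> r' \<in> carrier R"
        using total_fraction_add_same[OF _ _ nzd_one] by (auto simp: to_frac_def)
      then show ?case by blast
    qed
  next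
    have *: "mk_frac R z s \<in> ideal_prod ?Q (to_frac R ` I) ?B" if "z \<in> ideal_prod R I B" for z
      using that
    proof induction
      case (prod i j)
      have "to_frac R i \<otimes>\<^bsub>?Q\<^esub> mk_frac R j s \<in> ideal_prod ?Q (to_frac R ` I) ?B"
        using prod by (intro ideal_prod.prod) auto
      then show ?case unfolding fprod[OF prod] .
    next
      case (sum z1 z2)
      then have "z1 \<in> carrier R" "z2 \<in> carrier R" using ideal_prod_in_carrier[OF I B] by auto
      from total_fraction_add_same[OF this s] show ?case using ideal_prod.sum[OF sum(3,4)] by simp
    qed
    fix x assume "x \<in> to_frac R ` carrier R"
    then obtain r where r: "r \<in> carrier R" "x = to_frac R r" by blast
    have "s \<otimes> r \<in> ideal_prod R I B" using ideal_mult_right[OF ideal_prod_is_ideal[OF I B] r(1) sIB] .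
    from *[OF this] show "x \<in> ideal_prod ?Q (to_frac R ` I) ?B" using mk_frac_cancel[OF r(1) s] r(2) by simp
  qed
  moreover have "fractional_ideal (to_frac R ` I) R"
    using fractional_ideal_mk_frac[OF I nzd_one] by (simp add: to_frac_def[abs_def])
  ultimately show ?thesis
    using I fractional_ideal_mk_frac[OF B s] unfolding invertible_ideal_def invertible_fractional_ideal_def by blast
qed

end

section \<open>Invertible ideals from pairings, over the ring and over its idempotent
  components\<close>

context semihereditary
begin

text \<open>The support \<open>f\<close> fixes a non-zero-divisor of \<open>I\<close>, so
  \<open>f = 1\<close> and the pairing becomes \<open>IB = sR\<close>.\<close>

lemma invertible_ideal_of_regular:
  assumes fg: "finitely_generated_ideal I R" and t: "t \<in> nonzerodivisors R" "t \<in> I"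
  shows "invertible_ideal I R"
proof -
  obtain s f B where p: "divisible_pairing s f I B" using exists_divisible_pairing[OF fg] by blast
  have *: "s \<in> nonzerodivisors R" "f \<in> carrier R" "ideal I R" "ideal B R" "f \<otimes> t = t" "s \<otimes> f \<in> ideal_prod R I B"
    "\<forall>c\<in>I. \<forall>b\<in>B. \<exists>u\<in>carrier R. c \<otimes> b = s \<otimes> u"
    using p t(2) unfolding divisible_pairing_def idem_elem_def by simp_all
  have "t \<otimes> f = t \<otimes> \<one>" using *(2,5) nzd_closed[OF t(1)] by (simp add: m_comm)
  then have "f = \<one>" using nzd_cancel[OF t(1)] *(2) by simp
  then have "s \<in> ideal_prod R I B" using *(6) nzd_closed[OF *(1)] by simp
  then show ?thesis using invertible_idealI[OF *(3,4,1)] *(7) by blast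
qed

lemma idempotent_ring_carrier:
  "idem_elem R e \<Longrightarrow> carrier (idempotent_ring R e) = {x \<in> carrier R. x \<otimes> e = x}"
  by (auto simp: idempotent_ring_def idem_elem_def m_assoc) (metis)

lemma idempotent_ring_simps:
  "monoid.mult (idempotent_ring R e) = monoid.mult R" "add (idempotent_ring R e) = add R"
  "\<zero>\<^bsub>idempotent_ring R e\<^esub> = \<zero>" "\<one>\<^bsub>idempotent_ring R e\<^esub> = e"
  by (simp_all add: idempotent_ring_def)

lemma idempotent_ring_cring:
  assumes e: "idem_elem R e" shows "cring (idempotent_ring R e)"
proof (rule cringI)
  note [simp] = idempotent_ring_simps idempotent_ring_carrier[OF e]
  have [simp]: "e \<in> carrier R" "e \<otimes> e = e" using e by (auto simp: idem_elem_def)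
  show "abelian_group (idempotent_ring R e)"
  proof (rule abelian_groupI)
    fix x assume x: "x \<in> carrier (idempotent_ring R e)"
    show "\<exists>y\<in>carrier (idempotent_ring R e). y \<oplus>\<^bsub>idempotent_ring R e\<^esub> x = \<zero>\<^bsub>idempotent_ring R e\<^esub>"
      using x by (intro bexI[of _ "\<ominus> x"]) (auto simp: l_neg l_minus)
  qed (auto simp: l_distr a_ac)
  show "comm_monoid (idempotent_ring R e)"
    by (rule comm_monoidI) (auto simp: m_ac)
qed (auto simp: idempotent_ring_simps idempotent_ring_carrier[OF e] l_distr)

text \<open>The hypothesis on annihilators puts \<open>e\<close> under the support \<open>f\<close>
  of \<open>J\<close>. Multiplying \<open>JB = sRf\<close> by \<open>e\<close> then gives
  \<open>(eJ)(eB) = (es) Re\<close>.\<close>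

lemma idempotent_component_invertible:
  assumes fg: "finitely_generated_ideal J R" and e: "idem_elem R e"
    and supp: "\<And>r. r \<in> carrier R \<Longrightarrow> (\<And>c. c \<in> J \<Longrightarrow> r \<otimes> c = \<zero>) \<Longrightarrow> r \<otimes> e = \<zero>"
  shows "invertible_ideal ((\<lambda>x. e \<otimes> x) ` J) (idempotent_ring R e)"
proof -
  let ?S = "idempotent_ring R e"
  interpret S: cring ?S using idempotent_ring_cring[OF e] .
  note ops [simp] = idempotent_ring_simps
  note S = idempotent_ring_carrier[OF e]
  have e' [simp]: "e \<in> carrier R" "e \<otimes> e = e" using e by (auto simp: idem_elem_def)
  obtain s f B where p: "divisible_pairing s f J B" using exists_divisible_pairing[OF fg] by blast
  have *: "s \<in> nonzerodivisors R" "f \<in> carrier R" "ideal J R" "ideal B R" "\<forall>c\<in>J. f \<otimes> c = c" "s \<otimes> f \<in> ideal_prod R J B"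
    "\<forall>c\<in>J. \<forall>b\<in>B. \<exists>u\<in>carrier R. c \<otimes> b = s \<otimes> u"
    using p unfolding divisible_pairing_def idem_elem_def by simp_all
  have sR [simp]: "s \<in> carrier R" using nzd_closed[OF *(1)] .
  have ef: "e \<otimes> f = e"
  proof -
    have "(\<one> \<ominus> f) \<otimes> c = \<zero>" if "c \<in> J" for c
    proof -
      have "(\<one> \<ominus> f) \<otimes> c = c \<ominus> f \<otimes> c" using *(2) ideal_memD[OF *(3) that] by algebra
      then show ?thesis using *(5) that ideal_memD[OF *(3) that] by (simp add: a_minus_def r_neg)
    qed
    then have 0: "(\<one> \<ominus> f) \<otimes> e = \<zero>" using supp *(2) by simp
    have "(\<one> \<ominus> f) \<otimes> e = e \<ominus> e \<otimes> f" using *(2) e'(1) by algebra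
    then show ?thesis using 0 *(2) r_right_minus_eq[of e "e \<otimes> f"] by simp
  qed
  have eid: "ideal ((\<lambda>x. e \<otimes> x) ` L) ?S" if L: "ideal L R" for L
  proof (rule S.ideal_of_closed)
    have LR: "x \<in> carrier R" if "x \<in> L" for x using ideal_memD[OF L that] .
    have ee: "e \<otimes> x \<otimes> e = e \<otimes> x" if "x \<in> carrier R" for x
    proof -
      have "e \<otimes> x \<otimes> e = (e \<otimes> e) \<otimes> x" using that e'(1) by (simp only: m_ac m_closed)
      then show ?thesis by simp
    qed
    then show "(\<lambda>x. e \<otimes> x) ` L \<subseteq> carrier ?S" using LR by (auto simp: S)
    show "\<zero>\<^bsub>?S\<^esub> \<in> (\<lambda>x. e \<otimes> x) ` L" using ideal_zero[OF L] by (auto intro!: image_eqI[where x = \<zero>])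
    show "x \<oplus>\<^bsub>?S\<^esub> y \<in> (\<lambda>x. e \<otimes> x) ` L" if xy: "x \<in> (\<lambda>x. e \<otimes> x) ` L" "y \<in> (\<lambda>x. e \<otimes> x) ` L" for x y
    proof -
      obtain u v where uv: "u \<in> L" "v \<in> L" "x = e \<otimes> u" "y = e \<otimes> v" using xy by blast
      then have "x \<oplus>\<^bsub>?S\<^esub> y = e \<otimes> (u \<oplus> v)" using LR by (simp add: r_distr)
      then show ?thesis using ideal_add[OF L uv(1,2)] by blast
    qed
    show "r \<otimes>\<^bsub>?S\<^esub> x \<in> (\<lambda>x. e \<otimes> x) ` L" if rx: "r \<in> carrier ?S" "x \<in> (\<lambda>x. e \<otimes> x) ` L" for r x
    proof -
      obtain u where u: "u \<in> L" "x = e \<otimes> u" using rx by blast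
      have r: "r \<in> carrier R" using rx by (simp add: S)
      have "r \<otimes>\<^bsub>?S\<^esub> x = e \<otimes> (r \<otimes> u)" using u LR r by (simp add: m_lcomm)
      then show ?thesis using ideal_mult[OF L r u(1)] by blast
    qed
  qed
  let ?J = "(\<lambda>x. e \<otimes> x) ` J" and ?B = "(\<lambda>x. e \<otimes> x) ` B"
  show ?thesis
  proof (rule S.invertible_idealI[OF eid[OF *(3)] eid[OF *(4)], of "e \<otimes> s"])
    show "e \<otimes> s \<in> nonzerodivisors ?S"
    proof (rule S.nzdI)
      show "e \<otimes> s \<in> carrier ?S" by (simp add: S m_ac) (metis e' m_assoc m_comm sR)
      fix x assume x: "x \<in> carrier ?S" "x \<otimes>\<^bsub>?S\<^esub> (e \<otimes> s) = \<zero>\<^bsub>?S\<^esub>"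
      then have x': "x \<in> carrier R" "x \<otimes> e = x" by (auto simp: S)
      have "s \<otimes> x = x \<otimes> (e \<otimes> s)" using m_assoc[OF x'(1) e'(1) sR] x' by (simp add: m_comm)
      then show "x = \<zero>\<^bsub>?S\<^esub>" using x(2) nzd_zero[OF *(1) _ x'(1)] by simp
    qed
    show "\<exists>r\<in>carrier ?S. i \<otimes>\<^bsub>?S\<^esub> b = e \<otimes> s \<otimes>\<^bsub>?S\<^esub> r" if ib: "i \<in> ?J" "b \<in> ?B" for i b
    proof -
      obtain x y where xy: "x \<in> J" "y \<in> B" "i = e \<otimes> x" "b = e \<otimes> y" using ib by blast
      obtain t where t: "t \<in> carrier R" "x \<otimes> y = s \<otimes> t" using *(7) xy by blast
      have [simp]: "x \<in> carrier R" "y \<in> carrier R" using ideal_memD *(3,4) xy by blast+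
      have "i \<otimes> b = (e \<otimes> e) \<otimes> (x \<otimes> y)" unfolding xy(3,4) using e'(1) by (simp only: m_ac m_closed \<open>x \<in> carrier R\<close> \<open>y \<in> carrier R\<close>)
      also have "\<dots> = (e \<otimes> e) \<otimes> (s \<otimes> t)" unfolding t(2) ..
      also have "\<dots> = e \<otimes> s \<otimes> (e \<otimes> t)" using t(1) e'(1) by (simp only: m_ac m_closed sR)
      finally have "i \<otimes>\<^bsub>?S\<^esub> b = e \<otimes> s \<otimes>\<^bsub>?S\<^esub> (e \<otimes> t)" by simp
      moreover have "e \<otimes> t \<otimes> e = (e \<otimes> e) \<otimes> t" using t(1) e'(1) by (simp only: m_ac m_closed)
      then have "e \<otimes> t \<in> carrier ?S" using t(1) by (simp add: S)
      ultimately show ?thesis by blast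
    qed
    have prod: "e \<otimes> z \<in> ideal_prod ?S ?J ?B" if "z \<in> ideal_prod R J B" for z
      using that
    proof induction
      case (prod i j)
      have [simp]: "i \<in> carrier R" "j \<in> carrier R" using ideal_memD *(3,4) prod by blast+
      have "(e \<otimes> i) \<otimes> (e \<otimes> j) = (e \<otimes> e) \<otimes> (i \<otimes> j)" using e'(1) by (simp only: m_ac m_closed \<open>i \<in> carrier R\<close> \<open>j \<in> carrier R\<close>)
      then have "e \<otimes> (i \<otimes> j) = (e \<otimes> i) \<otimes>\<^bsub>?S\<^esub> (e \<otimes> j)" by simp
      moreover have "(e \<otimes> i) \<otimes>\<^bsub>?S\<^esub> (e \<otimes> j) \<in> ideal_prod ?S ?J ?B" using prod by (intro ideal_prod.prod) auto
      ultimately show ?case by (simp only:)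
    next
      case (sum z1 z2)
      have "z1 \<in> carrier R" "z2 \<in> carrier R" using ideal_prod_in_carrier[OF *(3,4)] sum(1,2) by auto
      then have "e \<otimes> (z1 \<oplus> z2) = (e \<otimes> z1) \<oplus>\<^bsub>?S\<^esub> (e \<otimes> z2)" by (simp add: r_distr)
      then show ?case using ideal_prod.sum[OF sum(3,4)] by (simp only:)
    qed
    have "e \<otimes> (s \<otimes> f) = s \<otimes> (e \<otimes> f)" using *(2) by (simp add: m_lcomm)
    then have "e \<otimes> (s \<otimes> f) = e \<otimes> s" unfolding ef by (simp add: m_comm)
    then show "e \<otimes> s \<in> ideal_prod ?S ?J ?B" using prod[OF *(6)] by simp
  qed
qed

section \<open>Sorting cyclic summands\<close>

lemma fg_carrier: "finitely_generated_ideal (carrier R) R"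
  unfolding finitely_generated_ideal_def by (intro exI[of _ "{\<one>}"]) (simp add: genideal_one)

lemma regular_carrier: "regular_ideal (carrier R)"
  using fg_carrier nzd_one by (auto simp: regular_ideal_def)

text \<open>Finitely generated ideals are locally comparable: \<open>(A : B) + (B : A) = R\<close>.\<close>

lemma regular_ideals_comparable:
  assumes A: "regular_ideal A" and B: "regular_ideal B"
  shows "\<exists>\<alpha>\<in>carrier R. \<exists>\<beta>\<in>carrier R. \<alpha> \<oplus> \<beta> = \<one> \<and> (\<forall>d\<in>Idl (A \<union> B). \<alpha> \<otimes> d \<in> A \<and> \<beta> \<otimes> d \<in> B)"
proof -
  let ?D = "Idl (A \<union> B)"
  have Ai: "ideal A R" and Bi: "ideal B R" using A B regular_idealD by auto
  have AR: "a \<in> carrier R" if "a \<in> A" for a using ideal_memD[OF Ai that] .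
  have BR: "b \<in> carrier R" if "b \<in> B" for b using ideal_memD[OF Bi that] .
  have sub: "A \<union> B \<subseteq> carrier R" using AR BR by blast
  have D: "ideal ?D R" and AD: "A \<subseteq> ?D" and BD: "B \<subseteq> ?D"
    using genideal_ideal[OF sub] genideal_self[OF sub] by auto
  have DR: "d \<in> carrier R" if "d \<in> ?D" for d using ideal_memD[OF D that] .
  obtain s f C where p: "divisible_pairing s f ?D C"
    using exists_divisible_pairing[OF fg_ideal_sum[of A B]] A B unfolding regular_ideal_def by blast
  have *: "s \<in> nonzerodivisors R" "f \<in> carrier R" "ideal C R" "\<forall>d\<in>?D. f \<otimes> d = d"
    "\<forall>c\<in>?D. \<forall>b\<in>C. \<exists>u\<in>carrier R. c \<otimes> b = s \<otimes> u"
    using p unfolding divisible_pairing_def idem_elem_def by simp_all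
  have sR: "s \<in> carrier R" using nzd_closed[OF *(1)] .
  obtain t where t: "t \<in> nonzerodivisors R" "t \<in> A" using A by (auto simp: regular_ideal_def)
  have "t \<otimes> f = t \<otimes> \<one>" using *(2,4) AD t nzd_closed[OF t(1)] by (auto simp: m_comm)
  then have f1: "f = \<one>" using nzd_cancel[OF t(1)] *(2) by simp
  \<comment> \<open>With \<open>D\<close> the sum of \<open>A\<close> and \<open>B\<close>, this is
    the ideal \<open>(A : D) + (B : D)\<close>, to be shown to contain 1.\<close>
  define E where "E = {x \<in> carrier R. \<exists>\<alpha>\<in>carrier R. \<exists>\<beta>\<in>carrier R. \<alpha> \<oplus> \<beta> = x \<and> (\<forall>d\<in>?D. \<alpha> \<otimes> d \<in> A \<and> \<beta> \<otimes> d \<in> B)}"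
  let ?E = "{x \<in> carrier R. \<exists>\<alpha>\<in>carrier R. \<exists>\<beta>\<in>carrier R. \<alpha> \<oplus> \<beta> = x \<and> (\<forall>d\<in>?D. \<alpha> \<otimes> d \<in> A \<and> \<beta> \<otimes> d \<in> B)}"
  have E: "ideal E R"
    unfolding E_def
  proof (rule ideal_of_closed)
    have "\<zero> \<otimes> d \<in> A \<and> \<zero> \<otimes> d \<in> B" if "d \<in> ?D" for d
      using DR[OF that] ideal_zero[OF Ai] ideal_zero[OF Bi] by simp
    then show "\<zero> \<in> ?E" by (auto intro!: bexI[of _ \<zero>])
    fix x y assume "x \<in> ?E" "y \<in> ?E"
    then obtain a b a' b' where ab: "a \<in> carrier R" "b \<in> carrier R" "a' \<in> carrier R" "b' \<in> carrier R"
      "x = a \<oplus> b" "y = a' \<oplus> b'" "\<forall>d\<in>?D. a \<otimes> d \<in> A \<and> b \<otimes> d \<in> B" "\<forall>d\<in>?D. a' \<otimes> d \<in> A \<and> b' \<otimes> d \<in> B" by blast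
    have "x \<oplus> y = (a \<oplus> a') \<oplus> (b \<oplus> b')" unfolding ab(5,6) using ab(1-4) by algebra
    moreover have "(a \<oplus> a') \<otimes> d \<in> A \<and> (b \<oplus> b') \<otimes> d \<in> B" if "d \<in> ?D" for d
      using ab(1-4,7,8) that DR ideal_add[OF Ai] ideal_add[OF Bi] by (simp add: l_distr)
    ultimately show "x \<oplus> y \<in> ?E" using ab(1-4) by (simp, metis a_closed)
  next
    fix r x assume r: "r \<in> carrier R" and "x \<in> ?E"
    then obtain a b where ab: "a \<in> carrier R" "b \<in> carrier R" "x = a \<oplus> b" "\<forall>d\<in>?D. a \<otimes> d \<in> A \<and> b \<otimes> d \<in> B" by blast
    have "r \<otimes> x = r \<otimes> a \<oplus> r \<otimes> b" unfolding ab(3) using ab(1,2) r by (simp add: r_distr)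
    moreover have "(r \<otimes> a) \<otimes> d \<in> A \<and> (r \<otimes> b) \<otimes> d \<in> B" if "d \<in> ?D" for d
      using ab(1,2,4) r that DR ideal_mult[OF Ai r] ideal_mult[OF Bi r] by (simp add: m_assoc)
    ultimately show "r \<otimes> x \<in> ?E" using ab(1,2) r by (simp, metis m_closed)
  qed auto
  have "f \<in> E"
  proof (rule divisible_pairing_ideal[OF p E])
    fix c b u assume c: "c \<in> ?D" and b: "b \<in> C" and u: "u \<in> carrier R" "c \<otimes> b = s \<otimes> u"
    have bR: "b \<in> carrier R" using ideal_memD[OF *(3) b] .
    \<comment> \<open>The numerators \<open>c\<close> for which \<open>c b / s\<close> is in
      \<open>E\<close>. As they form an ideal, it is enough to treat \<open>c\<close> in
      \<open>A\<close> or in \<open>B\<close>.\<close>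
    let ?K = "{c \<in> carrier R. \<exists>t\<in>E. c \<otimes> b = s \<otimes> t}"
    have ER: "t \<in> carrier R" if "t \<in> E" for t using that by (simp add: E_def)
    have K: "ideal ?K R"
    proof (rule ideal_of_closed)
      show "\<zero> \<in> ?K" using bR sR ideal_zero[OF E] by (intro CollectI conjI bexI[of _ \<zero>]) auto
      fix x y assume "x \<in> ?K" "y \<in> ?K"
      then obtain t v where tv: "x \<in> carrier R" "y \<in> carrier R" "t \<in> E" "v \<in> E" "x \<otimes> b = s \<otimes> t" "y \<otimes> b = s \<otimes> v" by blast
      have "(x \<oplus> y) \<otimes> b = s \<otimes> (t \<oplus> v)" using tv(1,2,5,6) bR sR ER[OF tv(3)] ER[OF tv(4)] by (simp add: l_distr r_distr)
      moreover have "t \<oplus> v \<in> E" using ideal_add[OF E tv(3,4)] .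
      ultimately show "x \<oplus> y \<in> ?K" using tv(1,2) by (intro CollectI conjI bexI[of _ "t \<oplus> v"]) simp_all
    next
      fix r x assume r: "r \<in> carrier R" and "x \<in> ?K"
      then obtain t where t: "x \<in> carrier R" "t \<in> E" "x \<otimes> b = s \<otimes> t" by blast
      have "r \<otimes> x \<otimes> b = s \<otimes> (r \<otimes> t)"
        using t(1,3) r bR sR ER[OF t(2)] by (simp add: m_assoc m_lcomm[of s r t])
      moreover have "r \<otimes> t \<in> E" using ideal_mult[OF E r t(2)] .
      ultimately show "r \<otimes> x \<in> ?K" using t(1) r by (intro CollectI conjI bexI[of _ "r \<otimes> t"]) simp_all
    qed auto
    \<comment> \<open>The fraction \<open>t = c b / s\<close> multiplies the sum into
      \<open>L\<close> because \<open>t d = c (d b / s)\<close>, where \<open>d b / s\<close> is an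
      element of \<open>R\<close>. Taken for \<open>L = A\<close> and for
      \<open>L = B\<close>.\<close>
    have quot: "t \<otimes> d \<in> L" if L: "ideal L R" "c \<in> L" and c: "c \<in> ?D" and t: "t \<in> carrier R" "c \<otimes> b = s \<otimes> t" and d: "d \<in> ?D" for L c t d
    proof -
      obtain v where v: "v \<in> carrier R" "d \<otimes> b = s \<otimes> v" using *(5) d b by blast
      note [simp] = DR[OF c] DR[OF d] bR sR t(1) v(1)
      have "s \<otimes> (t \<otimes> d) = (s \<otimes> t) \<otimes> d" by (simp add: m_assoc)
      also have "\<dots> = c \<otimes> (d \<otimes> b)" unfolding t(2)[symmetric] by (simp add: m_ac)
      also have "\<dots> = s \<otimes> (c \<otimes> v)" unfolding v(2) by (simp add: m_lcomm)
      finally have "t \<otimes> d = c \<otimes> v" using nzd_cancel[OF *(1)] by simp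
      then show ?thesis using ideal_mult_right[OF L(1) v(1) L(2)] by simp
    qed
    have "A \<union> B \<subseteq> ?K"
    proof
      fix c assume c: "c \<in> A \<union> B"
      have cD: "c \<in> ?D" using c AD BD by blast
      obtain t where t: "t \<in> carrier R" "c \<otimes> b = s \<otimes> t" using *(5) cD b by blast
      have z: "\<zero> \<otimes> d = \<zero>" if "d \<in> ?D" for d using DR[OF that] by simp
      have "t \<in> E"
      proof (cases "c \<in> A")
        case True
        have "\<forall>d\<in>?D. t \<otimes> d \<in> A \<and> \<zero> \<otimes> d \<in> B" using quot[OF Ai True cD t] z ideal_zero[OF Bi] by simp
        then show ?thesis using t(1) unfolding E_def by (intro CollectI conjI bexI[of _ t] bexI[of _ \<zero>]) simp_all
      next
        case False
        then have cB: "c \<in> B" using c by blast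
        have "\<forall>d\<in>?D. \<zero> \<otimes> d \<in> A \<and> t \<otimes> d \<in> B" using quot[OF Bi cB cD t] z ideal_zero[OF Ai] by simp
        then show ?thesis using t(1) unfolding E_def by (intro CollectI conjI bexI[of _ t] bexI[of _ \<zero>]) simp_all
      qed
      then show "c \<in> ?K" using DR[OF cD] t(2) by blast
    qed
    then have "c \<in> ?K" using genideal_minimal[OF K] c by blast
    then obtain v where v: "v \<in> E" "c \<otimes> b = s \<otimes> v" by blast
    then have "u = v" using nzd_cancel[OF *(1)] u ER[OF v(1)] by simp
    then show "u \<in> E" using v(1) by (simp only:)
  qed
  then show ?thesis unfolding f1 E_def by blast
qed

lemma regular_sum:
  assumes "regular_ideal A" "regular_ideal B" shows "regular_ideal (Idl (A \<union> B))"
proof -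
  have "A \<union> B \<subseteq> carrier R" using assms regular_idealD ideal_memD by blast
  then show ?thesis using assms fg_ideal_sum genideal_self[of "A \<union> B"] by (auto simp: regular_ideal_def)
qed

text \<open>Since \<open>x = \<alpha> x + \<beta> x\<close>, the intersection is generated by
  \<open>\<alpha> B\<close> and \<open>\<beta> A\<close>, hence finitely generated. A product of
  non-zero-divisors of \<open>A\<close> and \<open>B\<close> lies in it.\<close>

lemma regular_inter:
  assumes A: "regular_ideal A" and B: "regular_ideal B" shows "regular_ideal (A \<inter> B)"
proof -
  have Ai: "ideal A R" and Bi: "ideal B R" using A B regular_idealD by auto
  have AR: "A \<subseteq> carrier R" and BR: "B \<subseteq> carrier R" using ideal_memD Ai Bi by blast+
  obtain \<alpha> \<beta> where ab: "\<alpha> \<in> carrier R" "\<beta> \<in> carrier R" "\<alpha> \<oplus> \<beta> = \<one>" "\<And>d. d \<in> Idl (A \<union> B) \<Longrightarrow> \<alpha> \<otimes> d \<in> A \<and> \<beta> \<otimes> d \<in> B"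
    using regular_ideals_comparable[OF A B] by blast
  have AB: "A \<subseteq> Idl (A \<union> B)" "B \<subseteq> Idl (A \<union> B)" using genideal_self[of "A \<union> B"] AR BR by auto
  let ?S = "(\<lambda>x. \<alpha> \<otimes> x) ` B \<union> (\<lambda>x. \<beta> \<otimes> x) ` A"
  have S: "?S \<subseteq> A \<inter> B" using ab(1,2,4) AB ideal_mult[OF Ai] ideal_mult[OF Bi] by blast
  then have SR: "?S \<subseteq> carrier R" using AR by blast
  have "Idl ?S = A \<inter> B"
  proof
    show "Idl ?S \<subseteq> A \<inter> B" using S i_intersect[OF Ai Bi] by (intro genideal_minimal)
    show "A \<inter> B \<subseteq> Idl ?S"
    proof
      fix x assume x: "x \<in> A \<inter> B"
      then have xR: "x \<in> carrier R" using AR by blast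
      have "\<alpha> \<otimes> x \<oplus> \<beta> \<otimes> x \<in> Idl ?S"
        using x genideal_self[OF SR] by (intro ideal_add[OF genideal_ideal[OF SR]]) auto
      moreover have "\<alpha> \<otimes> x \<oplus> \<beta> \<otimes> x = x" using l_distr[OF ab(1,2) xR] ab(3) xR by simp
      ultimately show "x \<in> Idl ?S" by simp
    qed
  qed
  then have "finitely_generated_ideal (A \<inter> B) R"
    using fg_ideal_sum[OF fg_ideal_smult[OF _ ab(1)] fg_ideal_smult[OF _ ab(2)], of B A] A B
    by (simp add: regular_ideal_def)
  moreover obtain s t where "s \<in> nonzerodivisors R" "s \<in> A" "t \<in> nonzerodivisors R" "t \<in> B"
    using A B by (auto simp: regular_ideal_def)
  then have "s \<otimes> t \<in> nonzerodivisors R" "s \<otimes> t \<in> A \<inter> B"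
    using nzd_mult ideal_mult[OF Bi] ideal_mult_right[OF Ai] nzd_closed by auto
  ultimately show ?thesis unfolding regular_ideal_def by blast
qed

text \<open>Adding \<open>e p (w p - c)\<close> to \<open>c\<close> changes only the component at
  \<open>e p\<close>.\<close>

lemma orthogonal_interpolation:
  assumes J: "ideal J R" and e: "\<And>i. i < p \<Longrightarrow> idem_elem R (e i)"
    "\<And>i j. i < p \<Longrightarrow> j < p \<Longrightarrow> i \<noteq> j \<Longrightarrow> e i \<otimes> e j = \<zero>"
    and w: "\<And>i. i < p \<Longrightarrow> w i \<in> J" "\<And>i. i < p \<Longrightarrow> e i \<otimes> w i = w i"
  shows "\<exists>c\<in>J. \<forall>i<(p::nat). e i \<otimes> c = w i"
  using e w
proof (induction p)
  case 0
  then show ?case using ideal_zero[OF J] by blast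
next
  case (Suc p)
  have "\<exists>c\<in>J. \<forall>i<p. e i \<otimes> c = w i" by (rule Suc.IH) (use Suc.prems in auto)
  then obtain c where c: "c \<in> J" "\<forall>i<p. e i \<otimes> c = w i" by blast
  have eR: "e i \<in> carrier R" "e i \<otimes> e i = e i" if "i < Suc p" for i using Suc.prems(1)[OF that] by (auto simp: idem_elem_def)
  have cR: "c \<in> carrier R" and wR: "w p \<in> carrier R" using ideal_memD[OF J] c Suc.prems(3) by auto
  let ?c = "c \<oplus> e p \<otimes> (w p \<ominus> c)"
  have "?c \<in> J" using c(1) Suc.prems(3)[of p] eR(1)[of p] by (intro ideal_add[OF J] ideal_mult[OF J] ideal_minus[OF J]) auto
  moreover have "e i \<otimes> ?c = w i" if i: "i < Suc p" for i
  proof -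
    have eq: "e i \<otimes> ?c = e i \<otimes> c \<oplus> (e i \<otimes> e p) \<otimes> (w p \<ominus> c)"
      using eR(1)[OF i] eR(1)[OF lessI] cR wR by (simp add: r_distr m_assoc)
    show ?thesis
    proof (cases "i = p")
      case True
      have "e p \<otimes> c \<oplus> e p \<otimes> (w p \<ominus> c) = e p \<otimes> w p" using eR(1)[OF lessI] cR wR by algebra
      then show ?thesis using eq True eR(2)[OF lessI] Suc.prems(4)[of p] by simp
    next
      case False
      then have "i < p" using i by simp
      then show ?thesis unfolding eq Suc.prems(2)[OF i lessI False] using c(2) cR wR Suc.prems(3)[OF i] ideal_memD[OF J] by simp
    qed
  qed
  ultimately show ?case by blast
qed

end

context coord_module
begin

text \<open>A list of functionals and regular ideals which presents \<open>F / K\<close> as a direct sum of cyclic modules,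
  with representatives in \<open>Z\<close>.\<close>

definition cyclic_split :: "'c set \<Rightarrow> 'c set \<Rightarrow> (('c \<Rightarrow> 'a) \<times> 'a set) list \<Rightarrow> bool" where
  "cyclic_split K Z L \<longleftrightarrow> (\<forall>p\<in>set L. functional (fst p) \<and> regular_ideal (snd p)) \<and>
    (\<forall>x\<in>carrier F. x \<in> K \<longleftrightarrow> (\<forall>p\<in>set L. fst p x \<in> snd p)) \<and>
    (\<forall>rs. length rs = length L \<longrightarrow> set rs \<subseteq> carrier R \<longrightarrow>
      (\<exists>x\<in>Z. list_all2 (\<lambda>p r. fst p x \<ominus> r \<in> snd p) L rs))"

text \<open>The pair \<open>(\<phi>, \<psi>)\<close> is transformed by the matrix with rows
  \<open>(1, 1)\<close> and \<open>(-\<beta>, \<alpha>)\<close>, whose determinant is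
  \<open>\<alpha> + \<beta> = 1\<close>. It carries the conditions modulo \<open>A\<close> and
  \<open>B\<close> to conditions modulo their sum and their intersection.\<close>

lemma cyclic_split_swap:
  assumes Z: "Z \<subseteq> carrier F" and T: "cyclic_split K Z (P @ (\<phi>, A) # (\<psi>, B) # L)"
  shows "\<exists>\<phi>' \<psi>'. cyclic_split K Z (P @ (\<phi>', Idl (A \<union> B)) # (\<psi>', A \<inter> B) # L)"
proof -
  have \<phi>: "functional \<phi>" "functional \<psi>" and A: "regular_ideal A" and B: "regular_ideal B"
    using T by (auto simp: cyclic_split_def)
  note f\<phi> = functionalD[OF \<phi>(1)] and f\<psi> = functionalD[OF \<phi>(2)]
  have Ai: "ideal A R" and Bi: "ideal B R" using A B regular_idealD by auto
  have sub: "A \<union> B \<subseteq> carrier R" using ideal_memD Ai Bi by blast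
  have D: "ideal (Idl (A \<union> B)) R" and AD: "A \<subseteq> Idl (A \<union> B)" and BD: "B \<subseteq> Idl (A \<union> B)"
    using genideal_ideal[OF sub] genideal_self[OF sub] by auto
  obtain \<alpha> \<beta> where ab: "\<alpha> \<in> carrier R" "\<beta> \<in> carrier R" "\<alpha> \<oplus> \<beta> = \<one>"
    "\<And>d. d \<in> Idl (A \<union> B) \<Longrightarrow> \<alpha> \<otimes> d \<in> A \<and> \<beta> \<otimes> d \<in> B"
    using regular_ideals_comparable[OF A B] by blast
  let ?\<phi> = "\<lambda>x. \<phi> x \<oplus> \<psi> x" and ?\<psi> = "\<lambda>x. \<alpha> \<otimes> \<psi> x \<ominus> \<beta> \<otimes> \<phi> x"
  have iff: "\<phi> x \<in> A \<and> \<psi> x \<in> B \<longleftrightarrow> ?\<phi> x \<in> Idl (A \<union> B) \<and> ?\<psi> x \<in> A \<inter> B" if x: "x \<in> carrier F" for x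
  proof
    assume *: "\<phi> x \<in> A \<and> \<psi> x \<in> B"
    have "?\<phi> x \<in> Idl (A \<union> B)" using * AD BD by (intro ideal_add[OF D]) auto
    moreover have "\<alpha> \<otimes> \<psi> x \<in> A \<inter> B" using * ab(1,4) BD ideal_mult[OF Bi] by auto
    moreover have "\<beta> \<otimes> \<phi> x \<in> A \<inter> B" using * ab(2,4) AD ideal_mult[OF Ai] by auto
    ultimately show "?\<phi> x \<in> Idl (A \<union> B) \<and> ?\<psi> x \<in> A \<inter> B" using ideal_minus[OF Ai] ideal_minus[OF Bi] by blast
  next
    assume *: "?\<phi> x \<in> Idl (A \<union> B) \<and> ?\<psi> x \<in> A \<inter> B"
    have "\<alpha> \<otimes> ?\<phi> x \<ominus> ?\<psi> x = (\<alpha> \<oplus> \<beta>) \<otimes> \<phi> x" "\<beta> \<otimes> ?\<phi> x \<oplus> ?\<psi> x = (\<alpha> \<oplus> \<beta>) \<otimes> \<psi> x"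
      using ab(1,2) f\<phi>(1)[OF x] f\<psi>(1)[OF x] by algebra+
    then have "\<phi> x = \<alpha> \<otimes> ?\<phi> x \<ominus> ?\<psi> x" "\<psi> x = \<beta> \<otimes> ?\<phi> x \<oplus> ?\<psi> x"
      using ab(3) f\<phi>(1)[OF x] f\<psi>(1)[OF x] by simp_all
    moreover have "\<alpha> \<otimes> ?\<phi> x \<ominus> ?\<psi> x \<in> A" using * ab(4) ideal_minus[OF Ai] by blast
    moreover have "\<beta> \<otimes> ?\<phi> x \<oplus> ?\<psi> x \<in> B" using * ab(4) ideal_add[OF Bi] by blast
    ultimately show "\<phi> x \<in> A \<and> \<psi> x \<in> B" by metis
  qed
  have "cyclic_split K Z (P @ (?\<phi>, Idl (A \<union> B)) # (?\<psi>, A \<inter> B) # L)"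
    unfolding cyclic_split_def
  proof (intro conjI allI impI ballI)
    have f: "functional ?\<phi>" "functional ?\<psi>" using \<phi> ab(1,2) by (auto intro: functional_add functional_minus functional_smult)
    fix p assume "p \<in> set (P @ (?\<phi>, Idl (A \<union> B)) # (?\<psi>, A \<inter> B) # L)"
    then have p: "p \<in> set (P @ L) \<or> p = (?\<phi>, Idl (A \<union> B)) \<or> p = (?\<psi>, A \<inter> B)" by auto
    have PL: "functional (fst p) \<and> regular_ideal (snd p)" if "p \<in> set (P @ L)"
      using T that unfolding cyclic_split_def by auto
    show "functional (fst p)" using p PL f by auto
    show "regular_ideal (snd p)" using p PL regular_sum[OF A B] regular_inter[OF A B] by auto
  next
    fix x assume x: "x \<in> carrier F"
    have "x \<in> K \<longleftrightarrow> (\<forall>p\<in>set (P @ (\<phi>, A) # (\<psi>, B) # L). fst p x \<in> snd p)"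
      using T x unfolding cyclic_split_def by blast
    also have "\<dots> \<longleftrightarrow> (\<forall>p\<in>set (P @ L). fst p x \<in> snd p) \<and> (\<phi> x \<in> A \<and> \<psi> x \<in> B)" by auto
    also have "\<dots> \<longleftrightarrow> (\<forall>p\<in>set (P @ (?\<phi>, Idl (A \<union> B)) # (?\<psi>, A \<inter> B) # L). fst p x \<in> snd p)"
      unfolding iff[OF x] by auto
    finally show "(x \<in> K) = (\<forall>p\<in>set (P @ (?\<phi>, Idl (A \<union> B)) # (?\<psi>, A \<inter> B) # L). fst p x \<in> snd p)" .
  next
    fix rs assume len: "length rs = length (P @ (?\<phi>, Idl (A \<union> B)) # (?\<psi>, A \<inter> B) # L)" and rs: "set rs \<subseteq> carrier R"
    define us vs r r' where "us = take (length P) rs" and "vs = drop (length P + 2) rs"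
      and "r = rs ! length P" and "r' = rs ! Suc (length P)"
    have rs_eq: "rs = us @ r # r' # vs"
    proof -
      have l: "length P < length rs" "Suc (length P) < length rs" using len by auto
      have "drop (length P) rs = r # r' # vs"
        unfolding r_def r'_def vs_def using Cons_nth_drop_Suc[OF l(1)] Cons_nth_drop_Suc[OF l(2)] by simp
      then show ?thesis unfolding us_def by (metis append_take_drop_id)
    qed
    have lus: "length us = length P" using len by (simp add: us_def)
    have rR: "r \<in> carrier R" "r' \<in> carrier R" "set us \<subseteq> carrier R" "set vs \<subseteq> carrier R" using rs by (auto simp: rs_eq)
    \<comment> \<open>The inverse matrix, with rows \<open>(\<alpha>, -1)\<close> and
      \<open>(\<beta>, 1)\<close>, applied to the prescribed residues \<open>r\<close> and
      \<open>r'\<close>.\<close>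
    let ?rs = "us @ (\<alpha> \<otimes> r \<ominus> r') # (\<beta> \<otimes> r \<oplus> r') # vs"
    have "length ?rs = length (P @ (\<phi>, A) # (\<psi>, B) # L)" "set ?rs \<subseteq> carrier R"
      using len rR ab(1,2) by (simp_all add: rs_eq)
    then obtain x where x: "x \<in> Z" "list_all2 (\<lambda>p r. fst p x \<ominus> r \<in> snd p) (P @ (\<phi>, A) # (\<psi>, B) # L) ?rs"
      using T unfolding cyclic_split_def by blast
    have xF: "x \<in> carrier F" using x(1) Z by blast
    have la: "list_all2 (\<lambda>p r. fst p x \<ominus> r \<in> snd p) P us" "\<phi> x \<ominus> (\<alpha> \<otimes> r \<ominus> r') \<in> A"
      "\<psi> x \<ominus> (\<beta> \<otimes> r \<oplus> r') \<in> B" "list_all2 (\<lambda>p r. fst p x \<ominus> r \<in> snd p) L vs"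
      using x(2) lus by (simp_all add: list_all2_append)
    let ?u = "\<phi> x \<ominus> (\<alpha> \<otimes> r \<ominus> r')" and ?v = "\<psi> x \<ominus> (\<beta> \<otimes> r \<oplus> r')"
    note [simp] = f\<phi>(1)[OF xF] f\<psi>(1)[OF xF]
    have "?\<phi> x \<ominus> r = ?u \<oplus> ?v \<oplus> (\<alpha> \<oplus> \<beta>) \<otimes> r \<ominus> r" using ab(1,2) rR(1,2) f\<phi>(1)[OF xF] f\<psi>(1)[OF xF] by algebra
    also have "\<dots> = ?u \<oplus> ?v"
    proof -
      have "?u \<in> carrier R" "?v \<in> carrier R" using ab(1,2) rR(1,2) by auto
      then show ?thesis unfolding ab(3) using rR(1) by algebra
    qed
    finally have e1: "?\<phi> x \<ominus> r = ?u \<oplus> ?v" .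
    have 1: "?\<phi> x \<ominus> r \<in> Idl (A \<union> B)" unfolding e1 using la AD BD by (intro ideal_add[OF D]) auto
    have "?\<psi> x \<ominus> r' = \<alpha> \<otimes> ?v \<ominus> \<beta> \<otimes> ?u \<oplus> ((\<alpha> \<oplus> \<beta>) \<otimes> r' \<ominus> r')"
      using ab(1,2) rR(1,2) f\<phi>(1)[OF xF] f\<psi>(1)[OF xF] by algebra
    also have "\<dots> = \<alpha> \<otimes> ?v \<ominus> \<beta> \<otimes> ?u" unfolding ab(3) using ab(1,2) rR(1,2) by (simp add: r_right_minus_eq)
    finally have e2: "?\<psi> x \<ominus> r' = \<alpha> \<otimes> ?v \<ominus> \<beta> \<otimes> ?u" .
    have "\<alpha> \<otimes> ?v \<in> A" "\<alpha> \<otimes> ?v \<in> B" "\<beta> \<otimes> ?u \<in> A" "\<beta> \<otimes> ?u \<in> B"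
      using la(2,3) ab(1,2,4) AD BD ideal_mult[OF Ai] ideal_mult[OF Bi] by auto
    then have 2: "?\<psi> x \<ominus> r' \<in> A \<inter> B" unfolding e2 using ideal_minus[OF Ai] ideal_minus[OF Bi] by blast
    have "list_all2 (\<lambda>p r. fst p x \<ominus> r \<in> snd p) (P @ (?\<phi>, Idl (A \<union> B)) # (?\<psi>, A \<inter> B) # L) rs"
      unfolding rs_eq using la(1,4) 1 2 lus by (simp add: list_all2_append)
    then show "\<exists>x\<in>Z. list_all2 (\<lambda>p r. fst p x \<ominus> r \<in> snd p) (P @ (?\<phi>, Idl (A \<union> B)) # (?\<psi>, A \<inter> B) # L) rs"
      using x(1) by blast
  qed
  then show ?thesis by blast
qed

abbreviation descending :: "(('c \<Rightarrow> 'a) \<times> 'a set) list \<Rightarrow> bool" where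
  "descending \<equiv> sorted_wrt (\<lambda>p q. snd q \<subseteq> snd p)"

text \<open>One pass of insertion: the exchange of \<open>a\<close> with the head leaves the sum in
  front and sends the intersection on. The clause about \<open>D\<close> shows that all later ideals
  are still contained in that sum. The prefix \<open>P\<close> is carried along because a split is a
  statement about the whole list.\<close>

lemma cyclic_split_insert:
  assumes "Z \<subseteq> carrier F" "cyclic_split K Z (P @ a # L)" "descending L"
  shows "\<exists>L'. cyclic_split K Z (P @ L') \<and> descending L' \<and>
    (\<forall>D. snd a \<subseteq> D \<longrightarrow> (\<forall>p\<in>set L. snd p \<subseteq> D) \<longrightarrow> ideal D R \<longrightarrow> (\<forall>p\<in>set L'. snd p \<subseteq> D))"
  using assms(2,3)
proof (induction L arbitrary: a P)
  case Nil
  then show ?case by (intro exI[of _ "[a]"]) simp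
next
  case (Cons b L)
  obtain \<phi> A \<psi> B where ab: "a = (\<phi>, A)" "b = (\<psi>, B)" by (cases a, cases b) auto
  obtain \<phi>' \<psi>' where sw: "cyclic_split K Z (P @ (\<phi>', Idl (A \<union> B)) # (\<psi>', A \<inter> B) # L)"
    using cyclic_split_swap[OF assms(1)] Cons.prems(1) unfolding ab by blast
  have AB: "ideal A R" "ideal B R" using Cons.prems(1) regular_idealD unfolding cyclic_split_def ab by auto
  have sub: "A \<union> B \<subseteq> carrier R" using AB ideal_memD by blast
  have D: "ideal (Idl (A \<union> B)) R" "A \<union> B \<subseteq> Idl (A \<union> B)" using genideal_ideal[OF sub] genideal_self[OF sub] by auto
  have LB: "\<forall>p\<in>set L. snd p \<subseteq> B" and Ld: "descending L" using Cons.prems(2) unfolding ab by simp_all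
  have "cyclic_split K Z ((P @ [(\<phi>', Idl (A \<union> B))]) @ (\<psi>', A \<inter> B) # L)" using sw by simp
  from Cons.IH[OF this Ld] obtain L' where L': "cyclic_split K Z ((P @ [(\<phi>', Idl (A \<union> B))]) @ L')" "descending L'"
    "\<And>D. A \<inter> B \<subseteq> D \<Longrightarrow> (\<forall>p\<in>set L. snd p \<subseteq> D) \<Longrightarrow> ideal D R \<Longrightarrow> (\<forall>p\<in>set L'. snd p \<subseteq> D)" by auto
  let ?L = "(\<phi>', Idl (A \<union> B)) # L'"
  have "\<forall>p\<in>set L'. snd p \<subseteq> Idl (A \<union> B)" using L'(3)[OF _ _ D(1)] D(2) LB by blast
  then have "descending ?L" using L'(2) by simp
  moreover have "\<forall>p\<in>set ?L. snd p \<subseteq> D" if "snd a \<subseteq> D" "\<forall>p\<in>set (b # L). snd p \<subseteq> D" "ideal D R" for D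
  proof -
    have "A \<subseteq> D" "B \<subseteq> D" "\<forall>p\<in>set L. snd p \<subseteq> D" using that(1,2) ab by auto
    then have "Idl (A \<union> B) \<subseteq> D" "\<forall>p\<in>set L'. snd p \<subseteq> D"
      using L'(3)[OF _ _ that(3)] genideal_minimal[OF that(3), of "A \<union> B"] by auto
    then show ?thesis by simp
  qed
  moreover have "cyclic_split K Z (P @ ?L)" using L'(1) by simp
  ultimately show ?case by (intro exI[of _ ?L] conjI allI impI) blast+
qed

lemma cyclic_split_sort:
  assumes "Z \<subseteq> carrier F" "cyclic_split K Z (P @ L)"
  shows "\<exists>L'. cyclic_split K Z (P @ L') \<and> descending L'"
  using assms(2)
proof (induction L arbitrary: P)
  case Nil
  then show ?case by (intro exI[of _ "[]"]) simp
next
  case (Cons a L)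
  then have "cyclic_split K Z ((P @ [a]) @ L)" by simp
  from Cons.IH[OF this] obtain L' where "cyclic_split K Z (P @ a # L')" "descending L'" by auto
  then show ?case using cyclic_split_insert[OF assms(1)] by blast
qed

text \<open>The summand \<open>R / R\<close> is zero; the residue prescribed for it is immaterial
  and set to \<open>\<zero>\<close>.\<close>

lemma cyclic_split_drop:
  assumes "Z \<subseteq> carrier F" "cyclic_split K Z (P @ (\<phi>, carrier R) # L)"
  shows "cyclic_split K Z (P @ L)"
  unfolding cyclic_split_def
proof (intro conjI allI impI ballI)
  show "functional (fst p)" "regular_ideal (snd p)" if "p \<in> set (P @ L)" for p
    using assms(2) that unfolding cyclic_split_def by auto
  show "(x \<in> K) = (\<forall>p\<in>set (P @ L). fst p x \<in> snd p)" if x: "x \<in> carrier F" for x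
  proof -
    have "\<phi> x \<in> carrier R" using assms(2) x functionalD(1) unfolding cyclic_split_def by auto
    moreover have "x \<in> K \<longleftrightarrow> (\<forall>p\<in>set (P @ (\<phi>, carrier R) # L). fst p x \<in> snd p)"
      using assms(2) x unfolding cyclic_split_def by blast
    ultimately show ?thesis by auto
  qed
  fix rs assume len: "length rs = length (P @ L)" and rs: "set rs \<subseteq> carrier R"
  define us vs where "us = take (length P) rs" and "vs = drop (length P) rs"
  have rs_eq: "rs = us @ vs" and lus: "length us = length P" using len by (simp_all add: us_def vs_def)
  have "length (us @ \<zero> # vs) = length (P @ (\<phi>, carrier R) # L)" "set (us @ \<zero> # vs) \<subseteq> carrier R"
    using len rs by (auto simp: rs_eq)
  then obtain x where "x \<in> Z" "list_all2 (\<lambda>p r. fst p x \<ominus> r \<in> snd p) (P @ (\<phi>, carrier R) # L) (us @ \<zero> # vs)"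
    using assms(2) unfolding cyclic_split_def by blast
  then show "\<exists>x\<in>Z. list_all2 (\<lambda>p r. fst p x \<ominus> r \<in> snd p) (P @ L) rs"
    unfolding rs_eq using lus by (auto simp: list_all2_append)
qed

lemma cyclic_split_filter:
  assumes "Z \<subseteq> carrier F" "cyclic_split K Z (P @ L)"
  shows "cyclic_split K Z (P @ filter (\<lambda>p. snd p \<noteq> carrier R) L)"
  using assms(2)
proof (induction L arbitrary: P)
  case (Cons a L)
  obtain \<phi> A where a: "a = (\<phi>, A)" by (cases a)
  show ?case
  proof (cases "A = carrier R")
    case True
    then have "cyclic_split K Z (P @ L)" using cyclic_split_drop[OF assms(1)] Cons.prems unfolding a by blast
    from Cons.IH[OF this] show ?thesis using a True by simp
  next
    case False
    have "cyclic_split K Z ((P @ [a]) @ L)" using Cons.prems by simp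
    from Cons.IH[OF this] show ?thesis using a False by simp
  qed
qed simp

lemma cyclic_split_normalize:
  assumes "Z \<subseteq> carrier F" "cyclic_split K Z L"
  shows "\<exists>L'. cyclic_split K Z L' \<and> descending L' \<and> (\<forall>p\<in>set L'. snd p \<noteq> carrier R)"
proof -
  obtain L' where L': "cyclic_split K Z L'" "descending L'"
    using cyclic_split_sort[OF assms(1), of K "[]" L] assms(2) by auto
  have "cyclic_split K Z (filter (\<lambda>p. snd p \<noteq> carrier R) L')"
    using cyclic_split_filter[OF assms(1), of K "[]" L'] L'(1) by simp
  then show ?thesis using sorted_wrt_filter[OF L'(2)] by (intro exI[of _ "filter (\<lambda>p. snd p \<noteq> carrier R) L'"]) auto
qed

end

section \<open>Presentations\<close>

lemma restrict_eq_iff: "restrict f A = restrict g A \<longleftrightarrow> (\<forall>x\<in>A. f x = g x)"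
  by (auto simp: fun_eq_iff restrict_def)

text \<open>The isomorphism sends \<open>f x\<close> to \<open>g x\<close>. Comparing fibres
  replaces the passage through a quotient module of \<open>F\<close>.\<close>

lemma isomorphic_of_same_fibres:
  assumes F: "module R F" and f: "f \<in> module_hom R F M" "f ` carrier F = carrier M"
    and g: "g \<in> module_hom R F N" "g ` carrier F = carrier N"
    and eq: "\<And>x y. x \<in> carrier F \<Longrightarrow> y \<in> carrier F \<Longrightarrow> f x = f y \<longleftrightarrow> g x = g y"
  shows "isomorphic_modules R M N"
proof -
  interpret module R F by fact
  let ?h = "\<lambda>y. g (inv_into (carrier F) f y)"
  have h: "?h (f x) = g x" if "x \<in> carrier F" for x
  proof -
    have "f x \<in> f ` carrier F" using that by blast
    then show ?thesis using eq[OF inv_into_into that] f_inv_into_f by metis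
  qed
  have im: "\<exists>x\<in>carrier F. y = f x" if "y \<in> carrier M" for y using that f(2) by blast
  have "?h \<in> module_hom R M N"
  proof (rule module_homI)
    fix y z assume "y \<in> carrier M" "z \<in> carrier M"
    then obtain u v where uv: "u \<in> carrier F" "v \<in> carrier F" "y = f u" "z = f v" using im by blast
    have "y \<oplus>\<^bsub>M\<^esub> z = f (u \<oplus>\<^bsub>F\<^esub> v)" using module_homD(2)[OF f(1) uv(1,2)] uv by simp
    then show "?h (y \<oplus>\<^bsub>M\<^esub> z) = ?h y \<oplus>\<^bsub>N\<^esub> ?h z"
      using h uv module_homD(2)[OF g(1) uv(1,2)] by simp
  next
    fix r y assume r: "r \<in> carrier R" and "y \<in> carrier M"
    then obtain u where u: "u \<in> carrier F" "y = f u" using im by blast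
    have "r \<odot>\<^bsub>M\<^esub> y = f (r \<odot>\<^bsub>F\<^esub> u)" using module_homD(3)[OF f(1) r u(1)] u by simp
    then show "?h (r \<odot>\<^bsub>M\<^esub> y) = r \<odot>\<^bsub>N\<^esub> ?h y"
      using h u r module_homD(3)[OF g(1) r u(1)] by simp
  next
    fix y assume "y \<in> carrier M"
    then obtain u where "u \<in> carrier F" "y = f u" using im by blast
    then show "?h y \<in> carrier N" using h module_homD(1)[OF g(1)] by simp
  qed
  moreover have "bij_betw ?h (carrier M) (carrier N)"
    unfolding bij_betw_def
  proof
    show "inj_on ?h (carrier M)"
    proof (rule inj_onI)
      fix y z assume yz: "y \<in> carrier M" "z \<in> carrier M" "?h y = ?h z"
      then obtain u v where uv: "u \<in> carrier F" "v \<in> carrier F" "y = f u" "z = f v" using im by blast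
      have "g u = g v" using yz(3) unfolding uv(3,4) h[OF uv(1)] h[OF uv(2)] .
      then show "y = z" unfolding uv(3,4) using eq[OF uv(1,2)] by blast
    qed
    have "?h ` carrier M = (\<lambda>x. ?h (f x)) ` carrier F" unfolding f(2)[symmetric] image_image ..
    also have "\<dots> = g ` carrier F" using h by (intro image_cong) auto
    finally show "?h ` carrier M = carrier N" using g(2) by simp
  qed
  ultimately show ?thesis unfolding isomorphic_modules_def module_iso_def by blast
qed

lemma a_kernel_eq: "a_kernel F M f = {x \<in> carrier F. f x = \<zero>\<^bsub>M\<^esub>}"
  by (simp add: a_kernel_def kernel_def)

lemma module_hom_minus:
  assumes F: "module R F" and M: "module R M" and f: "f \<in> module_hom R F M"
  shows "f \<zero>\<^bsub>F\<^esub> = \<zero>\<^bsub>M\<^esub>"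
    and "x \<in> carrier F \<Longrightarrow> y \<in> carrier F \<Longrightarrow> f (x \<ominus>\<^bsub>F\<^esub> y) = f x \<ominus>\<^bsub>M\<^esub> f y"
proof -
  interpret F: module R F by fact
  interpret M: module R M by fact
  show "f \<zero>\<^bsub>F\<^esub> = \<zero>\<^bsub>M\<^esub>"
    using module_homD(3)[OF f F.R.zero_closed F.M.zero_closed] module_homD(1)[OF f F.M.zero_closed] by simp
  assume x: "x \<in> carrier F" and y: "y \<in> carrier F"
  have "f (\<ominus>\<^bsub>F\<^esub> y) = \<ominus>\<^bsub>M\<^esub> f y"
    using module_homD(3)[OF f _ y, of "\<ominus>\<^bsub>R\<^esub> \<one>\<^bsub>R\<^esub>"] module_homD(1)[OF f y] y
    by (simp add: F.smult_l_minus M.smult_l_minus)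
  then show "f (x \<ominus>\<^bsub>F\<^esub> y) = f x \<ominus>\<^bsub>M\<^esub> f y"
    using module_homD(2)[OF f x F.M.a_inv_closed[OF y]] by (simp add: a_minus_def)
qed

context cring
begin

lemma free_module_simps:
  "carrier (free_module R {..<n::nat}) = {..<n} \<rightarrow>\<^sub>E carrier R"
  "x \<oplus>\<^bsub>free_module R {..<n}\<^esub> y = (\<lambda>i\<in>{..<n}. x i \<oplus> y i)"
  "r \<odot>\<^bsub>free_module R {..<n}\<^esub> x = (\<lambda>i\<in>{..<n}. r \<otimes> x i)"
  "\<zero>\<^bsub>free_module R {..<n}\<^esub> = (\<lambda>i\<in>{..<n}. \<zero>)"
  by (auto simp: free_module_def direct_sum_def regular_module_def)

lemma PiE_eqI:
  assumes "x \<in> {..<n::nat} \<rightarrow>\<^sub>E A" "y \<in> {..<n} \<rightarrow>\<^sub>E B" "\<And>i. i < n \<Longrightarrow> x i = y i" shows "x = y"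
  by (rule extensionalityI[of _ "{..<n}"]) (use assms in \<open>auto simp: PiE_def\<close>)

lemma free_module_is_module: "module R (free_module R {..<n::nat})"
proof (rule moduleI)
  let ?V = "free_module R {..<n}"
  have mem: "x i \<in> carrier R" if "x \<in> carrier ?V" "i < n" for x i
    using that by (auto simp: free_module_simps)
  have eqI: "x = y" if "x \<in> carrier ?V" "y \<in> carrier ?V" "\<And>i. i < n \<Longrightarrow> x i = y i" for x y
    using that by (intro PiE_eqI) (auto simp: free_module_simps)
  have a: "x \<oplus>\<^bsub>?V\<^esub> y \<in> carrier ?V" if "x \<in> carrier ?V" "y \<in> carrier ?V" for x y
    using that mem by (auto simp: free_module_simps)
  have s: "r \<odot>\<^bsub>?V\<^esub> x \<in> carrier ?V" if "r \<in> carrier R" "x \<in> carrier ?V" for r x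
    using that mem by (auto simp: free_module_simps)
  have z: "\<zero>\<^bsub>?V\<^esub> \<in> carrier ?V" by (auto simp: free_module_simps)
  have ev: "(x \<oplus>\<^bsub>?V\<^esub> y) i = x i \<oplus> y i" "(r \<odot>\<^bsub>?V\<^esub> x) i = r \<otimes> x i" "\<zero>\<^bsub>?V\<^esub> i = \<zero>" if "i < n" for x y r i
    using that by (simp_all add: free_module_simps)
  show "cring R" by (rule is_cring)
  show "abelian_group ?V"
  proof (rule abelian_groupI)
    fix x assume x: "x \<in> carrier ?V"
    have "(\<ominus> \<one>) \<odot>\<^bsub>?V\<^esub> x \<oplus>\<^bsub>?V\<^esub> x = \<zero>\<^bsub>?V\<^esub>"
      using x a s z mem[OF x] by (intro eqI) (simp_all add: ev l_minus l_neg)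
    then show "\<exists>y\<in>carrier ?V. y \<oplus>\<^bsub>?V\<^esub> x = \<zero>\<^bsub>?V\<^esub>" using s[OF _ x, of "\<ominus> \<one>"] by blast
  next
    show "x \<oplus>\<^bsub>?V\<^esub> y \<oplus>\<^bsub>?V\<^esub> w = x \<oplus>\<^bsub>?V\<^esub> (y \<oplus>\<^bsub>?V\<^esub> w)"
      if "x \<in> carrier ?V" "y \<in> carrier ?V" "w \<in> carrier ?V" for x y w
      using that a mem by (intro eqI) (simp_all add: ev a_assoc)
    show "x \<oplus>\<^bsub>?V\<^esub> y = y \<oplus>\<^bsub>?V\<^esub> x" if "x \<in> carrier ?V" "y \<in> carrier ?V" for x y
      using that a mem by (intro eqI) (simp_all add: ev a_comm)
    show "\<zero>\<^bsub>?V\<^esub> \<oplus>\<^bsub>?V\<^esub> x = x" if "x \<in> carrier ?V" for x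
      using that a z mem by (intro eqI) (simp_all add: ev)
  qed (rule a z; assumption)+
  show "r \<odot>\<^bsub>?V\<^esub> x \<in> carrier ?V" if "r \<in> carrier R" "x \<in> carrier ?V" for r x by (rule s[OF that])
  show "(r \<oplus> t) \<odot>\<^bsub>?V\<^esub> x = r \<odot>\<^bsub>?V\<^esub> x \<oplus>\<^bsub>?V\<^esub> t \<odot>\<^bsub>?V\<^esub> x"
    if "r \<in> carrier R" "t \<in> carrier R" "x \<in> carrier ?V" for r t x
    using that a s mem by (intro eqI) (simp_all add: ev l_distr)
  show "r \<odot>\<^bsub>?V\<^esub> (x \<oplus>\<^bsub>?V\<^esub> y) = r \<odot>\<^bsub>?V\<^esub> x \<oplus>\<^bsub>?V\<^esub> r \<odot>\<^bsub>?V\<^esub> y"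
    if "r \<in> carrier R" "x \<in> carrier ?V" "y \<in> carrier ?V" for r x y
    using that a s mem by (intro eqI) (simp_all add: ev r_distr)
  show "(r \<otimes> t) \<odot>\<^bsub>?V\<^esub> x = r \<odot>\<^bsub>?V\<^esub> (t \<odot>\<^bsub>?V\<^esub> x)"
    if "r \<in> carrier R" "t \<in> carrier R" "x \<in> carrier ?V" for r t x
    using that a s mem by (intro eqI) (simp_all add: ev m_assoc)
  show "\<one> \<odot>\<^bsub>?V\<^esub> x = x" if "x \<in> carrier ?V" for x
    using that s mem by (intro eqI) (simp_all add: ev)
qed

end

context almost_local_global
begin

lemma free_module_coords:
  assumes F: "module R F" and \<psi>: "\<psi> \<in> module_iso R (free_module R {..<n::nat}) F"
  shows "\<exists>\<xi>. coord_module R F n \<xi>"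
proof -
  let ?V = "free_module R {..<n}"
  interpret V: module R ?V by (rule free_module_is_module)
  interpret F: plain_module R F using F by (simp add: plain_module_def)
  let ?g = "inv_into (carrier ?V) \<psi>"
  have g: "?g \<in> module_hom R F ?V" using module_iso_inv[OF \<psi>] by (simp add: module_iso_def)
  have bij: "bij_betw \<psi> (carrier ?V) (carrier F)" using \<psi> by (simp add: module_iso_def)
  have inv: "?g (\<psi> v) = v" "\<psi> v \<in> carrier F" if "v \<in> carrier ?V" for v
    using bij that by (auto simp: bij_betw_def)
  have inv': "\<psi> (?g x) = x" if "x \<in> carrier F" for x
    using f_inv_into_f[of x \<psi> "carrier ?V"] bij that by (simp add: bij_betw_def)
  have gV: "?g x \<in> {..<n} \<rightarrow>\<^sub>E carrier R" if "x \<in> carrier F" for x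
    using module_homD(1)[OF g that] by (simp add: free_module_simps)
  have "coord_module R F n (\<lambda>i x. ?g x i)"
  proof (intro coord_module.intro almost_local_global_axioms F.plain_module_axioms coord_module_axioms.intro)
    fix i assume i: "i < n"
    show "F.functional (\<lambda>x. ?g x i)"
    proof (rule F.functionalI)
      show "?g x i \<in> carrier R" if "x \<in> carrier F" for x using gV[OF that] i by auto
    qed (use i module_homD(2,3)[OF g] in \<open>auto simp: free_module_simps\<close>)
  next
    fix x y assume xy: "x \<in> carrier F" "y \<in> carrier F" "\<And>i. i < n \<Longrightarrow> ?g x i = ?g y i"
    have "?g x = ?g y" using PiE_eqI[OF gV[OF xy(1)] gV[OF xy(2)] xy(3)] .
    then have "\<psi> (?g x) = \<psi> (?g y)" by (rule arg_cong)
    then show "x = y" unfolding inv'[OF xy(1)] inv'[OF xy(2)] .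
  next
    fix a :: "nat \<Rightarrow> 'a" assume a: "\<And>i. i < n \<Longrightarrow> a i \<in> carrier R"
    let ?v = "\<lambda>i\<in>{..<n}. a i"
    have v: "?v \<in> carrier ?V" using a by (auto simp: free_module_simps)
    have "\<forall>i<n. ?g (\<psi> ?v) i = a i" unfolding inv(1)[OF v] by simp
    then show "\<exists>x\<in>carrier F. \<forall>i<n. ?g x i = a i" using inv(2)[OF v] by blast
  qed
  then show ?thesis by blast
qed

lemma free_module_self_coords: "\<exists>\<xi>. coord_module R (free_module R {..<n::nat}) n \<xi>"
proof (rule free_module_coords[OF free_module_is_module])
  show "(\<lambda>x. x) \<in> module_iso R (free_module R {..<n}) (free_module R {..<n})"
    by (auto simp: module_iso_def module_hom_def bij_betw_def)
qed

end

context coord_module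
begin

text \<open>The prescribed values are switched on one basis vector at a time, the others being sent
  to zero meanwhile.\<close>

lemma exists_hom:
  fixes P :: "('a, 'p) module"
  assumes P: "module R P" and p: "\<And>i. p i \<in> carrier P"
    and e: "\<And>j. e j \<in> carrier F" "\<And>i j. i < n \<Longrightarrow> \<xi> i (e j) = (if i = j then \<one> else \<zero>)"
  shows "\<exists>\<alpha>\<in>module_hom R F P. \<forall>i<n. \<alpha> (e i) = p i"
proof -
  interpret P: module R P by fact
  have "\<exists>\<alpha>\<in>module_hom R F P. \<forall>i<n. \<alpha> (e i) = (if i < k then p i else \<zero>\<^bsub>P\<^esub>)" if "k \<le> n" for k
    using that
  proof (induction k)
    case 0
    have "(\<lambda>x. \<zero>\<^bsub>P\<^esub>) \<in> module_hom R F P" by (rule module_homI) auto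
    then show ?case by (rule rev_bexI) simp
  next
    case (Suc k)
    then obtain \<alpha> where \<alpha>: "\<alpha> \<in> module_hom R F P" "\<forall>i<n. \<alpha> (e i) = (if i < k then p i else \<zero>\<^bsub>P\<^esub>)" by (auto dest: Suc_leD)
    have k: "k < n" using Suc by simp
    let ?\<alpha> = "\<lambda>x. \<alpha> x \<oplus>\<^bsub>P\<^esub> \<xi> k x \<odot>\<^bsub>P\<^esub> p k"
    have "?\<alpha> \<in> module_hom R F P"
    proof (rule module_homI)
      show "?\<alpha> x \<in> carrier P" if "x \<in> carrier F" for x using module_homD(1)[OF \<alpha>(1) that] that k p by simp
      show "?\<alpha> (x \<oplus>\<^bsub>F\<^esub> y) = ?\<alpha> x \<oplus>\<^bsub>P\<^esub> ?\<alpha> y" if "x \<in> carrier F" "y \<in> carrier F" for x y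
        using module_homD(1,2)[OF \<alpha>(1)] that k p by (simp add: P.smult_l_distr P.M.a_ac)
      show "?\<alpha> (r \<odot>\<^bsub>F\<^esub> x) = r \<odot>\<^bsub>P\<^esub> ?\<alpha> x" if "r \<in> carrier R" "x \<in> carrier F" for r x
        using module_homD(1,3)[OF \<alpha>(1)] that k p by (simp add: P.smult_r_distr P.smult_assoc1)
    qed
    moreover have "?\<alpha> (e i) = (if i < Suc k then p i else \<zero>\<^bsub>P\<^esub>)" if i: "i < n" for i
      using \<alpha>(2) i e(2)[OF k, of i] p by (auto simp: less_Suc_eq)
    ultimately show ?case by (intro bexI[of _ ?\<alpha>] allI impI)
  qed
  from this[of n] obtain \<alpha> where "\<alpha> \<in> module_hom R F P"
    "\<forall>i<n. \<alpha> (e i) = (if i < n then p i else \<zero>\<^bsub>P\<^esub>)" by auto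
  then show ?thesis by (intro bexI[of _ \<alpha>]) simp_all
qed

lemma diff_add_same: "x \<in> carrier F \<Longrightarrow> y \<in> carrier F \<Longrightarrow> (x \<ominus>\<^bsub>F\<^esub> y) \<oplus>\<^bsub>F\<^esub> y = x"
  by (simp add: a_minus_def M.a_assoc M.l_neg)

text \<open>The comparison of two presentations underlying Schanuel's lemma.\<close>

lemma kernel_fg:
  assumes M: "finitely_presented R M" and \<pi>: "\<pi> \<in> module_hom R F M" "\<pi> ` carrier F = carrier M"
  shows "finitely_generated_submodule (a_kernel F M \<pi>) R F"
proof -
  obtain k f where Mm: "module R M" and f: "f \<in> module_hom R (free_module R {..<k::nat}) M"
    "f ` carrier (free_module R {..<k}) = carrier M"
    and K: "finitely_generated_submodule (a_kernel (free_module R {..<k}) M f) R (free_module R {..<k})"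
    using M unfolding finitely_presented_def by blast
  let ?P = "free_module R {..<k}"
  obtain \<zeta> where "coord_module R ?P k \<zeta>" using free_module_self_coords by blast
  then interpret P: coord_module R ?P k \<zeta> .
  interpret M: module R M by fact
  have Fm: "module R F" and Pm: "module R ?P" using module_axioms P.module_axioms by auto
  obtain e where e: "\<And>j. e j \<in> carrier F" "\<And>i j. i < n \<Longrightarrow> \<xi> i (e j) = (if i = j then \<one> else \<zero>)"
    "\<And>N x. submodule N R F \<Longrightarrow> x \<in> carrier F \<Longrightarrow> (\<And>i. i < n \<Longrightarrow> \<xi> i x \<odot>\<^bsub>F\<^esub> e i \<in> N) \<Longrightarrow> x \<in> N"
    using coord_basis by blast
  obtain e' where e'0: "\<forall>j. e' j \<in> carrier ?P" "\<forall>i<k. \<forall>j. \<zeta> i (e' j) = (if i = j then \<one> else \<zero>)"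
    "\<forall>N x. submodule N R ?P \<longrightarrow> x \<in> carrier ?P \<longrightarrow> (\<forall>i<k. \<zeta> i x \<odot>\<^bsub>?P\<^esub> e' i \<in> N) \<longrightarrow> x \<in> N"
    using P.coord_basis by (elim exE conjE)
  have e'1: "e' j \<in> carrier ?P" for j using e'0(1) by blast
  have e'2: "\<zeta> i (e' j) = (if i = j then \<one> else \<zero>)" if "i < k" for i j using e'0(2) that by blast
  have e'3: "x \<in> N" if "submodule N R ?P" "x \<in> carrier ?P" "\<And>i. i < k \<Longrightarrow> \<zeta> i x \<odot>\<^bsub>?P\<^esub> e' i \<in> N" for N x
    using e'0(3)[rule_format, OF that] .
  note e' = e'1 e'2 e'3
  have "\<exists>y\<in>carrier ?P. f y = \<pi> (e j)" for j
  proof -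
    have "\<pi> (e j) \<in> f ` carrier ?P" unfolding f(2) using module_homD(1)[OF \<pi>(1) e(1)] .
    then show ?thesis by auto
  qed
  then obtain p where p: "\<And>j. p j \<in> carrier ?P" "\<And>j. f (p j) = \<pi> (e j)" by metis
  have "\<exists>y\<in>carrier F. \<pi> y = f (e' j)" for j
  proof -
    have "f (e' j) \<in> \<pi> ` carrier F" unfolding \<pi>(2) using module_homD(1)[OF f(1) e'(1)] .
    then show ?thesis by auto
  qed
  then obtain p' where p': "\<And>j. p' j \<in> carrier F" "\<And>j. \<pi> (p' j) = f (e' j)" by metis
  obtain \<alpha> where \<alpha>: "\<alpha> \<in> module_hom R F ?P" "\<And>i. i < n \<Longrightarrow> \<alpha> (e i) = p i"
  proof -
    have "\<exists>\<alpha>\<in>module_hom R F ?P. \<forall>i<n. \<alpha> (e i) = p i" by (rule exists_hom[OF Pm p(1) e(1)]) (rule e(2))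
    then show ?thesis using that by blast
  qed
  obtain \<beta> where \<beta>: "\<beta> \<in> module_hom R ?P F" "\<And>i. i < k \<Longrightarrow> \<beta> (e' i) = p' i"
  proof -
    have "\<exists>\<beta>\<in>module_hom R ?P F. \<forall>i<k. \<beta> (e' i) = p' i" by (rule P.exists_hom[OF Fm p'(1) e'(1)]) (rule e'(2))
    then show ?thesis using that by blast
  qed
  have f\<alpha>: "f (\<alpha> x) = \<pi> x" if "x \<in> carrier F" for x
  proof -
    have "submodule {x \<in> carrier F. f (\<alpha> x) = \<pi> x} R F"
      using module_homD[OF f(1)] module_homD[OF \<alpha>(1)] module_homD[OF \<pi>(1)]
        module_hom_minus(1)[OF Fm Mm \<pi>(1)] module_hom_minus(1)[OF Fm Pm \<alpha>(1)] module_hom_minus(1)[OF Pm Mm f(1)]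
      by (intro submodule_of_closed) auto
    then have "x \<in> {x \<in> carrier F. f (\<alpha> x) = \<pi> x}"
    proof (rule e(3)[OF _ that])
      fix i assume i: "i < n"
      show "\<xi> i x \<odot>\<^bsub>F\<^esub> e i \<in> {x \<in> carrier F. f (\<alpha> x) = \<pi> x}"
        using i that e(1) p \<alpha>(2) module_homD(3)[OF f(1)] module_homD(3)[OF \<alpha>(1)] module_homD(3)[OF \<pi>(1)] by simp
    qed
    then show ?thesis by simp
  qed
  have \<pi>\<beta>: "\<pi> (\<beta> x) = f x" if "x \<in> carrier ?P" for x
  proof -
    have "submodule {x \<in> carrier ?P. \<pi> (\<beta> x) = f x} R ?P"
      using module_homD[OF f(1)] module_homD[OF \<beta>(1)] module_homD[OF \<pi>(1)]
        module_hom_minus(1)[OF Fm Mm \<pi>(1)] module_hom_minus(1)[OF Pm Fm \<beta>(1)] module_hom_minus(1)[OF Pm Mm f(1)]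
      by (intro P.submodule_of_closed) auto
    then have "x \<in> {x \<in> carrier ?P. \<pi> (\<beta> x) = f x}"
    proof (rule e'(3)[OF _ that])
      fix i assume i: "i < k"
      show "\<zeta> i x \<odot>\<^bsub>?P\<^esub> e' i \<in> {x \<in> carrier ?P. \<pi> (\<beta> x) = f x}"
        using i that e'(1) p' \<beta>(2) module_homD(3)[OF f(1)] module_homD(3)[OF \<beta>(1)] module_homD(3)[OF \<pi>(1)] by simp
    qed
    then show ?thesis by simp
  qed
  \<comment> \<open>Both \<open>\<alpha>\<close> and \<open>\<beta>\<close> lift the identity of
    \<open>M\<close>, so \<open>?\<delta> = 1 - \<beta> \<alpha>\<close> maps \<open>F\<close> into
    \<open>?H\<close>. For \<open>x\<close> in \<open>?H\<close>, \<open>x\<close> is the sum of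
    \<open>?\<delta> x\<close> and \<open>\<beta> (\<alpha> x)\<close> with
    \<open>\<alpha> x\<close> in \<open>?K\<close>. So the images of generators of \<open>?K\<close>
    and the \<open>?\<delta> (e i)\<close> generate \<open>?H\<close>.\<close>
  let ?K = "a_kernel ?P M f" and ?H = "a_kernel F M \<pi>" and ?\<delta> = "\<lambda>x. x \<ominus>\<^bsub>F\<^esub> \<beta> (\<alpha> x)"
  obtain T where T: "submodule ?K R ?P" "finite T" "T \<subseteq> ?K" "\<And>N'. submodule N' R ?P \<Longrightarrow> T \<subseteq> N' \<Longrightarrow> ?K \<subseteq> N'"
    using P.fg_submoduleE[OF K] by metis
  have KP: "?K \<subseteq> carrier ?P" by (auto simp: a_kernel_eq)
  have "endo (\<lambda>x. \<beta> (\<alpha> x))"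
    using module_homD[OF \<alpha>(1)] module_homD[OF \<beta>(1)] by (intro endoI) simp_all
  then have \<delta>: "endo ?\<delta>" by (intro endo_minus endo_id)
  have H: "submodule ?H R F"
    unfolding a_kernel_eq using module_homD[OF \<pi>(1)] module_hom_minus(1)[OF Fm Mm \<pi>(1)]
    by (intro submodule_of_closed) auto
  have \<beta>K: "\<beta> x \<in> ?H" if "x \<in> ?K" for x
    using that \<pi>\<beta> module_homD(1)[OF \<beta>(1)] by (auto simp: a_kernel_eq)
  have \<delta>H: "?\<delta> x \<in> ?H" if "x \<in> carrier F" for x
  proof -
    have "\<pi> (?\<delta> x) = \<pi> x \<ominus>\<^bsub>M\<^esub> \<pi> (\<beta> (\<alpha> x))"
      using module_hom_minus(2)[OF Fm Mm \<pi>(1) that] module_homD(1)[OF \<beta>(1) module_homD(1)[OF \<alpha>(1) that]] .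
    also have "\<dots> = \<zero>\<^bsub>M\<^esub>" using \<pi>\<beta>[OF module_homD(1)[OF \<alpha>(1) that]] f\<alpha>[OF that] module_homD(1)[OF \<pi>(1) that]
      by (simp add: a_minus_def M.M.r_neg)
    finally show ?thesis using endoD(1)[OF \<delta> that] by (simp add: a_kernel_eq)
  qed
  show ?thesis
  proof (rule fg_submoduleI[OF H, of "\<beta> ` T \<union> (\<lambda>i. ?\<delta> (e i)) ` {..<n}"])
    show "finite (\<beta> ` T \<union> (\<lambda>i. ?\<delta> (e i)) ` {..<n})" using T(2) by simp
    show "\<beta> ` T \<union> (\<lambda>i. ?\<delta> (e i)) ` {..<n} \<subseteq> ?H" using T(3) \<beta>K \<delta>H[OF e(1)] by blast
    fix N assume N: "submodule N R F" "\<beta> ` T \<union> (\<lambda>i. ?\<delta> (e i)) ` {..<n} \<subseteq> N"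
    have "submodule {y \<in> carrier ?P. \<beta> y \<in> N} R ?P"
      using module_homD[OF \<beta>(1)] module_hom_minus(1)[OF Pm Fm \<beta>(1)] submoduleD(2-4)[OF N(1)]
      by (intro P.submodule_of_closed) auto
    then have KN: "?K \<subseteq> {y \<in> carrier ?P. \<beta> y \<in> N}" using T(3) KP N(2) by (intro T(4)) auto
    show "?H \<subseteq> N"
    proof
      fix x assume "x \<in> ?H"
      then have x: "x \<in> carrier F" "\<pi> x = \<zero>\<^bsub>M\<^esub>" by (auto simp: a_kernel_eq)
      have aP: "\<alpha> x \<in> carrier ?P" using module_homD(1)[OF \<alpha>(1) x(1)] .
      have "\<alpha> x \<in> ?K" using f\<alpha>[OF x(1)] x(2) aP by (simp add: a_kernel_eq)
      then have 1: "\<beta> (\<alpha> x) \<in> N" using KN by blast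
      have "x \<in> {x \<in> carrier F. ?\<delta> x \<in> N}"
      proof (rule e(3)[OF submodule_endo_vimage[OF \<delta> N(1)] x(1)])
        fix i assume i: "i < n"
        have "?\<delta> (\<xi> i x \<odot>\<^bsub>F\<^esub> e i) = \<xi> i x \<odot>\<^bsub>F\<^esub> ?\<delta> (e i)" using endoD(3)[OF \<delta> coord(1)[OF i x(1)] e(1)] .
        moreover have "\<xi> i x \<odot>\<^bsub>F\<^esub> ?\<delta> (e i) \<in> N"
          using N(2) i by (intro submoduleD(4)[OF N(1) coord(1)[OF i x(1)]]) blast
        ultimately show "\<xi> i x \<odot>\<^bsub>F\<^esub> e i \<in> {x \<in> carrier F. ?\<delta> x \<in> N}" using e(1) i x(1) by simp
      qed
      then have "?\<delta> x \<oplus>\<^bsub>F\<^esub> \<beta> (\<alpha> x) \<in> N" using 1 submoduleD(3)[OF N(1)] by blast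
      moreover have "?\<delta> x \<oplus>\<^bsub>F\<^esub> \<beta> (\<alpha> x) = x"
        using diff_add_same[OF x(1) module_homD(1)[OF \<beta>(1) aP]] .
      ultimately show "x \<in> N" by simp
    qed
  qed
qed

lemma exists_stacked_carrier:
  assumes H: "finitely_generated_submodule H R F"
  shows "\<exists>N m \<mu> I g. stacked (carrier F) H (carrier R) N m \<mu> I g"
proof -
  have HF: "H \<subseteq> carrier F" using submoduleD(1)[OF fg_submodule[OF H]] by blast
  have C: "content H \<subseteq> carrier R" using ideal_memD[OF content_ideal[OF HF]] by blast
  show ?thesis
    by (rule exists_stacked[OF rank_le_coords[OF order_refl] carrier_is_submodule _ carrier_fg, of \<one> H])
      (use H HF C regular_carrier in \<open>auto simp: pure_def idem_elem_def\<close>)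
qed

lemma stackedD:
  assumes "stacked G H A N m \<mu> I g"
  shows "m \<le> N" "splits N \<mu> G" "\<forall>j<N. component_support (\<mu> j) G (g j)"
    "\<forall>j<m. regular_ideal (I j) \<and> I j \<subseteq> A" "\<forall>i j. i \<le> j \<longrightarrow> j < m \<longrightarrow> I j \<subseteq> I i"
    "\<forall>x\<in>G. x \<in> H \<longleftrightarrow> (\<forall>j<m. \<mu> j x \<in> ideal_prod R (I j) (\<mu> j ` G)) \<and> (\<forall>j. m \<le> j \<longrightarrow> j < N \<longrightarrow> \<mu> j x = \<zero>)"
    "\<forall>j<m. \<forall>L. ideal L R \<longrightarrow> I j \<subseteq> L \<longrightarrow> \<mu> j ` G \<subseteq> L \<longrightarrow> g j \<in> L"
    "\<forall>i j. m \<le> i \<longrightarrow> i \<le> j \<longrightarrow> j < N \<longrightarrow> g j \<otimes> g i = g j"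
  using assms unfolding stacked_def by - (elim conjE, assumption)+

text \<open>The functionals \<open>\<mu> j\<close> are the components of the isomorphism, and
  \<open>J j\<close> is the image of \<open>F\<close> under \<open>\<mu> j\<close>.\<close>

lemma stacked_bases:
  assumes H: "finitely_generated_submodule H R F"
  shows "\<exists>(N::nat) (m::nat) J I \<phi>. m \<le> N \<and> (\<forall>j<N. finitely_generated_ideal (J j) R) \<and>
     (\<forall>j<m. invertible_ideal (I j) R) \<and> (\<forall>i j. i \<le> j \<longrightarrow> j < m \<longrightarrow> I j \<subseteq> I i) \<and>
     \<phi> \<in> module_iso R F (direct_sum {..<N} (\<lambda>j. ideal_module R (J j))) \<and>
     \<phi> ` H = (\<Pi>\<^sub>E j\<in>{..<N}. if j < m then ideal_prod R (I j) (J j) else {\<zero>})"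
proof -
  obtain N m \<mu> I g where st: "stacked (carrier F) H (carrier R) N m \<mu> I g" using exists_stacked_carrier[OF H] by blast
  note st = stackedD[OF st]
  have \<mu>: "functional (\<mu> j)" if "j < N" for j using st(2) that unfolding splits_def by blast
  have HF: "H \<subseteq> carrier F" using submoduleD(1)[OF fg_submodule[OF H]] by blast
  let ?J = "\<lambda>j. \<mu> j ` carrier F" and ?\<phi> = "\<lambda>x. \<lambda>j\<in>{..<N}. \<mu> j x"
  let ?T = "direct_sum {..<N} (\<lambda>j. ideal_module R (?J j))"
  have T: "carrier ?T = (\<Pi>\<^sub>E j\<in>{..<N}. ?J j)" "\<And>x y. x \<oplus>\<^bsub>?T\<^esub> y = (\<lambda>j\<in>{..<N}. x j \<oplus> y j)"
    "\<And>r x. r \<odot>\<^bsub>?T\<^esub> x = (\<lambda>j\<in>{..<N}. r \<otimes> x j)"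
    by (auto simp: direct_sum_def ideal_module_def regular_module_def)
  have J: "finitely_generated_ideal (?J j) R" if "j < N" for j using fg_functional_image[OF \<mu>[OF that] carrier_fg] .
  have surj: "\<exists>x\<in>carrier F. ?\<phi> x = y" if y: "y \<in> (\<Pi>\<^sub>E j\<in>{..<N}. ?J j)" for y
  proof -
    have "\<forall>j. \<exists>z\<in>carrier F. j < N \<longrightarrow> y j = \<mu> j z"
    proof
      fix j show "\<exists>z\<in>carrier F. j < N \<longrightarrow> y j = \<mu> j z"
      proof (cases "j < N")
        case True
        then have "y j \<in> ?J j" using PiE_mem[OF y, of j] by simp
        then show ?thesis by blast
      qed (use M.zero_closed in blast)
    qed
    then obtain z where z: "\<And>j. z j \<in> carrier F" "\<And>j. j < N \<Longrightarrow> y j = \<mu> j (z j)" by metis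
    then obtain x where x: "x \<in> carrier F" "\<forall>j<N. \<mu> j x = \<mu> j (z j)" using st(2) unfolding splits_def by blast
    have "?\<phi> x = y"
      using y x(2) z(2) by (intro extensionalityI[of _ "{..<N}"]) (auto simp: PiE_def)
    then show ?thesis using x(1) by blast
  qed
  have "?\<phi> \<in> module_iso R F ?T"
    unfolding module_iso_def
  proof (intro CollectI conjI module_homI)
    show "?\<phi> x \<in> carrier ?T" if "x \<in> carrier F" for x using that by (simp add: T(1) restrict_PiE_iff)
    show "?\<phi> (x \<oplus>\<^bsub>F\<^esub> y) = ?\<phi> x \<oplus>\<^bsub>?T\<^esub> ?\<phi> y" if "x \<in> carrier F" "y \<in> carrier F" for x y
      using that functionalD(2)[OF \<mu>] by (auto simp: T(2) restrict_eq_iff)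
    show "?\<phi> (r \<odot>\<^bsub>F\<^esub> x) = r \<odot>\<^bsub>?T\<^esub> ?\<phi> x" if "r \<in> carrier R" "x \<in> carrier F" for r x
      using that functionalD(3)[OF \<mu>] by (auto simp: T(3) restrict_eq_iff)
    show "bij_betw ?\<phi> (carrier F) (carrier ?T)"
      unfolding bij_betw_def
    proof
      show "inj_on ?\<phi> (carrier F)"
      proof (rule inj_onI)
        fix x y assume xy: "x \<in> carrier F" "y \<in> carrier F" "?\<phi> x = ?\<phi> y"
        have "\<mu> j (x \<ominus>\<^bsub>F\<^esub> y) = \<zero>" if j: "j < N" for j
        proof -
          have "\<mu> j x = \<mu> j y" using xy(3) j by (simp add: restrict_eq_iff)
          then show ?thesis using functionalD(1,6)[OF \<mu>[OF j]] xy(1,2) by (simp add: r_right_minus_eq)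
        qed
        then have 0: "x \<ominus>\<^bsub>F\<^esub> y = \<zero>\<^bsub>F\<^esub>" using st(2) xy(1,2) unfolding splits_def by simp
        have "(x \<ominus>\<^bsub>F\<^esub> y) \<oplus>\<^bsub>F\<^esub> y = x" using xy(1,2) by (simp add: a_minus_def M.a_assoc M.l_neg)
        then show "x = y" unfolding 0 using xy(2) by simp
      qed
      show "?\<phi> ` carrier F = carrier ?T" unfolding T(1)
      proof (intro subset_antisym subsetI)
        show "y \<in> (\<Pi>\<^sub>E j\<in>{..<N}. ?J j)" if "y \<in> ?\<phi> ` carrier F" for y
          using that by (elim imageE) (simp only: restrict_PiE_iff, blast)
        show "y \<in> ?\<phi> ` carrier F" if "y \<in> (\<Pi>\<^sub>E j\<in>{..<N}. ?J j)" for y using surj[OF that] by blast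
      qed
    qed
  qed
  moreover have "?\<phi> ` H = (\<Pi>\<^sub>E j\<in>{..<N}. if j < m then ideal_prod R (I j) (?J j) else {\<zero>})"
  proof (intro subset_antisym subsetI)
    fix y assume "y \<in> ?\<phi> ` H"
    then obtain x where x: "x \<in> H" "y = ?\<phi> x" by blast
    then have "(\<forall>j<m. \<mu> j x \<in> ideal_prod R (I j) (?J j)) \<and> (\<forall>j. m \<le> j \<longrightarrow> j < N \<longrightarrow> \<mu> j x = \<zero>)"
      using st(6) HF by blast
    then show "y \<in> (\<Pi>\<^sub>E j\<in>{..<N}. if j < m then ideal_prod R (I j) (?J j) else {\<zero>})"
      unfolding x(2) restrict_PiE_iff by simp
  next
    fix y assume y: "y \<in> (\<Pi>\<^sub>E j\<in>{..<N}. if j < m then ideal_prod R (I j) (?J j) else {\<zero>})"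
    have yj: "y j \<in> (if j < m then ideal_prod R (I j) (?J j) else {\<zero>})" if "j < N" for j
      using PiE_mem[OF y] that by simp
    have "y j \<in> ?J j" if j: "j < N" for j
    proof (cases "j < m")
      case True
      have "ideal_prod R (I j) (?J j) \<subseteq> I j \<inter> ?J j"
        using ideal_prod_inter[OF regular_idealD fg_ideal[OF J[OF j]]] st(4) True by blast
      then show ?thesis using yj[OF j] True by auto
    next
      case False
      then show ?thesis using yj[OF j] ideal_zero[OF fg_ideal[OF J[OF j]]] by simp
    qed
    then have "y \<in> (\<Pi>\<^sub>E j\<in>{..<N}. ?J j)" using y by (auto simp: PiE_iff)
    then obtain x where x: "x \<in> carrier F" "?\<phi> x = y" using surj by blast
    have yx: "y j = \<mu> j x" if "j < N" for j using x(2) that by auto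
    have "(\<forall>j<m. \<mu> j x \<in> ideal_prod R (I j) (?J j)) \<and> (\<forall>j. m \<le> j \<longrightarrow> j < N \<longrightarrow> \<mu> j x = \<zero>)"
    proof (intro conjI allI impI)
      fix j assume j: "j < m"
      then have "j < N" using st(1) by simp
      then show "\<mu> j x \<in> ideal_prod R (I j) (?J j)" using yj[of j] yx[of j] j by simp
    next
      fix j assume "m \<le> j" "j < N"
      then show "\<mu> j x = \<zero>" using yj[of j] yx[of j] by simp
    qed
    then have "x \<in> H" using st(6) x(1) by blast
    then show "y \<in> ?\<phi> ` H" using x(2) by blast
  qed
  moreover have "\<forall>j<m. invertible_ideal (I j) R"
    using st(4) invertible_ideal_of_regular unfolding regular_ideal_def by blast
  moreover have "\<forall>j<N. finitely_generated_ideal (?J j) R" using J by (intro allI impI)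
  ultimately show ?thesis using st(1,5)
    by (intro exI[of _ N] exI[of _ m] exI[of _ ?J] exI[of _ I] exI[of _ ?\<phi>] conjI)
qed

end

section \<open>Decomposition of finitely presented modules\<close>

text \<open>The \<open>e i\<close> are the nonzero differences \<open>f (k - 1) (1 - f k)\<close>,
  with \<open>n i\<close> the index \<open>k\<close> itself. Thus \<open>e i\<close> lies under
  \<open>f 0, ..., f (n i - 1)\<close> and is orthogonal to all later \<open>f\<close>. The last
  clause replaces writing \<open>f k\<close> as the sum of the \<open>e i\<close> with
  \<open>k < n i\<close>.\<close>

lemma (in cring) idempotent_chain:
  fixes f :: "nat \<Rightarrow> 'a"
  assumes f: "\<And>k. idem_elem R (f k)" "\<And>k l. k \<le> l \<Longrightarrow> f l \<otimes> f k = f l" and q: "f q = \<zero>"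
  shows "\<exists>(p::nat) n e. strict_mono_on {..<p} n \<and>
    (\<forall>i<p. 0 < n i \<and> n i \<le> q \<and> idem_elem R (e i) \<and> e i \<noteq> \<zero> \<and> (\<forall>k<n i. e i \<otimes> f k = e i)) \<and>
    (\<forall>i<p. \<forall>j<p. i \<noteq> j \<longrightarrow> e i \<otimes> e j = \<zero>) \<and>
    (\<forall>k. \<forall>y\<in>carrier R. f k \<otimes> y = y \<longrightarrow> (\<forall>i<p. k < n i \<longrightarrow> e i \<otimes> y = \<zero>) \<longrightarrow> y = \<zero>)"
proof -
  \<comment> \<open>Truncated subtraction makes the value at \<open>k = 0\<close> equal to
    \<open>f 0 (1 - f 0)\<close>, which is zero; only indices from 1 on are used.\<close>
  let ?\<omega> = "\<lambda>k. f (k - 1) \<otimes> (\<one> \<ominus> f k)"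
  have fR [simp]: "f k \<in> carrier R" for k using f(1) by (simp add: idem_elem_def)
  have \<omega>R [simp]: "?\<omega> k \<in> carrier R" for k by simp
  have f': "f k \<otimes> f l = f l" if "k \<le> l" for k l using f(2)[OF that] by (simp add: m_comm)
  have \<omega>f: "?\<omega> l \<otimes> f k = ?\<omega> l" if "k < l" for k l
  proof -
    have "?\<omega> l \<otimes> f k = (f (l - 1) \<otimes> f k) \<otimes> (\<one> \<ominus> f l)" by (simp add: m_ac)
    then show ?thesis using f(2)[of k "l - 1"] that by simp
  qed
  have \<omega>f0: "?\<omega> l \<otimes> f k = \<zero>" if "l \<le> k" for k l
  proof -
    have "?\<omega> l \<otimes> f k = f (l - 1) \<otimes> (f k \<ominus> f l \<otimes> f k)" using fR[of l] fR[of k] fR[of "l - 1"] by algebra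
    then show ?thesis using f'[OF that] by (simp add: a_minus_def r_neg)
  qed
  have \<omega>\<omega>: "?\<omega> l \<otimes> ?\<omega> k = ?\<omega> l \<otimes> f (k - 1) \<ominus> (?\<omega> l \<otimes> f k) \<otimes> f (k - 1)" for k l
    using \<omega>R[of l] fR[of k] fR[of "k - 1"] by algebra
  have orth1: "?\<omega> l \<otimes> ?\<omega> k = \<zero>" if "l < k" for k l
    using that by (simp only: \<omega>\<omega> \<omega>f0[of l "k - 1"] \<omega>f0[of l k]) (simp add: a_minus_def)
  have orth: "?\<omega> l \<otimes> ?\<omega> k = \<zero>" if "l \<noteq> k" for k l
    using that orth1[of l k] orth1[of k l] m_comm[OF \<omega>R[of l] \<omega>R[of k]] by (metis linorder_neqE_nat)
  have idem: "idem_elem R (?\<omega> k)" if "0 < k" for k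
  proof -
    have "?\<omega> k \<otimes> ?\<omega> k = ?\<omega> k"
      unfolding \<omega>\<omega> \<omega>f0[OF order_refl] using \<omega>f[of "k - 1" k] that by (simp add: a_minus_def)
    then show ?thesis unfolding idem_elem_def by simp
  qed
  \<comment> \<open>Only the indices where the chain drops are kept, in increasing order, so the
    idempotents are nonzero and \<open>n\<close> is strictly increasing.\<close>
  define ks where "ks = filter (\<lambda>k. ?\<omega> k \<noteq> \<zero>) [1..<Suc q]"
  have set_ks: "set ks = {k. 0 < k \<and> k \<le> q \<and> ?\<omega> k \<noteq> \<zero>}" unfolding ks_def by (auto simp del: upt_Suc)
  have ks: "0 < ks ! i \<and> ks ! i \<le> q \<and> ?\<omega> (ks ! i) \<noteq> \<zero>" if "i < length ks" for i
    using nth_mem[OF that] unfolding set_ks by simp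
  have sorted: "sorted_wrt (<) ks" unfolding ks_def by (intro sorted_wrt_filter sorted_wrt_upt)
  have mono: "ks ! i < ks ! j" if "i < j" "j < length ks" for i j
    using sorted that by (simp add: sorted_wrt_iff_nth_less)
  have neq: "ks ! i \<noteq> ks ! j" if "i < length ks" "j < length ks" "i \<noteq> j" for i j
    using that mono[of i j] mono[of j i] by (metis linorder_neqE_nat less_irrefl)
  have zero: "y = \<zero>" if y: "y \<in> carrier R" "f k \<otimes> y = y" and a: "\<forall>i<length ks. k < ks ! i \<longrightarrow> ?\<omega> (ks ! i) \<otimes> y = \<zero>" for k y
  proof -
    have \<omega>0: "?\<omega> l \<otimes> y = \<zero>" if "k < l" "l \<le> q" for l
    proof (cases "?\<omega> l = \<zero>")
      case False
      then have "l \<in> set ks" using that unfolding set_ks by simp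
      then obtain i where "i < length ks" "ks ! i = l" by (metis in_set_conv_nth)
      then show ?thesis using a that(1) by blast
    qed (use y in simp)
    \<comment> \<open>If no difference beyond \<open>k\<close> sees \<open>y\<close>, every later
      \<open>f\<close> up to index \<open>q\<close> still fixes \<open>y\<close>; but
      \<open>f q = \<zero>\<close>.\<close>
    have stable: "f (k + d) \<otimes> y = y" if "k + d \<le> q" for d
      using that
    proof (induction d)
      case (Suc d)
      have diff_eq: "k + Suc d - 1 = k + d" by simp
      have "?\<omega> (k + Suc d) \<otimes> y = f (k + d) \<otimes> y \<ominus> f (k + d) \<otimes> f (k + Suc d) \<otimes> y"
        unfolding diff_eq using y(1) fR[of "k + d"] fR[of "k + Suc d"] by algebra
      moreover have "?\<omega> (k + Suc d) \<otimes> y = \<zero>" by (rule \<omega>0) (use Suc.prems in auto)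
      moreover have "f (k + d) \<otimes> y = y" using Suc by simp
      moreover have "f (k + d) \<otimes> f (k + Suc d) = f (k + Suc d)" using f' by simp
      ultimately have "\<zero> = y \<ominus> f (k + Suc d) \<otimes> y" by (simp only:)
      then show ?case using y(1) r_right_minus_eq[of y "f (k + Suc d) \<otimes> y"] fR[of "k + Suc d"] by (metis m_closed)
    qed (use y in simp)
    show ?thesis
    proof (cases "k \<le> q")
      case True
      then show ?thesis using stable[of "q - k"] q y(1) by simp
    next
      case False
      then have "f k = \<zero>" using f(2)[of q k] q by simp
      then show ?thesis using y by simp
    qed
  qed
  have "strict_mono_on {..<length ks} ((!) ks)" using mono by (auto intro!: strict_mono_onI)
  moreover have "\<forall>i<length ks. 0 < ks ! i \<and> ks ! i \<le> q \<and> idem_elem R (?\<omega> (ks ! i)) \<and> ?\<omega> (ks ! i) \<noteq> \<zero> \<and>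
    (\<forall>k<ks ! i. ?\<omega> (ks ! i) \<otimes> f k = ?\<omega> (ks ! i))"
    using ks idem \<omega>f by blast
  moreover have "\<forall>i<length ks. \<forall>j<length ks. i \<noteq> j \<longrightarrow> ?\<omega> (ks ! i) \<otimes> ?\<omega> (ks ! j) = \<zero>"
    using orth neq by blast
  moreover have "\<forall>k. \<forall>y\<in>carrier R. f k \<otimes> y = y \<longrightarrow> (\<forall>i<length ks. k < ks ! i \<longrightarrow> ?\<omega> (ks ! i) \<otimes> y = \<zero>) \<longrightarrow> y = \<zero>"
    using zero by blast
  ultimately show ?thesis
    by (intro exI[of _ "length ks"] exI[of _ "(!) ks"] exI[of _ "\<lambda>i. ?\<omega> (ks ! i)"] conjI)
qed

context semihereditary
begin

text \<open>Adding \<open>1 - g\<close> to \<open>I\<close> turns \<open>J / I J\<close> into the cyclic module \<open>R / A\<close>.\<close>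

lemma cyclic_quotient:
  assumes I: "regular_ideal I" and J: "finitely_generated_ideal J R" and g: "idem_elem R g" "\<And>c. c \<in> J \<Longrightarrow> g \<otimes> c = c"
    and comax: "\<And>L. ideal L R \<Longrightarrow> I \<subseteq> L \<Longrightarrow> J \<subseteq> L \<Longrightarrow> g \<in> L"
  shows "\<exists>A. regular_ideal A \<and> (\<forall>y\<in>J. y \<in> ideal_prod R I J \<longleftrightarrow> y \<in> A) \<and> (\<forall>r\<in>carrier R. \<exists>y\<in>J. y \<ominus> r \<in> A)"
proof -
  have Ii: "ideal I R" and Ji: "ideal J R" using regular_idealD[OF I] fg_ideal[OF J] by auto
  have gR: "g \<in> carrier R" "g \<otimes> g = g" using g(1) by (auto simp: idem_elem_def)
  let ?h = "\<one> \<ominus> g"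
  have hR: "?h \<in> carrier R" using gR by simp
  let ?B = "Idl {?h}" and ?A = "Idl (I \<union> Idl {?h})"
  have Bi: "ideal ?B R" and hB: "?h \<in> ?B" using genideal_ideal[of "{?h}"] genideal_self[of "{?h}"] hR by auto
  have sub: "I \<union> ?B \<subseteq> carrier R" using ideal_memD[OF Ii] ideal_memD[OF Bi] by blast
  have A: "ideal ?A R" and IA: "I \<subseteq> ?A" and BA: "?B \<subseteq> ?A" using genideal_ideal[OF sub] genideal_self[OF sub] by auto
  have "finitely_generated_ideal ?B R" using hR unfolding finitely_generated_ideal_def by (intro exI[of _ "{?h}"]) simp
  then have "finitely_generated_ideal ?A R" using fg_ideal_sum I unfolding regular_ideal_def by blast
  then have reg: "regular_ideal ?A" using I IA unfolding regular_ideal_def by blast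
  have P: "ideal (ideal_prod R I J) R" using ideal_prod_is_ideal[OF Ii Ji] .
  have "y \<in> ideal_prod R I J \<longleftrightarrow> y \<in> ?A" if y: "y \<in> J" for y
  proof
    assume "y \<in> ideal_prod R I J"
    then show "y \<in> ?A" using ideal_prod_inter[OF Ii Ji] IA by blast
  next
    \<comment> \<open>First \<open>y = g y\<close> lies in \<open>I\<close>. Then \<open>I\<close>
      and \<open>J\<close> both multiply \<open>y\<close> into \<open>IJ\<close>, and comaximality
      over \<open>g\<close> puts \<open>g y = y\<close> into it.\<close>
    assume yA: "y \<in> ?A"
    have yR: "y \<in> carrier R" using ideal_memD[OF Ji y] .
    have E: "ideal {r \<in> carrier R. g \<otimes> r \<in> I} R"
      using gR ideal_zero[OF Ii] ideal_add[OF Ii] ideal_mult[OF Ii]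
      by (intro ideal_of_closed) (auto simp: r_distr m_lcomm[of g])
    have "g \<otimes> ?h = \<zero>" using gR by (simp add: a_minus_def r_distr r_minus r_neg)
    then have "?B \<subseteq> {r \<in> carrier R. g \<otimes> r \<in> I}" using hR ideal_zero[OF Ii] by (intro genideal_minimal[OF E]) simp
    then have "?A \<subseteq> {r \<in> carrier R. g \<otimes> r \<in> I}"
      using gR ideal_memD[OF Ii] ideal_mult[OF Ii] by (intro genideal_minimal[OF E]) auto
    then have yI: "y \<in> I" using yA g(2)[OF y] by auto
    have D: "ideal {r \<in> carrier R. r \<otimes> y \<in> ideal_prod R I J} R"
      using yR ideal_zero[OF P] ideal_add[OF P] ideal_mult[OF P]
      by (intro ideal_of_closed) (auto simp: l_distr m_assoc)
    have "g \<in> {r \<in> carrier R. r \<otimes> y \<in> ideal_prod R I J}"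
    proof (rule comax[OF D])
      show "I \<subseteq> {r \<in> carrier R. r \<otimes> y \<in> ideal_prod R I J}"
        using y ideal_memD[OF Ii] by (auto intro: ideal_prod.prod)
      show "J \<subseteq> {r \<in> carrier R. r \<otimes> y \<in> ideal_prod R I J}"
        using yI yR ideal_memD[OF Ji] by (auto simp: m_comm[of _ y] intro: ideal_prod.prod)
    qed
    then show "y \<in> ideal_prod R I J" using g(2)[OF y] by simp
  qed
  moreover have "\<exists>y\<in>J. y \<ominus> r \<in> ?A" if r: "r \<in> carrier R" for r
  proof -
    \<comment> \<open>The ideal \<open>J + ?A\<close>. It contains \<open>I\<close> and
      \<open>J\<close>, hence \<open>g\<close>, and also \<open>1 - g\<close>; so it is all of
      \<open>R\<close>.\<close>
    let ?E = "{r \<in> carrier R. \<exists>y\<in>J. y \<ominus> r \<in> ?A}"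
    have JR: "y \<in> carrier R" if "y \<in> J" for y using ideal_memD[OF Ji that] .
    have mem0: "r \<in> ?E" if "r \<in> ?A" for r
    proof -
      have "\<zero> \<ominus> r \<in> ?A" using ideal_minus[OF A ideal_zero[OF A] that] .
      then show ?thesis using ideal_zero[OF Ji] ideal_memD[OF A that] by blast
    qed
    have E: "ideal ?E R"
    proof (rule ideal_of_closed)
      show "\<zero> \<in> ?E" using mem0[OF ideal_zero[OF A]] .
    next
      fix x x' assume "x \<in> ?E" "x' \<in> ?E"
      then obtain y y' where y: "x \<in> carrier R" "x' \<in> carrier R" "y \<in> J" "y' \<in> J" "y \<ominus> x \<in> ?A" "y' \<ominus> x' \<in> ?A" by blast
      have "(y \<oplus> y') \<ominus> (x \<oplus> x') = (y \<ominus> x) \<oplus> (y' \<ominus> x')" using y(1,2) JR[OF y(3)] JR[OF y(4)] by algebra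
      then have "(y \<oplus> y') \<ominus> (x \<oplus> x') \<in> ?A" using ideal_add[OF A y(5,6)] by simp
      then show "x \<oplus> x' \<in> ?E" using ideal_add[OF Ji y(3,4)] y(1,2) by blast
    next
      fix s x assume s: "s \<in> carrier R" and "x \<in> ?E"
      then obtain y where y: "x \<in> carrier R" "y \<in> J" "y \<ominus> x \<in> ?A" by blast
      have "s \<otimes> y \<ominus> s \<otimes> x = s \<otimes> (y \<ominus> x)" using s y(1) JR[OF y(2)] by algebra
      then have "s \<otimes> y \<ominus> s \<otimes> x \<in> ?A" using ideal_mult[OF A s y(3)] by simp
      then show "s \<otimes> x \<in> ?E" using ideal_mult[OF Ji s y(2)] y(1) s by blast
    qed blast
    have "I \<subseteq> ?E" using mem0 IA by blast
    moreover have "J \<subseteq> ?E"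
    proof
      fix y assume y: "y \<in> J"
      have "y \<ominus> y \<in> ?A" using JR[OF y] ideal_zero[OF A] by (simp add: a_minus_def r_neg)
      then show "y \<in> ?E" using y JR[OF y] by blast
    qed
    ultimately have "g \<in> ?E" by (rule comax[OF E])
    moreover have "?h \<in> ?E" using mem0 hB BA by blast
    ultimately have "g \<oplus> ?h \<in> ?E" by (rule ideal_add[OF E])
    moreover have "g \<oplus> ?h = \<one>" using gR(1) by algebra
    ultimately have "\<one> \<in> ?E" by simp
    then have "r \<otimes> \<one> \<in> ?E" by (rule ideal_mult[OF E r])
    then show ?thesis using r by simp
  qed
  ultimately show ?thesis using reg by (intro exI[of _ ?A]) blast
qed

end

context coord_module
begin

text \<open>Representatives are confined to elements whose components from \<open>m\<close> on
  vanish, so that prescribing residues in the torsion part leaves the torsion-free part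
  untouched.\<close>

lemma stacked_cyclic_split:
  assumes "stacked (carrier F) H (carrier R) N m \<mu> I g"
  shows "\<exists>L. cyclic_split {x \<in> carrier F. \<forall>j<m. \<mu> j x \<in> ideal_prod R (I j) (\<mu> j ` carrier F)}
      {x \<in> carrier F. \<forall>j. m \<le> j \<longrightarrow> j < N \<longrightarrow> \<mu> j x = \<zero>} L \<and>
    descending L \<and> (\<forall>p\<in>set L. snd p \<noteq> carrier R)"
proof -
  note st = stackedD[OF assms]
  let ?J = "\<lambda>j. \<mu> j ` carrier F"
  let ?K = "{x \<in> carrier F. \<forall>j<m. \<mu> j x \<in> ideal_prod R (I j) (?J j)}"
  let ?Z = "{x \<in> carrier F. \<forall>j. m \<le> j \<longrightarrow> j < N \<longrightarrow> \<mu> j x = \<zero>}"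
  have \<mu>: "functional (\<mu> j)" if "j < N" for j using st(2) that unfolding splits_def by blast
  have "\<exists>A. j < m \<longrightarrow> regular_ideal A \<and> (\<forall>y\<in>?J j. y \<in> ideal_prod R (I j) (?J j) \<longleftrightarrow> y \<in> A) \<and>
    (\<forall>r\<in>carrier R. \<exists>y\<in>?J j. y \<ominus> r \<in> A)" for j
  proof (cases "j < m")
    case True
    then have jN: "j < N" using st(1) by simp
    have cs: "idem_elem R (g j)" "\<forall>x\<in>carrier F. g j \<otimes> \<mu> j x = \<mu> j x"
      using st(3) jN unfolding component_support_def by blast+
    have "\<exists>A. regular_ideal A \<and> (\<forall>y\<in>?J j. y \<in> ideal_prod R (I j) (?J j) \<longleftrightarrow> y \<in> A) \<and>
      (\<forall>r\<in>carrier R. \<exists>y\<in>?J j. y \<ominus> r \<in> A)"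
    proof (rule cyclic_quotient)
      show "regular_ideal (I j)" using st(4) True by blast
      show "finitely_generated_ideal (?J j) R" by (rule fg_functional_image[OF \<mu>[OF jN] carrier_fg])
      show "idem_elem R (g j)" by (rule cs(1))
      show "g j \<otimes> c = c" if "c \<in> ?J j" for c using that cs(2) by blast
      show "g j \<in> L" if "ideal L R" "I j \<subseteq> L" "?J j \<subseteq> L" for L using st(7) True that by blast
    qed
    then show ?thesis by blast
  qed blast
  then obtain A where A0: "\<forall>j. j < m \<longrightarrow> regular_ideal (A j) \<and> (\<forall>y\<in>?J j. y \<in> ideal_prod R (I j) (?J j) \<longleftrightarrow> y \<in> A j) \<and>
    (\<forall>r\<in>carrier R. \<exists>y\<in>?J j. y \<ominus> r \<in> A j)" by metis
  have A: "regular_ideal (A j)" "\<forall>y\<in>?J j. y \<in> ideal_prod R (I j) (?J j) \<longleftrightarrow> y \<in> A j"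
    "\<forall>r\<in>carrier R. \<exists>y\<in>?J j. y \<ominus> r \<in> A j" if "j < m" for j
    using A0[rule_format, OF that] by - (elim conjE, assumption)+
  let ?L = "map (\<lambda>j. (\<mu> j, A j)) [0..<m]"
  have "cyclic_split ?K ?Z ?L"
    unfolding cyclic_split_def
  proof (intro conjI allI impI ballI)
    show "functional (fst p)" "regular_ideal (snd p)" if "p \<in> set ?L" for p
      using that \<mu> A(1) st(1) by auto
    show "(x \<in> ?K) = (\<forall>p\<in>set ?L. fst p x \<in> snd p)" if "x \<in> carrier F" for x
      using that A(2) by auto
    fix rs assume len: "length rs = length ?L" and rs: "set rs \<subseteq> carrier R"
    \<comment> \<open>The default \<open>\<zero>\<close> for \<open>j\<close> from \<open>m\<close>
      on is what places the glued element in \<open>?Z\<close>.\<close>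
    have "\<exists>z\<in>carrier F. if j < m then \<mu> j z \<ominus> rs ! j \<in> A j else z = \<zero>\<^bsub>F\<^esub>" for j
    proof (cases "j < m")
      case True
      then have "rs ! j \<in> carrier R" using rs len by (auto simp: subset_iff)
      then show ?thesis using A(3)[OF True] True by auto
    qed auto
    then obtain z where z: "\<And>j. z j \<in> carrier F" "\<And>j. if j < m then \<mu> j (z j) \<ominus> rs ! j \<in> A j else z j = \<zero>\<^bsub>F\<^esub>" by metis
    have "\<exists>x\<in>carrier F. \<forall>j<N. \<mu> j x = \<mu> j (z j)" using st(2) z(1) unfolding splits_def by blast
    then obtain x where x: "x \<in> carrier F" "\<forall>j<N. \<mu> j x = \<mu> j (z j)" by blast
    have "x \<in> ?Z"
    proof (intro CollectI conjI x(1) allI impI)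
      fix j assume "m \<le> j" "j < N"
      then show "\<mu> j x = \<zero>" using x(2) z(2)[of j] functionalD(4)[OF \<mu>] by simp
    qed
    moreover have "list_all2 (\<lambda>p r. fst p x \<ominus> r \<in> snd p) ?L rs"
      unfolding list_all2_conv_all_nth
    proof (intro conjI allI impI)
      fix j assume "j < length ?L"
      then have j: "j < m" by simp
      then have "\<mu> j x = \<mu> j (z j)" using x(2) st(1) by simp
      then show "fst (?L ! j) x \<ominus> rs ! j \<in> snd (?L ! j)" using z(2)[of j] j by simp
    qed (use len in simp)
    ultimately show "\<exists>x\<in>?Z. list_all2 (\<lambda>p r. fst p x \<ominus> r \<in> snd p) ?L rs" by blast
  qed
  then show ?thesis by (intro cyclic_split_normalize) auto
qed

lemma quot_module_simps:
  assumes "ideal I R"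
  shows "carrier (quot_module R I) = a_rcosets I"
    "r \<in> carrier R \<Longrightarrow> s \<in> carrier R \<Longrightarrow> (I +> r) \<oplus>\<^bsub>quot_module R I\<^esub> (I +> s) = I +> (r \<oplus> s)"
    "r \<in> carrier R \<Longrightarrow> s \<in> carrier R \<Longrightarrow> r \<odot>\<^bsub>quot_module R I\<^esub> (I +> s) = I +> (r \<otimes> s)"
proof -
  interpret ideal I R by fact
  show "carrier (quot_module R I) = a_rcosets I"
    by (simp add: quot_module_def FactRing_def ring.defs)
  show "(I +> r) \<oplus>\<^bsub>quot_module R I\<^esub> (I +> s) = I +> (r \<oplus> s)" if "r \<in> carrier R" "s \<in> carrier R"
    using that by (simp add: quot_module_def FactRing_def ring.defs a_rcos_sum)
  show "r \<odot>\<^bsub>quot_module R I\<^esub> (I +> s) = I +> (r \<otimes> s)" if "r \<in> carrier R" "s \<in> carrier R"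
    using that by (simp add: quot_module_def FactRing_def ring.defs rcoset_mult_add)
qed

text \<open>Components below \<open>m\<close> give the cyclic part. A later component breaks up into
  its pieces over the idempotents \<open>e i\<close> below its support; as the supports decrease,
  exactly the first \<open>n i\<close> of these components contribute over
  \<open>e i\<close>.\<close>

lemma decomposition:
  assumes H: "finitely_generated_submodule H R F" and M: "module R M"
    and f: "f \<in> module_hom R F M" "f ` carrier F = carrier M" "H = a_kernel F M f"
  shows "\<exists>(m::nat) I (p::nat) e (n :: nat \<Rightarrow> nat) J.
         (\<forall>j<m. invertible_ideal (I j) R \<and> I j \<noteq> carrier R) \<and>
         (\<forall>i j. i \<le> j \<longrightarrow> j < m \<longrightarrow> I j \<subseteq> I i) \<and>
         (\<forall>i<p. e i \<in> carrier R \<and> e i \<otimes> e i = e i \<and> e i \<noteq> \<zero>) \<and>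
         (\<forall>i<p. \<forall>j<p. i \<noteq> j \<longrightarrow> e i \<otimes> e j = \<zero>) \<and>
         (\<forall>i<p. 0 < n i) \<and> strict_mono_on {..<p} n \<and>
         (\<forall>i<p. \<forall>k<n i. invertible_ideal (J i k) (idempotent_ring R (e i))) \<and>
         isomorphic_modules R M
           (direct_sum2
              (direct_sum {..<m} (\<lambda>j. quot_module R (I j)))
              (direct_sum {..<p} (\<lambda>i.
                 direct_sum {..<n i} (\<lambda>k.
                   ideal_module R ((\<lambda>x. x \<otimes> e i) ` J i k)))))"
proof -
  interpret M: module R M by fact
  obtain N m \<mu> I g where stk: "stacked (carrier F) H (carrier R) N m \<mu> I g" using exists_stacked_carrier[OF H] by blast
  note st = stackedD[OF stk]
  let ?C = "\<lambda>j. \<mu> j ` carrier F"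
  have \<mu>: "functional (\<mu> j)" if "j < N" for j using st(2) that unfolding splits_def by blast
  have C: "finitely_generated_ideal (?C j) R" if "j < N" for j using fg_functional_image[OF \<mu>[OF that] carrier_fg] .
  let ?K = "{x \<in> carrier F. \<forall>j<m. \<mu> j x \<in> ideal_prod R (I j) (?C j)}"
  let ?Z = "{x \<in> carrier F. \<forall>j. m \<le> j \<longrightarrow> j < N \<longrightarrow> \<mu> j x = \<zero>}"
  obtain L where L: "cyclic_split ?K ?Z L" "descending L" "\<forall>p\<in>set L. snd p \<noteq> carrier R"
    using stacked_cyclic_split[OF stk] by blast
  let ?h = "\<lambda>j. fst (L ! j)" and ?A = "\<lambda>j. snd (L ! j)" and ?l = "length L"
  have fA: "functional (?h j)" "regular_ideal (?A j)" if "j < ?l" for j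
    using L(1) nth_mem[OF that] unfolding cyclic_split_def by blast+
  have Ai: "ideal (?A j) R" if "j < ?l" for j using regular_idealD[OF fA(2)[OF that]] .
  have KL: "x \<in> ?K \<longleftrightarrow> (\<forall>j<?l. ?h j x \<in> ?A j)" if "x \<in> carrier F" for x
    using L(1) that unfolding cyclic_split_def all_set_conv_all_nth by blast
  \<comment> \<open>The supports of the torsion-free components, padded with zeros to a decreasing
    sequence that vanishes at index \<open>N - m\<close>.\<close>
  let ?f = "\<lambda>k. if m + k < N then g (m + k) else \<zero>"
  have cs: "idem_elem R (g j)" "\<forall>x\<in>carrier F. g j \<otimes> \<mu> j x = \<mu> j x"
    "\<forall>r\<in>carrier R. (\<forall>x\<in>carrier F. r \<otimes> \<mu> j x = \<zero>) \<longrightarrow> r \<otimes> g j = \<zero>" if "j < N" for j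
    using st(3) that unfolding component_support_def by blast+
  have gR: "g j \<in> carrier R" if "j < N" for j using cs(1)[OF that] by (simp add: idem_elem_def)
  have idf: "idem_elem R (?f k)" for k using cs(1) by (simp add: idem_elem_def)
  have "\<exists>(p::nat) n e. strict_mono_on {..<p} n \<and>
    (\<forall>i<p. 0 < n i \<and> n i \<le> N - m \<and> idem_elem R (e i) \<and> e i \<noteq> \<zero> \<and> (\<forall>k<n i. e i \<otimes> ?f k = e i)) \<and>
    (\<forall>i<p. \<forall>j<p. i \<noteq> j \<longrightarrow> e i \<otimes> e j = \<zero>) \<and>
    (\<forall>k. \<forall>y\<in>carrier R. ?f k \<otimes> y = y \<longrightarrow> (\<forall>i<p. k < n i \<longrightarrow> e i \<otimes> y = \<zero>) \<longrightarrow> y = \<zero>)"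
  proof (rule idempotent_chain[OF idf])
    show "?f l \<otimes> ?f k = ?f l" if "k \<le> l" for k l using st(8) that gR by simp
    show "?f (N - m) = \<zero>" using st(1) by simp
  qed
  then obtain p :: nat and n :: "nat \<Rightarrow> nat" and e :: "nat \<Rightarrow> 'a" where e: "strict_mono_on {..<p} n"
    "\<forall>i<p. 0 < n i \<and> n i \<le> N - m \<and> idem_elem R (e i) \<and> e i \<noteq> \<zero> \<and> (\<forall>k<n i. e i \<otimes> ?f k = e i)"
    "\<forall>i<p. \<forall>j<p. i \<noteq> j \<longrightarrow> e i \<otimes> e j = \<zero>"
    "\<forall>k. \<forall>y\<in>carrier R. ?f k \<otimes> y = y \<longrightarrow> (\<forall>i<p. k < n i \<longrightarrow> e i \<otimes> y = \<zero>) \<longrightarrow> y = \<zero>"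
    by (elim exE conjE)
  have ei: "idem_elem R (e i)" "e i \<in> carrier R" "e i \<otimes> e i = e i" if "i < p" for i
    using e(2) that by (auto simp: idem_elem_def)
  have nN: "m + k < N" if "i < p" "k < n i" for i k
  proof -
    have "n i \<le> N - m" using e(2) that(1) by blast
    then show ?thesis using that(2) by simp
  qed
  have eg: "e i \<otimes> g (m + k) = e i" if "i < p" "k < n i" for i k
  proof -
    have "e i \<otimes> ?f k = e i" using e(2) that by blast
    then show ?thesis using nN[OF that] by simp
  qed
  \<comment> \<open>For \<open>k < n i\<close> the idempotent \<open>e i\<close> lies under the
    support of component \<open>m + k\<close>, which makes this piece an invertible ideal of the
    ring of \<open>e i\<close>.\<close>
  let ?J = "\<lambda>i k. (\<lambda>x. e i \<otimes> x) ` ?C (m + k)"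
  have inv: "invertible_ideal (?J i k) (idempotent_ring R (e i))" if ik: "i < p" "k < n i" for i k
  proof (rule idempotent_component_invertible[OF C[OF nN[OF ik]] ei(1)[OF ik(1)]])
    fix r assume r: "r \<in> carrier R" and 0: "\<And>c. c \<in> ?C (m + k) \<Longrightarrow> r \<otimes> c = \<zero>"
    have gR': "g (m + k) \<in> carrier R" using gR[OF nN[OF ik]] .
    have "r \<otimes> g (m + k) = \<zero>" using cs(3)[OF nN[OF ik]] r 0 by blast
    then have "e i \<otimes> (r \<otimes> g (m + k)) = \<zero>" using ei(2)[OF ik(1)] by simp
    then have "r \<otimes> (e i \<otimes> g (m + k)) = \<zero>" using m_lcomm[OF ei(2)[OF ik(1)] r gR'] by simp
    then show "r \<otimes> e i = \<zero>" unfolding eg[OF ik] .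
  qed
  \<comment> \<open>The pieces already lie in the ring of \<open>e i\<close>, so multiplying by
    \<open>e i\<close> once more changes nothing.\<close>
  have Je: "(\<lambda>x. x \<otimes> e i) ` ?J i k = ?J i k" if ik: "i < p" "k < n i" for i k
  proof -
    have "(\<lambda>x. x \<otimes> e i) ` ?J i k = (\<lambda>c. e i \<otimes> c \<otimes> e i) ` ?C (m + k)" by (rule image_image)
    also have "\<dots> = ?J i k"
    proof (rule image_cong[OF refl])
      fix c assume "c \<in> ?C (m + k)"
      then have "c \<in> carrier R" using ideal_memD[OF fg_ideal[OF C[OF nN[OF ik]]]] by blast
      then show "e i \<otimes> c \<otimes> e i = e i \<otimes> c" using ei[OF ik(1)] by (metis m_assoc m_comm m_closed)
    qed
    finally show ?thesis .
  qed
  let ?T1 = "direct_sum {..<?l} (\<lambda>j. quot_module R (?A j))"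
  let ?D = "\<lambda>i. direct_sum {..<n i} (\<lambda>k. ideal_module R ((\<lambda>x. x \<otimes> e i) ` ?J i k))"
  let ?T2 = "direct_sum {..<p} ?D"
  let ?T = "direct_sum2 ?T1 ?T2"
  have T1: "carrier ?T1 = (\<Pi>\<^sub>E j\<in>{..<?l}. carrier (quot_module R (?A j)))"
    "\<And>x y. x \<oplus>\<^bsub>?T1\<^esub> y = (\<lambda>j\<in>{..<?l}. x j \<oplus>\<^bsub>quot_module R (?A j)\<^esub> y j)"
    "\<And>r x. r \<odot>\<^bsub>?T1\<^esub> x = (\<lambda>j\<in>{..<?l}. r \<odot>\<^bsub>quot_module R (?A j)\<^esub> x j)"
    by (auto simp: direct_sum_def)
  have D: "carrier (?D i) = (\<Pi>\<^sub>E k\<in>{..<n i}. ?J i k)" if "i < p" for i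
  proof -
    have "carrier (?D i) = (\<Pi>\<^sub>E k\<in>{..<n i}. (\<lambda>x. x \<otimes> e i) ` ?J i k)"
      by (auto simp: direct_sum_def ideal_module_def)
    also have "\<dots> = (\<Pi>\<^sub>E k\<in>{..<n i}. ?J i k)" by (rule PiE_cong) (use Je[OF that] in auto)
    finally show ?thesis .
  qed
  have D2: "x \<oplus>\<^bsub>?D i\<^esub> y = (\<lambda>k\<in>{..<n i}. x k \<oplus> y k)" "r \<odot>\<^bsub>?D i\<^esub> x = (\<lambda>k\<in>{..<n i}. r \<otimes> x k)" for i x y r
    by (simp_all add: direct_sum_def ideal_module_def regular_module_def)
  have fin: "finite {i. i < p \<and> Q i}" for Q by simp
  have T2: "carrier ?T2 = (\<Pi>\<^sub>E i\<in>{..<p}. carrier (?D i))"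
    "\<And>x y. x \<oplus>\<^bsub>?T2\<^esub> y = (\<lambda>i\<in>{..<p}. x i \<oplus>\<^bsub>?D i\<^esub> y i)"
    "\<And>r x. r \<odot>\<^bsub>?T2\<^esub> x = (\<lambda>i\<in>{..<p}. r \<odot>\<^bsub>?D i\<^esub> x i)"
    by (auto simp: direct_sum_def[of "{..<p}"] fin)
  have T: "carrier ?T = carrier ?T1 \<times> carrier ?T2"
    "\<And>x y x' y'. (x, y) \<oplus>\<^bsub>?T\<^esub> (x', y') = (x \<oplus>\<^bsub>?T1\<^esub> x', y \<oplus>\<^bsub>?T2\<^esub> y')"
    "\<And>r x y. r \<odot>\<^bsub>?T\<^esub> (x, y) = (r \<odot>\<^bsub>?T1\<^esub> x, r \<odot>\<^bsub>?T2\<^esub> y)"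
    by (simp_all add: direct_sum2_def)
  \<comment> \<open>The map \<open>?\<Theta>\<close> below, made of the residues for the sorted
    ideals and of the pieces over the \<open>e i\<close>, will be shown to have the same fibres as
    \<open>f\<close>.\<close>
  let ?a = "\<lambda>x. \<lambda>j\<in>{..<?l}. ?A j +> ?h j x"
  let ?b = "\<lambda>x. \<lambda>i\<in>{..<p}. \<lambda>k\<in>{..<n i}. e i \<otimes> \<mu> (m + k) x"
  let ?\<Theta> = "\<lambda>x. (?a x, ?b x)"
  note hD = functionalD[OF fA(1)]
  note \<mu>D = functionalD(1,2,3,6)[OF \<mu>[OF nN]]
  have hom: "?\<Theta> \<in> module_hom R F ?T"
  proof (rule module_homI)
    fix x assume x: "x \<in> carrier F"
    have "?a x \<in> carrier ?T1" unfolding T1(1) restrict_PiE_iff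
      using hD(1)[OF _ x] by (simp add: quot_module_simps(1)[OF Ai] A_RCOSETS_def') blast
    moreover have "?b x \<in> carrier ?T2" unfolding T2(1) restrict_PiE_iff
      using x by (auto simp: D restrict_PiE_iff)
    ultimately show "?\<Theta> x \<in> carrier ?T" unfolding T(1) by blast
  next
    fix x y assume xy: "x \<in> carrier F" "y \<in> carrier F"
    have "?a (x \<oplus>\<^bsub>F\<^esub> y) = ?a x \<oplus>\<^bsub>?T1\<^esub> ?a y"
      unfolding T1(2) restrict_eq_iff using hD(1,2) xy quot_module_simps(2)[OF Ai] by simp
    moreover have "?b (x \<oplus>\<^bsub>F\<^esub> y) = ?b x \<oplus>\<^bsub>?T2\<^esub> ?b y"
      unfolding T2(2) restrict_eq_iff
    proof
      fix i assume i: "i \<in> {..<p}"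
      show "(\<lambda>k\<in>{..<n i}. e i \<otimes> \<mu> (m + k) (x \<oplus>\<^bsub>F\<^esub> y)) = ?b x i \<oplus>\<^bsub>?D i\<^esub> ?b y i"
        unfolding D2 restrict_eq_iff using i xy ei(2) \<mu>D(1,2) by (auto simp: r_distr)
    qed
    ultimately show "?\<Theta> (x \<oplus>\<^bsub>F\<^esub> y) = ?\<Theta> x \<oplus>\<^bsub>?T\<^esub> ?\<Theta> y" unfolding T(2) by blast
  next
    fix r x assume rx: "r \<in> carrier R" "x \<in> carrier F"
    have "?a (r \<odot>\<^bsub>F\<^esub> x) = r \<odot>\<^bsub>?T1\<^esub> ?a x"
      unfolding T1(3) restrict_eq_iff using hD(1,3) rx quot_module_simps(3)[OF Ai] by simp
    moreover have "?b (r \<odot>\<^bsub>F\<^esub> x) = r \<odot>\<^bsub>?T2\<^esub> ?b x"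
      unfolding T2(3) restrict_eq_iff
    proof
      fix i assume i: "i \<in> {..<p}"
      show "(\<lambda>k\<in>{..<n i}. e i \<otimes> \<mu> (m + k) (r \<odot>\<^bsub>F\<^esub> x)) = r \<odot>\<^bsub>?D i\<^esub> ?b x i"
        unfolding D2 restrict_eq_iff using i rx ei(2) \<mu>D(1,3) by (auto simp: m_lcomm)
    qed
    ultimately show "?\<Theta> (r \<odot>\<^bsub>F\<^esub> x) = r \<odot>\<^bsub>?T\<^esub> ?\<Theta> x" unfolding T(3) by blast
  qed
  have fibres: "f x = f y \<longleftrightarrow> ?\<Theta> x = ?\<Theta> y" if xy: "x \<in> carrier F" "y \<in> carrier F" for x y
  proof -
    let ?z = "x \<ominus>\<^bsub>F\<^esub> y"
    have z: "?z \<in> carrier F" using xy by simp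
    have "f x = f y \<longleftrightarrow> f ?z = \<zero>\<^bsub>M\<^esub>"
    proof -
      have c: "f x \<in> carrier M" "f y \<in> carrier M" using module_homD(1)[OF f(1)] xy by auto
      have "(f x \<ominus>\<^bsub>M\<^esub> f y) \<oplus>\<^bsub>M\<^esub> f y = f x" using c by (simp add: a_minus_def M.M.a_assoc M.M.l_neg)
      then have "f x = f y" if "f x \<ominus>\<^bsub>M\<^esub> f y = \<zero>\<^bsub>M\<^esub>" using that c by simp
      moreover have "f y \<ominus>\<^bsub>M\<^esub> f y = \<zero>\<^bsub>M\<^esub>" using c by (simp add: a_minus_def M.M.r_neg)
      ultimately show ?thesis unfolding module_hom_minus(2)[OF module_axioms M f(1) xy] by auto
    qed
    also have "\<dots> \<longleftrightarrow> ?z \<in> H" using z unfolding f(3) a_kernel_eq by simp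
    also have "\<dots> \<longleftrightarrow> ?z \<in> ?K \<and> (\<forall>j. m \<le> j \<longrightarrow> j < N \<longrightarrow> \<mu> j ?z = \<zero>)" using st(6) z by blast
    also have "?z \<in> ?K \<longleftrightarrow> ?a x = ?a y"
      unfolding KL[OF z] restrict_eq_iff
      using hD(1,6) xy quotient_eq_iff_same_a_r_cos[OF Ai] by (simp add: Ball_def)
    also have "(\<forall>j. m \<le> j \<longrightarrow> j < N \<longrightarrow> \<mu> j ?z = \<zero>) \<longleftrightarrow> ?b x = ?b y"
    proof -
      have "(\<forall>j. m \<le> j \<longrightarrow> j < N \<longrightarrow> \<mu> j ?z = \<zero>) \<longleftrightarrow> (\<forall>i<p. \<forall>k<n i. e i \<otimes> \<mu> (m + k) ?z = \<zero>)"
      proof (intro iffI allI impI)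
        fix i k assume 0: "\<forall>j. m \<le> j \<longrightarrow> j < N \<longrightarrow> \<mu> j ?z = \<zero>" and ik: "i < p" "k < n i"
        show "e i \<otimes> \<mu> (m + k) ?z = \<zero>" using 0 nN[OF ik] ei(2)[OF ik(1)] by simp
      next
        \<comment> \<open>The covering clause of \<open>idempotent_chain\<close> applies: the
          support of the component fixes \<open>\<mu> j ?z\<close>, and every \<open>e i\<close>
          with \<open>j - m < n i\<close> kills it.\<close>
        fix j assume 0: "\<forall>i<p. \<forall>k<n i. e i \<otimes> \<mu> (m + k) ?z = \<zero>" and j: "m \<le> j" "j < N"
        have zR: "\<mu> j ?z \<in> carrier R" using functionalD(1)[OF \<mu>[OF j(2)] z] .
        have "?f (j - m) \<otimes> \<mu> j ?z = \<mu> j ?z" using j cs(2)[OF j(2)] z by simp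
        moreover have "\<forall>i<p. j - m < n i \<longrightarrow> e i \<otimes> \<mu> j ?z = \<zero>" using 0[rule_format, of _ "j - m"] j by simp
        ultimately show "\<mu> j ?z = \<zero>" using e(4) zR by blast
      qed
      also have "\<dots> \<longleftrightarrow> (\<forall>i<p. \<forall>k<n i. e i \<otimes> \<mu> (m + k) x = e i \<otimes> \<mu> (m + k) y)"
      proof -
        have "e i \<otimes> \<mu> (m + k) ?z = \<zero> \<longleftrightarrow> e i \<otimes> \<mu> (m + k) x = e i \<otimes> \<mu> (m + k) y" if ik: "i < p" "k < n i" for i k
        proof -
          have c: "e i \<in> carrier R" "\<mu> (m + k) x \<in> carrier R" "\<mu> (m + k) y \<in> carrier R"
            using ei(2)[OF ik(1)] \<mu>D(1)[OF ik] xy by blast+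
          have "e i \<otimes> \<mu> (m + k) ?z = e i \<otimes> \<mu> (m + k) x \<ominus> e i \<otimes> \<mu> (m + k) y"
            unfolding \<mu>D(4)[OF ik xy] using c by algebra
          then show ?thesis using c by (simp add: r_right_minus_eq)
        qed
        then show ?thesis by blast
      qed
      also have "\<dots> \<longleftrightarrow> ?b x = ?b y" by (simp add: restrict_eq_iff Ball_def)
      finally show ?thesis .
    qed
    finally show ?thesis unfolding prod.inject .
  qed
  have surj: "\<exists>x\<in>carrier F. t = ?\<Theta> x" if t: "t \<in> carrier ?T" for t
  proof -
    obtain a b where tab: "t = (a, b)" "a \<in> carrier ?T1" "b \<in> carrier ?T2" using t unfolding T(1) by blast
    have "\<exists>r\<in>carrier R. j < ?l \<longrightarrow> a j = ?A j +> r" for j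
    proof (cases "j < ?l")
      case True
      then have "a j \<in> carrier (quot_module R (?A j))" using PiE_mem[OF tab(2)[unfolded T1(1)], of j] by simp
      then have "a j \<in> a_rcosets (?A j)" unfolding quot_module_simps(1)[OF Ai[OF True]] .
      then show ?thesis by (auto simp: A_RCOSETS_def')
    qed auto
    then obtain r where r: "\<And>j. r j \<in> carrier R" "\<And>j. j < ?l \<Longrightarrow> a j = ?A j +> r j" by metis
    have "\<forall>rs. length rs = ?l \<longrightarrow> set rs \<subseteq> carrier R \<longrightarrow> (\<exists>x\<in>?Z. list_all2 (\<lambda>p r. fst p x \<ominus> r \<in> snd p) L rs)"
      using L(1) unfolding cyclic_split_def by (elim conjE)
    moreover have "length (map r [0..<?l]) = ?l" "set (map r [0..<?l]) \<subseteq> carrier R" using r(1) by auto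
    ultimately have "\<exists>x\<in>?Z. list_all2 (\<lambda>p r. fst p x \<ominus> r \<in> snd p) L (map r [0..<?l])" by (elim allE impE)
    then obtain x1 where x1: "x1 \<in> ?Z" "list_all2 (\<lambda>p r. fst p x1 \<ominus> r \<in> snd p) L (map r [0..<?l])"
      by (elim bexE)
    have x1A: "?h j x1 \<ominus> r j \<in> ?A j" if "j < ?l" for j
      using x1(2) that by (simp add: list_all2_conv_all_nth)
    have bD: "b i \<in> (\<Pi>\<^sub>E k\<in>{..<n i}. ?J i k)" if "i < p" for i
      using PiE_mem[OF tab(3)[unfolded T2(1)], of i] that unfolding D[OF that, symmetric] by simp
    have "\<exists>z\<in>carrier F. if m \<le> j \<and> j < N then \<forall>i<p. j - m < n i \<longrightarrow> e i \<otimes> \<mu> j z = b i (j - m) else z = \<zero>\<^bsub>F\<^esub>" for j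
    proof (cases "m \<le> j \<and> j < N")
      case True
      \<comment> \<open>The pieces prescribed over the various \<open>e i\<close> are glued to one
        element of \<open>?C j\<close>; the default \<open>\<zero>\<close> serves those
        \<open>e i\<close> over which component \<open>j\<close> does not contribute.\<close>
      let ?w = "\<lambda>i. if j - m < n i then b i (j - m) else \<zero>"
      have Ci: "ideal (?C j) R" using fg_ideal[OF C] True by blast
      have w: "?w i \<in> ?C j \<and> e i \<otimes> ?w i = ?w i" if i: "i < p" for i
      proof (cases "j - m < n i")
        case k: True
        then have "b i (j - m) \<in> (\<lambda>x. e i \<otimes> x) ` ?C j" using PiE_mem[OF bD[OF i], of "j - m"] True by simp
        then obtain c where c: "c \<in> ?C j" "b i (j - m) = e i \<otimes> c" by blast
        have "e i \<otimes> (e i \<otimes> c) = e i \<otimes> c"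
          using ei[OF i] ideal_memD[OF Ci c(1)] by (metis m_assoc)
        then show ?thesis using k c ideal_mult[OF Ci ei(2)[OF i] c(1)] by simp
      qed (use ideal_zero[OF Ci] ei(2)[OF i] in simp)
      have "\<exists>c\<in>?C j. \<forall>i<p. e i \<otimes> c = ?w i"
        by (rule orthogonal_interpolation[OF Ci]) (use ei(1) e(3) w in auto)
      then obtain c where c: "c \<in> ?C j" "\<forall>i<p. e i \<otimes> c = ?w i" by blast
      then obtain z where "z \<in> carrier F" "c = \<mu> j z" by blast
      then show ?thesis using c(2) True by (intro bexI[of _ z]) auto
    qed auto
    then obtain z where z: "\<And>j. z j \<in> carrier F"
      "\<And>j. if m \<le> j \<and> j < N then \<forall>i<p. j - m < n i \<longrightarrow> e i \<otimes> \<mu> j (z j) = b i (j - m) else z j = \<zero>\<^bsub>F\<^esub>" by metis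
    have "\<exists>x\<in>carrier F. \<forall>j<N. \<mu> j x = \<mu> j (z j)" using st(2) z(1) unfolding splits_def by blast
    then obtain x2 where x2: "x2 \<in> carrier F" "\<forall>j<N. \<mu> j x2 = \<mu> j (z j)" by blast
    have x1F: "x1 \<in> carrier F" using x1(1) by blast
    have "x2 \<in> ?K"
    proof (intro CollectI conjI x2(1) allI impI)
      fix j assume j: "j < m"
      then have jN: "j < N" using st(1) by simp
      have "z j = \<zero>\<^bsub>F\<^esub>" using z(2)[of j] j by simp
      then have "\<mu> j x2 = \<zero>" using x2(2) jN functionalD(4)[OF \<mu>[OF jN]] by simp
      moreover have "ideal (I j) R" using st(4) j regular_idealD by blast
      ultimately show "\<mu> j x2 \<in> ideal_prod R (I j) (?C j)"
        using ideal_zero[OF ideal_prod_is_ideal[OF _ fg_ideal[OF C[OF jN]]]] by simp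
    qed
    then have x2A: "?h j x2 \<in> ?A j" if "j < ?l" for j using KL[OF x2(1)] that by blast
    \<comment> \<open>The components of \<open>x1\<close> from \<open>m\<close> on are zero, and
      \<open>x2\<close> is zero modulo every \<open>?A j\<close>; so the sum meets both
      prescriptions.\<close>
    let ?x = "x1 \<oplus>\<^bsub>F\<^esub> x2"
    have "a = ?a ?x"
    proof (rule extensionalityI[of _ "{..<?l}"])
      show "a \<in> extensional {..<?l}" using tab(2) unfolding T1(1) by (simp add: PiE_def)
      fix j assume "j \<in> {..<?l}"
      then have j: "j < ?l" by simp
      have c: "?h j x1 \<in> carrier R" "?h j x2 \<in> carrier R" "r j \<in> carrier R" using hD(1)[OF j] x1F x2(1) r(1) by auto
      have "?h j ?x \<ominus> r j = (?h j x1 \<ominus> r j) \<oplus> ?h j x2" unfolding hD(2)[OF j x1F x2(1)] using c by algebra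
      then have "?h j ?x \<ominus> r j \<in> ?A j" using ideal_add[OF Ai[OF j] x1A[OF j] x2A[OF j]] by simp
      then have "?A j +> ?h j ?x = ?A j +> r j"
        using quotient_eq_iff_same_a_r_cos[OF Ai[OF j]] hD(1)[OF j] x1F x2(1) r(1) by simp
      then show "a j = ?a ?x j" using j r(2) by simp
    qed simp
    moreover have "b = ?b ?x"
    proof (rule extensionalityI[of _ "{..<p}"])
      show "b \<in> extensional {..<p}" using tab(3) unfolding T2(1) by (simp add: PiE_def)
      fix i assume "i \<in> {..<p}"
      then have i: "i < p" by simp
      have "b i = (\<lambda>k\<in>{..<n i}. e i \<otimes> \<mu> (m + k) ?x)"
      proof (rule extensionalityI[of _ "{..<n i}"])
        show "b i \<in> extensional {..<n i}" using bD[OF i] by (simp add: PiE_def)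
        fix k assume "k \<in> {..<n i}"
        then have k: "k < n i" by simp
        have "\<mu> (m + k) x1 = \<zero>" using x1(1) nN[OF i k] by simp
        then have "\<mu> (m + k) ?x = \<mu> (m + k) (z (m + k))"
          using \<mu>D(2)[OF i k x1F x2(1)] x2(2) nN[OF i k] \<mu>D(1)[OF i k z(1)] by simp
        then show "b i k = (\<lambda>k\<in>{..<n i}. e i \<otimes> \<mu> (m + k) ?x) k"
          using z(2)[of "m + k"] nN[OF i k] i k by simp
      qed simp
      then show "b i = ?b ?x i" using i by simp
    qed simp
    ultimately show ?thesis using x1F x2(1) tab(1) by (intro bexI[of _ ?x]) simp_all
  qed
  have "?\<Theta> ` carrier F = carrier ?T"
    using surj module_homD(1)[OF hom] by blast
  then have "isomorphic_modules R M ?T"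
    by (rule isomorphic_of_same_fibres[OF module_axioms f(1,2) hom _ fibres])
  moreover have "\<forall>j<?l. invertible_ideal (?A j) R \<and> ?A j \<noteq> carrier R"
    using fA(2) L(3) invertible_ideal_of_regular nth_mem unfolding regular_ideal_def by blast
  moreover have "\<forall>i j. i \<le> j \<longrightarrow> j < ?l \<longrightarrow> ?A j \<subseteq> ?A i"
    using L(2) unfolding sorted_wrt_iff_nth_less by (metis le_eq_less_or_eq subset_refl)
  moreover have "\<forall>i<p. e i \<in> carrier R \<and> e i \<otimes> e i = e i \<and> e i \<noteq> \<zero>" using ei(2,3) e(2) by blast
  moreover have "\<forall>i<p. 0 < n i" using e(2) by blast
  moreover have "\<forall>i<p. \<forall>k<n i. invertible_ideal (?J i k) (idempotent_ring R (e i))" using inv by blast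
  ultimately show ?thesis using e(1,3)
    by (intro exI[of _ ?l] exI[of _ ?A] exI[of _ p] exI[of _ e] exI[of _ n] exI[of _ ?J] conjI)
qed

end

theorem corollary3:
  fixes R :: "('a, 'r) ring_scheme"
  assumes semihereditary: "semihereditary_ring R"
    and cond: "finite_character R \<or> krull_dim R \<le> 1"
  shows "stacked_bases_property R TYPE('f) TYPE('m) \<and>
    (\<forall>M :: ('a, 'm) module. finitely_presented R M \<longrightarrow>
      (\<exists>(m::nat) I (p::nat) e (n :: nat \<Rightarrow> nat) J.
         (\<forall>j<m. invertible_ideal (I j) R \<and> I j \<noteq> carrier R) \<and>
         (\<forall>i j. i \<le> j \<longrightarrow> j < m \<longrightarrow> I j \<subseteq> I i) \<and>
         (\<forall>i<p. e i \<in> carrier R \<and> e i \<otimes>\<^bsub>R\<^esub> e i = e i \<and> e i \<noteq> \<zero>\<^bsub>R\<^esub>) \<and>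
         (\<forall>i<p. \<forall>j<p. i \<noteq> j \<longrightarrow> e i \<otimes>\<^bsub>R\<^esub> e j = \<zero>\<^bsub>R\<^esub>) \<and>
         (\<forall>i<p. 0 < n i) \<and> strict_mono_on {..<p} n \<and>
         (\<forall>i<p. \<forall>k<n i. invertible_ideal (J i k) (idempotent_ring R (e i))) \<and>
         isomorphic_modules R M
           (direct_sum2
              (direct_sum {..<m} (\<lambda>j. quot_module R (I j)))
              (direct_sum {..<p} (\<lambda>i.
                 direct_sum {..<n i} (\<lambda>k.
                   ideal_module R ((\<lambda>x. x \<otimes>\<^bsub>R\<^esub> e i) ` J i k)))))))"
proof -
  interpret semihereditary R
    using semihereditary unfolding semihereditary_ring_def semihereditary_def semihereditary_axioms_def by blast
  interpret almost_local_global R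
    using cond separating_finite_character separating_dim_le_1
    by unfold_locales blast
  have "stacked_bases_property R TYPE('f) TYPE('m)"
    unfolding stacked_bases_property_def
  proof (intro allI impI, elim conjE)
    fix M :: "('a, 'm) module" and F :: "('a, 'f) module" and H \<pi>
    assume M: "finitely_presented R M" and F: "fg_free_module R F"
      and \<pi>: "\<pi> \<in> module_hom R F M" "\<pi> ` carrier F = carrier M" and H: "a_kernel F M \<pi> = H"
    obtain k \<psi> where Fm: "module R F" and "\<psi> \<in> module_iso R (free_module R {..<k::nat}) F"
      using F unfolding fg_free_module_def isomorphic_modules_def by blast
    then obtain \<xi> where "coord_module R F k \<xi>" using free_module_coords by blast
    then interpret F: coord_module R F k \<xi> .
    \<comment> \<open>The presentation witnessing that \<open>M\<close> is finitely presented may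
      differ from the given \<open>\<pi>\<close>, so finite generation of \<open>H\<close> comes
      from \<open>kernel_fg\<close>.\<close>
    show "\<exists>(n::nat) (m::nat) J I \<phi>. m \<le> n \<and> (\<forall>j<n. finitely_generated_ideal (J j) R) \<and>
      (\<forall>j<m. invertible_ideal (I j) R) \<and> (\<forall>i j. i \<le> j \<longrightarrow> j < m \<longrightarrow> I j \<subseteq> I i) \<and>
      \<phi> \<in> module_iso R F (direct_sum {..<n} (\<lambda>j. ideal_module R (J j))) \<and>
      \<phi> ` H = (\<Pi>\<^sub>E j\<in>{..<n}. if j < m then ideal_prod R (I j) (J j) else {\<zero>\<^bsub>R\<^esub>})"
      using F.stacked_bases[OF F.kernel_fg[OF M \<pi>]] unfolding H .
  qed
  moreover have "\<exists>(m::nat) I (p::nat) e (n :: nat \<Rightarrow> nat) J.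
         (\<forall>j<m. invertible_ideal (I j) R \<and> I j \<noteq> carrier R) \<and>
         (\<forall>i j. i \<le> j \<longrightarrow> j < m \<longrightarrow> I j \<subseteq> I i) \<and>
         (\<forall>i<p. e i \<in> carrier R \<and> e i \<otimes>\<^bsub>R\<^esub> e i = e i \<and> e i \<noteq> \<zero>\<^bsub>R\<^esub>) \<and>
         (\<forall>i<p. \<forall>j<p. i \<noteq> j \<longrightarrow> e i \<otimes>\<^bsub>R\<^esub> e j = \<zero>\<^bsub>R\<^esub>) \<and>
         (\<forall>i<p. 0 < n i) \<and> strict_mono_on {..<p} n \<and>
         (\<forall>i<p. \<forall>k<n i. invertible_ideal (J i k) (idempotent_ring R (e i))) \<and>
         isomorphic_modules R M
           (direct_sum2
              (direct_sum {..<m} (\<lambda>j. quot_module R (I j)))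
              (direct_sum {..<p} (\<lambda>i.
                 direct_sum {..<n i} (\<lambda>k.
                   ideal_module R ((\<lambda>x. x \<otimes>\<^bsub>R\<^esub> e i) ` J i k)))))"
    if fp: "finitely_presented R M" for M :: "('a, 'm) module"
  proof -
    obtain k f where Mm: "module R M" and f: "f \<in> module_hom R (free_module R {..<k::nat}) M"
      "f ` carrier (free_module R {..<k}) = carrier M"
      and K: "finitely_generated_submodule (a_kernel (free_module R {..<k}) M f) R (free_module R {..<k})"
      using fp unfolding finitely_presented_def by blast
    obtain \<xi> where "coord_module R (free_module R {..<k}) k \<xi>" using free_module_self_coords by blast
    then interpret F: coord_module R "free_module R {..<k}" k \<xi> .
    show ?thesis by (rule F.decomposition[OF K Mm f refl])
  qed
  ultimately show ?thesis by blast
qed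

end
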